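(* Let $d,k\ge 1$ and let $\Phi=\{\phi_1,\dots,\phi_k\}\subset L^2(\mathbb{R}^d)$ be functions whose integer translates $E(\Phi)=\{\phi_i(\cdot-\ell): i=1,\dots,k,\ \ell\in\mathbb{Z}^d\}$ form an orthonormal system in $L^2(\mathbb{R}^d)$. Let $$V=S(\Phi):=\overline{\mathrm{span}}\{\phi_i(\cdot-\ell): i=1,\dots,k,\ \ell\in\mathbb{Z}^d\}\subset L^2(\mathbb{R}^d).$$ Assume: (1) There are functions $\psi_1,\dots,\psi_k\in L^2(\mathbb{R}^d)$ (repetitions allowed) and $\ell_1,\dots,\ell_k\in\mathbb{Z}^d$ such that $\phi_i(x)=e^{2\pi \mathrm{i}\langle \ell_i,x\rangle}\psi_i(x)$ for $i=1,\dots,k$ (where $\mathrm{i}$ in the exponent is the imaginary unit). (2) $\displaystyle \sup_{i=1,\dots,k}\ \sup_{x\in[-1/2,1/2]^d}\ \sum_{\ell\in\mathbb{Z}^d}|\psi_i(x+\ell)|^2<\infty.$ (3) $\displaystyle C:=\sup_{i=1,\dots,k}\ \operatorname*{ess\,sup}_{\omega\in[-1/2,1/2]^d}\ \sum_{\ell\in\mathbb{Z}^d}|\hat\psi_i(\omega+\ell)|<\infty.$ (4) $\displaystyle K:=\operatorname*{ess\,sup}_{\substack{\omega,\omega'\in[-1/2,1/2]^d\\ \omega\ne\omega'}}\ \sup_{\substack{x\in[-1/2,1/2]^d\\ i=1,\dots,k}}\ \frac{|Z_{\hat\psi_i}(\omega,x)-Z_{\hat\psi_i}(\omega',x)|}{\|\omega-\omega'\|_\infty}<\infty.$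 Then $V$ is a reproducing kernel Hilbert space: each function in $V$ is continuous, and the evaluation functional $V\ni f\mapsto f(x)$ is bounded for each $x\in\mathbb{R}^d$. Moreover, let $x_1,\dots,x_m$ be independent random variables uniformly distributed in $[-1/2,1/2]^d$, let $\varepsilon>0$ and $0<\alpha<1$. If $$m\ \ge\ 10\cdot\frac{C^2}{\alpha^2}\cdot k\cdot\log\left(\frac{2k}{\varepsilon}\left(\frac{2kCK}{\alpha}+1\right)^d\right),$$ then, with probability at least $1-\varepsilon$, the inequalities $$m(1-\alpha)\|f\|^2\ \le\ \sum_{r=1}^m\sum_{\ell\in\mathbb{Z}^d}|f(x_r+\ell)|^2\ \le\ m(1+\alpha)\|f\|^2$$ hold for every $f\in V$.
   Context: The Fourier transform is $\hat f(\omega)=\int_{\mathbb{R}^d}f(x)e^{-2\pi \mathrm{i}\langle x,\omega\rangle}\,dx$ (extended to $L^2$), and $\|\cdot\|$ is the $L^2(\mathbb{R}^d)$ norm. The Zak transform of $f\in L^2(\mathbb{R}^d)$ is $Z_f(x,\omega)=\sum_{\ell\in\mathbb{Z}^d}f(x+\ell)e^{-2\pi \mathrm{i}\langle\ell,\omega\rangle}$. In particular $Z_{\hat\psi_i}(\omega,x)=\sum_{\ell\in\mathbb{Z}^d}\hat\psi_i(\omega+\ell)e^{-2\pi \mathrm{i}\langle\ell,x\rangle}$, which under assumption (3) converges absolutely for a.e. $\omega$ and every $x$. The essential supremum in (4) is with respect to Lebesgue measure on pairs $(\omega,\omega')\in[-1/2,1/2]^d\times[-1/2,1/2]^d$. Pointwise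 values: by (3) each $\hat\psi_i$ is integrable, so $\psi_i$ (hence $\phi_i$) has a continuous representative, which is the one used; elements of $V$ are likewise identified with their continuous representatives when evaluated at points. *)

theory Defs
  imports "HOL-Probability.Probability"
begin

text \<open>
  The elements of \<open>L\<^sup>2(\<real>\<^sup>d)\<close> are represented by Borel measurable functions \<open>real ^ 'd \<Rightarrow> complex\<close>
  (every class contains one), with \<open>d = CARD('d)\<close>. Representatives are not identified, so equality
  in \<open>L\<^sup>2\<close> is almost everywhere equality.
\<close>

definition L2 :: "(real ^ 'd::finite \<Rightarrow> complex) set" where
  "L2 = {f \<in> borel_measurable lborel. integrable lborel (\<lambda>x. (norm (f x))\<^sup>2)}"

definition L2_norm :: "(real ^ 'd::finite \<Rightarrow> complex) \<Rightarrow> real" where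
  "L2_norm f = sqrt (LINT x|lborel. (norm (f x))\<^sup>2)"

definition L2_inner :: "(real ^ 'd::finite \<Rightarrow> complex) \<Rightarrow> (real ^ 'd \<Rightarrow> complex) \<Rightarrow> complex" where
  "L2_inner f g = (LINT x|lborel. f x * cnj (g x))"

definition L2_limit :: "(nat \<Rightarrow> real ^ 'd::finite \<Rightarrow> complex) \<Rightarrow> (real ^ 'd \<Rightarrow> complex) \<Rightarrow> bool" where
  "L2_limit u f \<longleftrightarrow> (\<lambda>n. L2_norm (\<lambda>x. u n x - f x)) \<longlonglongrightarrow> 0"

definition int_lattice :: "(real ^ 'd::finite) set" where
  "int_lattice = {l. \<forall>j. l $ j \<in> \<int>}"

definition unit_cube :: "(real ^ 'd::finite) set" where
  "unit_cube = cbox (\<chi> j. - 1 / 2) (\<chi> j. 1 / 2)"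

definition fourier :: "(real ^ 'd::finite \<Rightarrow> complex) \<Rightarrow> real ^ 'd \<Rightarrow> complex" where
  "fourier f \<omega> = (LINT x|lborel. f x * exp (- 2 * pi * \<i> * of_real (x \<bullet> \<omega>)))"

text \<open>
  The extension of the Fourier transform to \<open>L\<^sup>2\<close> by continuity from \<open>L\<^sup>1 \<inter> L\<^sup>2\<close>. Since \<open>g\<close> is
  determined only up to null sets, it is a relation: \<open>g\<close> is a version of the transform of \<open>f\<close>.
  (By Plancherel \<open>fourier (u n)\<close> is in \<open>L\<^sup>2\<close>, so the Bochner integral behind \<^const>\<open>L2_norm\<close> does not
  take its default value \<open>0\<close> for non-integrable functions.)
\<close>

definition is_L2_fourier :: "(real ^ 'd::finite \<Rightarrow> complex) \<Rightarrow> (real ^ 'd \<Rightarrow> complex) \<Rightarrow> bool" where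
  "is_L2_fourier f g \<longleftrightarrow> f \<in> L2 \<and> g \<in> L2 \<and>
     (\<exists>u. (\<forall>n. u n \<in> L2 \<and> integrable lborel (u n)) \<and>
          L2_limit u f \<and> L2_limit (\<lambda>n. fourier (u n)) g)"

text \<open>
  For complex-valued families \<^const>\<open>infsum\<close> is unconditional (equivalently absolute) summation,
  with value \<open>0\<close> for families that are not summable.
\<close>

definition zak :: "(real ^ 'd::finite \<Rightarrow> complex) \<Rightarrow> real ^ 'd \<Rightarrow> real ^ 'd \<Rightarrow> complex" where
  "zak f x \<omega> = (\<Sum>\<^sub>\<infinity>l\<in>int_lattice. f (x + l) * exp (- 2 * pi * \<i> * of_real (l \<bullet> \<omega>)))"

definition is_cont_rep :: "(real ^ 'd::finite \<Rightarrow> complex) \<Rightarrow> (real ^ 'd \<Rightarrow> complex) \<Rightarrow> bool" where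
  "is_cont_rep f g \<longleftrightarrow> continuous_on UNIV g \<and> (AE x in lborel. f x = g x)"

definition cont_rep :: "(real ^ 'd::finite \<Rightarrow> complex) \<Rightarrow> real ^ 'd \<Rightarrow> complex" where
  "cont_rep f = (THE g. is_cont_rep f g)"

lemma is_cont_rep_unique:
  fixes f g h :: "real ^ 'd::finite \<Rightarrow> complex"
  assumes "is_cont_rep f g" "is_cont_rep f h"
  shows "g = h"
proof -
  have c: "continuous_on UNIV g" "continuous_on UNIV h"
    and ae: "AE x in lborel. f x = g x" "AE x in lborel. f x = h x"
    using assms by (auto simp: is_cont_rep_def)
  have "AE x in lborel. g x = h x"
    using ae by eventually_elim auto
  moreover have op: "open {x. g x \<noteq> h x}"
    using c by (intro open_Collect_neq)
  ultimately have "{x. g x \<noteq> h x} \<in> null_sets lborel"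
    by (subst AE_iff_null_sets) auto
  then have "negligible {x. g x \<noteq> h x}"
    by (simp add: negligible_iff_null_sets null_sets_completionI)
  with op have "{x. g x \<noteq> h x} = {}"
    using open_not_negligible by blast
  then show ?thesis by auto
qed

lemma cont_rep_eq: "is_cont_rep f g \<Longrightarrow> cont_rep f = g"
  unfolding cont_rep_def by (rule the_equality) (auto intro: is_cont_rep_unique)

definition translates :: "nat \<Rightarrow> (nat \<Rightarrow> real ^ 'd::finite \<Rightarrow> complex) \<Rightarrow> (real ^ 'd \<Rightarrow> complex) set" where
  "translates k \<phi> = {\<lambda>x. \<phi> i (x - l) | i l. i \<in> {1..k} \<and> l \<in> int_lattice}"

definition orthonormal_translates :: "nat \<Rightarrow> (nat \<Rightarrow> real ^ 'd::finite \<Rightarrow> complex) \<Rightarrow> bool" where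
  "orthonormal_translates k \<phi> \<longleftrightarrow>
     (\<forall>i\<in>{1..k}. \<forall>j\<in>{1..k}. \<forall>l\<in>int_lattice. \<forall>l'\<in>int_lattice.
        L2_inner (\<lambda>x. \<phi> i (x - l)) (\<lambda>x. \<phi> j (x - l')) = (if i = j \<and> l = l' then 1 else 0))"

definition complex_span :: "(real ^ 'd::finite \<Rightarrow> complex) set \<Rightarrow> (real ^ 'd \<Rightarrow> complex) set" where
  "complex_span S = {\<lambda>x. \<Sum>g\<in>T. c g * g x | T c. finite T \<and> T \<subseteq> S}"

definition L2_closure :: "(real ^ 'd::finite \<Rightarrow> complex) set \<Rightarrow> (real ^ 'd \<Rightarrow> complex) set" where
  "L2_closure S = {f \<in> L2. \<exists>u. (\<forall>n. u n \<in> S) \<and> L2_limit u f}"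

definition shift_invariant_space ::
    "nat \<Rightarrow> (nat \<Rightarrow> real ^ 'd::finite \<Rightarrow> complex) \<Rightarrow> (real ^ 'd \<Rightarrow> complex) set" where
  "shift_invariant_space k \<phi> = L2_closure (complex_span (translates k \<phi>))"

text \<open>
  A linear subspace of \<open>L\<^sup>2\<close>, complete in the \<open>L\<^sup>2\<close> norm, all of whose members have a continuous
  representative, such that evaluation of that representative at each point is bounded.
\<close>

definition L2_RKHS :: "(real ^ 'd::finite \<Rightarrow> complex) set \<Rightarrow> bool" where
  "L2_RKHS V \<longleftrightarrow>
     V \<subseteq> L2 \<and> (\<lambda>x. 0) \<in> V \<and>
     (\<forall>f\<in>V. \<forall>g\<in>V. (\<lambda>x. f x + g x) \<in> V) \<and> (\<forall>c. \<forall>f\<in>V. (\<lambda>x. c * f x) \<in> V) \<and>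
     (\<forall>u. (\<forall>n. u n \<in> V) \<and>
          (\<forall>e>0. \<exists>N. \<forall>p\<ge>N. \<forall>q\<ge>N. L2_norm (\<lambda>x. u p x - u q x) < e) \<longrightarrow>
          (\<exists>f\<in>V. L2_limit u f)) \<and>
     (\<forall>f\<in>V. \<exists>g. is_cont_rep f g) \<and>
     (\<forall>x. \<exists>B. \<forall>f\<in>V. norm (cont_rep f x) \<le> B * L2_norm f)"

text \<open>
  The suprema below are taken in \<^typ>\<open>ennreal\<close>, where all sums and suprema exist.
  \<^const>\<open>esssup\<close> is \<open>\<infinity>\<close> on non-measurable functions, but the functions it is applied to are measurable when
  the \<open>\<psi>h i\<close> are Borel: \<open>zak (\<psi>h i) \<omega>\<close> is continuous for every \<open>\<omega>\<close>, so the supremum over \<open>x\<close> may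
  be restricted to a countable set.
\<close>

definition sample_bound :: "nat \<Rightarrow> (nat \<Rightarrow> real ^ 'd::finite \<Rightarrow> complex) \<Rightarrow> ennreal" where
  "sample_bound k \<psi> =
     (SUP i\<in>{1..k}. SUP x\<in>unit_cube.
        \<Sum>\<^sub>\<infinity>l\<in>int_lattice. ennreal ((norm (cont_rep (\<psi> i) (x + l)))\<^sup>2))"

definition fourier_bound :: "nat \<Rightarrow> (nat \<Rightarrow> real ^ 'd::finite \<Rightarrow> complex) \<Rightarrow> ennreal" where
  "fourier_bound k \<psi>h =
     (SUP i\<in>{1..k}. esssup (restrict_space lborel unit_cube)
        (\<lambda>\<omega>. \<Sum>\<^sub>\<infinity>l\<in>int_lattice. ennreal (norm (\<psi>h i (\<omega> + l)))))"

definition zak_lipschitz :: "nat \<Rightarrow> (nat \<Rightarrow> real ^ 'd::finite \<Rightarrow> complex) \<Rightarrow> ennreal" where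
  "zak_lipschitz k \<psi>h =
     esssup (restrict_space lborel {(\<omega>, \<omega>'). \<omega> \<in> unit_cube \<and> \<omega>' \<in> unit_cube \<and> \<omega> \<noteq> \<omega>'})
       (\<lambda>(\<omega>, \<omega>'). SUP x\<in>unit_cube. SUP i\<in>{1..k}.
          ennreal (norm (zak (\<psi>h i) \<omega> x - zak (\<psi>h i) \<omega>' x) / infnorm (\<omega> - \<omega>')))"

end

theory Submission
  imports Defs
begin

text \<open>
  With \<open>g i w = \<psi>h i (w - \<nu> i)\<close>, the transform of \<open>\<phi> i\<close>, let \<open>v w x\<close> be the vector of the Zak transforms
  \<open>\<Sum>\<^sub>l g i (w + l) chr l x\<close>. By Poisson summation the samples of \<open>f = \<Sum> c (i, l) \<phi> i (\<cdot> - l)\<close> on \<open>x + \<int>\<^sup>d\<close> are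
  Fourier coefficients of \<open>w \<mapsto> \<langle>v w x, y w\<rangle>\<close>, with \<open>y\<close> the Fourier series of \<open>c\<close>. Thus their square sum
  is the integral of \<open>|\<langle>v w x, y w\<rangle>|\<^sup>2\<close> over the cube, whereas \<open>\<parallel>f\<parallel>\<^sup>2\<close> is the integral of \<open>|y w|\<^sup>2\<close>, and the claim
  follows from an eigenvalue bound for the random matrix \<open>\<Sum>\<^sub>r v w (x\<^sub>r) v w (x\<^sub>r)\<^sup>*\<close> that is uniform in \<open>w\<close>.

  For fixed \<open>w\<close> the summands have mean \<open>I\<close>, by orthonormality of the translates, and norm at most
  \<open>k C\<^sup>2\<close>. Since they have rank one, the trace inequalities needed for a matrix Chernoff bound follow
  from the log-convexity of the moments \<open>n \<mapsto> \<langle>u, T\<^sup>n u\<rangle>\<close> of a positive operator, without the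
  Golden-Thompson inequality. The bound is applied at one point \<open>w\<close> close to the center of each of
  \<open>N\<^sup>d\<close> subcubes, with \<open>N \<le> 2 k C K / \<alpha> + 1\<close>, and the Lipschitz condition extends it to all \<open>w\<close>.
\<close>

section \<open>Moments of positive operators\<close>

text \<open>A rank one term enters a product of operators only through scalars, so the effect of
  adding it to \<open>T\<close> is governed by the moments of \<open>T\<close> at its vector.
  Log-convexity bounds them by their values in the commuting case. The two tails need different
  one-step estimates. Isotropy averages the form of an operator that does not depend on the new
  sample. For the upper tail this is the operator before the sample is added; for the lower tail it
  is the larger of the two operators, and passing to its form costs the factor 1 - \<theta>R/2.
  Isotropy and the Lipschitz estimate hold only for almost every w and may fail at the centers of
  the subcubes, so the net points are displaced by up to \<eta>. The tolerance \<alpha> is spent as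
  0.495 on the deviation at net points, 0.5 on the mesh and 0.005 on the displacement. The factor 10
  comes from 0.41 * 0.495^2 > 1/10, where 0.41 is the rate of the deviation bounds. The event
  quantifies over the uncountable \<open>V\<close>; a countable dense family of coefficients makes
  it measurable.\<close>

definition ip :: "'i set \<Rightarrow> ('i \<Rightarrow> complex) \<Rightarrow> ('i \<Rightarrow> complex) \<Rightarrow> complex" where
  "ip I x y = (\<Sum>i\<in>I. cnj (x i) * y i)"

definition nsq :: "'i set \<Rightarrow> ('i \<Rightarrow> complex) \<Rightarrow> real" where
  "nsq I x = (\<Sum>i\<in>I. (cmod (x i))\<^sup>2)"

text \<open>Vectors are functions on the whole index type, while the forms see only the coordinates
  in \<open>I\<close>. Linearity is asked as an equation of functions, so that it passes to powers
  of \<open>T\<close>.\<close>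

definition psd_op :: "'i set \<Rightarrow> (('i \<Rightarrow> complex) \<Rightarrow> 'i \<Rightarrow> complex) \<Rightarrow> bool" where
  "psd_op I T \<longleftrightarrow>
     (\<forall>x y a. T (\<lambda>i. x i + a * y i) = (\<lambda>i. T x i + a * T y i)) \<and>
     (\<forall>x y. ip I x (T y) = ip I (T x) y) \<and>
     (\<forall>x. 0 \<le> Re (ip I x (T x)))"

definition op_le :: "'i set \<Rightarrow> (('i \<Rightarrow> complex) \<Rightarrow> 'i \<Rightarrow> complex) \<Rightarrow> real \<Rightarrow> bool" where
  "op_le I T \<beta> \<longleftrightarrow> (\<forall>x. Re (ip I x (T x)) \<le> \<beta> * nsq I x)"

definition add_rank1 ::
    "'i set \<Rightarrow> (('i \<Rightarrow> complex) \<Rightarrow> 'i \<Rightarrow> complex) \<Rightarrow> ('i \<Rightarrow> complex) \<Rightarrow> ('i \<Rightarrow> complex) \<Rightarrow> 'i \<Rightarrow> complex" where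
  "add_rank1 I T u x = (\<lambda>i. T x i + u i * ip I u x)"

text \<open>These are the moments of the spectral measure of \<open>T\<close> at
  \<open>x\<close>.\<close>

definition moment :: "'i set \<Rightarrow> (('i \<Rightarrow> complex) \<Rightarrow> 'i \<Rightarrow> complex) \<Rightarrow> ('i \<Rightarrow> complex) \<Rightarrow> nat \<Rightarrow> real" where
  "moment I T x n = Re (ip I x ((T ^^ n) x))"

definition unit_vec :: "'i \<Rightarrow> 'i \<Rightarrow> complex" where
  "unit_vec i = (\<lambda>j. if j = i then 1 else 0)"

definition trace_pow :: "'i set \<Rightarrow> (('i \<Rightarrow> complex) \<Rightarrow> 'i \<Rightarrow> complex) \<Rightarrow> nat \<Rightarrow> real" where
  "trace_pow I T n = (\<Sum>i\<in>I. moment I T (unit_vec i) n)"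

text \<open>This is the trace of e^T, and \<open>exp_form\<close> is the quadratic form of e^T; both
  are scalar power series over the moments.\<close>

definition exp_trace :: "'i set \<Rightarrow> (('i \<Rightarrow> complex) \<Rightarrow> 'i \<Rightarrow> complex) \<Rightarrow> real" where
  "exp_trace I T = (\<Sum>n. trace_pow I T n / fact n)"

definition exp_form :: "'i set \<Rightarrow> (('i \<Rightarrow> complex) \<Rightarrow> 'i \<Rightarrow> complex) \<Rightarrow> ('i \<Rightarrow> complex) \<Rightarrow> real" where
  "exp_form I T x = (\<Sum>n. moment I T x n / fact n)"

section \<open>Sesquilinear algebra and positive forms\<close>

lemma nsq_nonneg [simp]: "0 \<le> nsq I x"
  by (simp add: nsq_def sum_nonneg)

lemma ip_self: "ip I x x = of_real (nsq I x)"
  by (simp add: ip_def nsq_def complex_norm_square mult.commute del: of_real_power)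

lemma ip_add_right: "ip I x (\<lambda>i. y i + z i) = ip I x y + ip I x z"
  and ip_scale_right: "ip I x (\<lambda>i. a * y i) = a * ip I x y"
  and ip_scale_right': "ip I x (\<lambda>i. y i * a) = ip I x y * a"
  and ip_add_left: "ip I (\<lambda>i. y i + z i) x = ip I y x + ip I z x"
  and ip_scale_left: "ip I (\<lambda>i. a * y i) x = cnj a * ip I y x"
  and ip_scale_left': "ip I (\<lambda>i. y i * a) x = ip I y x * cnj a"
  and cnj_ip: "cnj (ip I x y) = ip I y x"
  by (simp_all add: ip_def algebra_simps sum.distrib sum_distrib_left)

lemma ip_sum_right: "ip I x (\<lambda>i. \<Sum>a\<in>A. f a i) = (\<Sum>a\<in>A. ip I x (f a))"
  unfolding ip_def by (subst sum.swap) (simp add: sum_distrib_left)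

lemma ip_unit_vec:
  assumes "finite I" "i \<in> I"
  shows "ip I (unit_vec i) x = x i" "ip I x (unit_vec i) = cnj (x i)"
  using assms by (simp_all add: ip_def unit_vec_def if_distrib[of cnj] if_distrib[of "\<lambda>z. z * _"]
      if_distrib[of "\<lambda>z. _ * z"] sum.delta cong: if_cong)

lemma nsq_scale: "nsq I (\<lambda>i. a * x i) = (cmod a)\<^sup>2 * nsq I x"
  by (simp add: nsq_def norm_mult power_mult_distrib sum_distrib_left)

lemma psd_opD:
  assumes "psd_op I T"
  shows "T (\<lambda>i. x i + a * y i) = (\<lambda>i. T x i + a * T y i)"
    and "ip I x (T y) = ip I (T x) y" and "0 \<le> Re (ip I x (T x))"
  using assms unfolding psd_op_def by auto

lemma psd_op_scale:
  assumes "psd_op I T" shows "T (\<lambda>i. a * x i) = (\<lambda>i. a * T x i)"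
proof -
  have z: "T (\<lambda>i. 0) = (\<lambda>i. 0)"
    using psd_opD(1)[OF assms, of "\<lambda>i. 0" "-1" "\<lambda>i. 0"] by simp
  show ?thesis
    using psd_opD(1)[OF assms, of "\<lambda>i. 0" a x] z by simp
qed

lemma psd_op_sum:
  assumes "psd_op I T"
  shows "T (\<lambda>i. \<Sum>a\<in>A. c a * f a i) = (\<lambda>i. \<Sum>a\<in>A. c a * T (f a) i)"
proof (induction A rule: infinite_finite_induct)
  case (insert x F)
  then show ?case
    using psd_opD(1)[OF assms, of "\<lambda>i. \<Sum>a\<in>F. c a * f a i" "c x" "f x"]
    by (simp add: add.commute)
qed (use psd_op_scale[OF assms, of 0] in simp_all)

lemma psd_op_Cauchy_Schwarz:
  assumes T: "psd_op I T"
  shows "(cmod (ip I x (T y)))\<^sup>2 \<le> Re (ip I x (T x)) * Re (ip I y (T y))"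
proof -
  define b where "b = ip I x (T y)"
  define A where "A = Re (ip I x (T x))"
  define D where "D = Re (ip I y (T y))"
  have A: "0 \<le> A" and D: "0 \<le> D" unfolding A_def D_def using psd_opD(3)[OF T] by auto
  have yx: "ip I y (T x) = cnj b"
    unfolding b_def using psd_opD(2)[OF T, of y x] by (simp add: cnj_ip)
  \<comment> \<open>The choice of the phase of \<open>a\<close> makes the cross terms real, so the
    form along this line is a real quadratic polynomial in t.\<close>
  have q: "0 \<le> A + 2 * t * (cmod b)\<^sup>2 + t\<^sup>2 * (cmod b)\<^sup>2 * D" for t :: real
  proof -
    define a where "a = of_real t * cnj b"
    have "0 \<le> Re (ip I (\<lambda>i. x i + a * y i) (T (\<lambda>i. x i + a * y i)))"
      by (rule psd_opD(3)[OF T])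
    also have "ip I (\<lambda>i. x i + a * y i) (T (\<lambda>i. x i + a * y i)) =
        ip I x (T x) + (a * b + cnj (a * b)) + (a * cnj a) * ip I y (T y)"
      by (simp add: psd_opD(1)[OF T] ip_add_left ip_add_right ip_scale_left ip_scale_right yx
          b_def[symmetric] algebra_simps)
    also have "a * b = of_real (t * (cmod b)\<^sup>2)"
      unfolding a_def of_real_mult complex_norm_square by (simp add: mult_ac)
    also have "a * cnj a = of_real (t\<^sup>2 * (cmod b)\<^sup>2)"
      unfolding a_def of_real_mult complex_norm_square by (simp add: power2_eq_square mult_ac)
    finally show ?thesis
      by (simp add: A_def D_def)
  qed
  show ?thesis unfolding b_def[symmetric] A_def[symmetric] D_def[symmetric]
  proof (cases "b = 0")
    case True then show "(cmod b)\<^sup>2 \<le> A * D" using A D by simp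
  next
    case False
    then have b2: "0 < (cmod b)\<^sup>2" by simp
    show "(cmod b)\<^sup>2 \<le> A * D"
    proof (cases "D = 0")
      case True
      \<comment> \<open>For D = 0 the polynomial is affine in t, and this t gives it the value
        -1.\<close>
      have "0 \<le> A + 2 * (- (A + 1) / (2 * (cmod b)\<^sup>2)) * (cmod b)\<^sup>2"
        using q[of "- (A + 1) / (2 * (cmod b)\<^sup>2)"] True by simp
      also have "2 * (- (A + 1) / (2 * (cmod b)\<^sup>2)) * (cmod b)\<^sup>2 = - (A + 1)"
        using b2 by (simp add: field_simps)
      finally show ?thesis by simp
    next
      case False
      with D have D: "0 < D" by simp
      \<comment> \<open>The polynomial has its minimum at t = -1/D.\<close>
      have "0 \<le> A + 2 * (- 1 / D) * (cmod b)\<^sup>2 + (- 1 / D)\<^sup>2 * (cmod b)\<^sup>2 * D" by (rule q)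
      also have "\<dots> = A - (cmod b)\<^sup>2 / D"
        using D by (simp add: field_simps power2_eq_square)
      finally show ?thesis using D by (simp add: field_simps)
    qed
  qed
qed

lemma psd_op_id: "psd_op I (\<lambda>x. x)"
  by (simp add: psd_op_def ip_self)

lemma ip_Cauchy_Schwarz: "(cmod (ip I x y))\<^sup>2 \<le> nsq I x * nsq I y"
  using psd_op_Cauchy_Schwarz[OF psd_op_id, of I x y] by (simp add: ip_self)

section \<open>Moment sequences\<close>

lemma psd_op_funpow_selfadjoint:
  assumes "psd_op I T" shows "ip I x ((T ^^ n) y) = ip I ((T ^^ n) x) y"
proof (induction n arbitrary: x)
  case (Suc n)
  show ?case
    using Suc[of "T x"] by (simp add: psd_opD(2)[OF assms] flip: funpow_swap1)
qed simp

lemma moment_add: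
  assumes "psd_op I T" shows "moment I T x (a + b) = Re (ip I ((T ^^ a) x) ((T ^^ b) x))"
  by (simp add: moment_def funpow_add psd_op_funpow_selfadjoint[OF assms])

lemma moment_even_odd:
  assumes "psd_op I T"
  shows "moment I T x (2 * n) = nsq I ((T ^^ n) x)"
    and "moment I T x (Suc (2 * n)) = Re (ip I ((T ^^ n) x) (T ((T ^^ n) x)))"
proof -
  show "moment I T x (2 * n) = nsq I ((T ^^ n) x)"
    using moment_add[OF assms, of x n n] by (simp add: ip_self mult_2)
  show "moment I T x (Suc (2 * n)) = Re (ip I ((T ^^ n) x) (T ((T ^^ n) x)))"
    using moment_add[OF assms, of x n "Suc n"] by (simp add: mult_2)
qed

lemma moment_nonneg:
  assumes "psd_op I T" shows "0 \<le> moment I T x n"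
proof (cases "even n")
  case True then show ?thesis using moment_even_odd(1)[OF assms] by (auto elim!: evenE)
next
  case False then show ?thesis using moment_even_odd(2)[OF assms] psd_opD(3)[OF assms]
    by (auto elim!: oddE)
qed

lemma psd_op_funpow:
  assumes "psd_op I T" shows "psd_op I (T ^^ n)"
  unfolding psd_op_def
proof (intro conjI allI)
  fix x y a
  show "(T ^^ n) (\<lambda>i. x i + a * y i) = (\<lambda>i. (T ^^ n) x i + a * (T ^^ n) y i)"
    by (induction n) (simp_all add: psd_opD(1)[OF assms])
qed (use psd_op_funpow_selfadjoint[OF assms] moment_nonneg[OF assms] in \<open>auto simp: moment_def\<close>)

lemma ip_funpow_self:
  assumes "psd_op I T" shows "ip I x ((T ^^ n) x) = of_real (moment I T x n)"
proof -
  have "cnj (ip I x ((T ^^ n) x)) = ip I x ((T ^^ n) x)"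
    by (simp add: cnj_ip psd_op_funpow_selfadjoint[OF assms])
  then show ?thesis unfolding moment_def by (simp add: complex_eq_iff)
qed

text \<open>Three consecutive moments are the entries of a 2 by 2 Gram matrix of
  \<open>(T ^^ m) x\<close> and \<open>(T ^^ Suc m) x\<close>: in the standard inner product if n =
  2 m, in the positive form of \<open>T\<close> if n = 2 m + 1. Splitting by parity stands in for a
  square root of \<open>T\<close>.\<close>

lemma moment_log_convex:
  assumes T: "psd_op I T"
  shows "(moment I T x (Suc n))\<^sup>2 \<le> moment I T x n * moment I T x (Suc (Suc n))"
proof (cases "even n")
  case True
  then obtain m where n: "n = 2 * m" by blast
  have "(moment I T x (Suc n))\<^sup>2 \<le> (cmod (ip I ((T ^^ m) x) ((T ^^ Suc m) x)))\<^sup>2"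
    unfolding n moment_even_odd[OF T] by (simp add: abs_Re_le_cmod power2_le_iff_abs_le)
  also have "\<dots> \<le> nsq I ((T ^^ m) x) * nsq I ((T ^^ Suc m) x)" by (rule ip_Cauchy_Schwarz)
  finally show ?thesis
    using moment_even_odd(1)[OF T, of x "Suc m"] by (simp add: n moment_even_odd(1)[OF T])
next
  case False
  then obtain m where n: "n = 2 * m + 1" by (blast elim: oddE)
  let ?a = "(T ^^ m) x" and ?b = "(T ^^ Suc m) x"
  have "moment I T x (Suc n) = Re (ip I ?a (T ?b))"
    using moment_add[OF T, of x m "Suc (Suc m)"] by (simp add: n mult_2)
  then have "(moment I T x (Suc n))\<^sup>2 \<le> (cmod (ip I ?a (T ?b)))\<^sup>2"
    by (simp add: abs_Re_le_cmod power2_le_iff_abs_le)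
  also have "\<dots> \<le> Re (ip I ?a (T ?a)) * Re (ip I ?b (T ?b))" by (rule psd_op_Cauchy_Schwarz[OF T])
  finally show ?thesis
    using moment_even_odd(2)[OF T, of x m] moment_even_odd(2)[OF T, of x "Suc m"] by (simp add: n)
qed

text \<open>By log-convexity consecutive ratios increase; the cross-multiplied form stays meaningful
  when members of the sequence vanish.\<close>

lemma log_convex_ratio:
  fixes s :: "nat \<Rightarrow> real"
  assumes nn: "\<And>n. 0 \<le> s n" and lc: "\<And>n. (s (Suc n))\<^sup>2 \<le> s n * s (Suc (Suc n))"
    and "n \<le> m"
  shows "s (Suc n) * s m \<le> s n * s (Suc m)"
  using \<open>n \<le> m\<close>
proof (induction m rule: dec_induct)
  case (step m)
  show ?case
  proof (cases "s (Suc m) = 0")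
    case True then show ?thesis using nn by simp
  next
    case False
    then have pos: "0 < s (Suc m)" using nn[of "Suc m"] by simp
    have "s (Suc n) * s (Suc m) * s (Suc m) \<le> s (Suc n) * (s m * s (Suc (Suc m)))"
      using mult_left_mono[OF lc[of m] nn[of "Suc n"]] by (simp add: power2_eq_square mult_ac)
    also have "\<dots> \<le> s n * s (Suc m) * s (Suc (Suc m))"
      using mult_right_mono[OF step.IH nn[of "Suc (Suc m)"]] by (simp add: mult_ac)
    finally show ?thesis using pos by (simp add: mult_ac)
  qed
qed simp

text \<open>Each use of \<open>log_convex_ratio\<close> moves one unit from the smaller index to the
  larger one, until the smaller index is 0. For moments of a measure this is the Chebyshev
  inequality for increasing functions.\<close>

lemma log_convex_Chebyshev:
  fixes s :: "nat \<Rightarrow> real"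
  assumes nn: "\<And>n. 0 \<le> s n" and lc: "\<And>n. (s (Suc n))\<^sup>2 \<le> s n * s (Suc (Suc n))"
  shows "s a * s b \<le> s 0 * s (a + b)"
proof -
  have *: "s a * s b \<le> s 0 * s (a + b)" if "a \<le> b" for a b
    using that
  proof (induction a arbitrary: b)
    case (Suc a)
    have "s (Suc a) * s b \<le> s a * s (Suc b)"
      using Suc.prems nn lc by (intro log_convex_ratio) auto
    also have "\<dots> \<le> s 0 * s (a + Suc b)" using Suc.prems by (intro Suc.IH) auto
    finally show ?case by simp
  qed simp
  show ?thesis
    using *[of a b] *[of b a] by (cases "a \<le> b") (auto simp: mult.commute add.commute)
qed

lemma moment_0 [simp]: "moment I T x 0 = nsq I x"
  by (simp add: moment_def ip_self)

lemma moment_Chebyshev: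
  assumes T: "psd_op I T"
  shows "moment I T x a * moment I T x b \<le> nsq I x * moment I T x (a + b)"
  using log_convex_Chebyshev[of "moment I T x" a b] moment_nonneg[OF T] moment_log_convex[OF T]
  by simp

text \<open>The hypothesis controls the ratio of moments only from an even index 2 n to 2 n + 1,
  where it is the form bound at \<open>(T ^^ n) x\<close>. Since the ratios increase, the ratio at n
  is at most the one at 2 n.\<close>

lemma moment_bound:
  assumes T: "psd_op I T" and b: "op_le I T \<beta>" and "0 \<le> \<beta>"
  shows "moment I T x n \<le> \<beta> ^ n * nsq I x"
proof (induction n)
  case (Suc n)
  have odd: "moment I T x (Suc (2 * n)) \<le> \<beta> * moment I T x (2 * n)" for n
    unfolding moment_even_odd[OF T] using b unfolding op_le_def by blast
  have "moment I T x (Suc n) \<le> \<beta> * moment I T x n"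
  proof (cases "moment I T x n = 0")
    case True
    have "(moment I T x (Suc n))\<^sup>2 \<le> 0" using moment_log_convex[OF T, of x n] True by simp
    then show ?thesis using True by simp
  next
    case False
    then have pos: "0 < moment I T x n" using moment_nonneg[OF T, of x n] by simp
    show ?thesis
    proof (cases "moment I T x (2 * n) = 0")
      case True
      \<comment> \<open>If the moment at 2 n vanishes, the norm of \<open>(T ^^ n) x\<close>
        vanishes, and with it the moment at n, against \<open>pos\<close>.\<close>
      then have "nsq I ((T ^^ n) x) = 0" using moment_even_odd(1)[OF T] by simp
      moreover have "(moment I T x n)\<^sup>2 \<le> nsq I x * nsq I ((T ^^ n) x)"
      proof -
        have "(moment I T x n)\<^sup>2 \<le> (cmod (ip I x ((T ^^ n) x)))\<^sup>2"
          unfolding moment_def by (simp add: abs_Re_le_cmod power2_le_iff_abs_le)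
        then show ?thesis using ip_Cauchy_Schwarz[of I x "(T ^^ n) x"] by linarith
      qed
      ultimately show ?thesis using pos by simp
    next
      case False
      then have p2: "0 < moment I T x (2 * n)" using moment_nonneg[OF T, of x "2 * n"] by simp
      have "moment I T x (Suc n) * moment I T x (2 * n) \<le> moment I T x n * moment I T x (Suc (2 * n))"
        by (intro log_convex_ratio moment_nonneg[OF T] moment_log_convex[OF T]) simp
      also have "\<dots> \<le> moment I T x n * (\<beta> * moment I T x (2 * n))"
        by (intro mult_left_mono odd moment_nonneg[OF T])
      finally show ?thesis using p2 by (simp add: mult_ac)
    qed
  qed
  also have "\<dots> \<le> \<beta> * (\<beta> ^ n * nsq I x)" using Suc \<open>0 \<le> \<beta>\<close> by (rule mult_left_mono)
  finally show ?case by (simp add: mult_ac)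
qed simp

section \<open>Rank one updates\<close>

lemma add_rank1_psd:
  assumes T: "psd_op I T" shows "psd_op I (add_rank1 I T u)"
  unfolding psd_op_def add_rank1_def
proof (intro conjI allI)
  fix x y a
  show "(\<lambda>i. T (\<lambda>i. x i + a * y i) i + u i * ip I u (\<lambda>i. x i + a * y i)) =
      (\<lambda>i. T x i + u i * ip I u x + a * (T y i + u i * ip I u y))"
    by (simp add: psd_opD(1)[OF T] ip_add_right ip_scale_right algebra_simps)
  show "ip I x (\<lambda>i. T y i + u i * ip I u y) = ip I (\<lambda>i. T x i + u i * ip I u x) y"
    by (simp add: ip_add_left ip_add_right ip_scale_left' ip_scale_right' psd_opD(2)[OF T] cnj_ip
        mult.commute)
  show "0 \<le> Re (ip I x (\<lambda>i. T x i + u i * ip I u x))"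
  proof -
    have "ip I x u * ip I u x = of_real ((cmod (ip I u x))\<^sup>2)"
      by (metis cnj_ip complex_norm_square mult.commute)
    then show ?thesis
      using psd_opD(3)[OF T, of x] by (simp add: ip_add_right ip_scale_right')
  qed
qed

lemma ip_add_rank1: "ip I x (add_rank1 I T u x) = ip I x (T x) + of_real ((cmod (ip I u x))\<^sup>2)"
proof -
  have "ip I x u * ip I u x = of_real ((cmod (ip I u x))\<^sup>2)"
    by (metis cnj_ip complex_norm_square mult.commute)
  then show ?thesis by (simp add: add_rank1_def ip_add_right ip_scale_right')
qed

lemma add_rank1_le:
  assumes "op_le I T \<beta>" shows "op_le I (add_rank1 I T u) (\<beta> + nsq I u)"
  unfolding op_le_def
proof
  fix x
  have "Re (ip I x (T x)) \<le> \<beta> * nsq I x" using assms by (simp add: op_le_def)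
  moreover have "(cmod (ip I u x))\<^sup>2 \<le> nsq I u * nsq I x" by (rule ip_Cauchy_Schwarz)
  ultimately show "Re (ip I x (add_rank1 I T u x)) \<le> (\<beta> + nsq I u) * nsq I x"
    by (simp add: ip_add_rank1 algebra_simps)
qed

text \<open>Duhamel's formula: \<open>T\<close> is replaced by the updated operator one factor at a
  time. The powers of the updated operator are left unexpanded, so that pairing with powers of
  \<open>T\<close> at u yields a recursion.\<close>

lemma funpow_add_rank1:
  assumes T: "psd_op I T"
  shows "(add_rank1 I T u ^^ n) x =
    (\<lambda>i. (T ^^ n) x i + (\<Sum>a<n. ip I u ((T ^^ a) x) * (add_rank1 I T u ^^ (n - 1 - a)) u i))"
proof (induction n)
  case (Suc n)
  let ?M = "add_rank1 I T u"
  have M: "psd_op I ?M" by (rule add_rank1_psd[OF T])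
  \<comment> \<open>The factor 1 puts the argument into the shape x + a y of
    \<open>psd_opD\<close>.\<close>
  have "(?M ^^ Suc n) x = ?M (\<lambda>i. (T ^^ n) x i + 1 * (\<Sum>a<n. ip I u ((T ^^ a) x) * (?M ^^ (n - 1 - a)) u i))"
    using Suc by simp
  also have "\<dots> = (\<lambda>i. ?M ((T ^^ n) x) i + (\<Sum>a<n. ip I u ((T ^^ a) x) * ?M ((?M ^^ (n - 1 - a)) u) i))"
    by (subst psd_opD(1)[OF M]) (simp add: psd_op_sum[OF M])
  also have "\<dots> = (\<lambda>i. ?M ((T ^^ n) x) i + (\<Sum>a<n. ip I u ((T ^^ a) x) * (?M ^^ (n - a)) u i))"
  proof -
    have "?M ((?M ^^ (n - 1 - a)) u) = (?M ^^ (n - a)) u" if "a < n" for a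
    proof -
      have "n - a = Suc (n - 1 - a)" using that by simp
      then show ?thesis by (simp only: funpow.simps comp_apply)
    qed
    then show ?thesis by (simp cong: sum.cong_simp)
  qed
  also have "\<dots> = (\<lambda>i. (T ^^ Suc n) x i + (\<Sum>a<Suc n. ip I u ((T ^^ a) x) * (?M ^^ (Suc n - 1 - a)) u i))"
    unfolding add_rank1_def[of I T u "(T ^^ n) x"] by (rule ext) (simp only: sum.lessThan_Suc, simp)
  finally show ?case .
qed simp

text \<open>For x = u the scalars in Duhamel's formula are moments of \<open>T\<close>, so the cross
  moments satisfy a recursion in b that involves the operator only through these numbers.\<close>

lemma cross_moment_rec:
  assumes T: "psd_op I T"
  shows "Re (ip I ((T ^^ a) u) ((add_rank1 I T u ^^ b) u)) = moment I T u (a + b) +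
    (\<Sum>c<b. moment I T u c * Re (ip I ((T ^^ a) u) ((add_rank1 I T u ^^ (b - 1 - c)) u)))"
  by (subst funpow_add_rank1[OF T])
    (simp add: ip_add_right ip_sum_right ip_scale_right ip_funpow_self[OF T] moment_add[OF T])

lemma cross_moment_lower:
  assumes T: "psd_op I T"
  shows "moment I T u (a + b) \<le> Re (ip I ((T ^^ a) u) ((add_rank1 I T u ^^ b) u))"
proof (induction b rule: less_induct)
  case (less b)
  have "0 \<le> Re (ip I ((T ^^ a) u) ((add_rank1 I T u ^^ (b - 1 - c)) u))" if "c < b" for c
    using less[of "b - 1 - c"] that moment_nonneg[OF T, of u "a + (b - 1 - c)"] by linarith
  then show ?case
    by (subst cross_moment_rec[OF T]) (auto intro!: sum_nonneg mult_nonneg_nonneg moment_nonneg[OF T])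
qed

text \<open>The hockey stick identity with the summation reversed.\<close>

lemma sum_choose_reverse: "(\<Sum>c<b. (b - 1 - c) choose j) = b choose Suc j"
proof -
  have "(\<Sum>c<b. (b - 1 - c) choose j) = (\<Sum>c<b. c choose j)"
    using sum.nat_diff_reindex[of "\<lambda>c. c choose j" b] by (simp add: diff_diff_left)
  also have "\<dots> = b choose Suc j"
  proof (cases b)
    case (Suc n)
    then show ?thesis
      using sum_choose_upper[of j n] by (simp add: lessThan_Suc_atMost atMost_atLeast0 del: binomial_Suc_Suc)
  qed simp
  finally show ?thesis .
qed

text \<open>The right-hand side is the form of T^a (T + |u|^2)^b at u, which is the exact value when
  u is an eigenvector of \<open>T\<close>. In general the recursion produces products of two
  moments, and \<open>moment_Chebyshev\<close> merges each product into |u|^2 times a single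
  moment.\<close>

lemma cross_moment_upper:
  assumes T: "psd_op I T"
  shows "Re (ip I ((T ^^ a) u) ((add_rank1 I T u ^^ b) u))
    \<le> (\<Sum>j\<le>b. real (b choose j) * nsq I u ^ j * moment I T u (a + b - j))"
proof (induction b rule: less_induct)
  case (less b)
  let ?s = "moment I T u" and ?r = "\<lambda>b. Re (ip I ((T ^^ a) u) ((add_rank1 I T u ^^ b) u))"
  have nn: "0 \<le> ?s n" for n by (rule moment_nonneg[OF T])
  have "?s c * ?r (b - 1 - c) \<le>
      (\<Sum>j<b. real ((b - 1 - c) choose j) * (nsq I u ^ Suc j * ?s (a + b - Suc j)))"
    if c: "c < b" for c
  proof -
    have "?s c * ?r (b - 1 - c) \<le> ?s c *
        (\<Sum>j\<le>b - 1 - c. real ((b - 1 - c) choose j) * nsq I u ^ j * ?s (a + (b - 1 - c) - j))"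
      using less[of "b - 1 - c"] c nn by (intro mult_left_mono) auto
    also have "\<dots> = (\<Sum>j\<le>b - 1 - c. real ((b - 1 - c) choose j) * nsq I u ^ j * (?s c * ?s (a + (b - 1 - c) - j)))"
      by (simp add: sum_distrib_left mult_ac)
    also have "\<dots> \<le> (\<Sum>j\<le>b - 1 - c. real ((b - 1 - c) choose j) * nsq I u ^ j * (nsq I u * ?s (a + b - Suc j)))"
    proof (intro sum_mono mult_left_mono)
      fix j assume "j \<in> {..b - 1 - c}"
      \<comment> \<open>The truncated subtractions are exact here, because j is at most b - 1 -
        c.\<close>
      then have e: "c + (a + (b - 1 - c) - j) = a + b - Suc j" using c by auto
      show "?s c * ?s (a + (b - 1 - c) - j) \<le> nsq I u * ?s (a + b - Suc j)"
        using moment_Chebyshev[OF T, of u c "a + (b - 1 - c) - j"] unfolding e .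
    qed auto
    also have "\<dots> = (\<Sum>j\<le>b - 1 - c. real ((b - 1 - c) choose j) * (nsq I u ^ Suc j * ?s (a + b - Suc j)))"
      by (simp add: mult_ac)
    also have "\<dots> \<le> (\<Sum>j<b. real ((b - 1 - c) choose j) * (nsq I u ^ Suc j * ?s (a + b - Suc j)))"
      using c by (intro sum_mono2) (auto intro!: mult_nonneg_nonneg nn)
    finally show ?thesis .
  qed
  then have "(\<Sum>c<b. ?s c * ?r (b - 1 - c)) \<le>
      (\<Sum>c<b. \<Sum>j<b. real ((b - 1 - c) choose j) * (nsq I u ^ Suc j * ?s (a + b - Suc j)))"
    by (intro sum_mono) auto
  also have "\<dots> = (\<Sum>j<b. real (\<Sum>c<b. (b - 1 - c) choose j) * (nsq I u ^ Suc j * ?s (a + b - Suc j)))"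
    by (subst sum.swap) (simp add: sum_distrib_right)
  also have "\<dots> = (\<Sum>j<b. real (b choose Suc j) * (nsq I u ^ Suc j * ?s (a + b - Suc j)))"
    by (simp only: sum_choose_reverse)
  finally have "?r b \<le> ?s (a + b) + (\<Sum>j<b. real (b choose Suc j) * (nsq I u ^ Suc j * ?s (a + b - Suc j)))"
    by (subst cross_moment_rec[OF T]) simp
  also have "\<dots> = (\<Sum>j<Suc b. real (b choose j) * nsq I u ^ j * ?s (a + b - j))"
    by (subst sum.lessThan_Suc_shift) (simp add: mult_ac)
  finally show ?case by (simp add: lessThan_Suc_atMost)
qed

text \<open>Each summand of Duhamel's formula is a rank one operator, whose trace is the inner
  product of its two vectors.\<close>

lemma trace_pow_add_rank1:
  assumes T: "psd_op I T" and fin: "finite I"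
  shows "trace_pow I (add_rank1 I T u) n = trace_pow I T n +
    (\<Sum>a<n. Re (ip I ((T ^^ a) u) ((add_rank1 I T u ^^ (n - 1 - a)) u)))"
proof -
  let ?M = "add_rank1 I T u"
  have "moment I ?M (unit_vec i) n = moment I T (unit_vec i) n +
      (\<Sum>a<n. Re (cnj ((T ^^ a) u i) * (?M ^^ (n - 1 - a)) u i))" if "i \<in> I" for i
    unfolding moment_def using that fin
    by (subst funpow_add_rank1[OF T])
      (simp add: ip_add_right ip_sum_right ip_scale_right ip_unit_vec psd_op_funpow_selfadjoint[OF T])
  then have "trace_pow I ?M n = trace_pow I T n +
      (\<Sum>i\<in>I. \<Sum>a<n. Re (cnj ((T ^^ a) u i) * (?M ^^ (n - 1 - a)) u i))"
    by (simp add: trace_pow_def sum.distrib)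
  also have "(\<Sum>i\<in>I. \<Sum>a<n. Re (cnj ((T ^^ a) u i) * (?M ^^ (n - 1 - a)) u i)) =
      (\<Sum>a<n. Re (ip I ((T ^^ a) u) ((?M ^^ (n - 1 - a)) u)))"
    unfolding ip_def Re_sum by (rule sum.swap)
  finally show ?thesis .
qed

section \<open>The trace of the exponential\<close>

definition bounded_psd :: "'i set \<Rightarrow> (('i \<Rightarrow> complex) \<Rightarrow> 'i \<Rightarrow> complex) \<Rightarrow> bool" where
  "bounded_psd I T \<longleftrightarrow> finite I \<and> psd_op I T \<and> (\<exists>\<beta>\<ge>0. op_le I T \<beta>)"

lemma bounded_psdD: "bounded_psd I T \<Longrightarrow> psd_op I T" "bounded_psd I T \<Longrightarrow> finite I"
  by (auto simp: bounded_psd_def)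

lemma add_rank1_bounded_psd: "bounded_psd I T \<Longrightarrow> bounded_psd I (add_rank1 I T u)"
  unfolding bounded_psd_def using add_rank1_psd add_rank1_le
  by (metis add_nonneg_nonneg nsq_nonneg)

lemma exp_converges_div: "(\<lambda>n. s ^ n / fact n) sums exp (s::real)"
  using exp_converges[of s] by (simp add: divide_inverse mult.commute)

lemma summable_exp_form:
  assumes "bounded_psd I T" shows "summable (\<lambda>n. moment I T x n / fact n)"
proof -
  obtain \<beta> where b: "0 \<le> \<beta>" "op_le I T \<beta>" and T: "psd_op I T"
    using assms by (auto simp: bounded_psd_def)
  show ?thesis
  proof (rule summable_comparison_test')
    show "summable (\<lambda>n. nsq I x * (\<beta> ^ n / fact n))"
      by (intro summable_mult sums_summable[OF exp_converges_div])
    fix n :: nat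
    have "moment I T x n / fact n \<le> \<beta> ^ n * nsq I x / fact n"
      by (intro divide_right_mono moment_bound[OF T b(2,1)]) simp
    then show "norm (moment I T x n / fact n) \<le> nsq I x * (\<beta> ^ n / fact n)"
      using moment_nonneg[OF T, of x n] by (simp only: real_norm_def abs_of_nonneg
        divide_nonneg_nonneg fact_ge_zero times_divide_eq_right mult.commute[of "nsq I x"])
  qed
qed

lemma exp_trace_eq:
  assumes "bounded_psd I T"
  shows "summable (\<lambda>n. trace_pow I T n / fact n)"
    and "exp_trace I T = (\<Sum>i\<in>I. exp_form I T (unit_vec i))"
proof -
  have s: "(\<lambda>n. \<Sum>i\<in>I. moment I T (unit_vec i) n / fact n) sums (\<Sum>i\<in>I. exp_form I T (unit_vec i))"
    unfolding exp_form_def by (intro sums_sum summable_sums summable_exp_form[OF assms])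
  show "summable (\<lambda>n. trace_pow I T n / fact n)"
    using sums_summable[OF s] by (simp add: trace_pow_def sum_divide_distrib)
  show "exp_trace I T = (\<Sum>i\<in>I. exp_form I T (unit_vec i))"
    unfolding exp_trace_def using sums_unique[OF s] by (simp add: trace_pow_def sum_divide_distrib)
qed

lemma exp_form_nonneg: "bounded_psd I T \<Longrightarrow> 0 \<le> exp_form I T x"
  unfolding exp_form_def
  by (intro suminf_nonneg summable_exp_form divide_nonneg_nonneg moment_nonneg[OF bounded_psdD(1)]) simp_all

lemma exp_trace_nonneg: "bounded_psd I T \<Longrightarrow> 0 \<le> exp_trace I T"
  by (simp add: exp_trace_eq(2) sum_nonneg exp_form_nonneg)

lemma moment_scale:
  assumes "psd_op I T" shows "moment I T (\<lambda>i. a * x i) n = (cmod a)\<^sup>2 * moment I T x n"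
proof -
  have "ip I (\<lambda>i. a * x i) ((T ^^ n) (\<lambda>i. a * x i)) = (a * cnj a) * ip I x ((T ^^ n) x)"
    by (simp add: psd_op_scale[OF psd_op_funpow[OF assms]] ip_scale_left ip_scale_right)
  then show ?thesis by (simp add: moment_def complex_norm_square[symmetric] del: of_real_power)
qed

lemma exp_form_scale:
  assumes "bounded_psd I T" shows "exp_form I T (\<lambda>i. a * x i) = (cmod a)\<^sup>2 * exp_form I T x"
  unfolding exp_form_def
  by (subst suminf_mult[symmetric, OF summable_exp_form[OF assms]])
    (simp add: moment_scale[OF bounded_psdD(1)[OF assms]])

text \<open>Divided by n!, the binomial bound of \<open>cross_moment_upper\<close> is the n-th term
  of the Cauchy product of the series of e^(|u|^2) and of \<open>exp_form I T u\<close>.\<close>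

lemma exp_form_add_rank1_le:
  assumes T: "bounded_psd I T"
  shows "exp_form I (add_rank1 I T u) u \<le> exp (nsq I u) * exp_form I T u"
proof -
  note P = bounded_psdD(1)[OF T]
  let ?f = "\<lambda>j. nsq I u ^ j / fact j" and ?g = "\<lambda>n. moment I T u n / fact n"
  have f: "summable ?f" "(\<Sum>j. ?f j) = exp (nsq I u)"
    using sums_summable[OF exp_converges_div[of "nsq I u"]] sums_unique[OF exp_converges_div[of "nsq I u"]]
    by simp_all
  have g: "summable ?g" by (rule summable_exp_form[OF T])
  have prod: "(\<lambda>n. \<Sum>j\<le>n. ?f j * ?g (n - j)) sums ((\<Sum>j. ?f j) * (\<Sum>n. ?g n))"
    using f g by (intro Cauchy_product_sums) (simp_all add: moment_nonneg[OF P])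
  have "exp_form I (add_rank1 I T u) u \<le> (\<Sum>n. \<Sum>j\<le>n. ?f j * ?g (n - j))"
    unfolding exp_form_def
  proof (intro suminf_le summable_exp_form add_rank1_bounded_psd T sums_summable[OF prod])
    fix n
    have "moment I (add_rank1 I T u) u n / fact n \<le>
        (\<Sum>j\<le>n. real (n choose j) * nsq I u ^ j * moment I T u (n - j)) / fact n"
      using cross_moment_upper[OF P, of 0 u n] by (intro divide_right_mono) (simp_all add: moment_def)
    also have "\<dots> = (\<Sum>j\<le>n. ?f j * ?g (n - j))"
      unfolding sum_divide_distrib
      by (intro sum.cong refl) (simp add: binomial_fact)
    finally show "moment I (add_rank1 I T u) u n / fact n \<le> (\<Sum>j\<le>n. ?f j * ?g (n - j))" .
  qed
  also have "\<dots> = exp (nsq I u) * exp_form I T u"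
    using sums_unique[OF prod] f by (simp add: exp_form_def)
  finally show ?thesis .
qed

text \<open>This is the series of (e^s - 1) / s, in a form that includes s = 0.\<close>

lemma sums_exp_shifted:
  fixes s :: real
  shows "summable (\<lambda>j. s ^ j / fact (Suc j))" and "s * (\<Sum>j. s ^ j / fact (Suc j)) = exp s - 1"
proof -
  note e = exp_converges_div[of s]
  show sm: "summable (\<lambda>j. s ^ j / fact (Suc j))"
  proof (cases "s = 0")
    case True
    have "summable (\<lambda>j. if j = 0 then 1 else 0::real)"
      using summable_single[of 0 "\<lambda>_. 1::real"] by simp
    then show ?thesis
      by (rule summable_cong[THEN iffD1, rotated]) (auto simp: True intro!: always_eventually)
  next
    case False
    have "summable (\<lambda>j. s ^ Suc j / fact (Suc j))"
      using sums_summable[OF e] by (subst summable_Suc_iff)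
    then have "summable (\<lambda>j. (s ^ Suc j / fact (Suc j)) / s)" by (rule summable_divide)
    then show ?thesis using False by simp
  qed
  have "(\<lambda>n. s ^ Suc n / fact (Suc n)) sums (exp s - 1)"
    using e by (subst sums_Suc_iff) simp
  then show "s * (\<Sum>j. s ^ j / fact (Suc j)) = exp s - 1"
    by (subst suminf_mult[symmetric, OF sm]) (simp add: sums_iff)
qed

text \<open>The lower bound is the first order inequality for the convex function tr e^T. For s =
  |u|^2 the upper bound is the trace of e^T times the exponential of the rank one operator, since
  that exponential is the identity plus (e^s - 1) / s times the rank one operator. Both are proved
  term by term: the traces of order n + 1 differ by a sum of n + 1 cross moments, each at least the
  moment of order n and at most the binomial sum of \<open>cross_moment_upper\<close>.\<close>

lemma exp_trace_add_rank1:
  assumes T: "bounded_psd I T"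
  shows "exp_trace I T + exp_form I T u \<le> exp_trace I (add_rank1 I T u)"
    and "nsq I u \<le> s \<Longrightarrow> 0 < s \<Longrightarrow>
      exp_trace I (add_rank1 I T u) \<le> exp_trace I T + (exp s - 1) / s * exp_form I T u"
proof -
  note P = bounded_psdD(1)[OF T]
  let ?M = "add_rank1 I T u" and ?s = "moment I T u"
  let ?r = "\<lambda>n a. Re (ip I ((T ^^ a) u) ((?M ^^ (n - a)) u))"
  let ?d = "\<lambda>n. (\<Sum>a\<le>n. ?r n a) / fact (Suc n)"
  have M: "bounded_psd I ?M" by (rule add_rank1_bounded_psd[OF T])
  have "(\<lambda>n. trace_pow I ?M n / fact n - trace_pow I T n / fact n) sums (exp_trace I ?M - exp_trace I T)"
    unfolding exp_trace_def by (intro sums_diff summable_sums exp_trace_eq(1) T M)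
  \<comment> \<open>The terms of order 0 agree, both being the trace of the identity.\<close>
  then have "(\<lambda>n. trace_pow I ?M (Suc n) / fact (Suc n) - trace_pow I T (Suc n) / fact (Suc n))
      sums (exp_trace I ?M - exp_trace I T)"
    by (subst sums_Suc_iff) (simp add: trace_pow_def)
  moreover have "trace_pow I ?M (Suc n) / fact (Suc n) - trace_pow I T (Suc n) / fact (Suc n) = ?d n" for n
    by (simp only: trace_pow_add_rank1[OF P bounded_psdD(2)[OF T]])
      (simp add: lessThan_Suc_atMost add_divide_distrib del: fact_Suc)
  ultimately have d: "?d sums (exp_trace I ?M - exp_trace I T)" by simp
  have form: "(\<lambda>n. ?s n / fact n) sums exp_form I T u"
    unfolding exp_form_def by (rule summable_sums[OF summable_exp_form[OF T]])
  have "?s n / fact n \<le> ?d n" for n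
  proof -
    have "(\<Sum>a\<le>n. ?s n) \<le> (\<Sum>a\<le>n. ?r n a)"
    proof (rule sum_mono)
      fix a assume "a \<in> {..n}"
      then show "?s n \<le> ?r n a" using cross_moment_lower[OF P, of u a "n - a"] by simp
    qed
    then have "real (Suc n) * ?s n / fact (Suc n) \<le> ?d n"
      by (intro divide_right_mono) simp_all
    moreover have "real (Suc n) * ?s n / fact (Suc n) = ?s n / fact n"
      unfolding fact_Suc by (simp del: of_nat_Suc)
    ultimately show ?thesis by simp
  qed
  then have "exp_form I T u \<le> exp_trace I ?M - exp_trace I T"
    by (rule sums_le[OF _ form d])
  then show "exp_trace I T + exp_form I T u \<le> exp_trace I ?M" by simp
  assume s: "nsq I u \<le> s" "0 < s"
  let ?f = "\<lambda>j. s ^ j / fact (Suc j)" and ?g = "\<lambda>n. ?s n / fact n"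
  have prod: "(\<lambda>n. \<Sum>j\<le>n. ?f j * ?g (n - j)) sums ((\<Sum>j. ?f j) * (\<Sum>n. ?g n))"
    using sums_exp_shifted(1)[of s] summable_exp_form[OF T] s
    by (intro Cauchy_product_sums) (simp_all add: moment_nonneg[OF P] del: fact_Suc)
  have "?d n \<le> (\<Sum>j\<le>n. ?f j * ?g (n - j))" for n
  proof -
    have "?r n a \<le> (\<Sum>j\<le>n. real ((n - a) choose j) * (s ^ j * ?s (n - j)))" if "a \<le> n" for a
    proof -
      have "?r n a \<le> (\<Sum>j\<le>n - a. real ((n - a) choose j) * nsq I u ^ j * ?s (n - j))"
        using cross_moment_upper[OF P, of a u "n - a"] that by simp
      also have "\<dots> \<le> (\<Sum>j\<le>n - a. real ((n - a) choose j) * s ^ j * ?s (n - j))"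
        using s by (intro sum_mono mult_right_mono mult_left_mono power_mono moment_nonneg[OF P]) auto
      also have "\<dots> \<le> (\<Sum>j\<le>n. real ((n - a) choose j) * s ^ j * ?s (n - j))"
        using s by (intro sum_mono2) (auto intro!: mult_nonneg_nonneg moment_nonneg[OF P])
      finally show ?thesis by (simp add: mult_ac)
    qed
    then have "(\<Sum>a\<le>n. ?r n a) \<le> (\<Sum>a\<le>n. \<Sum>j\<le>n. real ((n - a) choose j) * (s ^ j * ?s (n - j)))"
      by (intro sum_mono) auto
    \<comment> \<open>Over a this is a hockey stick sum. Division by (n + 1)! then splits the
      binomial coefficient into 1/(j + 1)! and 1/(n - j)!, the coefficients of the two
      series.\<close>
    also have "\<dots> = (\<Sum>j\<le>n. real (\<Sum>a<Suc n. (Suc n - 1 - a) choose j) * (s ^ j * ?s (n - j)))"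
      by (subst sum.swap) (simp add: sum_distrib_right lessThan_Suc_atMost del: sum.lessThan_Suc)
    also have "\<dots> = (\<Sum>j\<le>n. real (Suc n choose Suc j) * (s ^ j * ?s (n - j)))"
      by (simp only: sum_choose_reverse)
    finally have "?d n \<le> (\<Sum>j\<le>n. real (Suc n choose Suc j) * (s ^ j * ?s (n - j))) / fact (Suc n)"
      by (intro divide_right_mono) simp_all
    also have "\<dots> = (\<Sum>j\<le>n. ?f j * ?g (n - j))"
      unfolding sum_divide_distrib
    proof (intro sum.cong refl)
      fix j assume "j \<in> {..n}"
      then have "real (Suc n choose Suc j) = fact (Suc n) / (fact (Suc j) * fact (n - j))"
        using binomial_fact[of "Suc j" "Suc n", where 'a = real] by simp
      then show "real (Suc n choose Suc j) * (s ^ j * ?s (n - j)) / fact (Suc n) = ?f j * ?g (n - j)"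
        by (simp del: fact_Suc)
    qed
    finally show ?thesis .
  qed
  then have "exp_trace I ?M - exp_trace I T \<le> (\<Sum>j. ?f j) * (\<Sum>n. ?g n)"
    by (rule sums_le[OF _ d prod])
  also have "(\<Sum>j. ?f j) = (exp s - 1) / s"
    using sums_exp_shifted(2)[of s] s by (simp add: field_simps)
  finally show "exp_trace I ?M \<le> exp_trace I T + (exp s - 1) / s * exp_form I T u"
    by (simp add: exp_form_def)
qed

lemma nsq_real_scale: "0 \<le> t \<Longrightarrow> nsq I (\<lambda>i. complex_of_real (sqrt t) * u i) = t * nsq I u"
  by (simp add: nsq_scale)

text \<open>Scaling the vector by a square root makes the path from \<open>T\<close> to the full
  update additive in the parameter.\<close>

lemma add_rank1_add_rank1:
  assumes "0 \<le> s" "0 \<le> t"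
  shows "add_rank1 I (add_rank1 I T (\<lambda>i. complex_of_real (sqrt s) * u i)) (\<lambda>i. complex_of_real (sqrt t) * u i)
    = add_rank1 I T (\<lambda>i. complex_of_real (sqrt (s + t)) * u i)"
proof (intro ext)
  fix x i
  have q: "complex_of_real (sqrt a) * u i * (complex_of_real (sqrt a) * ip I u x) =
      complex_of_real a * (u i * ip I u x)" if "0 \<le> a" for a
  proof -
    have "complex_of_real (sqrt a) * complex_of_real (sqrt a) = complex_of_real a"
      using that by (simp flip: of_real_mult)
    then show ?thesis by (metis mult.assoc mult.left_commute)
  qed
  show "add_rank1 I (add_rank1 I T (\<lambda>i. complex_of_real (sqrt s) * u i)) (\<lambda>i. complex_of_real (sqrt t) * u i) x i
    = add_rank1 I T (\<lambda>i. complex_of_real (sqrt (s + t)) * u i) x i"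
    unfolding add_rank1_def ip_scale_left complex_cnj_complex_of_real
    using assms by (simp only: q add_nonneg_nonneg) (simp add: distrib_right)
qed

text \<open>The rank one term is added in \<open>N\<close> small steps. Along the path the form \<^const>\<open>exp_form\<close>, which
  is the derivative of \<^const>\<open>exp_trace\<close>, grows at most exponentially, so that each step gains
  nearly what it would gain at the end of the path.\<close>

lemma exp_trace_remove_rank1:
  assumes T: "bounded_psd I T"
  shows "exp_trace I T \<le> exp_trace I (add_rank1 I T u) - (1 - nsq I u / 2) * exp_form I (add_rank1 I T u) u"
proof -
  define M where "M = (\<lambda>t. add_rank1 I T (\<lambda>i. complex_of_real (sqrt t) * u i))"
  define q where "q = exp_form I (add_rank1 I T u) u"
  have bM: "bounded_psd I (M t)" for t unfolding M_def by (rule add_rank1_bounded_psd[OF T])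
  have M0: "M 0 = T" by (simp add: M_def add_rank1_def fun_eq_iff)
  have M1: "M 1 = add_rank1 I T u" by (simp add: M_def)
  have Madd: "M (s + t) = add_rank1 I (M s) (\<lambda>i. complex_of_real (sqrt t) * u i)" if "0 \<le> s" "0 \<le> t" for s t
    unfolding M_def using that by (rule add_rank1_add_rank1[symmetric])
  \<comment> \<open>From parameter t to 1 the form grows at most by the factor e^((1 - t)|u|^2), and
    e^(-z) is at least 1 - z.\<close>
  have form: "(1 - (1 - t) * nsq I u) * q \<le> exp_form I (M t) u" if t: "0 \<le> t" "t \<le> 1" for t
  proof (cases "t = 1")
    case True then show ?thesis by (simp add: q_def M1)
  next
    case False
    with t have t1: "0 < 1 - t" by simp
    have "exp_form I (M (t + (1 - t))) (\<lambda>i. complex_of_real (sqrt (1 - t)) * u i) \<le>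
        exp (nsq I (\<lambda>i. complex_of_real (sqrt (1 - t)) * u i)) *
        exp_form I (M t) (\<lambda>i. complex_of_real (sqrt (1 - t)) * u i)"
      using t by (subst Madd) (auto intro!: exp_form_add_rank1_le bM)
    then have "(1 - t) * q \<le> exp ((1 - t) * nsq I u) * ((1 - t) * exp_form I (M t) u)"
      using t1 by (simp add: exp_form_scale[OF bM] exp_form_scale[OF add_rank1_bounded_psd[OF T]]
          nsq_real_scale M1 q_def)
    then have "q \<le> exp ((1 - t) * nsq I u) * exp_form I (M t) u"
      using t1 by (simp add: mult.left_commute)
    then have "exp (- ((1 - t) * nsq I u)) * q \<le>
        exp (- ((1 - t) * nsq I u)) * (exp ((1 - t) * nsq I u) * exp_form I (M t) u)"
      by (rule mult_left_mono) simp
    then have "exp (- ((1 - t) * nsq I u)) * q \<le> exp_form I (M t) u"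
      by (simp only: mult.assoc[symmetric] exp_add[symmetric]) simp
    moreover have "(1 - (1 - t) * nsq I u) * q \<le> exp (- ((1 - t) * nsq I u)) * q"
      using exp_ge_add_one_self[of "- ((1 - t) * nsq I u)"]
      by (intro mult_right_mono) (auto simp: q_def exp_form_nonneg add_rank1_bounded_psd T)
    ultimately show ?thesis by linarith
  qed
  have step: "exp_trace I (M s) + t * exp_form I (M s) u \<le> exp_trace I (M (s + t))"
    if "0 \<le> s" "0 \<le> t" for s t
    using exp_trace_add_rank1(1)[OF bM, of s "\<lambda>i. complex_of_real (sqrt t) * u i"] that
    by (simp add: Madd exp_form_scale[OF bM])
  \<comment> \<open>The factor of q is the left Riemann sum with N + 1 steps for the integral of 1 -
    (1 - t)|u|^2 over [0, 1], which is 1 - |u|^2 / 2.\<close>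
  have "q * (1 - nsq I u * (1 / 2 + 1 / 2 * inverse (real (Suc N)))) \<le> exp_trace I (M 1) - exp_trace I (M 0)" for N
  proof -
    let ?n = "real (Suc N)"
    have "exp_trace I (M 0) + (\<Sum>i<k. 1 / ?n * ((1 - (1 - real i / ?n) * nsq I u) * q)) \<le>
        exp_trace I (M (real k / ?n))" if "k \<le> Suc N" for k
      using that
    proof (induction k)
      case (Suc k)
      have "exp_trace I (M (real k / ?n)) + 1 / ?n * exp_form I (M (real k / ?n)) u
          \<le> exp_trace I (M (real k / ?n + 1 / ?n))"
        by (rule step) auto
      moreover have "1 / ?n * ((1 - (1 - real k / ?n) * nsq I u) * q) \<le> 1 / ?n * exp_form I (M (real k / ?n)) u"
        using Suc.prems by (intro mult_left_mono form) auto
      moreover have "real k / ?n + 1 / ?n = real (Suc k) / ?n" by (simp add: add_divide_distrib)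
      ultimately show ?case using Suc by simp
    qed simp
    from this[of "Suc N"] have "(\<Sum>i<Suc N. 1 / ?n * ((1 - (1 - real i / ?n) * nsq I u) * q)) \<le> exp_trace I (M 1) - exp_trace I (M 0)"
      by (simp del: sum.lessThan_Suc of_nat_Suc)
    moreover have "(\<Sum>i<Suc N. 1 / ?n * ((1 - (1 - real i / ?n) * nsq I u) * q)) =
        q * (1 - nsq I u * (1 / 2 + 1 / 2 * inverse ?n))"
    proof -
      have g: "(\<Sum>i<Suc N. real i) = ?n * (?n - 1) / 2"
        by (induction N) (simp_all add: field_simps)
      have "(\<Sum>i<Suc N. 1 / ?n * ((1 - (1 - real i / ?n) * nsq I u) * q)) =
          (\<Sum>i<Suc N. q / ?n * (1 - nsq I u) + q * nsq I u / (?n * ?n) * real i)"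
        by (intro sum.cong refl) (simp add: field_simps del: of_nat_Suc)
      also have "\<dots> = q * (1 - nsq I u) + q * nsq I u / (?n * ?n) * (?n * (?n - 1) / 2)"
        by (simp only: sum.distrib sum_distrib_left[symmetric] g sum_constant card_lessThan) simp
      also have "\<dots> = q * (1 - nsq I u * (1 / 2 + 1 / 2 * inverse ?n))"
        by (simp add: field_simps del: of_nat_Suc)
      finally show ?thesis .
    qed
    ultimately show ?thesis by simp
  qed
  moreover have "(\<lambda>N. q * (1 - nsq I u * (1 / 2 + 1 / 2 * inverse (real (Suc N))))) \<longlonglongrightarrow> q * (1 - nsq I u * (1 / 2 + 1 / 2 * 0))"
    by (intro tendsto_intros LIMSEQ_inverse_real_of_nat)
  ultimately have "q * (1 - nsq I u * (1 / 2 + 1 / 2 * 0)) \<le> exp_trace I (M 1) - exp_trace I (M 0)"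
    by (intro LIMSEQ_le_const2) auto
  then show ?thesis by (simp add: M0 M1 q_def algebra_simps)
qed

text \<open>An eigenvalue of a positive operator is at most the trace. In coordinates,
  \<open>psd_op_Cauchy_Schwarz\<close> against a unit vector bounds each entry of
  \<open>(T ^^ n) y\<close> by a diagonal entry of \<open>T ^^ n\<close> and the moment at y itself;
  a square root of this moment then cancels.\<close>

lemma moment_le_trace_pow:
  assumes T: "psd_op I T" and fin: "finite I"
  shows "moment I T y n \<le> nsq I y * trace_pow I T n"
proof -
  define P where "P = T ^^ n"
  have P: "psd_op I P" unfolding P_def by (rule psd_op_funpow[OF T])
  define q where "q = moment I T y n"
  define p where "p = (\<lambda>i. moment I T (unit_vec i) n)"
  have q0: "0 \<le> q" and p0: "0 \<le> p i" for i unfolding q_def p_def by (rule moment_nonneg[OF T])+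
  have Pi: "cmod (P y i) \<le> sqrt (p i) * sqrt q" if "i \<in> I" for i
  proof -
    have "(cmod (P y i))\<^sup>2 \<le> p i * q"
      using psd_op_Cauchy_Schwarz[OF P, of "unit_vec i" y] that fin
      by (simp add: ip_unit_vec p_def q_def moment_def P_def)
    then show ?thesis by (metis real_le_rsqrt real_sqrt_mult)
  qed
  have "q \<le> cmod (ip I y (P y))" unfolding q_def moment_def P_def by (rule complex_Re_le_cmod)
  also have "\<dots> \<le> (\<Sum>i\<in>I. cmod (y i) * (sqrt (p i) * sqrt q))"
    unfolding ip_def using Pi by (intro sum_norm_le) (simp add: norm_mult mult_left_mono)
  also have "\<dots> = sqrt q * (\<Sum>i\<in>I. cmod (y i) * sqrt (p i))" by (simp add: sum_distrib_left mult_ac)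
  finally have a: "q \<le> sqrt q * (\<Sum>i\<in>I. cmod (y i) * sqrt (p i))" .
  have "q \<le> (\<Sum>i\<in>I. cmod (y i) * sqrt (p i))\<^sup>2"
  proof (cases "q = 0")
    case False
    then have "0 < sqrt q" using q0 by simp
    moreover have "sqrt q * sqrt q \<le> sqrt q * (\<Sum>i\<in>I. cmod (y i) * sqrt (p i))"
      using a unfolding real_sqrt_mult_self abs_of_nonneg[OF q0] .
    ultimately have "sqrt q \<le> (\<Sum>i\<in>I. cmod (y i) * sqrt (p i))" by (rule mult_left_le_imp_le[rotated])
    then show ?thesis using q0 by (simp add: real_sqrt_le_iff sqrt_le_D)
  qed simp
  also have "\<dots> \<le> (\<Sum>i\<in>I. (cmod (y i))\<^sup>2) * (\<Sum>i\<in>I. (sqrt (p i))\<^sup>2)" by (rule Cauchy_Schwarz_ineq_sum)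
  finally show ?thesis using p0 by (simp add: q_def nsq_def trace_pow_def p_def)
qed

text \<open>By \<open>moment_Chebyshev\<close> a Rayleigh quotient of at least L propagates to all
  moments, which are then at least L^n |y|^2. A large value of the form is thus visible in the
  trace.\<close>

lemma exp_le_exp_trace:
  assumes T: "bounded_psd I T" and L: "0 \<le> L" "L * nsq I y \<le> Re (ip I y (T y))" and y: "0 < nsq I y"
  shows "exp L \<le> exp_trace I T"
proof -
  note P = bounded_psdD(1)[OF T]
  have pow: "L ^ n * nsq I y \<le> moment I T y n" for n
  proof (induction n)
    case (Suc n)
    have "L * nsq I y * moment I T y n \<le> moment I T y 1 * moment I T y n"
      using L by (intro mult_right_mono moment_nonneg[OF P]) (simp add: moment_def)
    also have "\<dots> \<le> nsq I y * moment I T y (Suc n)" using moment_Chebyshev[OF P, of y 1 n] by simp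
    finally have "L * moment I T y n \<le> moment I T y (Suc n)" using y by (simp add: mult_ac)
    moreover have "L * (L ^ n * nsq I y) \<le> L * moment I T y n" by (rule mult_left_mono[OF Suc L(1)])
    ultimately show ?case by simp
  qed simp
  note e = exp_converges_div[of L]
  have "L ^ n / fact n \<le> trace_pow I T n / fact n" for n
  proof (intro divide_right_mono)
    have "L ^ n * nsq I y \<le> trace_pow I T n * nsq I y"
      using pow[of n] moment_le_trace_pow[OF P bounded_psdD(2)[OF T], of y n] by (simp add: mult.commute)
    then show "L ^ n \<le> trace_pow I T n" using y by simp
  qed simp
  then show ?thesis
    using sums_le[OF _ e summable_sums[OF exp_trace_eq(1)[OF T]]] by (simp add: exp_trace_def)
qed

section \<open>Deviation of isotropic rank one sums\<close>

text \<open>The lower tail uses a negative t; the multiple c of the identity then keeps the operator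
  positive.\<close>

definition sample_op ::
    "'i set \<Rightarrow> real \<Rightarrow> real \<Rightarrow> ('a \<Rightarrow> 'i \<Rightarrow> complex) \<Rightarrow> (nat \<Rightarrow> 'a) \<Rightarrow> nat \<Rightarrow> ('i \<Rightarrow> complex) \<Rightarrow> 'i \<Rightarrow> complex" where
  "sample_op I c t v x r y = (\<lambda>i. of_real c * y i + of_real t * (\<Sum>j=1..r. v (x j) i * ip I (v (x j)) y))"

lemma ip_times_ip: "ip I x u * ip I u x = of_real ((cmod (ip I u x))\<^sup>2)"
  by (metis cnj_ip complex_norm_square mult.commute)

lemma ip_sample_op:
  "ip I y (sample_op I c t v x r z) =
     of_real c * ip I y z + of_real t * (\<Sum>j=1..r. ip I y (v (x j)) * ip I (v (x j)) z)"
  by (simp add: sample_op_def ip_add_right ip_scale_right ip_scale_right' ip_sum_right)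

lemma ip_sample_op_self:
  "Re (ip I y (sample_op I c t v x r y)) = c * nsq I y + t * (\<Sum>j=1..r. (cmod (ip I (v (x j)) y))\<^sup>2)"
  by (simp add: ip_sample_op ip_times_ip ip_self del: of_real_power)

lemma sample_op_bounded_psd:
  assumes fin: "finite I" and R: "\<And>j. j \<in> {1..r} \<Longrightarrow> nsq I (v (x j)) \<le> R" "0 \<le> R"
    and c: "0 \<le> c" "0 \<le> t \<or> - t * real r * R \<le> c"
  shows "bounded_psd I (sample_op I c t v x r)"
proof -
  have s: "(\<Sum>j=1..r. (cmod (ip I (v (x j)) y))\<^sup>2) \<le> real r * R * nsq I y" for y
  proof -
    have "(\<Sum>j=1..r. (cmod (ip I (v (x j)) y))\<^sup>2) \<le> (\<Sum>j=1..r. R * nsq I y)"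
      by (intro sum_mono order_trans[OF ip_Cauchy_Schwarz] mult_right_mono R) auto
    then show ?thesis by simp
  qed
  have nn: "0 \<le> Re (ip I y (sample_op I c t v x r y))" for y
  proof (cases "0 \<le> t")
    case True
    then show ?thesis using c by (simp add: ip_sample_op_self sum_nonneg)
  next
    case False
    then have "- t * (\<Sum>j=1..r. (cmod (ip I (v (x j)) y))\<^sup>2) \<le> - t * (real r * R * nsq I y)"
      by (intro mult_left_mono s) auto
    also have "\<dots> = (- t * real r * R) * nsq I y" by simp
    also have "\<dots> \<le> c * nsq I y" using c False by (intro mult_right_mono) auto
    finally show ?thesis by (simp add: ip_sample_op_self)
  qed
  have "psd_op I (sample_op I c t v x r)"
    unfolding psd_op_def
  proof (intro conjI allI nn)
    fix y z a
    show "sample_op I c t v x r (\<lambda>i. y i + a * z i) = (\<lambda>i. sample_op I c t v x r y i + a * sample_op I c t v x r z i)"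
      by (simp add: sample_op_def fun_eq_iff ip_add_right ip_scale_right algebra_simps sum.distrib sum_distrib_left)
    have "ip I (sample_op I c t v x r y) z = cnj (ip I z (sample_op I c t v x r y))" by (simp add: cnj_ip)
    then show "ip I y (sample_op I c t v x r z) = ip I (sample_op I c t v x r y) z"
      by (simp add: ip_sample_op cnj_ip mult.commute)
  qed
  moreover have "op_le I (sample_op I c t v x r) (c + \<bar>t\<bar> * (real r * R))"
    unfolding op_le_def
  proof
    fix y
    have "t * (\<Sum>j=1..r. (cmod (ip I (v (x j)) y))\<^sup>2) \<le> \<bar>t\<bar> * (real r * R * nsq I y)"
      by (intro mult_mono s sum_nonneg) auto
    then show "Re (ip I y (sample_op I c t v x r y)) \<le> (c + \<bar>t\<bar> * (real r * R)) * nsq I y"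
      by (simp add: ip_sample_op_self algebra_simps)
  qed
  moreover have "0 \<le> c + \<bar>t\<bar> * (real r * R)" using c R by simp
  ultimately show ?thesis unfolding bounded_psd_def using fin by blast
qed

text \<open>Updates by \<open>add_rank1\<close> are positive. For a negative coefficient the roles
  are therefore exchanged: the operator of r samples is an update of the operator of r + 1
  samples.\<close>

lemma sample_op_Suc:
  assumes "0 \<le> \<theta>"
  shows "sample_op I c \<theta> v (x(Suc r := y)) (Suc r) =
      add_rank1 I (sample_op I c \<theta> v x r) (\<lambda>i. complex_of_real (sqrt \<theta>) * v y i)"
    and "sample_op I c (- \<theta>) v x r =
      add_rank1 I (sample_op I c (- \<theta>) v (x(Suc r := y)) (Suc r)) (\<lambda>i. complex_of_real (sqrt \<theta>) * v y i)"
proof -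
  have q: "complex_of_real (sqrt \<theta>) * a * (complex_of_real (sqrt \<theta>) * b) = of_real \<theta> * (a * b)" for a b
  proof -
    have "complex_of_real (sqrt \<theta>) * complex_of_real (sqrt \<theta>) = complex_of_real \<theta>"
      using assms by (simp flip: of_real_mult)
    then show ?thesis by (metis mult.assoc mult.left_commute)
  qed
  have s: "(\<Sum>j=1..Suc r. f ((x(Suc r := y)) j)) = (\<Sum>j=1..r. f (x j)) + f y" for f :: "_ \<Rightarrow> complex"
    by simp
  show "sample_op I c \<theta> v (x(Suc r := y)) (Suc r) =
      add_rank1 I (sample_op I c \<theta> v x r) (\<lambda>i. complex_of_real (sqrt \<theta>) * v y i)"
    unfolding sample_op_def add_rank1_def ip_scale_left complex_cnj_complex_of_real q s
    by (simp add: fun_eq_iff distrib_left)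
  show "sample_op I c (- \<theta>) v x r =
      add_rank1 I (sample_op I c (- \<theta>) v (x(Suc r := y)) (Suc r)) (\<lambda>i. complex_of_real (sqrt \<theta>) * v y i)"
    unfolding sample_op_def add_rank1_def ip_scale_left complex_cnj_complex_of_real q s
    by (simp add: fun_eq_iff distrib_left)
qed

lemma exp_trace_sample_op_0:
  assumes "finite I" shows "exp_trace I (sample_op I c t v x 0) = real (card I) * exp c"
proof -
  have p: "(sample_op I c t v x 0 ^^ n) y = (\<lambda>i. of_real (c ^ n) * y i)" for n y
    by (induction n) (simp_all add: sample_op_def mult.assoc)
  have "moment I (sample_op I c t v x 0) (unit_vec i) n = c ^ n" if "i \<in> I" for i n
    unfolding moment_def p ip_scale_right ip_unit_vec(1)[OF assms that] by (simp add: unit_vec_def del: of_real_power)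
  then have "trace_pow I (sample_op I c t v x 0) n = real (card I) * c ^ n" for n
    by (simp add: trace_pow_def)
  then show ?thesis
    unfolding exp_trace_def
    using sums_unique[OF sums_mult[OF exp_converges_div[of c], of "real (card I)"]] by simp
qed

lemma borel_measurable_cnj [measurable (raw)]:
  "f \<in> borel_measurable M \<Longrightarrow> (\<lambda>x. cnj (f x)) \<in> borel_measurable M"
  by (rule measurable_compose[OF _ borel_measurable_continuous_onI]) (auto intro: continuous_intros)

section \<open>Averages over an isotropic random vector\<close>

locale isotropic_sample = prob_space \<mu> for \<mu> :: "'a measure" +
  fixes I :: "'i set" and v :: "'a \<Rightarrow> 'i \<Rightarrow> complex" and R :: real
  assumes finite_index: "finite I"
    and measurable_sample: "i \<in> I \<Longrightarrow> (\<lambda>x. v x i) \<in> borel_measurable \<mu>"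
    and sample_le: "x \<in> space \<mu> \<Longrightarrow> nsq I (v x) \<le> R" and R_pos: "0 < R"
    and isotropic: "i \<in> I \<Longrightarrow> j \<in> I \<Longrightarrow> (LINT x|\<mu>. cnj (v x i) * v x j) = (if i = j then 1 else 0)"
begin

lemma integrable_sample_entry:
  assumes "i \<in> I" "j \<in> I" shows "integrable \<mu> (\<lambda>x. cnj (v x i) * v x j)"
proof (rule integrable_const_bound[where B = R])
  have le: "(cmod (v x l))\<^sup>2 \<le> R" if "x \<in> space \<mu>" "l \<in> I" for x l
  proof -
    have "(cmod (v x l))\<^sup>2 \<le> nsq I (v x)"
      unfolding nsq_def using finite_index that by (intro member_le_sum) auto
    then show ?thesis using sample_le[OF that(1)] by simp
  qed
  show "AE x in \<mu>. norm (cnj (v x i) * v x j) \<le> R"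
  proof (rule AE_I2)
    fix x assume x: "x \<in> space \<mu>"
    have "2 * (cmod (v x i) * cmod (v x j)) \<le> (cmod (v x i))\<^sup>2 + (cmod (v x j))\<^sup>2"
      using sum_squares_bound[of "cmod (v x i)" "cmod (v x j)"] by simp
    then show "norm (cnj (v x i) * v x j) \<le> R"
      using le[OF x assms(1)] le[OF x assms(2)] by (simp add: norm_mult)
  qed
  show "(\<lambda>x. cnj (v x i) * v x j) \<in> borel_measurable \<mu>"
    by (intro borel_measurable_times borel_measurable_cnj measurable_sample assms)
qed

text \<open>The moment is linear in the entries of the outer product of the sample with itself,
  whose average is the identity; so averaging produces a trace.\<close>

lemma has_integral_moment:
  assumes T: "psd_op I T"
  shows "has_bochner_integral \<mu> (\<lambda>x. moment I T (v x) n) (trace_pow I T n)"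
proof -
  let ?w = "\<lambda>i. (T ^^ n) (unit_vec i)"
  have m: "moment I T y n = Re (\<Sum>i\<in>I. \<Sum>j\<in>I. cnj (?w i j) * (cnj (y i) * y j))" for y
  proof -
    have "(T ^^ n) y i = (\<Sum>j\<in>I. cnj (?w i j) * y j)" if "i \<in> I" for i
      using ip_unit_vec(1)[OF finite_index that, of "(T ^^ n) y"]
        psd_op_funpow_selfadjoint[OF T, of "unit_vec i" n y] by (simp add: ip_def)
    then show ?thesis
      by (simp add: moment_def ip_def sum_distrib_left mult_ac del: Re_sum)
  qed
  have e: "has_bochner_integral \<mu> (\<lambda>x. cnj (v x i) * v x j) (if i = j then 1 else 0)"
    if "i \<in> I" "j \<in> I" for i j
    using that by (simp add: has_bochner_integral_iff isotropic integrable_sample_entry)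
  have "has_bochner_integral \<mu> (\<lambda>x. \<Sum>i\<in>I. \<Sum>j\<in>I. cnj (?w i j) * (cnj (v x i) * v x j))
      (\<Sum>i\<in>I. \<Sum>j\<in>I. cnj (?w i j) * (if i = j then 1 else 0))"
    by (intro has_bochner_integral_sum has_bochner_integral_mult_right e)
  also have "(\<Sum>i\<in>I. \<Sum>j\<in>I. cnj (?w i j) * (if i = j then 1 else 0)) = (\<Sum>i\<in>I. cnj (?w i i))"
    using finite_index by (simp add: if_distrib[of "\<lambda>z. _ * z"] cong: if_cong)
  finally have "has_bochner_integral \<mu> (\<lambda>x. moment I T (v x) n) (Re (\<Sum>i\<in>I. cnj (?w i i)))"
    unfolding m by (rule has_bochner_integral_bounded_linear[OF bounded_linear_Re])
  also have "Re (\<Sum>i\<in>I. cnj (?w i i)) = trace_pow I T n"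
    using finite_index by (simp add: trace_pow_def moment_def ip_unit_vec)
  finally show ?thesis .
qed

lemma has_integral_exp_form:
  assumes T: "bounded_psd I T"
  shows "has_bochner_integral \<mu> (\<lambda>x. exp_form I T (v x)) (exp_trace I T)"
proof -
  note P = bounded_psdD(1)[OF T]
  have i: "integrable \<mu> (\<lambda>x. moment I T (v x) n / fact n)"
    and e: "(LINT x|\<mu>. moment I T (v x) n / fact n) = trace_pow I T n / fact n" for n
    using has_integral_moment[OF P, of n] by (auto simp: has_bochner_integral_iff)
  have a: "AE x in \<mu>. summable (\<lambda>n. norm (moment I T (v x) n / fact n))"
    using summable_exp_form[OF T] by (simp add: moment_nonneg[OF P])
  have s: "summable (\<lambda>n. LINT x|\<mu>. norm (moment I T (v x) n / fact n))"
    using exp_trace_eq(1)[OF T] unfolding e[symmetric] by (simp add: moment_nonneg[OF P])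
  show ?thesis
    unfolding exp_form_def exp_trace_def has_bochner_integral_iff
    using integrable_suminf[OF i a s] integral_suminf[OF i a s] unfolding e by simp
qed

lemma nsq_scaled_sample_le:
  "0 \<le> \<theta> \<Longrightarrow> x \<in> space \<mu> \<Longrightarrow> nsq I (\<lambda>i. complex_of_real (sqrt \<theta>) * v x i) \<le> \<theta> * R"
  by (simp add: nsq_real_scale mult_left_mono sample_le)

text \<open>This is \<open>exp_trace_add_rank1\<close> with s = \<theta>R, after averaging has
  turned the form of e^T at the sample into the trace.\<close>

lemma nn_integral_exp_trace_add:
  assumes T: "bounded_psd I T" and \<theta>: "0 < \<theta>"
  shows "(\<integral>\<^sup>+x. ennreal (exp_trace I (add_rank1 I T (\<lambda>i. complex_of_real (sqrt \<theta>) * v x i))) \<partial>\<mu>)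
    \<le> ennreal ((1 + (exp (\<theta> * R) - 1) / R) * exp_trace I T)"
proof -
  let ?g = "\<lambda>x. exp_trace I T + (exp (\<theta> * R) - 1) / R * exp_form I T (v x)"
  have g: "has_bochner_integral \<mu> ?g (exp_trace I T + (exp (\<theta> * R) - 1) / R * exp_trace I T)"
    by (intro has_bochner_integral_add has_bochner_integral_mult_right has_integral_exp_form[OF T])
      (simp add: has_bochner_integral_iff prob_space)
  have c: "0 \<le> (exp (\<theta> * R) - 1) / R" using \<theta> R_pos by simp
  have "(\<integral>\<^sup>+x. ennreal (exp_trace I (add_rank1 I T (\<lambda>i. complex_of_real (sqrt \<theta>) * v x i))) \<partial>\<mu>)
      \<le> (\<integral>\<^sup>+x. ennreal (?g x) \<partial>\<mu>)"
  proof (intro nn_integral_mono ennreal_leI)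
    fix x assume x: "x \<in> space \<mu>"
    have "exp_trace I (add_rank1 I T (\<lambda>i. complex_of_real (sqrt \<theta>) * v x i)) \<le>
        exp_trace I T + (exp (\<theta> * R) - 1) / (\<theta> * R) * exp_form I T (\<lambda>i. complex_of_real (sqrt \<theta>) * v x i)"
      using \<theta> R_pos x by (intro exp_trace_add_rank1(2)[OF T] nsq_scaled_sample_le) auto
    also have "\<dots> = ?g x" using \<theta> by (simp add: exp_form_scale[OF T])
    finally show "exp_trace I (add_rank1 I T (\<lambda>i. complex_of_real (sqrt \<theta>) * v x i)) \<le> ?g x" .
  qed
  also have "\<dots> = ennreal (exp_trace I T + (exp (\<theta> * R) - 1) / R * exp_trace I T)"
    using g c exp_form_nonneg[OF T] exp_trace_nonneg[OF T]
    by (subst nn_integral_eq_integral)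
      (auto simp: has_bochner_integral_iff simp del: times_divide_eq_left intro!: AE_I2 add_nonneg_nonneg mult_nonneg_nonneg)
  finally show ?thesis by (simp add: algebra_simps)
qed

text \<open>\<open>N\<close> does not depend on the sample, while \<open>T x\<close>, which is
  \<open>N\<close> with the sample removed, does. Isotropy can be applied only to the form of
  \<open>N\<close>, which is why \<open>exp_trace_remove_rank1\<close> measures the loss by the form
  of the larger operator.\<close>

lemma nn_integral_exp_trace_remove:
  assumes N: "bounded_psd I N" and \<theta>: "0 < \<theta>" "\<theta> * R \<le> 1"
    and T: "\<And>x. x \<in> space \<mu> \<Longrightarrow> bounded_psd I (T x)"
      "\<And>x. x \<in> space \<mu> \<Longrightarrow> N = add_rank1 I (T x) (\<lambda>i. complex_of_real (sqrt \<theta>) * v x i)"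
  shows "(\<integral>\<^sup>+x. ennreal (exp_trace I (T x)) \<partial>\<mu>) \<le> ennreal ((1 - \<theta> * (1 - \<theta> * R / 2)) * exp_trace I N)"
proof -
  let ?g = "\<lambda>x. exp_trace I N - (1 - \<theta> * R / 2) * \<theta> * exp_form I N (v x)"
  have g: "has_bochner_integral \<mu> ?g (exp_trace I N - (1 - \<theta> * R / 2) * \<theta> * exp_trace I N)"
    by (intro has_bochner_integral_diff has_bochner_integral_mult_right has_integral_exp_form[OF N])
      (simp add: has_bochner_integral_iff prob_space)
  have le: "exp_trace I (T x) \<le> ?g x" if x: "x \<in> space \<mu>" for x
  proof -
    let ?u = "\<lambda>i. complex_of_real (sqrt \<theta>) * v x i"
    have "exp_trace I (T x) \<le> exp_trace I N - (1 - nsq I ?u / 2) * exp_form I N ?u"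
      using exp_trace_remove_rank1[OF T(1)[OF x], of ?u] T(2)[OF x] by simp
    also have "\<dots> \<le> exp_trace I N - (1 - \<theta> * R / 2) * exp_form I N ?u"
      using nsq_scaled_sample_le[of \<theta> x] \<theta> x exp_form_nonneg[OF N]
      by (intro diff_left_mono mult_right_mono) auto
    also have "\<dots> = ?g x" using \<theta> by (simp add: exp_form_scale[OF N])
    finally show ?thesis .
  qed
  have "(\<integral>\<^sup>+x. ennreal (exp_trace I (T x)) \<partial>\<mu>) \<le> (\<integral>\<^sup>+x. ennreal (?g x) \<partial>\<mu>)"
    using le by (intro nn_integral_mono ennreal_leI)
  also have "\<dots> = ennreal (exp_trace I N - (1 - \<theta> * R / 2) * \<theta> * exp_trace I N)"
    using g order_trans[OF exp_trace_nonneg[OF T(1)] le]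
    by (subst nn_integral_eq_integral) (auto simp only: has_bochner_integral_iff intro!: AE_I2)
  finally show ?thesis by (simp add: algebra_simps)
qed

lemma measurable_sample_op_funpow:
  assumes "\<And>i. i \<in> I \<Longrightarrow> (\<lambda>x. w x i) \<in> borel_measurable (PiM {1..m} (\<lambda>_. \<mu>))" "r \<le> m" "i \<in> I"
  shows "(\<lambda>x. (sample_op I c t v x r ^^ n) (w x) i) \<in> borel_measurable (PiM {1..m} (\<lambda>_. \<mu>))"
  using \<open>i \<in> I\<close>
proof (induction n arbitrary: i)
  case (Suc n)
  have v: "(\<lambda>x. v (x j) l) \<in> borel_measurable (PiM {1..m} (\<lambda>_. \<mu>))" if "j \<in> {1..r}" "l \<in> I" for j l
    using that \<open>r \<le> m\<close>
    by (intro measurable_compose[where g = "\<lambda>x. v x l", OF measurable_component_singleton] measurable_sample) auto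
  show ?case
    unfolding funpow.simps comp_apply sample_op_def[of I c t v _ r "(_ ^^ _) _"] ip_def
    using Suc v by (intro borel_measurable_add borel_measurable_times borel_measurable_sum
        borel_measurable_const borel_measurable_cnj) auto
qed (use assms in simp)

lemma measurable_exp_trace_sample_op:
  assumes "r \<le> m"
  shows "(\<lambda>x. exp_trace I (sample_op I c t v x r)) \<in> borel_measurable (PiM {1..m} (\<lambda>_. \<mu>))"
proof -
  have "(\<lambda>x. (sample_op I c t v x r ^^ n) (unit_vec i) i) \<in> borel_measurable (PiM {1..m} (\<lambda>_. \<mu>))" if "i \<in> I" for i n
    by (rule measurable_sample_op_funpow[OF _ assms that]) simp
  then show ?thesis
    unfolding exp_trace_def trace_pow_def moment_def
    using finite_index by (auto simp: ip_unit_vec intro!: borel_measurable_suminf borel_measurable_divide borel_measurable_sum)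
qed

text \<open>Integrating out the last sample first leaves the expected trace for one sample fewer,
  times \<rho>.\<close>

lemma nn_integral_exp_trace_iterate:
  assumes \<rho>: "0 \<le> \<rho>" and r: "r \<le> m"
    and base: "\<And>x. ennreal (exp_trace I (sample_op I c t v x 0)) \<le> ennreal a" and a: "0 \<le> a"
    and step: "\<And>x r. r < m \<Longrightarrow> x \<in> space (PiM {1..r} (\<lambda>_. \<mu>)) \<Longrightarrow>
      (\<integral>\<^sup>+y. ennreal (exp_trace I (sample_op I c t v (x(Suc r := y)) (Suc r))) \<partial>\<mu>)
        \<le> ennreal (\<rho> * exp_trace I (sample_op I c t v x r))"
  shows "(\<integral>\<^sup>+x. ennreal (exp_trace I (sample_op I c t v x r)) \<partial>PiM {1..r} (\<lambda>_. \<mu>)) \<le> ennreal (\<rho> ^ r * a)"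
  using r
proof (induction r)
  case 0
  interpret P: prob_space "PiM {1..0::nat} (\<lambda>_. \<mu>)" by (intro prob_space_PiM prob_space_axioms)
  have "(\<integral>\<^sup>+x. ennreal (exp_trace I (sample_op I c t v x 0)) \<partial>PiM {1..0::nat} (\<lambda>_. \<mu>)) \<le>
      (\<integral>\<^sup>+x. ennreal a \<partial>PiM {1..0::nat} (\<lambda>_. \<mu>))"
    by (intro nn_integral_mono base)
  also have "\<dots> = ennreal a" using P.emeasure_space_1 by (simp only: nn_integral_const) simp
  finally show ?case by simp
next
  case (Suc r)
  interpret product_sigma_finite "\<lambda>_::nat. \<mu>" ..
  have e: "{1..Suc r} = insert (Suc r) {1..r}" by auto
  have "(\<integral>\<^sup>+x. ennreal (exp_trace I (sample_op I c t v x (Suc r))) \<partial>PiM {1..Suc r} (\<lambda>_. \<mu>)) =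
      (\<integral>\<^sup>+x. (\<integral>\<^sup>+y. ennreal (exp_trace I (sample_op I c t v (x(Suc r := y)) (Suc r))) \<partial>\<mu>) \<partial>PiM {1..r} (\<lambda>_. \<mu>))"
    unfolding e using measurable_exp_trace_sample_op[of "Suc r" "Suc r" c t, unfolded e]
    by (subst product_nn_integral_insert) (simp_all del: fun_upd_apply)
  also have "\<dots> \<le> (\<integral>\<^sup>+x. ennreal \<rho> * ennreal (exp_trace I (sample_op I c t v x r)) \<partial>PiM {1..r} (\<lambda>_. \<mu>))"
    using Suc.prems \<rho> by (intro nn_integral_mono) (simp add: step flip: ennreal_mult')
  also have "\<dots> = ennreal \<rho> * (\<integral>\<^sup>+x. ennreal (exp_trace I (sample_op I c t v x r)) \<partial>PiM {1..r} (\<lambda>_. \<mu>))"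
    using measurable_exp_trace_sample_op[of r r c t] by (intro nn_integral_cmult) auto
  also have "\<dots> \<le> ennreal \<rho> * ennreal (\<rho> ^ r * a)" using Suc by (intro mult_left_mono) auto
  finally show ?case using \<rho> a by (simp add: mult.assoc flip: ennreal_mult)
qed

lemma exp_trace_Markov:
  assumes "(\<integral>\<^sup>+x. ennreal (exp_trace I (sample_op I c t v x m)) \<partial>PiM {1..m} (\<lambda>_. \<mu>)) \<le> ennreal b"
  shows "{x \<in> space (PiM {1..m} (\<lambda>_. \<mu>)). exp L \<le> exp_trace I (sample_op I c t v x m)} \<in> sets (PiM {1..m} (\<lambda>_. \<mu>))"
    and "0 \<le> b \<Longrightarrow> emeasure (PiM {1..m} (\<lambda>_. \<mu>)) {x \<in> space (PiM {1..m} (\<lambda>_. \<mu>)). exp L \<le> exp_trace I (sample_op I c t v x m)}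
      \<le> ennreal (exp (- L) * b)"
proof -
  note [measurable] = measurable_exp_trace_sample_op[of m m c t, OF order_refl]
  show "{x \<in> space (PiM {1..m} (\<lambda>_. \<mu>)). exp L \<le> exp_trace I (sample_op I c t v x m)} \<in> sets (PiM {1..m} (\<lambda>_. \<mu>))"
    by measurable
  assume b: "0 \<le> b"
  have "emeasure (PiM {1..m} (\<lambda>_. \<mu>)) {x \<in> space (PiM {1..m} (\<lambda>_. \<mu>)). exp L \<le> exp_trace I (sample_op I c t v x m)}
      \<le> emeasure (PiM {1..m} (\<lambda>_. \<mu>)) {x \<in> space (PiM {1..m} (\<lambda>_. \<mu>)). 1 \<le> ennreal (exp (- L)) * ennreal (exp_trace I (sample_op I c t v x m))}"
  proof (intro emeasure_mono subsetI, clarsimp)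
    fix x assume "exp L \<le> exp_trace I (sample_op I c t v x m)"
    then have "exp (- L) * exp L \<le> exp (- L) * exp_trace I (sample_op I c t v x m)"
      by (intro mult_left_mono) auto
    then show "1 \<le> ennreal (exp (- L)) * ennreal (exp_trace I (sample_op I c t v x m))"
      by (simp flip: exp_add ennreal_mult' add: ennreal_ge_1)
  qed measurable
  also have "\<dots> \<le> ennreal (exp (- L)) * (\<integral>\<^sup>+x. ennreal (exp_trace I (sample_op I c t v x m)) * indicator (space (PiM {1..m} (\<lambda>_. \<mu>))) x \<partial>PiM {1..m} (\<lambda>_. \<mu>))"
    by (rule nn_integral_Markov_inequality) measurable
  also have "\<dots> = ennreal (exp (- L)) * (\<integral>\<^sup>+x. ennreal (exp_trace I (sample_op I c t v x m)) \<partial>PiM {1..m} (\<lambda>_. \<mu>))"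
    by (intro arg_cong2[of _ _ _ _ "(*)"] nn_integral_cong refl) simp
  also have "\<dots> \<le> ennreal (exp (- L)) * ennreal b"
    using assms by (intro mult_left_mono) auto
  finally show "emeasure (PiM {1..m} (\<lambda>_. \<mu>)) {x \<in> space (PiM {1..m} (\<lambda>_. \<mu>)). exp L \<le> exp_trace I (sample_op I c t v x m)}
      \<le> ennreal (exp (- L) * b)"
    using b by (simp add: ennreal_mult)
qed

end

section \<open>Deviation bounds with explicit constants\<close>

lemma exp_le_quadratic:
  fixes t :: real
  assumes "0 \<le> t" "t \<le> 42 / 100"
  shows "exp t \<le> 1 + t + 6 / 10 * t\<^sup>2"
proof -
  obtain s where s: "\<bar>s\<bar> \<le> \<bar>t\<bar>" "exp t = (\<Sum>m<4. t ^ m / fact m) + exp s / fact 4 * t ^ 4"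
    using Maclaurin_exp_le[of t 4] by blast
  have "exp s \<le> exp (42 / 100)" using s assms by simp
  also have "\<dots> \<le> 1 + 42 / 100 + (42 / 100)\<^sup>2" by (rule exp_bound) auto
  finally have "exp s \<le> 16 / 10" by (simp add: power2_eq_square)
  then have "exp s * t ^ 4 \<le> 16 / 10 * t ^ 4" by (intro mult_right_mono) auto
  \<comment> \<open>The coefficients of t^2 add up to 1/2 + 0.42/6 + 1.6 * 0.1764/24, which is about
    0.582.\<close>
  moreover have "t ^ 3 \<le> 42 / 100 * t\<^sup>2"
    using mult_right_mono[OF assms(2), of "t\<^sup>2"] by (simp add: power3_eq_cube power2_eq_square)
  moreover have "t ^ 4 \<le> 1764 / 10000 * t\<^sup>2"
    using mult_right_mono[OF power_mono[OF assms(2,1), of 2], of "t\<^sup>2"] by (simp add: power4_eq_xxxx power2_eq_square)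
  moreover have "exp t = 1 + t + t\<^sup>2 / 2 + t ^ 3 / 6 + exp s * t ^ 4 / 24"
    using s(2) by (simp add: numeral_eq_Suc)
  moreover have "0 \<le> t\<^sup>2" by simp
  ultimately show ?thesis by linarith
qed

context isotropic_sample
begin

lemma upper_deviation:
  assumes \<delta>: "0 < \<delta>" "\<delta> \<le> 1 / 2"
  obtains A where "A \<in> sets (PiM {1..m} (\<lambda>_. \<mu>))"
    and "emeasure (PiM {1..m} (\<lambda>_. \<mu>)) A \<le> ennreal (real (card I) * exp (- (41 / 100 * real m * \<delta>\<^sup>2 / R)))"
    and "\<And>x y. x \<in> space (PiM {1..m} (\<lambda>_. \<mu>)) \<Longrightarrow> x \<notin> A \<Longrightarrow>
      (\<Sum>j=1..m. (cmod (ip I (v (x j)) y))\<^sup>2) \<le> real m * (1 + \<delta>) * nsq I y"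
proof -
  \<comment> \<open>With \<theta> = t/R the exponent of the bound is m/R times 0.6 t^2 - t \<delta>,
    which is smallest at t = \<delta>/1.2. Rounding to 0.84 \<delta> gives -0.41664 \<delta>^2 and
    keeps t within 0.42, the range of \<open>exp_le_quadratic\<close>.\<close>
  define t where "t = 84 / 100 * \<delta>"
  define \<theta> where "\<theta> = t / R"
  have t: "0 < t" "t \<le> 42 / 100" using \<delta> by (auto simp: t_def)
  have \<theta>: "0 < \<theta>" "\<theta> * R = t" using t R_pos by (auto simp: \<theta>_def)
  define \<rho> where "\<rho> = 1 + (exp t - 1) / R"
  define b where "b = \<rho> ^ m * real (card I)"
  \<comment> \<open>A violation at y makes the form of the operator at least L |y|^2, and hence its
    exponential trace at least e^L.\<close>
  define L where "L = \<theta> * (1 + \<delta>) * real m"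
  have e1: "0 \<le> (exp t - 1) / R" using t R_pos by simp
  then have \<rho>: "0 \<le> \<rho>" unfolding \<rho>_def by simp
  have bdd: "bounded_psd I (sample_op I 0 \<theta> v x r)" if "x \<in> space (PiM {1..r} (\<lambda>_. \<mu>))" for x r
    using \<theta> R_pos sample_le that
    by (intro sample_op_bounded_psd[where R = R] finite_index) (auto simp: space_PiM PiE_iff)
  have I: "(\<integral>\<^sup>+x. ennreal (exp_trace I (sample_op I 0 \<theta> v x m)) \<partial>PiM {1..m} (\<lambda>_. \<mu>)) \<le> ennreal b"
    unfolding b_def
  proof (rule nn_integral_exp_trace_iterate[where m = m])
    fix x :: "nat \<Rightarrow> 'a" and r assume "x \<in> space (PiM {1..r} (\<lambda>_. \<mu>))"
    then show "(\<integral>\<^sup>+y. ennreal (exp_trace I (sample_op I 0 \<theta> v (x(Suc r := y)) (Suc r))) \<partial>\<mu>)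
        \<le> ennreal (\<rho> * exp_trace I (sample_op I 0 \<theta> v x r))"
      using nn_integral_exp_trace_add[OF bdd \<theta>(1)] \<theta>
      by (simp add: sample_op_Suc(1) \<rho>_def del: fun_upd_apply)
  qed (use \<rho> in \<open>simp_all add: exp_trace_sample_op_0 finite_index\<close>)
  have "exp (- L) * b \<le> real (card I) * exp (- (41 / 100 * real m * \<delta>\<^sup>2 / R))"
  proof -
    have "\<rho> \<le> exp ((exp t - 1) / R)" unfolding \<rho>_def by (rule exp_ge_add_one_self)
    also have "\<dots> \<le> exp ((t + 6 / 10 * t\<^sup>2) / R)"
      using exp_le_quadratic[of t] t R_pos by (simp add: divide_right_mono)
    finally have "\<rho> ^ m \<le> exp ((t + 6 / 10 * t\<^sup>2) / R) ^ m" using \<rho> by (rule power_mono)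
    also have "\<dots> = exp (real m * ((t + 6 / 10 * t\<^sup>2) / R))" by (rule exp_of_nat_mult[symmetric])
    finally have "exp (- L) * \<rho> ^ m \<le> exp (- L) * exp (real m * ((t + 6 / 10 * t\<^sup>2) / R))"
      by (intro mult_left_mono) auto
    also have "\<dots> = exp (- (41664 / 100000 * (real m * \<delta>\<^sup>2 / R)))"
      unfolding exp_add[symmetric] exp_inj_iff L_def \<theta>_def t_def using R_pos
      by (simp add: field_simps power2_eq_square)
    also have "\<dots> \<le> exp (- (41 / 100 * (real m * \<delta>\<^sup>2 / R)))"
    proof -
      have "0 \<le> real m * \<delta>\<^sup>2 / R" using R_pos by simp
      then have "- (41664 / 100000 * (real m * \<delta>\<^sup>2 / R)) \<le> - (41 / 100 * (real m * \<delta>\<^sup>2 / R))" by linarith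
      then show ?thesis by simp
    qed
    finally have "exp (- L) * \<rho> ^ m \<le> exp (- (41 / 100 * real m * \<delta>\<^sup>2 / R))" by (simp add: mult.assoc)
    then show ?thesis
      unfolding b_def by (simp add: mult_left_mono mult.left_commute mult.commute[of _ "real (card I)"])
  qed
  moreover have "0 \<le> b" using \<rho> by (simp add: b_def)
  moreover have "(\<Sum>j=1..m. (cmod (ip I (v (x j)) y))\<^sup>2) \<le> real m * (1 + \<delta>) * nsq I y"
    if x: "x \<in> space (PiM {1..m} (\<lambda>_. \<mu>))"
      and nA: "x \<notin> {x \<in> space (PiM {1..m} (\<lambda>_. \<mu>)). exp L \<le> exp_trace I (sample_op I 0 \<theta> v x m)}" for x y
  proof (rule ccontr)
    assume "\<not> ?thesis"
    then have gt: "real m * (1 + \<delta>) * nsq I y < (\<Sum>j=1..m. (cmod (ip I (v (x j)) y))\<^sup>2)" by simp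
    have y: "0 < nsq I y"
    proof (rule ccontr)
      assume "\<not> 0 < nsq I y"
      then have "nsq I y = 0" using nsq_nonneg[of I y] by linarith
      then have "(cmod (ip I (v (x j)) y))\<^sup>2 \<le> 0" for j using ip_Cauchy_Schwarz[of I "v (x j)" y] by simp
      then have "(\<Sum>j=1..m. (cmod (ip I (v (x j)) y))\<^sup>2) \<le> 0" by (intro sum_nonpos)
      then show False using gt \<open>nsq I y = 0\<close> by simp
    qed
    have "\<theta> * (real m * (1 + \<delta>) * nsq I y) \<le> \<theta> * (\<Sum>j=1..m. (cmod (ip I (v (x j)) y))\<^sup>2)"
      using gt \<theta> by (intro mult_left_mono) auto
    then have "L * nsq I y \<le> Re (ip I y (sample_op I 0 \<theta> v x m y))"
      by (simp add: ip_sample_op_self L_def mult_ac)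
    then have "exp L \<le> exp_trace I (sample_op I 0 \<theta> v x m)"
      using \<theta> \<delta> by (intro exp_le_exp_trace[OF bdd[OF x] _ _ y]) (auto simp: L_def)
    then show False using nA x by simp
  qed
  ultimately show ?thesis
    using exp_trace_Markov[OF I, of L]
    by (intro that[of "{x \<in> space (PiM {1..m} (\<lambda>_. \<mu>)). exp L \<le> exp_trace I (sample_op I 0 \<theta> v x m)}"])
      (auto intro: order_trans ennreal_leI)
qed

lemma lower_deviation:
  assumes \<delta>: "0 < \<delta>" "\<delta> \<le> 1 / 2"
  obtains A where "A \<in> sets (PiM {1..m} (\<lambda>_. \<mu>))"
    and "emeasure (PiM {1..m} (\<lambda>_. \<mu>)) A \<le> ennreal (real (card I) * exp (- (41 / 100 * real m * \<delta>\<^sup>2 / R)))"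
    and "\<And>x y. x \<in> space (PiM {1..m} (\<lambda>_. \<mu>)) \<Longrightarrow> x \<notin> A \<Longrightarrow>
      real m * (1 - \<delta>) * nsq I y \<le> (\<Sum>j=1..m. (cmod (ip I (v (x j)) y))\<^sup>2)"
proof -
  \<comment> \<open>The exponent is -m (\<theta>\<delta> - \<theta>^2 R/2), and this \<theta>
    minimizes it. The resulting rate 1/2 is weakened to 0.41 to match the upper tail.\<close>
  define \<theta> where "\<theta> = \<delta> / R"
  have \<theta>: "0 < \<theta>" "\<theta> * R = \<delta>" using \<delta> R_pos by (auto simp: \<theta>_def)
  \<comment> \<open>The part \<theta> m R keeps the operators positive. The further \<theta> m makes
    L = \<theta> m (R + \<delta>) nonnegative without comparing R with 1. In the final exponent c
    cancels.\<close>
  define c where "c = \<theta> * real m * (R + 1)"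
  define \<rho> where "\<rho> = exp (- (\<theta> * (1 - \<theta> * R / 2)))"
  define b where "b = \<rho> ^ m * (real (card I) * exp c)"
  define L where "L = c - \<theta> * (1 - \<delta>) * real m"
  have c: "0 \<le> c" using \<theta> R_pos by (simp add: c_def)
  have bdd: "bounded_psd I (sample_op I c (- \<theta>) v x r)"
    if "x \<in> space (PiM {1..r} (\<lambda>_. \<mu>))" "r \<le> m" for x r
  proof (rule sample_op_bounded_psd[OF finite_index])
    have "- (- \<theta>) * real r * R \<le> c"
    proof -
      have "\<theta> * real r * R \<le> \<theta> * real m * (R + 1)"
        using \<theta> R_pos that by (intro mult_mono) auto
      then show ?thesis by (simp add: c_def)
    qed
    then show "0 \<le> - \<theta> \<or> - (- \<theta>) * real r * R \<le> c" ..
    show "nsq I (v (x j)) \<le> R" if "j \<in> {1..r}" for j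
      using sample_le that \<open>x \<in> space (PiM {1..r} (\<lambda>_. \<mu>))\<close> by (auto simp: space_PiM PiE_iff)
  qed (use R_pos c in auto)
  have I: "(\<integral>\<^sup>+x. ennreal (exp_trace I (sample_op I c (- \<theta>) v x m)) \<partial>PiM {1..m} (\<lambda>_. \<mu>)) \<le> ennreal b"
    unfolding b_def
  proof (rule nn_integral_exp_trace_iterate[where m = m])
    fix x :: "nat \<Rightarrow> 'a" and r assume x: "x \<in> space (PiM {1..r} (\<lambda>_. \<mu>))" and r: "r < m"
    have "(\<integral>\<^sup>+y. ennreal (exp_trace I (sample_op I c (- \<theta>) v (x(Suc r := y)) (Suc r))) \<partial>\<mu>)
        \<le> ennreal ((1 - \<theta> * (1 - \<theta> * R / 2)) * exp_trace I (sample_op I c (- \<theta>) v x r))"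
    proof (rule nn_integral_exp_trace_remove)
      fix y assume y: "y \<in> space \<mu>"
      have "x(Suc r := y) \<in> space (PiM {1..Suc r} (\<lambda>_. \<mu>))"
        using x y by (auto simp: space_PiM PiE_iff extensional_def)
      then show "bounded_psd I (sample_op I c (- \<theta>) v (x(Suc r := y)) (Suc r))"
        using r by (intro bdd) auto
      show "sample_op I c (- \<theta>) v x r = add_rank1 I (sample_op I c (- \<theta>) v (x(Suc r := y)) (Suc r))
          (\<lambda>i. complex_of_real (sqrt \<theta>) * v y i)"
        using \<theta> by (intro sample_op_Suc(2)) auto
    qed (use \<theta> \<delta> bdd[OF x] r in auto)
    also have "\<dots> \<le> ennreal (\<rho> * exp_trace I (sample_op I c (- \<theta>) v x r))"
      unfolding \<rho>_def using exp_ge_add_one_self[of "- (\<theta> * (1 - \<theta> * R / 2))"] exp_trace_nonneg[OF bdd[OF x]] r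
      by (intro ennreal_leI mult_right_mono) auto
    finally show "(\<integral>\<^sup>+y. ennreal (exp_trace I (sample_op I c (- \<theta>) v (x(Suc r := y)) (Suc r))) \<partial>\<mu>)
        \<le> ennreal (\<rho> * exp_trace I (sample_op I c (- \<theta>) v x r))" .
  qed (simp_all add: exp_trace_sample_op_0 finite_index \<rho>_def)
  have "exp (- L) * b \<le> real (card I) * exp (- (41 / 100 * real m * \<delta>\<^sup>2 / R))"
  proof -
    have "\<rho> ^ m = exp (real m * (- (\<theta> * (1 - \<theta> * R / 2))))" by (simp only: \<rho>_def exp_of_nat_mult)
    then have "exp (- L) * b = real (card I) * exp (- L + real m * (- (\<theta> * (1 - \<theta> * R / 2))) + c)"
      by (simp only: b_def exp_add mult_ac)
    also have "- L + real m * (- (\<theta> * (1 - \<theta> * R / 2))) + c = - (1 / 2 * (real m * \<delta>\<^sup>2 / R))"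
      unfolding L_def \<theta>_def using R_pos by (simp add: field_simps power2_eq_square)
    also have "real (card I) * exp (- (1 / 2 * (real m * \<delta>\<^sup>2 / R))) \<le>
        real (card I) * exp (- (41 / 100 * (real m * \<delta>\<^sup>2 / R)))"
    proof -
      have "0 \<le> real m * \<delta>\<^sup>2 / R" using R_pos by simp
      then have "- (1 / 2 * (real m * \<delta>\<^sup>2 / R)) \<le> - (41 / 100 * (real m * \<delta>\<^sup>2 / R))" by linarith
      then show ?thesis by (intro mult_left_mono) auto
    qed
    finally show ?thesis by (simp add: mult.assoc)
  qed
  moreover have "0 \<le> b" by (simp add: b_def \<rho>_def)
  moreover have "real m * (1 - \<delta>) * nsq I y \<le> (\<Sum>j=1..m. (cmod (ip I (v (x j)) y))\<^sup>2)"
    if x: "x \<in> space (PiM {1..m} (\<lambda>_. \<mu>))"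
      and nA: "x \<notin> {x \<in> space (PiM {1..m} (\<lambda>_. \<mu>)). exp L \<le> exp_trace I (sample_op I c (- \<theta>) v x m)}" for x y
  proof (rule ccontr)
    assume "\<not> ?thesis"
    then have lt: "(\<Sum>j=1..m. (cmod (ip I (v (x j)) y))\<^sup>2) < real m * (1 - \<delta>) * nsq I y" by simp
    have y: "0 < nsq I y"
    proof (rule ccontr)
      assume "\<not> 0 < nsq I y"
      then have "nsq I y = 0" using nsq_nonneg[of I y] by linarith
      moreover have "0 \<le> (\<Sum>j=1..m. (cmod (ip I (v (x j)) y))\<^sup>2)" by (intro sum_nonneg) simp
      ultimately show False using lt by simp
    qed
    have "\<theta> * (\<Sum>j=1..m. (cmod (ip I (v (x j)) y))\<^sup>2) \<le> \<theta> * (real m * (1 - \<delta>) * nsq I y)"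
      using lt \<theta> by (intro mult_left_mono) auto
    then have "L * nsq I y \<le> Re (ip I y (sample_op I c (- \<theta>) v x m y))"
      by (simp add: ip_sample_op_self L_def algebra_simps)
    moreover have "0 \<le> L"
    proof -
      have "L = \<theta> * real m * (R + \<delta>)" by (simp add: L_def c_def algebra_simps)
      then show ?thesis using \<theta> \<delta> R_pos by simp
    qed
    ultimately have "exp L \<le> exp_trace I (sample_op I c (- \<theta>) v x m)"
      by (intro exp_le_exp_trace[OF bdd[OF x order_refl] _ _ y]) auto
    then show False using nA x by simp
  qed
  ultimately show ?thesis
    using exp_trace_Markov[OF I, of L]
    by (intro that[of "{x \<in> space (PiM {1..m} (\<lambda>_. \<mu>)). exp L \<le> exp_trace I (sample_op I c (- \<theta>) v x m)}"])
      (auto intro: order_trans ennreal_leI)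
qed

end

section \<open>The torus\<close>

text \<open>An enumeration turns sums over the lattice into series, to which the theorems on limits
  and integrals of series apply.\<close>

definition lat :: "nat \<Rightarrow> real ^ 'd::finite" where
  "lat = from_nat_into int_lattice"

lemma countable_int_lattice: "countable (int_lattice :: (real ^ 'd::finite) set)"
proof -
  have "(int_lattice :: (real ^ 'd) set) \<subseteq> (\<lambda>f. \<chi> j. f j) ` (PiE UNIV (\<lambda>_. \<int>))"
  proof
    fix l :: "real ^ 'd" assume "l \<in> int_lattice"
    then have "(\<lambda>j. l $ j) \<in> PiE UNIV (\<lambda>_. \<int>)" by (auto simp: int_lattice_def PiE_iff)
    moreover have "l = (\<chi> j. l $ j)" by simp
    ultimately show "l \<in> (\<lambda>f. \<chi> j. f j) ` (PiE UNIV (\<lambda>_. \<int>))" by blast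
  qed
  moreover have "countable (\<int> :: real set)" by (simp add: Ints_def)
  then have "countable ((\<lambda>f. \<chi> j. f j) ` (PiE UNIV (\<lambda>_. \<int>)) :: (real ^ 'd) set)"
    by (intro countable_image countable_PiE) auto
  ultimately show ?thesis by (rule countable_subset)
qed

lemma infinite_int_lattice: "infinite (int_lattice :: (real ^ 'd::finite) set)"
proof
  assume "finite (int_lattice :: (real ^ 'd) set)"
  moreover have "range (\<lambda>n::nat. (\<chi> j. real n) :: real ^ 'd) \<subseteq> int_lattice"
    by (auto simp: int_lattice_def)
  ultimately have "finite (range (\<lambda>n::nat. (\<chi> j. real n) :: real ^ 'd))" by (rule finite_subset[rotated])
  moreover have "inj (\<lambda>n::nat. (\<chi> j. real n) :: real ^ 'd)" by (auto simp: inj_def vec_eq_iff)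
  ultimately show False using finite_imageD by blast
qed

lemma bij_lat: "bij_betw (lat :: nat \<Rightarrow> real ^ 'd::finite) UNIV int_lattice"
  unfolding lat_def by (rule bij_betw_from_nat_into[OF countable_int_lattice infinite_int_lattice])

lemma lat_in [simp]: "lat n \<in> int_lattice"
  using bij_lat by (auto simp: bij_betw_def)

lemma lat_surj: "l \<in> int_lattice \<Longrightarrow> \<exists>n. l = lat n"
  using bij_lat by (auto simp: bij_betw_def)

lemma lat_eq_iff [simp]: "lat n = lat m \<longleftrightarrow> n = m"
  using bij_lat by (auto simp: bij_betw_def inj_on_def)

lemma int_lattice_0 [simp]: "0 \<in> int_lattice"
  and int_lattice_add: "a \<in> int_lattice \<Longrightarrow> b \<in> int_lattice \<Longrightarrow> a + b \<in> int_lattice"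
  and int_lattice_diff: "a \<in> int_lattice \<Longrightarrow> b \<in> int_lattice \<Longrightarrow> a - b \<in> int_lattice"
  and int_lattice_uminus: "a \<in> int_lattice \<Longrightarrow> - a \<in> int_lattice"
  by (auto simp: int_lattice_def)

lemma infsum_lattice_ennreal:
  fixes f :: "real ^ 'd::finite \<Rightarrow> ennreal"
  shows "(\<Sum>\<^sub>\<infinity>l\<in>int_lattice. f l) = (\<Sum>n. f (lat n))"
proof -
  have "(\<Sum>\<^sub>\<infinity>l\<in>int_lattice. f l) = (\<Sum>\<^sub>\<infinity>n. f (lat n))"
    by (rule infsum_reindex_bij_betw[OF bij_lat, symmetric])
  also have "\<dots> = (\<Sum>n. f (lat n))"
    by (intro sums_unique has_sum_imp_sums has_sum_infsum nonneg_summable_on_complete) simp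
  finally show ?thesis .
qed

lemma infsum_lattice:
  fixes f :: "real ^ 'd::finite \<Rightarrow> complex"
  assumes "summable (\<lambda>n. norm (f (lat n)))"
  shows "(\<Sum>\<^sub>\<infinity>l\<in>int_lattice. f l) = (\<Sum>n. f (lat n))"
proof -
  have "(\<Sum>\<^sub>\<infinity>l\<in>int_lattice. f l) = (\<Sum>\<^sub>\<infinity>n. f (lat n))"
    by (rule infsum_reindex_bij_betw[OF bij_lat, symmetric])
  also have "\<dots> = (\<Sum>n. f (lat n))"
    using assms by (intro infsumI norm_summable_imp_has_sum) (auto intro: summable_norm_cancel summable_sums)
  finally show ?thesis .
qed

section \<open>Characters and integration over the unit cube\<close>

definition chr :: "real ^ 'd::finite \<Rightarrow> real ^ 'd \<Rightarrow> complex" where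
  "chr a x = cis (2 * pi * (a \<bullet> x))"

lemma norm_chr [simp]: "norm (chr a x) = 1"
  by (simp add: chr_def)

lemma chr_add_left: "chr (a + b) x = chr a x * chr b x"
  and chr_add_right: "chr a (x + y) = chr a x * chr a y"
  by (simp_all add: chr_def cis_mult inner_add_left inner_add_right algebra_simps)

lemma cnj_chr [simp]: "cnj (chr a x) = chr (- a) x"
  by (simp add: chr_def cis_cnj)

lemma chr_minus_swap: "chr (- a) x = chr a (- x)"
  by (simp add: chr_def)

lemma chr_commute: "chr a x = chr x a"
  by (simp add: chr_def inner_commute)

lemma chr_0 [simp]: "chr 0 x = 1" "chr x 0 = 1"
  by (simp_all add: chr_def)

lemma chr_lattice [simp]:
  assumes "a \<in> int_lattice" "l \<in> int_lattice" shows "chr a l = 1"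
proof -
  have "a \<bullet> l \<in> \<int>"
    using assms unfolding inner_vec_def int_lattice_def by (intro Ints_sum) (auto intro: Ints_mult)
  then obtain n :: int where "a \<bullet> l = of_int n" by (auto elim: Ints_cases)
  then show ?thesis unfolding chr_def by (metis cis_2pi cis_multiple_2pi Ints_of_int mult.commute)
qed

lemma continuous_on_chr [continuous_intros]:
  "continuous_on S f \<Longrightarrow> continuous_on S g \<Longrightarrow> continuous_on S (\<lambda>x. chr (f x) (g x))"
  unfolding chr_def by (intro continuous_intros)

lemma borel_measurable_chr [measurable (raw)]:
  "f \<in> borel_measurable M \<Longrightarrow> g \<in> borel_measurable M \<Longrightarrow> (\<lambda>x. chr (f x) (g x)) \<in> borel_measurable M"
  by (rule borel_measurable_continuous_Pair) (auto intro!: continuous_intros)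

lemma exp_eq_chr:
  "exp (- 2 * pi * \<i> * of_real (x \<bullet> w)) = chr (- w) x"
  "exp (2 * pi * \<i> * of_real (x \<bullet> w)) = chr w x"
  by (simp_all add: chr_def cis_conv_exp inner_commute mult_ac)

text \<open>Fubini's theorem in coordinates: \<open>lborel\<close> on vectors is an image of the
  product measure indexed by \<open>Basis\<close>, and \<open>axis\<close> matches this index set
  with the coordinates.\<close>

lemma integral_prod_vec:
  fixes f :: "'d::finite \<Rightarrow> real \<Rightarrow> complex"
  assumes "\<And>j. integrable lborel (f j)"
  shows "integrable lborel (\<lambda>x::real^'d. \<Prod>j\<in>UNIV. f j (x $ j))"
    and "integral\<^sup>L lborel (\<lambda>x::real^'d. \<Prod>j\<in>UNIV. f j (x $ j)) = (\<Prod>j\<in>UNIV. LINT t|lborel. f j t)"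
proof -
  define ax :: "'d \<Rightarrow> real ^ 'd" where "ax = (\<lambda>j. axis j 1)"
  have bij: "bij_betw ax UNIV Basis"
    by (auto simp: bij_betw_def inj_on_def ax_def axis_eq_axis Basis_vec_def)
  define F where "F b = f (inv_into UNIV ax b)" for b
  have F: "F (ax j) = f j" for j
    using bij by (simp add: F_def bij_betw_def)
  interpret product_sigma_finite "\<lambda>_::real^'d. lborel :: real measure" ..
  have int: "integrable lborel (F b)" for b unfolding F_def by (rule assms)
  have L: "(lborel :: (real^'d) measure) = distr (PiM Basis (\<lambda>_. lborel)) borel (\<lambda>w. \<Sum>b\<in>Basis. w b *\<^sub>R b)"
    by (rule lborel_eq)
  have comp: "(\<Sum>b\<in>Basis. w b *\<^sub>R b) $ j = w (ax j)" for w and j :: 'd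
  proof -
    have "(\<Sum>b\<in>Basis. w b *\<^sub>R b) $ j = (\<Sum>b\<in>Basis. w b *\<^sub>R b) \<bullet> ax j"
      unfolding ax_def by (rule cart_eq_inner_axis)
    also have "\<dots> = w (ax j)"
      using bij by (subst inner_sum_left_Basis) (auto simp: bij_betw_def)
    finally show ?thesis .
  qed
  have P: "(\<Prod>j\<in>UNIV. f j ((\<Sum>b\<in>Basis. w b *\<^sub>R b) $ j)) = (\<Prod>b\<in>Basis. F b (w b))" for w :: "real^'d \<Rightarrow> real"
    unfolding comp using prod.reindex_bij_betw[OF bij, of "\<lambda>b. F b (w b)"] unfolding F .
  have meas: "(\<lambda>x::real^'d. \<Prod>j\<in>UNIV. f j (x $ j)) \<in> borel_measurable borel"
  proof (rule borel_measurable_prod)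
    fix j
    have "f j \<in> borel_measurable borel" using borel_measurable_integrable[OF assms[of j]] by simp
    moreover have "(\<lambda>x::real^'d. x $ j) \<in> borel_measurable borel"
      by (intro borel_measurable_continuous_onI continuous_intros)
    ultimately show "(\<lambda>x::real^'d. f j (x $ j)) \<in> borel_measurable borel"
      by (rule measurable_compose[rotated])
  qed
  have [measurable]: "(\<lambda>w. \<Sum>b\<in>Basis. w b *\<^sub>R b) \<in> PiM Basis (\<lambda>_. lborel) \<rightarrow>\<^sub>M (borel :: (real^'d) measure)"
    by measurable
  show "integrable lborel (\<lambda>x::real^'d. \<Prod>j\<in>UNIV. f j (x $ j))"
    unfolding L using product_integrable_prod[of Basis F, OF finite_Basis int]
    by (subst integrable_distr_eq[OF _ meas]) (measurable, simp only: P)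
  have "integral\<^sup>L lborel (\<lambda>x::real^'d. \<Prod>j\<in>UNIV. f j (x $ j)) = (\<Prod>b\<in>(Basis :: (real^'d) set). LINT t|lborel. F b t)"
    unfolding L using product_integral_prod[of Basis F, OF finite_Basis int]
    by (subst integral_distr[OF _ meas]) (measurable, simp only: P)
  also have "\<dots> = (\<Prod>j\<in>UNIV. LINT t|lborel. f j t)"
    using prod.reindex_bij_betw[OF bij, of "\<lambda>b. LINT t|lborel. F b t"] unfolding F by (rule sym)
  finally show "integral\<^sup>L lborel (\<lambda>x::real^'d. \<Prod>j\<in>UNIV. f j (x $ j)) = (\<Prod>j\<in>UNIV. LINT t|lborel. f j t)" .
qed

lemma mem_unit_cube: "x \<in> unit_cube \<longleftrightarrow> (\<forall>j. - 1 / 2 \<le> x $ j \<and> x $ j \<le> 1 / 2)"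
  by (simp add: unit_cube_def mem_box_cart)

lemma unit_cube_uminus: "x \<in> unit_cube \<Longrightarrow> - x \<in> unit_cube"
proof -
  have "- 1 / 2 \<le> - t \<and> - t \<le> 1 / 2" if "- 1 / 2 \<le> t \<and> t \<le> 1 / 2" for t :: real
    using that by linarith
  then show "x \<in> unit_cube \<Longrightarrow> - x \<in> unit_cube" unfolding mem_unit_cube vector_uminus_component by blast
qed

lemma sets_unit_cube [measurable]: "unit_cube \<in> sets borel"
  by (simp add: unit_cube_def)

text \<open>A density rather than a restriction: its measurable sets are all Borel sets and its
  space is \<open>UNIV\<close>.\<close>

definition cube_measure :: "(real ^ 'd::finite) measure" where
  "cube_measure = density lborel (indicator unit_cube)"

lemma sets_cube_measure [measurable_cong, simp]: "sets cube_measure = sets borel"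
  and space_cube_measure [simp]: "space cube_measure = UNIV"
  by (simp_all add: cube_measure_def)

lemma emeasure_unit_cube: "emeasure lborel (unit_cube :: (real ^ 'd::finite) set) = 1"
proof -
  have "emeasure lborel (unit_cube :: (real ^ 'd) set) = ennreal (\<Prod>b\<in>Basis. ((\<chi> j. 1 / 2) - (\<chi> j. - 1 / 2)) \<bullet> (b :: real ^ 'd))"
    unfolding unit_cube_def by (rule emeasure_lborel_cbox) (auto simp: Basis_vec_def inner_axis)
  also have "(\<Prod>b\<in>Basis. ((\<chi> j. 1 / 2) - (\<chi> j. - 1 / 2)) \<bullet> (b :: real^'d)) = (1 :: real)"
    by (intro prod.neutral) (auto simp: Basis_vec_def inner_axis)
  finally show ?thesis by simp
qed

lemma cube_measure_eq_uniform: "cube_measure = uniform_measure lborel unit_cube"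
  by (simp add: cube_measure_def uniform_measure_def emeasure_unit_cube divide_ennreal_def)

lemma prob_space_cube_measure: "prob_space (cube_measure :: (real ^ 'd::finite) measure)"
  unfolding cube_measure_eq_uniform by (rule prob_space_uniform_measure) (simp_all add: emeasure_unit_cube)

lemma AE_cube_measure: "(AE x in cube_measure. P x) \<longleftrightarrow> (AE x in lborel. x \<in> unit_cube \<longrightarrow> P x)"
  unfolding cube_measure_def by (subst AE_density) (auto simp: indicator_def)

lemma nn_integral_cube_measure:
  "f \<in> borel_measurable borel \<Longrightarrow> (\<integral>\<^sup>+x. f x \<partial>cube_measure) = (\<integral>\<^sup>+x. indicator unit_cube x * f x \<partial>lborel)"
  unfolding cube_measure_def by (subst nn_integral_density) simp_all

lemma integrable_cube_measure:
  fixes f :: "real ^ 'd::finite \<Rightarrow> complex"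
  assumes [measurable]: "f \<in> borel_measurable borel"
  shows "integrable cube_measure f \<longleftrightarrow> integrable lborel (\<lambda>x. indicator unit_cube x *\<^sub>R f x)"
    and "integral\<^sup>L cube_measure f = (LINT x|lborel. indicator unit_cube x *\<^sub>R f x)"
  unfolding cube_measure_def
  using integrable_density[of f lborel "indicator unit_cube :: _ \<Rightarrow> real"]
    integral_density[of f lborel "indicator unit_cube :: _ \<Rightarrow> real"]
  by (simp_all add: ennreal_indicator)

interpretation cube: prob_space "cube_measure :: (real ^ 'd::finite) measure"
  by (rule prob_space_cube_measure)

lemma integral_exp_unit_interval:
  fixes n :: real
  assumes "n \<in> \<int>"
  shows "integrable lborel (\<lambda>t. indicator {-1/2..1/2} t *\<^sub>R cis (2 * pi * (n * t)))"
    and "(LINT t|lborel. indicator {-1/2..1/2} t *\<^sub>R cis (2 * pi * (n * t))) = (if n = 0 then 1 else 0)"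
proof -
  show "integrable lborel (\<lambda>t. indicator {-1/2..1/2} t *\<^sub>R cis (2 * pi * (n * t)))"
    by (intro borel_integrable_compact) (auto intro!: continuous_intros)
  show "(LINT t|lborel. indicator {-1/2..1/2} t *\<^sub>R cis (2 * pi * (n * t))) = (if n = 0 then 1 else 0)"
  proof (cases "n = 0")
    case True
    then show ?thesis by (simp add: scaleR_conv_of_real)
  next
    case False
    define F where "F t = cis (2 * pi * (n * t)) / (2 * pi * \<i> * of_real n)" for t
    have "(LINT t|lborel. indicator {-1/2..1/2} t *\<^sub>R cis (2 * pi * (n * t))) = F (1/2) - F (-1/2)"
    proof (rule integral_FTC_Icc)
      fix x :: real
      have e: "cis (2 * pi * (n * t)) = exp (2 * pi * \<i> * of_real n * of_real t)" for t
        by (simp add: cis_conv_exp mult_ac)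
      have "((\<lambda>t. exp (2 * pi * \<i> * of_real n * of_real t) / (2 * pi * \<i> * of_real n)) has_vector_derivative
          exp (2 * pi * \<i> * of_real n * of_real x)) (at x within {-1/2..1/2})"
        using False by (auto intro!: derivative_eq_intros has_vector_derivative_real_field)
      then show "(F has_vector_derivative cis (2 * pi * (n * x))) (at x within {-1/2..1/2})"
        unfolding F_def e .
    qed (auto intro!: continuous_intros)
    also have "F (1/2) = F (-1/2)"
    proof -
      have "cis (2 * pi * (n * (1/2))) = cis (2 * pi * (n * (-1/2)) + 2 * pi * n)" by (simp add: algebra_simps)
      also have "\<dots> = cis (2 * pi * (n * (-1/2)))"
        unfolding cis_mult[symmetric] cis_multiple_2pi[OF assms] by simp
      finally show ?thesis by (simp add: F_def)
    qed
    finally show ?thesis using False by simp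
  qed
qed

lemma integral_chr:
  fixes l :: "real ^ 'd::finite"
  assumes "l \<in> int_lattice"
  shows "(LINT x|cube_measure. chr l x) = (if l = 0 then 1 else 0)"
proof -
  have e: "indicator unit_cube x *\<^sub>R chr l x =
      (\<Prod>j\<in>UNIV. indicator {-1/2..1/2} (x $ j) *\<^sub>R cis (2 * pi * (l $ j * x $ j)))" for x
  proof -
    have "chr l x = (\<Prod>j\<in>UNIV. cis (2 * pi * (l $ j * x $ j)))"
      unfolding chr_def inner_vec_def
      by (simp add: cis_conv_exp exp_sum[symmetric] sum_distrib_left)
    moreover have "(indicator unit_cube x :: real) = (\<Prod>j\<in>UNIV. indicator {-1/2..1/2} (x $ j))"
      by (auto simp: indicator_def mem_unit_cube intro!: prod_zero[symmetric])
    ultimately show ?thesis by (simp add: scaleR_conv_of_real prod.distrib)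
  qed
  have l: "l $ j \<in> \<int>" for j using assms by (simp add: int_lattice_def)
  have "(LINT x|cube_measure. chr l x) = (LINT x|lborel. indicator unit_cube x *\<^sub>R chr l x)"
    by (rule integrable_cube_measure(2)) measurable
  also have "\<dots> = (\<Prod>j\<in>UNIV. if l $ j = 0 then 1 else 0)"
    unfolding e by (subst integral_prod_vec(2)[OF integral_exp_unit_interval(1)[OF l]])
      (simp only: integral_exp_unit_interval(2)[OF l])
  also have "\<dots> = (if l = 0 then 1 else 0)"
    by (auto simp: vec_eq_iff intro!: prod_zero)
  finally show ?thesis .
qed

section \<open>Trigonometric polynomials and their density\<close>

definition trig_poly :: "(real ^ 'd::finite \<Rightarrow> complex) \<Rightarrow> bool" where
  "trig_poly p \<longleftrightarrow> (\<exists>T c. finite T \<and> T \<subseteq> int_lattice \<and> p = (\<lambda>x. \<Sum>l\<in>T. c l * chr l x))"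

lemma trig_poly_chr: "l \<in> int_lattice \<Longrightarrow> trig_poly (\<lambda>x. a * chr l x)"
  unfolding trig_poly_def by (intro exI[of _ "{l}"] exI[of _ "\<lambda>_. a"]) simp

lemma trig_poly_const: "trig_poly (\<lambda>x. a)"
  using trig_poly_chr[OF int_lattice_0, of a] by simp

lemma trig_poly_add:
  assumes "trig_poly p" "trig_poly q" shows "trig_poly (\<lambda>x. p x + q x)"
proof -
  obtain T c where p: "finite T" "T \<subseteq> int_lattice" "p = (\<lambda>x. \<Sum>l\<in>T. c l * chr l x)"
    using assms(1) by (auto simp: trig_poly_def)
  obtain U e where q: "finite U" "U \<subseteq> int_lattice" "q = (\<lambda>x. \<Sum>l\<in>U. e l * chr l x)"
    using assms(2) by (auto simp: trig_poly_def)
  have "p x + q x = (\<Sum>l\<in>T \<union> U. ((if l \<in> T then c l else 0) + (if l \<in> U then e l else 0)) * chr l x)" for x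
  proof -
    have "p x = (\<Sum>l\<in>T \<union> U. (if l \<in> T then c l else 0) * chr l x)"
      unfolding p(3) using p(1) q(1) by (intro sum.mono_neutral_cong_left) auto
    moreover have "q x = (\<Sum>l\<in>T \<union> U. (if l \<in> U then e l else 0) * chr l x)"
      unfolding q(3) using p(1) q(1) by (intro sum.mono_neutral_cong_left) auto
    ultimately show ?thesis by (simp add: sum.distrib algebra_simps)
  qed
  then show ?thesis
    unfolding trig_poly_def using p q
    by (intro exI[of _ "T \<union> U"] exI[of _ "\<lambda>l. (if l \<in> T then c l else 0) + (if l \<in> U then e l else 0)"]) auto
qed

lemma trig_poly_sum:
  assumes "\<And>a. a \<in> A \<Longrightarrow> trig_poly (f a)" shows "trig_poly (\<lambda>x. \<Sum>a\<in>A. f a x)"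
  using assms
  by (induction A rule: infinite_finite_induct) (auto simp: trig_poly_const trig_poly_add)

lemma trig_poly_mult:
  assumes "trig_poly p" "trig_poly q" shows "trig_poly (\<lambda>x. p x * q x)"
proof -
  obtain T c where p: "finite T" "T \<subseteq> int_lattice" "p = (\<lambda>x. \<Sum>l\<in>T. c l * chr l x)"
    using assms(1) by (auto simp: trig_poly_def)
  obtain U e where q: "finite U" "U \<subseteq> int_lattice" "q = (\<lambda>x. \<Sum>l\<in>U. e l * chr l x)"
    using assms(2) by (auto simp: trig_poly_def)
  have "(\<lambda>x. p x * q x) = (\<lambda>x. \<Sum>l\<in>T. \<Sum>k\<in>U. (c l * e k) * chr (l + k) x)"
    unfolding p(3) q(3) sum_product by (simp add: chr_add_left mult_ac)
  moreover have "trig_poly (\<lambda>x. \<Sum>l\<in>T. \<Sum>k\<in>U. (c l * e k) * chr (l + k) x)"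
    using p(2) q(2) by (intro trig_poly_sum trig_poly_chr int_lattice_add) auto
  ultimately show ?thesis by simp
qed

lemma trig_poly_borel: "trig_poly p \<Longrightarrow> p \<in> borel_measurable borel"
  by (auto simp: trig_poly_def)

definition torus_map :: "real ^ 'd::finite \<Rightarrow> complex ^ 'd" where
  "torus_map x = (\<chi> j. cis (2 * pi * x $ j))"

lemma continuous_on_torus_map: "continuous_on S torus_map"
  unfolding torus_map_def by (intro continuous_intros)

text \<open>The difference s - t is an integer of absolute value at most 1. Hence the torus map
  identifies only opposite faces of the closed cube.\<close>

lemma cis_eq_unit_interval:
  assumes "- 1 / 2 \<le> s" "s \<le> 1 / 2" "- 1 / 2 \<le> t" "t \<le> 1 / 2" "cis (2 * pi * s) = cis (2 * pi * t)"
  shows "s = t \<or> \<bar>s\<bar> = 1 / 2 \<and> \<bar>t\<bar> = 1 / 2"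
proof -
  have "cis (2 * pi * s - 2 * pi * t) = 1"
    using assms(5) by (simp flip: cis_divide)
  then have "cos (2 * pi * s - 2 * pi * t) = 1" by (simp add: complex_eq_iff)
  then obtain n :: int where "2 * pi * s - 2 * pi * t = 2 * pi * of_int n"
    by (auto simp: cos_one_2pi_int)
  then have "2 * pi * (s - t) = 2 * pi * of_int n" by (simp add: algebra_simps)
  then have n: "s - t = of_int n" by simp
  with assms have "\<bar>of_int n :: real\<bar> \<le> 1" by linarith
  then have "\<bar>n\<bar> \<le> 1" by linarith
  then have "n = 0 \<or> n = 1 \<or> n = - 1" by linarith
  then show ?thesis using n assms by (auto simp: abs_if)
qed

text \<open>A continuous function on the cube that vanishes on its boundary descends to the torus, where
  the trigonometric polynomials are an algebra to which Stone-Weierstrass applies.\<close>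

lemma trig_approx_continuous_real:
  fixes h :: "real ^ 'd::finite \<Rightarrow> real"
  assumes h: "continuous_on unit_cube h" and e: "0 < e"
    and bd: "\<And>x j. x \<in> unit_cube \<Longrightarrow> \<bar>x $ j\<bar> = 1 / 2 \<Longrightarrow> h x = 0"
  obtains p where "trig_poly p" "\<And>x. x \<in> unit_cube \<Longrightarrow> norm (of_real (h x) - p x) < e"
proof -
  define S where "S = torus_map ` (unit_cube :: (real^'d) set)"
  have cube: "compact (unit_cube :: (real^'d) set)" by (simp add: unit_cube_def)
  have S: "compact S" unfolding S_def by (intro compact_continuous_image continuous_on_torus_map cube)
  \<comment> \<open>\<open>F\<close> is \<open>h\<close> transported to the torus along a chosen
    preimage. The choice does not affect the value: two distinct preimages both lie on the boundary
    of the cube, where \<open>h\<close> vanishes.\<close>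
  define F where "F z = h (SOME x. x \<in> unit_cube \<and> torus_map x = z)" for z
  have F: "F (torus_map x) = h x" if x: "x \<in> unit_cube" for x
  proof -
    define y where "y = (SOME y. y \<in> unit_cube \<and> torus_map y = torus_map x)"
    have y: "y \<in> unit_cube \<and> torus_map y = torus_map x"
      unfolding y_def using x by (intro someI[of "\<lambda>y. y \<in> unit_cube \<and> torus_map y = torus_map x" x]) simp
    have c: "y $ j = x $ j \<or> \<bar>y $ j\<bar> = 1 / 2 \<and> \<bar>x $ j\<bar> = 1 / 2" for j
    proof (rule cis_eq_unit_interval)
      show "cis (2 * pi * y $ j) = cis (2 * pi * x $ j)" using y by (simp add: torus_map_def vec_eq_iff)
    qed (use x y in \<open>auto simp: mem_unit_cube\<close>)
    show ?thesis
    proof (cases "y = x")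
      case True then show ?thesis by (simp add: F_def y_def)
    next
      case False
      then obtain j where "y $ j \<noteq> x $ j" by (auto simp: vec_eq_iff)
      with c[of j] have "h y = 0" "h x = 0" using bd x y by auto
      then show ?thesis by (simp add: F_def y_def)
    qed
  qed
  have contF: "continuous_on S F"
    unfolding continuous_on_open
  proof (intro allI impI)
    fix V :: "real set"
    assume V: "openin (top_of_set (F ` S)) V"
    have "(unit_cube \<inter> torus_map -` (S \<inter> F -` V)) = unit_cube \<inter> h -` V"
    proof -
      have "torus_map x \<in> S \<inter> F -` V \<longleftrightarrow> h x \<in> V" if "x \<in> unit_cube" for x
        using that by (simp add: S_def F)
      then show ?thesis by blast
    qed
    moreover have "F ` S = h ` unit_cube" by (auto simp: S_def F image_iff)
    then have "openin (top_of_set unit_cube) (unit_cube \<inter> h -` V)"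
      using h V by (metis continuous_on_open)
    ultimately have "openin (top_of_set unit_cube) (unit_cube \<inter> torus_map -` (S \<inter> F -` V))" by simp
    \<comment> \<open>A continuous map on the compact cube is a quotient map onto its image, so
      openness can be tested on the cube.\<close>
    then show "openin (top_of_set S) (S \<inter> F -` V)"
      using Abstract_Topology_2.continuous_imp_quotient_map[OF continuous_on_torus_map S_def[symmetric] cube, of "S \<inter> F -` V"]
      by simp
  qed
  \<comment> \<open>The algebra of functions on the torus that pull back to trigonometric
    polynomials. The real and imaginary parts of the coordinates belong to it and separate
    points.\<close>
  define P where "P f \<longleftrightarrow> continuous_on S f \<and> (\<exists>p. trig_poly p \<and> (\<forall>x. complex_of_real (f (torus_map x)) = p x))"
    for f :: "complex ^ 'd \<Rightarrow> real"
  have ax: "axis j 1 \<in> (int_lattice :: (real^'d) set)" for j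
    by (auto simp: int_lattice_def axis_def)
  have chr_ax: "chr (axis j 1) x = cis (2 * pi * x $ j)" for j and x :: "real ^ 'd"
    by (simp add: chr_def inner_axis')
  have re: "P (\<lambda>z. Re (z $ j))" for j
    unfolding P_def
  proof (intro conjI exI allI)
    show "continuous_on S (\<lambda>z. Re (z $ j))" by (intro continuous_intros)
    show "trig_poly (\<lambda>x. (1 / 2) * chr (axis j 1) x + (1 / 2) * chr (- axis j 1) x)"
      by (intro trig_poly_add trig_poly_chr int_lattice_uminus ax)
    show "complex_of_real (Re (torus_map x $ j)) = (1 / 2) * chr (axis j 1) x + (1 / 2) * chr (- axis j 1) x" for x
      unfolding cnj_chr[symmetric] chr_ax by (simp add: torus_map_def complex_eq_iff)
  qed
  have im: "P (\<lambda>z. Im (z $ j))" for j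
    unfolding P_def
  proof (intro conjI exI allI)
    show "continuous_on S (\<lambda>z. Im (z $ j))" by (intro continuous_intros)
    show "trig_poly (\<lambda>x. (- \<i> / 2) * chr (axis j 1) x + (\<i> / 2) * chr (- axis j 1) x)"
      by (intro trig_poly_add trig_poly_chr int_lattice_uminus ax)
    show "complex_of_real (Im (torus_map x $ j)) = (- \<i> / 2) * chr (axis j 1) x + (\<i> / 2) * chr (- axis j 1) x" for x
      unfolding cnj_chr[symmetric] chr_ax by (simp add: torus_map_def complex_eq_iff)
  qed
  have "\<exists>f. P f \<and> (\<forall>z\<in>S. \<bar>F z - f z\<bar> < e)"
  proof (rule Stone_Weierstrass_HOL[OF S])
    show "P (\<lambda>z. c)" for c :: real
      unfolding P_def by (auto intro!: exI[of _ "\<lambda>x. complex_of_real c"] trig_poly_const continuous_intros)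
    show "continuous_on S f" if "P f" for f using that by (simp add: P_def)
    show "P (\<lambda>z. f z + g z)" if "P f \<and> P g" for f g
    proof -
      from that obtain p q where "trig_poly p" "\<forall>x. complex_of_real (f (torus_map x)) = p x"
        "trig_poly q" "\<forall>x. complex_of_real (g (torus_map x)) = q x" by (auto simp: P_def)
      then show ?thesis using that
        unfolding P_def by (auto intro!: exI[of _ "\<lambda>x. p x + q x"] trig_poly_add continuous_intros)
    qed
    show "P (\<lambda>z. f z * g z)" if "P f \<and> P g" for f g
    proof -
      from that obtain p q where "trig_poly p" "\<forall>x. complex_of_real (f (torus_map x)) = p x"
        "trig_poly q" "\<forall>x. complex_of_real (g (torus_map x)) = q x" by (auto simp: P_def)
      then show ?thesis using that
        unfolding P_def by (auto intro!: exI[of _ "\<lambda>x. p x * q x"] trig_poly_mult continuous_intros)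
    qed
    show "\<exists>f. P f \<and> f z \<noteq> f w" if "z \<in> S \<and> w \<in> S \<and> z \<noteq> w" for z w
    proof -
      from that obtain j where "z $ j \<noteq> w $ j" by (auto simp: vec_eq_iff)
      then have "Re (z $ j) \<noteq> Re (w $ j) \<or> Im (z $ j) \<noteq> Im (w $ j)" by (auto simp: complex_eq_iff)
      then show ?thesis using re[of j] im[of j] by blast
    qed
    show "continuous_on S F" by (rule contF)
    show "0 < e" by (rule e)
  qed
  then obtain f p where f: "\<forall>z\<in>S. \<bar>F z - f z\<bar> < e" and p: "trig_poly p" "\<And>x. complex_of_real (f (torus_map x)) = p x"
    by (auto simp: P_def)
  show ?thesis
  proof (rule that[OF p(1)])
    fix x :: "real ^ 'd" assume x: "x \<in> unit_cube"
    then have "\<bar>h x - f (torus_map x)\<bar> < e" using f F by (auto simp: S_def)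
    then show "norm (of_real (h x) - p x) < e"
      by (simp add: p(2)[symmetric] flip: of_real_diff)
  qed
qed

lemma AE_boundary_unit_cube:
  "AE x :: real ^ 'd::finite in lborel. \<forall>j. \<bar>x $ j\<bar> \<noteq> 1 / 2"
proof -
  have "AE x in lborel. (x :: real^'d) $ j \<noteq> a" for j a
  proof -
    have "axis j 1 \<in> (Basis :: (real^'d) set)" by (auto simp: Basis_vec_def)
    then have "negligible {x :: real^'d. x $ j = a}"
      using negligible_standard_hyperplane[of "axis j 1 :: real^'d" a] by (simp add: cart_eq_inner_axis)
    then have "{x :: real^'d. x $ j = a} \<in> null_sets lebesgue" by (simp add: negligible_iff_null_sets)
    then have "AE x in lebesgue. (x :: real^'d) $ j \<noteq> a" by (auto dest: AE_not_in)
    then show ?thesis by (simp add: AE_completion_iff)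
  qed
  then have "AE x in lborel. (x :: real^'d) $ j \<noteq> 1 / 2 \<and> x $ j \<noteq> - 1 / 2" for j
    by (intro AE_conjI)
  then have "AE x in lborel. \<forall>j. (x :: real^'d) $ j \<noteq> 1 / 2 \<and> x $ j \<noteq> - 1 / 2"
    unfolding AE_all_countable by blast
  then show ?thesis
  proof eventually_elim
    case (elim x)
    show ?case
    proof
      fix j
      from elim have "x $ j \<noteq> 1 / 2 \<and> x $ j \<noteq> - 1 / 2" by blast
      then show "\<bar>x $ j\<bar> \<noteq> 1 / 2" by linarith
    qed
  qed
qed

text \<open>A measurable function is almost everywhere a limit of continuous ones. Truncation at B
  keeps them bounded, and a cutoff that tends to 1 in the open cube makes them vanish on its
  boundary, as \<open>trig_approx_continuous_real\<close> requires.\<close>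

lemma trig_approx_real:
  fixes h :: "real ^ 'd::finite \<Rightarrow> real"
  assumes h: "h \<in> borel_measurable borel" "\<And>x. \<bar>h x\<bar> \<le> B"
  obtains p where "\<And>n. trig_poly (p n)" "\<And>n x. x \<in> unit_cube \<Longrightarrow> norm (p n x) \<le> B + 1"
    "AE x in cube_measure. (\<lambda>n. p n x) \<longlonglongrightarrow> of_real (h x)"
proof -
  have B: "0 \<le> B" using h(2)[of 0] by linarith
  have "h measurable_on UNIV"
    using h(1) by (intro lebesgue_measurable_imp_measurable_on) (auto simp: measurable_completion)
  then obtain N g where N: "negligible N" and g: "\<And>n. continuous_on UNIV (g n)"
    and lim: "\<And>x. x \<notin> N \<Longrightarrow> (\<lambda>n::nat. g n x) \<longlonglongrightarrow> h x"
    unfolding measurable_on_def by auto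
  define u where "u n x = max (- B) (min B (g n x)) * max 0 (min 1 (real n * (1 / 2 - infnorm x)))" for n x
  have cu: "continuous_on S (u n)" for S n
    unfolding u_def using continuous_on_subset[OF g subset_UNIV] by (intro continuous_intros)
  have ub: "\<bar>u n x\<bar> \<le> B" for n x
  proof -
    have "\<bar>max (- B) (min B (g n x))\<bar> * \<bar>max 0 (min 1 (real n * (1 / 2 - infnorm x)))\<bar> \<le> B * 1"
      using B by (intro mult_mono) auto
    then show ?thesis by (simp add: u_def abs_mult)
  qed
  have bd: "u n x = 0" if x: "x \<in> unit_cube" "\<bar>x $ j\<bar> = 1 / 2" for n x j
  proof -
    have "1 / 2 \<le> infnorm x" using component_le_infnorm_cart[of x j] x by simp
    then have "real n * (1 / 2 - infnorm x) \<le> 0" by (simp add: mult_nonneg_nonpos)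
    then show ?thesis by (simp add: u_def)
  qed
  have "\<exists>p. trig_poly p \<and> (\<forall>x\<in>unit_cube. norm (of_real (u n x) - p x) < 1 / Suc n)" for n
    by (rule trig_approx_continuous_real[OF cu, of "1 / Suc n"]) (auto intro: bd)
  then obtain p where p: "\<And>n. trig_poly (p n)"
    and pu: "\<And>n x. x \<in> unit_cube \<Longrightarrow> norm (of_real (u n x) - p n x) < 1 / Suc n" by metis
  have pb: "norm (p n x) \<le> B + 1" if "x \<in> unit_cube" for n x
  proof -
    have "norm (p n x) \<le> norm (complex_of_real (u n x)) + norm (of_real (u n x) - p n x)"
      using norm_triangle_ineq4[of "complex_of_real (u n x)" "of_real (u n x) - p n x"] by simp
    also have "\<dots> \<le> B + 1 / Suc n" using ub[of n x] pu[OF that, of n] by simp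
    also have "\<dots> \<le> B + 1" by simp
    finally show ?thesis .
  qed
  have "N \<in> null_sets lebesgue" using N by (simp add: negligible_iff_null_sets)
  then have "AE x in lborel. x \<notin> N" by (auto simp: AE_completion_iff dest: AE_not_in)
  then have "AE x in lborel. x \<in> unit_cube \<longrightarrow> (\<lambda>n. p n x) \<longlonglongrightarrow> of_real (h x)"
    using AE_boundary_unit_cube
  proof eventually_elim
    case (elim x)
    show ?case
    proof
      assume x: "x \<in> unit_cube"
      have "infnorm x < 1 / 2"
      proof -
        have "\<bar>x $ j\<bar> < 1 / 2" for j
        proof -
          have "- 1 / 2 \<le> x $ j \<and> x $ j \<le> 1 / 2" using x unfolding mem_unit_cube by blast
          moreover have "\<bar>x $ j\<bar> \<noteq> 1 / 2" using elim(2) by blast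
          ultimately show ?thesis by linarith
        qed
        then have "\<forall>b\<in>Basis. \<bar>x \<bullet> b\<bar> < 1 / 2" by (auto simp: Basis_vec_def inner_axis)
        then show ?thesis unfolding infnorm_Max by (subst Max_less_iff) auto
      qed
      then have "\<forall>\<^sub>F n in sequentially. 1 \<le> real n * (1 / 2 - infnorm x)"
        by real_asymp
      then have "\<forall>\<^sub>F n in sequentially. max (- B) (min B (g n x)) = u n x"
        by eventually_elim (simp add: u_def)
      moreover have "(\<lambda>n. max (- B) (min B (g n x))) \<longlonglongrightarrow> max (- B) (min B (h x))"
        using lim elim(1) by (intro tendsto_intros) auto
      ultimately have "(\<lambda>n. u n x) \<longlonglongrightarrow> max (- B) (min B (h x))"
        by (blast intro: Lim_transform_eventually)
      moreover have "max (- B) (min B (h x)) = h x" using h(2)[of x] by linarith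
      ultimately have "(\<lambda>n. u n x) \<longlonglongrightarrow> h x" by simp
      then have "(\<lambda>n. complex_of_real (u n x)) \<longlonglongrightarrow> of_real (h x)" by (rule tendsto_of_real)
      moreover have "(\<lambda>n. complex_of_real (u n x) - p n x) \<longlonglongrightarrow> 0"
        using pu[OF x] by (intro Lim_null_comparison[OF _ LIMSEQ_inverse_real_of_nat])
          (auto simp: inverse_eq_divide intro!: always_eventually less_imp_le)
      ultimately have "(\<lambda>n. complex_of_real (u n x) - (complex_of_real (u n x) - p n x)) \<longlonglongrightarrow> of_real (h x) - 0"
        by (rule tendsto_diff)
      then show "(\<lambda>n. p n x) \<longlonglongrightarrow> of_real (h x)" by simp
    qed
  qed
  then show ?thesis by (intro that[of p] p pb) (auto simp: AE_cube_measure)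
qed

lemma trig_approx:
  fixes h :: "real ^ 'd::finite \<Rightarrow> complex"
  assumes h: "h \<in> borel_measurable borel" "\<And>x. norm (h x) \<le> B"
  obtains p where "\<And>n. trig_poly (p n)" "\<And>n x. x \<in> unit_cube \<Longrightarrow> norm (p n x) \<le> 2 * (B + 1)"
    "AE x in cube_measure. (\<lambda>n. p n x) \<longlonglongrightarrow> h x"
proof -
  obtain p where p: "\<And>n. trig_poly (p n)" "\<And>n x. x \<in> unit_cube \<Longrightarrow> norm (p n x) \<le> B + 1"
    "AE x in cube_measure. (\<lambda>n. p n x) \<longlonglongrightarrow> of_real (Re (h x))"
    using h order_trans[OF abs_Re_le_cmod h(2)] trig_approx_real[of "\<lambda>x. Re (h x)" B] by auto
  obtain q where q: "\<And>n. trig_poly (q n)" "\<And>n x. x \<in> unit_cube \<Longrightarrow> norm (q n x) \<le> B + 1"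
    "AE x in cube_measure. (\<lambda>n. q n x) \<longlonglongrightarrow> of_real (Im (h x))"
    using h order_trans[OF abs_Im_le_cmod h(2)] trig_approx_real[of "\<lambda>x. Im (h x)" B] by auto
  show ?thesis
  proof (rule that[of "\<lambda>n x. p n x + \<i> * q n x"])
    show "trig_poly (\<lambda>x. p n x + \<i> * q n x)" for n
      by (intro trig_poly_add trig_poly_mult trig_poly_const p q)
    show "norm (p n x + \<i> * q n x) \<le> 2 * (B + 1)" if "x \<in> unit_cube" for n x
      using norm_triangle_ineq[of "p n x" "\<i> * q n x"] p(2)[OF that, of n] q(2)[OF that, of n]
      by (simp add: norm_mult)
    show "AE x in cube_measure. (\<lambda>n. p n x + \<i> * q n x) \<longlonglongrightarrow> h x"
      using p(3) q(3)
    proof eventually_elim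
      case (elim x)
      then have "(\<lambda>n. p n x + \<i> * q n x) \<longlonglongrightarrow> of_real (Re (h x)) + \<i> * of_real (Im (h x))"
        by (intro tendsto_intros)
      then show ?case by (simp flip: complex_eq)
    qed
  qed
qed

section \<open>Uniqueness and Parseval's identity on the cube\<close>

lemma AE_cube_measure_mem: "AE x in cube_measure. x \<in> unit_cube"
  by (simp add: AE_cube_measure)

text \<open>Tested against bounded trigonometric polynomials that converge almost everywhere to the
  conjugate sign of \<open>D\<close>, the vanishing integrals tend to the integral of |D|.\<close>

lemma cube_L1_unique:
  fixes D :: "real ^ 'd::finite \<Rightarrow> complex"
  assumes D: "integrable cube_measure D"
    and z: "\<And>l. l \<in> int_lattice \<Longrightarrow> (LINT x|cube_measure. D x * chr l x) = 0"
  shows "AE x in cube_measure. D x = 0"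
proof -
  have [measurable]: "D \<in> borel_measurable borel" using D by (auto dest: borel_measurable_integrable)
  have trig: "(LINT x|cube_measure. D x * p x) = 0" if "trig_poly p" for p
  proof -
    obtain T c where p: "finite T" "T \<subseteq> int_lattice" "p = (\<lambda>x. \<Sum>l\<in>T. c l * chr l x)"
      using \<open>trig_poly p\<close> by (auto simp: trig_poly_def)
    have i: "integrable cube_measure (\<lambda>x. c l * (D x * chr l x))" for l
      by (intro integrable_mult_right Bochner_Integration.integrable_bound[OF D]) (auto simp: norm_mult)
    have "(LINT x|cube_measure. D x * p x) = (LINT x|cube_measure. (\<Sum>l\<in>T. c l * (D x * chr l x)))"
      by (simp add: p(3) sum_distrib_left mult_ac)
    also have "\<dots> = (\<Sum>l\<in>T. LINT x|cube_measure. c l * (D x * chr l x))"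
      by (rule Bochner_Integration.integral_sum) (rule i)
    also have "\<dots> = 0" using z p(2) by (intro sum.neutral) auto
    finally show ?thesis .
  qed
  define h where "h x = cnj (sgn (D x))" for x
  have [measurable]: "h \<in> borel_measurable borel" unfolding h_def by measurable
  have hb: "norm (h x) \<le> 1" for x by (simp add: h_def norm_sgn)
  obtain p where p: "\<And>n. trig_poly (p n)" "\<And>n x. x \<in> unit_cube \<Longrightarrow> norm (p n x) \<le> 2 * (1 + 1)"
    "AE x in cube_measure. (\<lambda>n. p n x) \<longlonglongrightarrow> h x"
    using trig_approx[of h 1] hb by auto
  note [measurable] = trig_poly_borel[OF p(1)]
  have "(\<lambda>n. LINT x|cube_measure. D x * p n x) \<longlonglongrightarrow> (LINT x|cube_measure. D x * h x)"
  proof (rule integral_dominated_convergence[where w = "\<lambda>x. 4 * norm (D x)"])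
    show "AE x in cube_measure. (\<lambda>n. D x * p n x) \<longlonglongrightarrow> D x * h x"
      using p(3) by eventually_elim (intro tendsto_intros)
    show "AE x in cube_measure. norm (D x * p n x) \<le> 4 * norm (D x)" for n
      using AE_cube_measure_mem
    proof eventually_elim
      case (elim x)
      then show ?case using p(2)[of x n] mult_left_mono[of "norm (p n x)" 4 "norm (D x)"]
        by (simp add: norm_mult mult.commute)
    qed
  qed (use D in auto)
  then have "(LINT x|cube_measure. D x * h x) = 0" by (simp add: trig p(1) LIMSEQ_const_iff)
  moreover have "D x * h x = of_real (norm (D x))" for x
  proof (cases "D x = 0")
    case False
    then show ?thesis
      by (simp add: h_def sgn_div_norm complex_cnj_scaleR scaleR_conv_of_real divide_inverse
          mult.left_commute[of "D x"] complex_norm_square[symmetric] power2_eq_square del: of_real_power)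
  qed (simp add: h_def)
  ultimately have "(LINT x|cube_measure. norm (D x)) = 0"
    using integral_complex_of_real[of cube_measure "\<lambda>x. norm (D x)"] by simp
  then show ?thesis
    using integral_nonneg_eq_0_iff_AE[of cube_measure "\<lambda>x. norm (D x)"] D by auto
qed


lemma cube_integrable_bounded:
  fixes f :: "real ^ 'd::finite \<Rightarrow> 'b::{banach, second_countable_topology}"
  assumes "f \<in> borel_measurable borel" "\<And>x. x \<in> unit_cube \<Longrightarrow> norm (f x) \<le> B"
  shows "integrable cube_measure f"
  using assms AE_cube_measure_mem
  by (intro cube.integrable_const_bound[of _ B]) (auto elim: eventually_mono)

text \<open>Pythagoras' theorem, by completing the square in each coefficient. The number
  \<open>a l\<close> belongs to the character of -l, since it is the integral against
  \<open>chr l\<close>.\<close>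

lemma integral_norm_diff_trig_poly:
  fixes W :: "real ^ 'd::finite \<Rightarrow> complex" and B :: real
  assumes [measurable]: "W \<in> borel_measurable borel" and B: "\<And>x. norm (W x) \<le> B"
    and T: "finite T" "T \<subseteq> int_lattice"
  defines "a \<equiv> \<lambda>l. LINT x|cube_measure. W x * chr l x"
  shows "(LINT x|cube_measure. (norm (W x - (\<Sum>l\<in>T. c l * chr (- l) x)))\<^sup>2) =
    (LINT x|cube_measure. (norm (W x))\<^sup>2) - (\<Sum>l\<in>T. (norm (a l))\<^sup>2) + (\<Sum>l\<in>T. (norm (c l - a l))\<^sup>2)"
proof -
  have B0: "0 \<le> B" using norm_ge_zero B order_trans by blast
  define P where "P x = (\<Sum>l\<in>T. c l * chr (- l) x)" for x
  have [measurable]: "P \<in> borel_measurable borel" unfolding P_def by measurable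
  have iW: "integrable cube_measure (\<lambda>x. W x * chr l x)" for l
    by (rule cube_integrable_bounded[of _ B]) (auto simp: norm_mult B)
  have iW': "integrable cube_measure (\<lambda>x. cnj (W x) * chr l x)" for l
    by (rule cube_integrable_bounded[of _ B]) (auto simp: norm_mult B)
  have ic: "integrable cube_measure (\<lambda>x. chr l x)" for l
    by (rule cube_integrable_bounded[of _ 1]) auto
  have iWW: "integrable cube_measure (\<lambda>x. W x * cnj (W x))"
  proof (rule cube_integrable_bounded[of _ "B * B"])
    show "norm (W x * cnj (W x)) \<le> B * B" for x
      using B[of x] B0 by (simp add: norm_mult mult_mono)
  qed measurable
  have cnjP: "cnj (P x) = (\<Sum>l\<in>T. cnj (c l) * chr l x)" for x by (simp add: P_def)
  have WP: "W x * cnj (P x) = (\<Sum>l\<in>T. cnj (c l) * (W x * chr l x))" for x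
    by (simp add: cnjP sum_distrib_left mult_ac)
  have PW: "P x * cnj (W x) = (\<Sum>l\<in>T. c l * (cnj (W x) * chr (- l) x))" for x
    by (simp add: P_def sum_distrib_right mult.assoc) (simp add: mult.commute)
  have PP: "P x * cnj (P x) = (\<Sum>l\<in>T. \<Sum>k\<in>T. (c l * cnj (c k)) * chr (k - l) x)" for x
    unfolding cnjP unfolding P_def sum_product by (simp add: chr_add_left[of _ "- _", simplified] mult_ac)
  have conj_a: "(LINT x|cube_measure. cnj (W x) * chr (- l) x) = cnj (a l)" for l
    unfolding a_def by (subst Bochner_Integration.integral_cnj[symmetric]) simp
  have "complex_of_real (LINT x|cube_measure. (norm (W x - P x))\<^sup>2) =
      (LINT x|cube_measure. W x * cnj (W x) - W x * cnj (P x) - P x * cnj (W x) + P x * cnj (P x))"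
    unfolding integral_complex_of_real[symmetric] complex_norm_square by (simp add: algebra_simps)
  also have "\<dots> = (LINT x|cube_measure. W x * cnj (W x)) - (\<Sum>l\<in>T. cnj (c l) * a l) - (\<Sum>l\<in>T. c l * cnj (a l))
      + (\<Sum>l\<in>T. c l * cnj (c l))"
  proof -
    have i1: "integrable cube_measure (\<lambda>x. W x * cnj (P x))"
      unfolding WP by (intro Bochner_Integration.integrable_sum integrable_mult_right iW)
    have i2: "integrable cube_measure (\<lambda>x. P x * cnj (W x))"
      unfolding PW by (intro Bochner_Integration.integrable_sum integrable_mult_right iW')
    have i3: "integrable cube_measure (\<lambda>x. P x * cnj (P x))"
      unfolding PP by (intro Bochner_Integration.integrable_sum integrable_mult_right ic)
    have e1: "(LINT x|cube_measure. W x * cnj (P x)) = (\<Sum>l\<in>T. cnj (c l) * a l)"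
      unfolding WP a_def by (subst Bochner_Integration.integral_sum) (auto intro!: integrable_mult_right iW)
    have e2: "(LINT x|cube_measure. P x * cnj (W x)) = (\<Sum>l\<in>T. c l * cnj (a l))"
      unfolding PW conj_a[symmetric] by (subst Bochner_Integration.integral_sum) (auto intro!: integrable_mult_right iW')
    have "(LINT x|cube_measure. P x * cnj (P x)) = (\<Sum>l\<in>T. \<Sum>k\<in>T. (c l * cnj (c k)) * (LINT x|cube_measure. chr (k - l) x))"
      unfolding PP
      by (subst Bochner_Integration.integral_sum,
          (intro Bochner_Integration.integrable_sum integrable_mult_right ic)[1],
          subst Bochner_Integration.integral_sum,
          (intro Bochner_Integration.integrable_sum integrable_mult_right ic)[1]) simp
    also have "\<dots> = (\<Sum>l\<in>T. \<Sum>k\<in>T. if k = l then c l * cnj (c k) else 0)"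
      using T(2) by (intro sum.cong refl) (auto simp: integral_chr int_lattice_diff subset_iff)
    also have "\<dots> = (\<Sum>l\<in>T. c l * cnj (c l))" using T(1) by simp
    finally have e3: "(LINT x|cube_measure. P x * cnj (P x)) = (\<Sum>l\<in>T. c l * cnj (c l))" .
    show ?thesis
      using i1 i2 i3 iWW by (simp add: e1 e2 e3)
  qed
  also have "\<dots> = (LINT x|cube_measure. W x * cnj (W x)) - (\<Sum>l\<in>T. a l * cnj (a l)) + (\<Sum>l\<in>T. (c l - a l) * cnj (c l - a l))"
    by (simp add: algebra_simps sum.distrib sum_subtractf)
  also have "\<dots> = complex_of_real ((LINT x|cube_measure. (norm (W x))\<^sup>2) - (\<Sum>l\<in>T. (norm (a l))\<^sup>2) + (\<Sum>l\<in>T. (norm (c l - a l))\<^sup>2))"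
    unfolding of_real_add of_real_diff of_real_sum integral_complex_of_real[symmetric] complex_norm_square ..
  finally show ?thesis unfolding P_def of_real_eq_iff .
qed

text \<open>Bessel's inequality is the case c = a of \<open>integral_norm_diff_trig_poly\<close>.
  The partial sums reach the limit because the polynomials of \<open>trig_approx\<close> converge in
  mean square, dominated by B + 2(B + 1) = 3 B + 2.\<close>

lemma cube_parseval:
  fixes W :: "real ^ 'd::finite \<Rightarrow> complex"
  assumes [measurable]: "W \<in> borel_measurable borel" and B: "\<And>x. norm (W x) \<le> B"
  shows "(\<lambda>n. (norm (LINT x|cube_measure. W x * chr (lat n) x))\<^sup>2) sums (LINT x|cube_measure. (norm (W x))\<^sup>2)"
proof -
  define a where "a l = (LINT x|cube_measure. W x * chr l x)" for l
  define A where "A = (LINT x|cube_measure. (norm (W x))\<^sup>2)"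
  have B0: "0 \<le> B" using norm_ge_zero B order_trans by blast
  note diff = integral_norm_diff_trig_poly[OF assms, folded a_def A_def]
  have le: "(\<Sum>l\<in>T. (norm (a l))\<^sup>2) \<le> A" if "finite T" "T \<subseteq> int_lattice" for T
  proof -
    have "0 \<le> (LINT x|cube_measure. (norm (W x - (\<Sum>l\<in>T. a l * chr (- l) x)))\<^sup>2)" by simp
    then show ?thesis unfolding diff[OF that] by simp
  qed
  obtain p where p: "\<And>n. trig_poly (p n)" "\<And>n x. x \<in> unit_cube \<Longrightarrow> norm (p n x) \<le> 2 * (B + 1)"
    "AE x in cube_measure. (\<lambda>n. p n x) \<longlonglongrightarrow> W x"
    using trig_approx[OF assms] by metis
  note [measurable] = trig_poly_borel[OF p(1)]
  have "(\<lambda>n. LINT x|cube_measure. (norm (W x - p n x))\<^sup>2) \<longlonglongrightarrow> (LINT x|(cube_measure :: (real^'d) measure). 0)"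
  proof (rule integral_dominated_convergence[where w = "\<lambda>x. (3 * B + 2)\<^sup>2"])
    show "AE x in cube_measure. (\<lambda>n. (norm (W x - p n x))\<^sup>2) \<longlonglongrightarrow> 0"
      using p(3)
    proof eventually_elim
      case (elim x)
      have "(\<lambda>n. (norm (W x - p n x))\<^sup>2) \<longlonglongrightarrow> (norm (W x - W x))\<^sup>2" by (intro tendsto_intros elim)
      then show ?case by simp
    qed
    show "AE x in cube_measure. norm ((norm (W x - p n x))\<^sup>2) \<le> (3 * B + 2)\<^sup>2" for n
      using AE_cube_measure_mem
    proof eventually_elim
      case (elim x)
      have "norm (W x - p n x) \<le> 3 * B + 2"
        using norm_triangle_ineq4[of "W x" "p n x"] B[of x] p(2)[OF elim, of n]
        unfolding distrib_left by linarith
      then show ?case by (simp add: power_mono)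
    qed
  qed auto
  then have lim: "(\<lambda>n. LINT x|cube_measure. (norm (W x - p n x))\<^sup>2) \<longlonglongrightarrow> 0" by simp
  have "(\<lambda>N. \<Sum>n<N. (norm (a (lat n)))\<^sup>2) \<longlonglongrightarrow> A"
  proof (rule increasing_LIMSEQ)
    show "(\<Sum>n<N. (norm (a (lat n)))\<^sup>2) \<le> (\<Sum>n<Suc N. (norm (a (lat n)))\<^sup>2)" for N by simp
    show "(\<Sum>n<N. (norm (a (lat n)))\<^sup>2) \<le> A" for N
    proof -
      have "(\<Sum>l\<in>lat ` {..<N}. (norm (a l))\<^sup>2) \<le> A" by (rule le) auto
      then show ?thesis by (subst (asm) sum.reindex) (auto simp: inj_on_def)
    qed
    fix e :: real assume "0 < e"
    then obtain n where n: "(LINT x|cube_measure. (norm (W x - p n x))\<^sup>2) < e"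
      using eventually_happens'[OF _ order_tendstoD(2)[OF lim]] by auto
    obtain U f where U: "finite U" "U \<subseteq> int_lattice" "p n = (\<lambda>x. \<Sum>l\<in>U. f l * chr l x)"
      using p(1)[of n] by (auto simp: trig_poly_def)
    \<comment> \<open>The sign change matches the convention of
      \<open>integral_norm_diff_trig_poly\<close>.\<close>
    have pn: "p n x = (\<Sum>l\<in>uminus ` U. f (- l) * chr (- l) x)" for x
      unfolding U(3) by (subst sum.reindex) (auto simp: inj_on_def)
    have T: "finite (uminus ` U)" "uminus ` U \<subseteq> int_lattice"
      using U by (auto intro: int_lattice_uminus)
    have "0 \<le> (\<Sum>l\<in>uminus ` U. (norm (f (- l) - a l))\<^sup>2)" by (intro sum_nonneg) simp
    then have "A \<le> (\<Sum>l\<in>uminus ` U. (norm (a l))\<^sup>2) + e"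
      using n diff[OF T, of "\<lambda>l. f (- l)"] unfolding pn by linarith
    moreover obtain N where "uminus ` U \<subseteq> lat ` {..<N}"
    proof -
      have "uminus ` U \<subseteq> range lat" using T(2) lat_surj by blast
      then obtain V where V: "finite V" "uminus ` U = lat ` V"
        using finite_subset_image[OF T(1)] by metis
      then obtain N where "V \<subseteq> {..<N}" by (auto simp: finite_nat_iff_bounded)
      then have "uminus ` U \<subseteq> lat ` {..<N}" unfolding V(2) by (rule image_mono)
      then show ?thesis by (rule that)
    qed
    then have "(\<Sum>l\<in>uminus ` U. (norm (a l))\<^sup>2) \<le> (\<Sum>l\<in>lat ` {..<N}. (norm (a l))\<^sup>2)"
      by (intro sum_mono2) auto
    moreover have "(\<Sum>l\<in>lat ` {..<N}. (norm (a l))\<^sup>2) = (\<Sum>n<N. (norm (a (lat n)))\<^sup>2)"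
      by (subst sum.reindex) (auto simp: inj_on_def)
    ultimately show "\<exists>N. A \<le> (\<Sum>n<N. (norm (a (lat n)))\<^sup>2) + e" by (intro exI[of _ N]) linarith
  qed
  then show ?thesis unfolding sums_def a_def A_def .
qed

section \<open>Periodization over the lattice\<close>

lemma AE_cube_translates:
  "AE x :: real ^ 'd::finite in lborel. \<exists>n0. \<forall>n. x - lat n \<in> unit_cube \<longleftrightarrow> n = n0"
proof -
  have "AE x in lborel. \<forall>j. \<bar>((x :: real^'d) - lat n) $ j\<bar> \<noteq> 1 / 2" for n
  proof -
    have "AE x in distr lborel borel ((+) (- lat n)). \<forall>j. \<bar>(x :: real^'d) $ j\<bar> \<noteq> 1 / 2"
      unfolding lborel_distr_plus by (rule AE_boundary_unit_cube)
    then show ?thesis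
      by (subst (asm) AE_distr_iff) (auto simp: algebra_simps)
  qed
  then have "AE x in lborel. \<forall>n. \<forall>j. \<bar>((x :: real^'d) - lat n) $ j\<bar> \<noteq> 1 / 2"
    by (subst AE_all_countable) (rule allI)
  then show ?thesis
  proof eventually_elim
    case (elim x)
    \<comment> \<open>The floor of x + 1/2 selects the translate. Closed cubes overlap only in their
      boundaries, which the null set excludes.\<close>
    define l :: "real ^ 'd" where "l = (\<chi> j. of_int \<lfloor>x $ j + 1 / 2\<rfloor>)"
    have "l \<in> int_lattice" by (simp add: l_def int_lattice_def)
    then obtain n0 where n0: "l = lat n0" using lat_surj by blast
    have "x - lat n \<in> unit_cube \<longleftrightarrow> n = n0" for n
    proof
      assume "n = n0"
      then have "(x - lat n) $ j = x $ j - of_int \<lfloor>x $ j + 1 / 2\<rfloor>" for j by (simp add: n0[symmetric] l_def)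
      moreover have "- 1 / 2 \<le> t - of_int \<lfloor>t + 1 / 2\<rfloor> \<and> t - of_int \<lfloor>t + 1 / 2\<rfloor> \<le> 1 / 2" for t :: real
        by linarith
      ultimately show "x - lat n \<in> unit_cube" unfolding mem_unit_cube by metis
    next
      assume c: "x - lat n \<in> unit_cube"
      have "lat n $ j = l $ j" for j
      proof -
        have "lat n $ j \<in> \<int>" using lat_in[of n] unfolding int_lattice_def by blast
        then obtain z :: int where z: "lat n $ j = of_int z" by (auto elim: Ints_cases)
        have "- 1 / 2 \<le> (x - lat n) $ j \<and> (x - lat n) $ j \<le> 1 / 2" using c unfolding mem_unit_cube by blast
        moreover have "\<bar>(x - lat n) $ j\<bar> \<noteq> 1 / 2" using elim by blast
        ultimately have "of_int z \<le> x $ j + 1 / 2 \<and> x $ j + 1 / 2 < of_int z + 1" using z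
          unfolding vector_minus_component by linarith
        then have "\<lfloor>x $ j + 1 / 2\<rfloor> = z" by (intro floor_unique) auto
        then show ?thesis by (simp add: l_def z)
      qed
      then have "lat n = (lat n0 :: real ^ 'd)" unfolding n0[symmetric] vec_eq_iff by blast
      then show "n = n0" by simp
    qed
    then show ?case by blast
  qed
qed

lemma lborel_nn_integral_translate:
  fixes c :: "real ^ 'd::finite"
  assumes "f \<in> borel_measurable borel"
  shows "(\<integral>\<^sup>+x. f (x + c) \<partial>lborel) = (\<integral>\<^sup>+x. f x \<partial>lborel)"
  using nn_integral_distr[of "(+) c" lborel borel f] assms by (simp add: lborel_distr_plus add.commute)

lemma lborel_integrable_translate:
  fixes c :: "real ^ 'd::finite" and g :: "real ^ 'd \<Rightarrow> 'b::{banach, second_countable_topology}"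
  assumes "g \<in> borel_measurable borel"
  shows "integrable lborel (\<lambda>x. g (x + c)) \<longleftrightarrow> integrable lborel g"
  using integrable_distr_eq[of "(+) c" lborel borel g] assms by (simp add: lborel_distr_plus add.commute)

lemma lborel_integral_translate:
  fixes c :: "real ^ 'd::finite" and g :: "real ^ 'd \<Rightarrow> 'b::{banach, second_countable_topology}"
  assumes "g \<in> borel_measurable borel"
  shows "(LINT x|lborel. g (x + c)) = (LINT x|lborel. g x)"
  using integral_distr[of "(+) c" lborel borel g] assms by (simp add: lborel_distr_plus add.commute)

lemma lborel_integral_cube_translate:
  fixes c :: "real ^ 'd::finite" and g :: "real ^ 'd \<Rightarrow> 'b::{banach, second_countable_topology}"
  assumes [measurable]: "g \<in> borel_measurable borel"
  shows "(LINT x|lborel. indicator unit_cube (x - c) *\<^sub>R g x) = (LINT x|lborel. indicator unit_cube x *\<^sub>R g (x + c))"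
  using lborel_integral_translate[of "\<lambda>x. indicator unit_cube (x - c) *\<^sub>R g x" c] by simp

text \<open>The translates of the cube tile the space up to a null set.\<close>

lemma nn_integral_periodize:
  fixes f :: "real ^ 'd::finite \<Rightarrow> ennreal"
  assumes [measurable]: "f \<in> borel_measurable borel"
  shows "(\<integral>\<^sup>+x. f x \<partial>lborel) = (\<integral>\<^sup>+x. (\<Sum>n. f (x + lat n)) \<partial>cube_measure)"
proof -
  have "(\<integral>\<^sup>+x. f x \<partial>lborel) = (\<integral>\<^sup>+x. (\<Sum>n. indicator unit_cube (x - lat n) * f x) \<partial>lborel)"
  proof (rule nn_integral_cong_AE)
    show "AE x in lborel. f x = (\<Sum>n. indicator unit_cube (x - lat n) * f x)"
      using AE_cube_translates
    proof eventually_elim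
      case (elim x)
      then obtain n0 where n0: "\<And>n. x - lat n \<in> unit_cube \<longleftrightarrow> n = n0" by blast
      have "(\<lambda>n. indicator unit_cube (x - lat n) * f x) = (\<lambda>n. if n = n0 then f x else 0)"
        by (auto simp: n0 indicator_def)
      then show ?case using sums_single[of n0 "\<lambda>_. f x"] by (simp add: sums_iff)
    qed
  qed
  also have "\<dots> = (\<Sum>n. \<integral>\<^sup>+x. indicator unit_cube (x - lat n) * f x \<partial>lborel)"
    by (rule nn_integral_suminf) measurable
  also have "\<dots> = (\<Sum>n. \<integral>\<^sup>+x. indicator unit_cube x * f (x + lat n) \<partial>lborel)"
  proof (intro arg_cong[where f = suminf] ext)
    fix n
    show "(\<integral>\<^sup>+x. indicator unit_cube (x - lat n) * f x \<partial>lborel) = (\<integral>\<^sup>+x. indicator unit_cube x * f (x + lat n) \<partial>lborel)"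
      using lborel_nn_integral_translate[of "\<lambda>x. indicator unit_cube (x - lat n) * f x" "lat n"] by simp
  qed
  also have "\<dots> = (\<Sum>n. \<integral>\<^sup>+x. f (x + lat n) \<partial>cube_measure)"
    by (simp add: nn_integral_cube_measure)
  also have "\<dots> = (\<integral>\<^sup>+x. (\<Sum>n. f (x + lat n)) \<partial>cube_measure)"
    by (rule nn_integral_suminf[symmetric]) measurable
  finally show ?thesis .
qed

text \<open>Absolute convergence of the periodized series comes from the nonnegative case, and both
  integrals are the sum of the integrals over the translates of the cube.\<close>

lemma integral_periodize:
  fixes h :: "real ^ 'd::finite \<Rightarrow> complex"
  assumes h: "integrable lborel h"
  shows "AE x in cube_measure. summable (\<lambda>n. norm (h (x + lat n)))"
    and "integrable cube_measure (\<lambda>x. \<Sum>n. h (x + lat n))"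
    and "(LINT x|cube_measure. (\<Sum>n. h (x + lat n))) = (LINT x|lborel. h x)"
proof -
  have [measurable]: "h \<in> borel_measurable borel" using h by (auto dest: borel_measurable_integrable)
  have fin: "(\<integral>\<^sup>+x. ennreal (norm (h x)) \<partial>lborel) \<noteq> \<infinity>"
    using h by (auto simp: integrable_iff_bounded)
  have per: "(\<integral>\<^sup>+x. (\<Sum>n. ennreal (norm (h (x + lat n)))) \<partial>cube_measure) \<noteq> \<infinity>"
    using fin by (subst nn_integral_periodize[symmetric, of "\<lambda>x. ennreal (norm (h x))"]) auto
  have "AE x in cube_measure. (\<Sum>n. ennreal (norm (h (x + lat n)))) \<noteq> \<infinity>"
    by (rule nn_integral_noteq_infinite[OF _ per]) measurable
  then show s: "AE x in cube_measure. summable (\<lambda>n. norm (h (x + lat n)))"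
    by eventually_elim (intro summable_suminf_not_top, auto)
  have i: "integrable cube_measure (\<lambda>x. h (x + lat n))" for n
  proof -
    have "integrable lborel (\<lambda>x. h (x + lat n))" using h by (subst lborel_integrable_translate) auto
    then have "integrable lborel (\<lambda>x. indicator unit_cube x *\<^sub>R h (x + lat n))"
      by (rule Bochner_Integration.integrable_bound) (auto simp: indicator_def)
    then show ?thesis by (subst integrable_cube_measure) auto
  qed
  have sm: "summable (\<lambda>n. LINT x|cube_measure. norm (h (x + lat n)))"
  proof (rule summable_suminf_not_top)
    have "(\<Sum>n. ennreal (LINT x|cube_measure. norm (h (x + lat n)))) =
        (\<Sum>n. \<integral>\<^sup>+x. ennreal (norm (h (x + lat n))) \<partial>cube_measure)"
      by (intro arg_cong[where f = suminf] ext nn_integral_eq_integral[symmetric] integrable_norm i) auto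
    also have "\<dots> = (\<integral>\<^sup>+x. (\<Sum>n. ennreal (norm (h (x + lat n)))) \<partial>cube_measure)"
      by (rule nn_integral_suminf[symmetric]) measurable
    finally show "(\<Sum>n. ennreal (LINT x|cube_measure. norm (h (x + lat n)))) \<noteq> top" using per by simp
  qed simp
  show "integrable cube_measure (\<lambda>x. \<Sum>n. h (x + lat n))" by (rule integrable_suminf[OF i s sm])
  let ?k = "\<lambda>n x. indicator unit_cube (x - lat n) *\<^sub>R h x"
  have ki: "integrable lborel (?k n)" for n
    by (rule Bochner_Integration.integrable_bound[OF h]) (auto simp: indicator_def)
  have cm: "(LINT x|cube_measure. h (x + lat n)) = (LINT x|lborel. ?k n x)" for n
    by (subst integrable_cube_measure(2)) (simp_all add: lborel_integral_cube_translate)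
  have single: "AE x in lborel. \<exists>n0. \<forall>n. ?k n x = (if n = n0 then h x else 0)"
    using AE_cube_translates
  proof eventually_elim
    case (elim x)
    then obtain n0 where "\<And>n. x - lat n \<in> unit_cube \<longleftrightarrow> n = n0" by blast
    then show ?case by (intro exI[of _ n0]) (auto simp: indicator_def)
  qed
  have ks: "AE x in lborel. summable (\<lambda>n. norm (?k n x))"
    using single
  proof eventually_elim
    case (elim x)
    then obtain n0 where "\<And>n. ?k n x = (if n = n0 then h x else 0)" by blast
    then have "(\<lambda>n. norm (?k n x)) = (\<lambda>n. if n = n0 then norm (h x) else 0)" by (auto simp del: norm_scaleR)
    then show ?case by (simp add: summable_single del: norm_scaleR)
  qed
  have ksm: "summable (\<lambda>n. LINT x|lborel. norm (?k n x))"
  proof -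
    have "(LINT x|lborel. norm (?k n x)) = (LINT x|cube_measure. norm (h (x + lat n)))" for n
    proof -
      have "(LINT x|lborel. norm (?k n x)) = (LINT x|lborel. indicator unit_cube (x - lat n) *\<^sub>R norm (h x))"
        by simp
      also have "\<dots> = (LINT x|lborel. indicator unit_cube x *\<^sub>R norm (h (x + lat n)))" by (rule lborel_integral_cube_translate) measurable
      also have "\<dots> = (LINT x|cube_measure. norm (h (x + lat n)))"
        unfolding cube_measure_def
        using integral_density[of "\<lambda>x. norm (h (x + lat n))" lborel "indicator unit_cube :: _ \<Rightarrow> real"]
        by (simp add: ennreal_indicator)
      finally show ?thesis .
    qed
    then show ?thesis using sm by simp
  qed
  have "(LINT x|lborel. h x) = (LINT x|lborel. (\<Sum>n. ?k n x))"
  proof (rule integral_cong_AE)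
    show "(\<lambda>x. \<Sum>n. ?k n x) \<in> borel_measurable lborel"
      using integrable_suminf[OF ki ks ksm] by (rule borel_measurable_integrable)
    show "AE x in lborel. h x = (\<Sum>n. ?k n x)"
      using single
    proof eventually_elim
      case (elim x)
      then obtain n0 where "\<And>n. ?k n x = (if n = n0 then h x else 0)" by blast
      then show ?case using sums_single[of n0 "\<lambda>_. h x"] by (simp add: sums_iff)
    qed
  qed measurable
  also have "\<dots> = (\<Sum>n. LINT x|lborel. ?k n x)" by (rule integral_suminf[OF ki ks ksm])
  also have "\<dots> = (LINT x|cube_measure. (\<Sum>n. h (x + lat n)))"
    by (simp add: integral_suminf[OF i s sm] cm)
  finally show "(LINT x|cube_measure. (\<Sum>n. h (x + lat n))) = (LINT x|lborel. h x)" ..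
qed

section \<open>Fourier transform on \<open>L\<^sup>2\<close>\<close>

lemma L2_iff: "f \<in> L2 \<longleftrightarrow> f \<in> borel_measurable borel \<and> integrable lborel (\<lambda>x. (norm (f x))\<^sup>2)"
  by (simp add: L2_def)

lemma L2_borel: "f \<in> L2 \<Longrightarrow> f \<in> borel_measurable borel"
  and L2_integrable: "f \<in> L2 \<Longrightarrow> integrable lborel (\<lambda>x. (norm (f x))\<^sup>2)"
  by (simp_all add: L2_iff)

lemma L2_norm_nonneg [simp]: "0 \<le> L2_norm f"
  by (simp add: L2_norm_def)

lemma L2_norm_square: "(L2_norm f)\<^sup>2 = (LINT x|lborel. (norm (f x))\<^sup>2)"
  by (simp add: L2_norm_def)

lemma nn_integral_L2: "f \<in> L2 \<Longrightarrow> (\<integral>\<^sup>+x. ennreal ((norm (f x))\<^sup>2) \<partial>lborel) = ennreal ((L2_norm f)\<^sup>2)"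
  unfolding L2_norm_square by (intro nn_integral_eq_integral L2_integrable) auto

lemma L2I:
  assumes "f \<in> borel_measurable borel" "(\<integral>\<^sup>+x. ennreal ((norm (f x))\<^sup>2) \<partial>lborel) \<le> ennreal b"
  shows "f \<in> L2"
  unfolding L2_iff using assms
  by (intro conjI integrableI_bounded) (auto intro: le_less_trans)

lemma L2_cong_AE:
  assumes "f \<in> L2" "AE x in lborel. f x = g x" "g \<in> borel_measurable borel"
  shows "g \<in> L2" "L2_norm g = L2_norm f"
proof -
  have e: "AE x in lborel. (norm (g x))\<^sup>2 = (norm (f x))\<^sup>2"
    using assms(2) by eventually_elim simp
  note [measurable] = assms(3) L2_borel[OF assms(1)]
  show "g \<in> L2"
    unfolding L2_iff
  proof
    show "integrable lborel (\<lambda>x. (norm (g x))\<^sup>2)"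
      by (rule integrable_cong_AE[THEN iffD2, OF _ _ e L2_integrable[OF assms(1)]]) measurable
  qed measurable
  show "L2_norm g = L2_norm f"
    unfolding L2_norm_def using e by (intro arg_cong[where f = sqrt] integral_cong_AE) measurable
qed

lemma L2_scale: "f \<in> L2 \<Longrightarrow> (\<lambda>x. c * f x) \<in> L2"
  and L2_norm_scale: "L2_norm (\<lambda>x. c * f x) = norm c * L2_norm f"
  by (auto simp: L2_iff L2_norm_def norm_mult power_mult_distrib real_sqrt_mult)

lemma L2_add:
  assumes "f \<in> L2" "g \<in> L2" shows "(\<lambda>x. f x + g x) \<in> L2"
  unfolding L2_iff
proof
  note [measurable] = L2_borel[OF assms(1)] L2_borel[OF assms(2)]
  show "(\<lambda>x. f x + g x) \<in> borel_measurable borel" by measurable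
  show "integrable lborel (\<lambda>x. (norm (f x + g x))\<^sup>2)"
  proof (rule Bochner_Integration.integrable_bound)
    show "integrable lborel (\<lambda>x. 2 * (norm (f x))\<^sup>2 + 2 * (norm (g x))\<^sup>2)"
      using assms by (intro Bochner_Integration.integrable_add integrable_mult_right L2_integrable)
    show "AE x in lborel. norm ((norm (f x + g x))\<^sup>2) \<le> norm (2 * (norm (f x))\<^sup>2 + 2 * (norm (g x))\<^sup>2)"
    proof (rule AE_I2)
      fix x
      have "(norm (f x + g x))\<^sup>2 \<le> (norm (f x) + norm (g x))\<^sup>2"
        by (intro power_mono norm_triangle_ineq) simp
      also have "\<dots> \<le> 2 * (norm (f x))\<^sup>2 + 2 * (norm (g x))\<^sup>2"
        using sum_squares_bound[of "norm (f x)" "norm (g x)"] by (simp add: power2_sum)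
      finally show "norm ((norm (f x + g x))\<^sup>2) \<le> norm (2 * (norm (f x))\<^sup>2 + 2 * (norm (g x))\<^sup>2)"
        by simp
    qed
  qed measurable
qed

lemma L2_diff: "f \<in> L2 \<Longrightarrow> g \<in> L2 \<Longrightarrow> (\<lambda>x. f x - g x) \<in> L2"
  using L2_add[OF _ L2_scale[of g "-1"], of f] by simp

lemma L2_zero: "(\<lambda>x. 0) \<in> L2"
  by (simp add: L2_iff)

lemma L2_sum: "(\<And>a. a \<in> A \<Longrightarrow> f a \<in> L2) \<Longrightarrow> (\<lambda>x. \<Sum>a\<in>A. f a x) \<in> L2"
  by (induction A rule: infinite_finite_induct) (auto simp: L2_zero L2_add)

lemma L2_mult_integrable:
  assumes "f \<in> L2" "g \<in> L2"
  shows "integrable lborel (\<lambda>x. f x * g x)"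
    and "(LINT x|lborel. norm (f x) * norm (g x)) \<le> L2_norm f * L2_norm g"
proof -
  note [measurable] = L2_borel[OF assms(1)] L2_borel[OF assms(2)]
  have cs: "(\<integral>\<^sup>+x. ennreal (norm (f x)) * ennreal (norm (g x)) \<partial>lborel)\<^sup>2 \<le> ennreal ((L2_norm f * L2_norm g)\<^sup>2)"
    using Cauchy_Schwarz_nn_integral[of "\<lambda>x. ennreal (norm (f x))" lborel "\<lambda>x. ennreal (norm (g x))"]
      nn_integral_L2[OF assms(1)] nn_integral_L2[OF assms(2)]
    by (simp add: ennreal_power power_mult_distrib ennreal_mult)
  then have le: "(\<integral>\<^sup>+x. ennreal (norm (f x) * norm (g x)) \<partial>lborel) \<le> ennreal (L2_norm f * L2_norm g)"
    unfolding ennreal_mult[OF norm_ge_zero norm_ge_zero]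
  proof (cases "\<integral>\<^sup>+x. ennreal (norm (f x)) * ennreal (norm (g x)) \<partial>lborel" rule: ennreal_cases)
    case (real r)
    then have "r\<^sup>2 \<le> (L2_norm f * L2_norm g)\<^sup>2" using cs by (simp add: ennreal_power)
    then have "r \<le> L2_norm f * L2_norm g" by (rule power2_le_imp_le) simp
    then show "(\<integral>\<^sup>+x. ennreal (norm (f x)) * ennreal (norm (g x)) \<partial>lborel) \<le> ennreal (L2_norm f * L2_norm g)"
      unfolding real(2) by (rule ennreal_leI)
  next
    case top
    then show "(\<integral>\<^sup>+x. ennreal (norm (f x)) * ennreal (norm (g x)) \<partial>lborel) \<le> ennreal (L2_norm f * L2_norm g)"
      using cs by (simp add: top_unique)
  qed
  then show i: "integrable lborel (\<lambda>x. f x * g x)"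
    by (intro integrableI_bounded) (auto simp: norm_mult intro: le_less_trans)
  have "ennreal (LINT x|lborel. norm (f x) * norm (g x)) = (\<integral>\<^sup>+x. ennreal (norm (f x) * norm (g x)) \<partial>lborel)"
    using integrable_norm[OF i] by (intro nn_integral_eq_integral[symmetric]) (simp_all add: norm_mult)
  with le have "ennreal (LINT x|lborel. norm (f x) * norm (g x)) \<le> ennreal (L2_norm f * L2_norm g)" by (simp only:)
  then show "(LINT x|lborel. norm (f x) * norm (g x)) \<le> L2_norm f * L2_norm g"
    by (subst (asm) ennreal_le_iff) simp_all
qed

lemma L2_cnj: "f \<in> L2 \<Longrightarrow> (\<lambda>x. cnj (f x)) \<in> L2" and L2_norm_cnj: "L2_norm (\<lambda>x. cnj (f x)) = L2_norm f"
  by (auto simp: L2_iff L2_norm_def borel_measurable_cnj)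

lemma L2_Cauchy_Schwarz:
  assumes "f \<in> L2" "g \<in> L2"
  shows "norm (LINT x|lborel. f x * cnj (g x)) \<le> L2_norm f * L2_norm g"
proof -
  have "norm (LINT x|lborel. f x * cnj (g x)) \<le> (LINT x|lborel. norm (f x * cnj (g x)))"
    by (rule integral_norm_bound)
  also have "\<dots> \<le> L2_norm f * L2_norm g"
    using L2_mult_integrable(2)[OF assms] by (simp add: norm_mult)
  finally show ?thesis .
qed

lemma L2_norm_triangle:
  assumes "f \<in> L2" "g \<in> L2" shows "L2_norm (\<lambda>x. f x + g x) \<le> L2_norm f + L2_norm g"
proof -
  have "(L2_norm (\<lambda>x. f x + g x))\<^sup>2 \<le> (LINT x|lborel. (norm (f x))\<^sup>2 + 2 * (norm (f x) * norm (g x)) + (norm (g x))\<^sup>2)"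
    unfolding L2_norm_square
  proof (rule integral_mono)
    show "integrable lborel (\<lambda>x. (norm (f x))\<^sup>2 + 2 * (norm (f x) * norm (g x)) + (norm (g x))\<^sup>2)"
      using assms integrable_norm[OF L2_mult_integrable(1)[OF assms]]
      by (intro Bochner_Integration.integrable_add L2_integrable integrable_mult_right) (simp_all add: norm_mult)
    show "(norm (f x + g x))\<^sup>2 \<le> (norm (f x))\<^sup>2 + 2 * (norm (f x) * norm (g x)) + (norm (g x))\<^sup>2" for x
      using power_mono[OF norm_triangle_ineq[of "f x" "g x"], of 2] by (simp add: power2_sum mult.assoc)
  qed (intro L2_integrable L2_add assms)
  also have "\<dots> = (L2_norm f)\<^sup>2 + 2 * (LINT x|lborel. norm (f x) * norm (g x)) + (L2_norm g)\<^sup>2"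
    unfolding L2_norm_square
    using integrable_norm[OF L2_mult_integrable(1)[OF assms]] L2_integrable[OF assms(1)] L2_integrable[OF assms(2)]
    by (simp add: norm_mult)
  also have "\<dots> \<le> (L2_norm f + L2_norm g)\<^sup>2"
    using L2_mult_integrable(2)[OF assms] by (simp add: power2_sum)
  finally show ?thesis by (rule power2_le_imp_le) simp
qed

lemma L2_norm_minus_commute: "L2_norm (\<lambda>x. f x - g x) = L2_norm (\<lambda>x. g x - f x)"
  by (simp add: L2_norm_def norm_minus_commute)

lemma L2_norm_triangle_diff:
  assumes "f \<in> L2" "g \<in> L2" "h \<in> L2"
  shows "L2_norm (\<lambda>x. f x - h x) \<le> L2_norm (\<lambda>x. f x - g x) + L2_norm (\<lambda>x. g x - h x)"
  using L2_norm_triangle[OF L2_diff[OF assms(1,2)] L2_diff[OF assms(2,3)]] by simp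

lemma L2_norm_diff_ge:
  assumes "f \<in> L2" "g \<in> L2" shows "\<bar>L2_norm f - L2_norm g\<bar> \<le> L2_norm (\<lambda>x. f x - g x)"
  using L2_norm_triangle[OF L2_diff[OF assms] assms(2)]
    L2_norm_triangle[OF L2_diff[OF assms(2,1)] assms(1)] L2_norm_minus_commute[of f g] by simp

lemma L2_translate:
  fixes c :: "real ^ 'd::finite"
  assumes "f \<in> L2" shows "(\<lambda>x. f (x + c)) \<in> L2" "L2_norm (\<lambda>x. f (x + c)) = L2_norm f"
proof -
  note [measurable] = L2_borel[OF assms]
  have m: "(\<lambda>x. (norm (f x))\<^sup>2) \<in> borel_measurable borel" by measurable
  show "(\<lambda>x. f (x + c)) \<in> L2"
    using L2_integrable[OF assms] lborel_integrable_translate[OF m, of c] by (simp add: L2_iff)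
  show "L2_norm (\<lambda>x. f (x + c)) = L2_norm f"
    using lborel_integral_translate[OF m, of c] by (simp add: L2_norm_def)
qed

lemma tendsto_L2_inner:
  assumes "\<And>n. u n \<in> L2" "f \<in> L2" "g \<in> L2" "L2_limit u f"
  shows "(\<lambda>n. LINT x|lborel. u n x * cnj (g x)) \<longlonglongrightarrow> (LINT x|lborel. f x * cnj (g x))"
proof -
  have "(\<lambda>n. (LINT x|lborel. u n x * cnj (g x)) - (LINT x|lborel. f x * cnj (g x))) \<longlonglongrightarrow> 0"
  proof (rule Lim_null_comparison[OF always_eventually])
    show "\<forall>n. norm ((LINT x|lborel. u n x * cnj (g x)) - (LINT x|lborel. f x * cnj (g x)))
        \<le> L2_norm (\<lambda>x. u n x - f x) * L2_norm g"
    proof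
      fix n
      have "(LINT x|lborel. u n x * cnj (g x)) - (LINT x|lborel. f x * cnj (g x)) =
          (LINT x|lborel. (u n x - f x) * cnj (g x))"
        unfolding left_diff_distrib
        by (intro Bochner_Integration.integral_diff[symmetric] L2_mult_integrable(1) L2_cnj assms)
      then show "norm ((LINT x|lborel. u n x * cnj (g x)) - (LINT x|lborel. f x * cnj (g x)))
        \<le> L2_norm (\<lambda>x. u n x - f x) * L2_norm g"
        using L2_Cauchy_Schwarz[OF L2_diff[OF assms(1,2)] assms(3)] by simp
    qed
    have "(\<lambda>n. L2_norm (\<lambda>x. u n x - f x) * L2_norm g) \<longlonglongrightarrow> 0 * L2_norm g"
      using assms(4) unfolding L2_limit_def by (intro tendsto_intros)
    then show "(\<lambda>n. L2_norm (\<lambda>x. u n x - f x) * L2_norm g) \<longlonglongrightarrow> 0" by simp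
  qed
  then show ?thesis by (simp add: Lim_null[symmetric])
qed

section \<open>Gaussians and the Plancherel inequality\<close>

definition gauss :: "real \<Rightarrow> real ^ 'd::finite \<Rightarrow> real" where
  "gauss s x = exp (- (pi * s\<^sup>2 * (x \<bullet> x)))"

lemma gauss_pos [simp]: "0 < gauss s x" and gauss_nonneg [simp]: "0 \<le> gauss s x"
  and gauss_le_1: "gauss s x \<le> 1" and gauss_uminus [simp]: "gauss s (- x) = gauss s x"
  by (simp_all add: gauss_def)

lemma gauss_borel [measurable]: "gauss s \<in> borel_measurable borel"
  unfolding gauss_def by (intro borel_measurable_continuous_onI continuous_intros)

lemma gauss_minus_commute: "gauss s (x - y) = gauss s (y - x)"
  using gauss_uminus[of s "x - y"] by simp

text \<open>This is the characteristic function of the standard normal distribution after the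
  substitution t = c x, with c chosen so that \<pi> s^2 c^2 = 1/2.\<close>

lemma integral_gaussian_real:
  fixes s a :: real
  assumes s: "0 < s"
  shows "integrable lborel (\<lambda>t. complex_of_real (exp (- (pi * s\<^sup>2 * t\<^sup>2))) * cis (2 * pi * (a * t)))"
    and "(LINT t|lborel. complex_of_real (exp (- (pi * s\<^sup>2 * t\<^sup>2))) * cis (2 * pi * (a * t))) =
      complex_of_real (inverse s * exp (- (pi * (1 / s)\<^sup>2 * a\<^sup>2)))"
proof -
  define c where "c = 1 / (s * sqrt (2 * pi))"
  have c: "0 < c" using s by (simp add: c_def)
  have c2: "c\<^sup>2 = 1 / (s\<^sup>2 * (2 * pi))" by (simp add: c_def power_divide power_mult_distrib)
  define f where "f t = complex_of_real (exp (- (pi * s\<^sup>2 * t\<^sup>2))) * cis (2 * pi * (a * t))" for t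
  define \<tau> where "\<tau> = 2 * pi * a * c"
  have fc: "f (0 + c * x) = sqrt (2 * pi) *\<^sub>R (std_normal_density x *\<^sub>R iexp (\<tau> * x))" for x
  proof -
    have "pi * s\<^sup>2 * (c * x)\<^sup>2 = x\<^sup>2 / 2" using s by (simp add: power_mult_distrib c2)
    moreover have "sqrt (2 * pi) * std_normal_density x = exp (- x\<^sup>2 / 2)" by (simp add: std_normal_density_def)
    moreover have "cis (2 * pi * (a * (c * x))) = iexp (\<tau> * x)" by (simp add: cis_conv_exp \<tau>_def mult_ac)
    ultimately show ?thesis by (simp add: f_def scaleR_conv_of_real flip: of_real_mult)
  qed
  have m: "(\<lambda>x. iexp (\<tau> * x)) \<in> borel_measurable lborel" by measurable
  interpret N: prob_space "density lborel std_normal_density" by (rule prob_space_normal_density) simp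
  have iN: "integrable (density lborel std_normal_density) (\<lambda>x. iexp (\<tau> * x))"
    by (intro N.integrable_const_bound[of _ 1]) auto
  have i: "integrable lborel (\<lambda>x. std_normal_density x *\<^sub>R iexp (\<tau> * x))"
    using iN by (subst (asm) integrable_density) auto
  have e: "(LINT x|lborel. std_normal_density x *\<^sub>R iexp (\<tau> * x)) = complex_of_real (exp (- (\<tau>\<^sup>2) / 2))"
    using char_std_normal_distribution integral_density[OF m, of std_normal_density]
    by (simp add: char_def fun_eq_iff)
  have "integrable lborel (\<lambda>x. f (0 + c * x))" unfolding fc by (intro integrable_scaleR_right i)
  then show "integrable lborel (\<lambda>t. complex_of_real (exp (- (pi * s\<^sup>2 * t\<^sup>2))) * cis (2 * pi * (a * t)))"
    using lborel_integrable_real_affine_iff[of c f 0] c unfolding f_def by simp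
  have "(LINT t|lborel. f t) = \<bar>c\<bar> *\<^sub>R (LINT x|lborel. f (0 + c * x))"
    using c by (intro lborel_integral_real_affine) simp
  also have "\<dots> = complex_of_real (c * sqrt (2 * pi) * exp (- (\<tau>\<^sup>2) / 2))"
    unfolding fc using c e by (simp add: scaleR_conv_of_real)
  also have "c * sqrt (2 * pi) = inverse s" using s by (simp add: c_def field_simps)
  also have "- (\<tau>\<^sup>2) / 2 = - (pi * (1 / s)\<^sup>2 * a\<^sup>2)"
  proof -
    have "\<tau>\<^sup>2 = 4 * pi * pi * a\<^sup>2 * c\<^sup>2" by (simp add: \<tau>_def power_mult_distrib power2_eq_square[of pi])
    then show ?thesis using s unfolding c2 by (simp add: power_divide)
  qed
  finally show "(LINT t|lborel. complex_of_real (exp (- (pi * s\<^sup>2 * t\<^sup>2))) * cis (2 * pi * (a * t))) =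
      complex_of_real (inverse s * exp (- (pi * (1 / s)\<^sup>2 * a\<^sup>2)))"
    unfolding f_def .
qed

lemma integral_gaussian:
  fixes a :: "real ^ 'd::finite"
  assumes s: "0 < s"
  shows "integrable lborel (\<lambda>x. of_real (gauss s x) * chr a x)"
    and "(LINT x|lborel. of_real (gauss s x) * chr a x) = of_real (inverse s ^ CARD('d) * gauss (1 / s) a)"
proof -
  have e: "complex_of_real (gauss s x) * chr a x =
      (\<Prod>j\<in>UNIV. complex_of_real (exp (- (pi * s\<^sup>2 * (x $ j)\<^sup>2))) * cis (2 * pi * (a $ j * x $ j)))" for x
  proof -
    have "gauss s x = (\<Prod>j\<in>UNIV. exp (- (pi * s\<^sup>2 * (x $ j)\<^sup>2)))"
      unfolding gauss_def inner_vec_def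
      by (simp add: exp_sum[symmetric] sum_distrib_left sum_negf power2_eq_square)
    moreover have "chr a x = (\<Prod>j\<in>UNIV. cis (2 * pi * (a $ j * x $ j)))"
      unfolding chr_def inner_vec_def by (simp add: cis_conv_exp exp_sum[symmetric] sum_distrib_left)
    ultimately show ?thesis by (simp add: prod.distrib)
  qed
  show "integrable lborel (\<lambda>x. of_real (gauss s x) * chr a x)"
    unfolding e by (rule integral_prod_vec(1)[OF integral_gaussian_real(1)[OF s]])
  have g: "gauss (1 / s) a = (\<Prod>j\<in>UNIV. exp (- (pi * (1 / s)\<^sup>2 * (a $ j)\<^sup>2)))"
    unfolding gauss_def inner_vec_def
    by (simp add: exp_sum[symmetric] sum_distrib_left sum_negf power2_eq_square)
  show "(LINT x|lborel. of_real (gauss s x) * chr a x) = of_real (inverse s ^ CARD('d) * gauss (1 / s) a)"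
    unfolding e integral_prod_vec(2)[OF integral_gaussian_real(1)[OF s]] integral_gaussian_real(2)[OF s] g
    by (simp add: prod.distrib)
qed

lemma gauss_integrable: "0 < s \<Longrightarrow> integrable lborel (gauss s :: real ^ 'd::finite \<Rightarrow> real)"
  and integral_gauss: "0 < s \<Longrightarrow> (LINT x|lborel. gauss s (x :: real ^ 'd)) = inverse s ^ CARD('d)"
  using integral_gaussian[of s "0 :: real ^ 'd"]
  by (simp_all add: integral_complex_of_real gauss_def[of _ 0] complex_of_real_integrable_eq del: of_real_mult of_real_power)

lemma gauss_L2: "0 < s \<Longrightarrow> (\<lambda>x. complex_of_real (gauss s x) * chr a x) \<in> L2"
  unfolding L2_iff
  by (intro conjI Bochner_Integration.integrable_bound[OF gauss_integrable])
    (auto simp: norm_mult gauss_le_1 power_le_one_iff power2_eq_square mult_left_le)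

text \<open>When the kernel is a character, this moves the Fourier transform from one factor of an
  integral to the other.\<close>

lemma Fubini_kernel:
  fixes u h :: "real ^ 'd::finite \<Rightarrow> complex" and k :: "real ^ 'd \<Rightarrow> real ^ 'd \<Rightarrow> complex"
  assumes u: "integrable lborel u" and h: "integrable lborel h"
    and k: "(\<lambda>(w, x). k w x) \<in> borel_measurable (borel \<Otimes>\<^sub>M borel)" "\<And>w x. norm (k w x) \<le> 1"
  shows "(LINT w|lborel. h w * (LINT x|lborel. u x * k w x)) = (LINT x|lborel. u x * (LINT w|lborel. h w * k w x))"
proof -
  note [measurable] = borel_measurable_integrable[OF u] borel_measurable_integrable[OF h]
  have [measurable]: "(\<lambda>(w, x). k w x) \<in> borel_measurable (lborel \<Otimes>\<^sub>M lborel)"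
    using k(1) by (simp cong: measurable_cong_sets sets_pair_measure_cong)
  let ?f = "\<lambda>w x. h w * (u x * k w x)"
  have [measurable]: "(\<lambda>(w, x). ?f w x) \<in> borel_measurable (lborel \<Otimes>\<^sub>M lborel)" by measurable
  have iu: "integrable lborel (\<lambda>x. u x * k w x)" for w
    using k(2) by (intro Bochner_Integration.integrable_bound[OF u]) (auto simp: norm_mult mult_left_le)
  have "integrable (lborel \<Otimes>\<^sub>M lborel) (\<lambda>(w, x). ?f w x)"
  proof (rule lborel_pair.Fubini_integrable)
    show "AE w in lborel. integrable lborel (\<lambda>x. (case (w, x) of (w, x) \<Rightarrow> ?f w x))"
      using iu by (intro AE_I2) auto
    show "integrable lborel (\<lambda>w. LINT x|lborel. norm (case (w, x) of (w, x) \<Rightarrow> ?f w x))"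
    proof (rule Bochner_Integration.integrable_bound)
      show "integrable lborel (\<lambda>w. norm (h w) * (LINT x|lborel. norm (u x)))"
        using h by (intro integrable_mult_left integrable_norm)
      show "AE w in lborel. norm (LINT x|lborel. norm (case (w, x) of (w, x) \<Rightarrow> ?f w x)) \<le>
          norm (norm (h w) * (LINT x|lborel. norm (u x)))"
      proof (rule AE_I2)
        fix w
        have "(LINT x|lborel. norm (u x * k w x)) \<le> (LINT x|lborel. norm (u x))"
          using k(2) by (intro integral_mono integrable_norm iu u) (auto simp: norm_mult mult_left_le)
        then show "norm (LINT x|lborel. norm (case (w, x) of (w, x) \<Rightarrow> ?f w x)) \<le>
            norm (norm (h w) * (LINT x|lborel. norm (u x)))"
          by (simp add: norm_mult[of "h w"] abs_mult mult_left_mono)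
      qed
    qed measurable
  qed measurable
  then have "(LINT x|lborel. LINT w|lborel. ?f w x) = (LINT w|lborel. LINT x|lborel. ?f w x)"
    by (rule lborel_pair.Fubini_integral)
  moreover have "(LINT x|lborel. ?f w x) = h w * (LINT x|lborel. u x * k w x)" for w by simp
  moreover have "(LINT w|lborel. ?f w x) = u x * (LINT w|lborel. h w * k w x)" for x
    by (simp add: mult.left_commute[of "h _" "u _"])
  ultimately show ?thesis by simp
qed

text \<open>A function with definite values at every point, so that it can supply continuous
  representatives.\<close>

definition inv_fourier :: "(real ^ 'd::finite \<Rightarrow> complex) \<Rightarrow> real ^ 'd \<Rightarrow> complex" where
  "inv_fourier g x = (LINT w|lborel. g w * chr w x)"

lemma norm_integral_le_nn_integral:
  fixes f :: "'a \<Rightarrow> 'b::{banach, second_countable_topology}"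
  shows "ennreal (norm (integral\<^sup>L M f)) \<le> (\<integral>\<^sup>+x. ennreal (norm (f x)) \<partial>M)"
  by (cases "integrable M f") (simp_all add: integral_norm_bound_ennreal not_integrable_integral_eq)

lemma fourier_eq: "fourier u w = (LINT x|lborel. u x * chr (- w) x)"
  unfolding fourier_def exp_eq_chr ..

lemma integrable_chr_mult:
  assumes "integrable lborel g"
  shows "integrable lborel (\<lambda>w. g w * chr w x)" "integrable lborel (\<lambda>w. g w * chr x w)"
    "integrable lborel (\<lambda>w. g w * chr (- w) x)" "integrable lborel (\<lambda>w. g w * chr (- x) w)"
proof -
  note [measurable] = borel_measurable_integrable[OF assms]
  show "integrable lborel (\<lambda>w. g w * chr w x)" "integrable lborel (\<lambda>w. g w * chr x w)"
    "integrable lborel (\<lambda>w. g w * chr (- w) x)" "integrable lborel (\<lambda>w. g w * chr (- x) w)"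
    by (rule Bochner_Integration.integrable_bound[OF assms]; simp add: norm_mult)+
qed

lemma norm_inv_fourier_le:
  assumes "integrable lborel g"
  shows "norm (inv_fourier g x) \<le> (LINT w|lborel. norm (g w))"
  using integral_norm_bound[of lborel "\<lambda>w. g w * chr w x"] by (simp add: inv_fourier_def norm_mult)

lemma continuous_inv_fourier:
  fixes g :: "real ^ 'd::finite \<Rightarrow> complex"
  assumes g: "integrable lborel g"
  shows "continuous_on UNIV (inv_fourier g)"
proof (rule continuous_at_imp_continuous_on, rule ballI)
  fix x :: "real ^ 'd"
  note [measurable] = borel_measurable_integrable[OF g]
  show "isCont (inv_fourier g) x"
    unfolding continuous_at_sequentially comp_def
  proof (intro allI impI)
    fix u assume u: "u \<longlonglongrightarrow> x"
    show "(\<lambda>n. inv_fourier g (u n)) \<longlonglongrightarrow> inv_fourier g x"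
      unfolding inv_fourier_def
    proof (rule integral_dominated_convergence[where w = "\<lambda>w. norm (g w)"])
      have "(\<lambda>n. chr w (u n)) \<longlonglongrightarrow> chr w x" for w
        using continuous_on_chr[of UNIV "\<lambda>_. w" "\<lambda>x. x"] u
        by (auto simp: continuous_on_eq_continuous_at intro: isCont_tendsto_compose)
      then show "AE w in lborel. (\<lambda>n. g w * chr w (u n)) \<longlonglongrightarrow> g w * chr w x"
        by (intro AE_I2 tendsto_intros)
    qed (use g in \<open>auto simp: norm_mult\<close>)
  qed
qed

lemma inv_fourier_borel: "integrable lborel g \<Longrightarrow> inv_fourier g \<in> borel_measurable borel"
  by (intro borel_measurable_continuous_onI continuous_inv_fourier)

lemma fourier_inv_fourier:
  fixes u :: "real ^ 'd::finite \<Rightarrow> complex"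
  shows "fourier u w = cnj (inv_fourier (\<lambda>x. cnj (u x)) w)" "fourier u w = inv_fourier u (- w)"
proof -
  show "fourier u w = cnj (inv_fourier (\<lambda>x. cnj (u x)) w)"
    unfolding fourier_eq inv_fourier_def Bochner_Integration.integral_cnj[symmetric]
    by (simp add: chr_commute[of w] chr_commute[of "- w"] chr_minus_swap)
  show "fourier u w = inv_fourier u (- w)"
    unfolding fourier_eq inv_fourier_def by (simp add: chr_commute[of "- w"])
qed

lemma fourier_borel: "integrable lborel u \<Longrightarrow> fourier u \<in> borel_measurable borel"
  unfolding fourier_inv_fourier(2)[abs_def]
  by (rule measurable_compose[OF _ inv_fourier_borel]) auto

text \<open>Damping by a Gaussian turns the square integral of the transform into the pairing of \<open>u\<close> with
  a convolution by a probability density; Young's inequality bounds it by \<open>L2_norm u\<close>.\<close>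

lemma fourier_gauss_bound:
  fixes u :: "real ^ 'd::finite \<Rightarrow> complex"
  assumes u1: "integrable lborel u" and u2: "u \<in> L2" and s: "0 < s"
  shows "(\<integral>\<^sup>+w. ennreal ((norm (fourier u w))\<^sup>2 * gauss s w) \<partial>lborel) \<le> ennreal ((L2_norm u)\<^sup>2)"
proof -
  note [measurable] = L2_borel[OF u2] fourier_borel[OF u1]
  define \<gamma> :: "real ^ 'd \<Rightarrow> real" where "\<gamma> y = inverse s ^ CARD('d) * gauss (1 / s) y" for y
  have [measurable]: "\<gamma> \<in> borel_measurable borel" unfolding \<gamma>_def by measurable
  have \<gamma>0: "0 \<le> \<gamma> y" for y using s by (simp add: \<gamma>_def)
  have \<gamma>sym: "\<gamma> (x - y) = \<gamma> (y - x)" for x y unfolding \<gamma>_def by (simp add: gauss_minus_commute)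
  have \<gamma>1: "(\<integral>\<^sup>+y. ennreal (\<gamma> (y - x)) \<partial>lborel) = 1" for x
  proof -
    have "(\<integral>\<^sup>+y. ennreal (\<gamma> (y - x)) \<partial>lborel) = (\<integral>\<^sup>+y. ennreal (\<gamma> y) \<partial>lborel)"
      using lborel_nn_integral_translate[of "\<lambda>y. ennreal (\<gamma> y)" "- x"] by simp
    also have "\<dots> = ennreal (LINT y|lborel. \<gamma> y)"
      unfolding \<gamma>_def using s by (intro nn_integral_eq_integral integrable_mult_right gauss_integrable) auto
    also have "(LINT y|lborel. \<gamma> y) = 1"
      unfolding \<gamma>_def using s integral_gauss[of "1 / s", where 'd = 'd] by (simp add: power_one_over field_simps)
    finally show ?thesis by simp
  qed
  have \<gamma>1': "(\<integral>\<^sup>+y. ennreal (\<gamma> (x - y)) \<partial>lborel) = 1" for x using \<gamma>1[of x] by (simp add: \<gamma>sym)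
  have gF: "integrable lborel (\<lambda>w. complex_of_real (gauss s w) * cnj (fourier u w))"
  proof (rule Bochner_Integration.integrable_bound)
    show "integrable lborel (\<lambda>w. gauss s w * (LINT x|lborel. norm (u x)))"
      by (intro integrable_mult_left gauss_integrable s)
    show "AE w in lborel. norm (complex_of_real (gauss s w) * cnj (fourier u w)) \<le> norm (gauss s w * (LINT x|lborel. norm (u x)))"
      using norm_inv_fourier_le[OF u1]
      by (intro AE_I2) (simp add: norm_mult fourier_inv_fourier(2) mult_left_mono abs_mult)
  qed measurable
  have ucnj: "integrable lborel (\<lambda>y. cnj (u y))" using u1 by simp
  have sg: "integrable lborel (\<lambda>w. complex_of_real (gauss s w))" using gauss_integrable[OF s] by (rule integrable_of_real)
  \<comment> \<open>Integrating out the frequency first leaves the convolution of the conjugate of u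
    with the density \<gamma>, the transform of the damping Gaussian.\<close>
  have inner: "(LINT w|lborel. (complex_of_real (gauss s w) * cnj (fourier u w)) * chr (- w) x) =
      (LINT y|lborel. cnj (u y) * of_real (\<gamma> (y - x)))" for x
  proof -
    have "(LINT w|lborel. (complex_of_real (gauss s w) * cnj (fourier u w)) * chr (- w) x) =
        (LINT w|lborel. complex_of_real (gauss s w) * (LINT y|lborel. cnj (u y) * chr w (y - x)))"
    proof (intro Bochner_Integration.integral_cong refl)
      fix w
      have "cnj (fourier u w) = (LINT y|lborel. cnj (u y) * chr w y)"
        unfolding fourier_eq Bochner_Integration.integral_cnj[symmetric] by simp
      then have "cnj (fourier u w) * chr (- w) x = (LINT y|lborel. (cnj (u y) * chr w y) * chr (- w) x)" by simp
      also have "\<dots> = (LINT y|lborel. cnj (u y) * chr w (y - x))"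
        by (simp add: chr_add_right[of w _ "- x", simplified] chr_minus_swap mult.assoc)
      finally show "(complex_of_real (gauss s w) * cnj (fourier u w)) * chr (- w) x =
          complex_of_real (gauss s w) * (LINT y|lborel. cnj (u y) * chr w (y - x))" by (simp add: mult.assoc)
    qed
    also have "\<dots> = (LINT y|lborel. cnj (u y) * (LINT w|lborel. complex_of_real (gauss s w) * chr w (y - x)))"
      by (rule Fubini_kernel[OF ucnj sg]) auto
    also have "\<dots> = (LINT y|lborel. cnj (u y) * of_real (\<gamma> (y - x)))"
      unfolding chr_commute[of _ "_ - x"] \<gamma>_def integral_gaussian(2)[OF s] by simp
    finally show ?thesis .
  qed
  have main: "(LINT w|lborel. (complex_of_real (gauss s w) * cnj (fourier u w)) * fourier u w) =
      (LINT x|lborel. u x * (LINT y|lborel. cnj (u y) * of_real (\<gamma> (y - x))))"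
  proof -
    have "(LINT w|lborel. (complex_of_real (gauss s w) * cnj (fourier u w)) * fourier u w) =
        (LINT w|lborel. (complex_of_real (gauss s w) * cnj (fourier u w)) * (LINT x|lborel. u x * chr (- w) x))"
      by (simp only: fourier_eq)
    also have "\<dots> = (LINT x|lborel. u x * (LINT w|lborel. (complex_of_real (gauss s w) * cnj (fourier u w)) * chr (- w) x))"
      by (rule Fubini_kernel[OF u1 gF]) auto
    finally show ?thesis unfolding inner .
  qed
  have bound: "(\<integral>\<^sup>+x. \<integral>\<^sup>+y. ennreal (norm (u x) * norm (u y) * \<gamma> (y - x)) \<partial>lborel \<partial>lborel) \<le> ennreal ((L2_norm u)\<^sup>2)"
  proof -
    define h :: real where "h = 1 / 2"
    have h: "0 \<le> h" by (simp add: h_def)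
    have "(\<integral>\<^sup>+x. \<integral>\<^sup>+y. ennreal (norm (u x) * norm (u y) * \<gamma> (y - x)) \<partial>lborel \<partial>lborel) \<le>
        (\<integral>\<^sup>+x. \<integral>\<^sup>+y. ennreal h * (ennreal ((norm (u x))\<^sup>2) * ennreal (\<gamma> (y - x))) +
          ennreal h * (ennreal ((norm (u y))\<^sup>2) * ennreal (\<gamma> (y - x))) \<partial>lborel \<partial>lborel)"
    proof (intro nn_integral_mono)
      fix x y :: "real ^ 'd"
      have "norm (u x) * norm (u y) * \<gamma> (y - x) \<le> h * ((norm (u x))\<^sup>2 * \<gamma> (y - x)) + h * ((norm (u y))\<^sup>2 * \<gamma> (y - x))"
        using mult_right_mono[OF sum_squares_bound[of "norm (u x)" "norm (u y)"] \<gamma>0[of "y - x"]]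
        by (simp add: h_def algebra_simps)
      then show "ennreal (norm (u x) * norm (u y) * \<gamma> (y - x)) \<le>
          ennreal h * (ennreal ((norm (u x))\<^sup>2) * ennreal (\<gamma> (y - x))) +
          ennreal h * (ennreal ((norm (u y))\<^sup>2) * ennreal (\<gamma> (y - x)))"
        by (simp add: \<gamma>0 h flip: ennreal_mult ennreal_plus)
    qed
    also have "\<dots> = ennreal h * (\<integral>\<^sup>+x. \<integral>\<^sup>+y. ennreal ((norm (u x))\<^sup>2) * ennreal (\<gamma> (y - x)) \<partial>lborel \<partial>lborel) +
        ennreal h * (\<integral>\<^sup>+x. \<integral>\<^sup>+y. ennreal ((norm (u y))\<^sup>2) * ennreal (\<gamma> (y - x)) \<partial>lborel \<partial>lborel)"
      by (simp add: nn_integral_add nn_integral_cmult)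
    also have "(\<integral>\<^sup>+x. \<integral>\<^sup>+y. ennreal ((norm (u x))\<^sup>2) * ennreal (\<gamma> (y - x)) \<partial>lborel \<partial>lborel) = ennreal ((L2_norm u)\<^sup>2)"
      by (simp add: nn_integral_cmult \<gamma>1 nn_integral_L2[OF u2])
    also have "(\<integral>\<^sup>+x. \<integral>\<^sup>+y. ennreal ((norm (u y))\<^sup>2) * ennreal (\<gamma> (y - x)) \<partial>lborel \<partial>lborel) =
        (\<integral>\<^sup>+y. \<integral>\<^sup>+x. ennreal ((norm (u y))\<^sup>2) * ennreal (\<gamma> (y - x)) \<partial>lborel \<partial>lborel)"
      by (rule lborel_pair.Fubini') measurable
    also have "\<dots> = ennreal ((L2_norm u)\<^sup>2)"
      by (simp add: nn_integral_cmult \<gamma>1' nn_integral_L2[OF u2])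
    also have "ennreal h * ennreal ((L2_norm u)\<^sup>2) + ennreal h * ennreal ((L2_norm u)\<^sup>2) = ennreal ((L2_norm u)\<^sup>2)"
      by (simp add: h flip: ennreal_mult ennreal_plus) (simp add: h_def)
    finally show ?thesis .
  qed
  have "(\<integral>\<^sup>+w. ennreal ((norm (fourier u w))\<^sup>2 * gauss s w) \<partial>lborel) =
      ennreal (LINT w|lborel. (norm (fourier u w))\<^sup>2 * gauss s w)"
  proof (rule nn_integral_eq_integral)
    have "integrable lborel (\<lambda>w. (complex_of_real (gauss s w) * cnj (fourier u w)) * fourier u w)"
    proof (rule Bochner_Integration.integrable_bound)
      show "integrable lborel (\<lambda>w. norm (complex_of_real (gauss s w) * cnj (fourier u w)) * (LINT x|lborel. norm (u x)))"
        by (intro integrable_mult_left integrable_norm gF)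
      show "AE w in lborel. norm ((complex_of_real (gauss s w) * cnj (fourier u w)) * fourier u w) \<le>
          norm (norm (complex_of_real (gauss s w) * cnj (fourier u w)) * (LINT x|lborel. norm (u x)))"
        using norm_inv_fourier_le[OF u1]
        by (intro AE_I2) (simp add: norm_mult fourier_inv_fourier(2) mult_left_mono abs_mult)
    qed measurable
    then have "integrable lborel (\<lambda>w. norm ((complex_of_real (gauss s w) * cnj (fourier u w)) * fourier u w))"
      by (rule integrable_norm)
    then show "integrable lborel (\<lambda>w. (norm (fourier u w))\<^sup>2 * gauss s w)"
      by (simp add: norm_mult power2_eq_square mult_ac)
  qed simp
  also have "(LINT w|lborel. (norm (fourier u w))\<^sup>2 * gauss s w) =
      norm (complex_of_real (LINT w|lborel. (norm (fourier u w))\<^sup>2 * gauss s w))"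
    by simp
  also have "complex_of_real (LINT w|lborel. (norm (fourier u w))\<^sup>2 * gauss s w) =
      (LINT w|lborel. (complex_of_real (gauss s w) * cnj (fourier u w)) * fourier u w)"
    unfolding integral_complex_of_real[symmetric] of_real_mult complex_norm_square by (simp add: mult_ac)
  also have "ennreal (norm (LINT w|lborel. (complex_of_real (gauss s w) * cnj (fourier u w)) * fourier u w)) \<le>
      (\<integral>\<^sup>+x. ennreal (norm (u x * (LINT y|lborel. cnj (u y) * of_real (\<gamma> (y - x))))) \<partial>lborel)"
    unfolding main by (rule norm_integral_le_nn_integral)
  also have "\<dots> \<le> (\<integral>\<^sup>+x. \<integral>\<^sup>+y. ennreal (norm (u x) * norm (u y) * \<gamma> (y - x)) \<partial>lborel \<partial>lborel)"
  proof (rule nn_integral_mono)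
    fix x
    have "ennreal (norm (LINT y|lborel. cnj (u y) * complex_of_real (\<gamma> (y - x)))) \<le>
        (\<integral>\<^sup>+y. ennreal (norm (cnj (u y) * complex_of_real (\<gamma> (y - x)))) \<partial>lborel)"
      by (rule norm_integral_le_nn_integral)
    then have "ennreal (norm (u x)) * ennreal (norm (LINT y|lborel. cnj (u y) * complex_of_real (\<gamma> (y - x)))) \<le>
        ennreal (norm (u x)) * (\<integral>\<^sup>+y. ennreal (norm (cnj (u y) * complex_of_real (\<gamma> (y - x)))) \<partial>lborel)"
      by (rule mult_left_mono) simp
    also have "\<dots> = (\<integral>\<^sup>+y. ennreal (norm (u x)) * ennreal (norm (cnj (u y) * complex_of_real (\<gamma> (y - x)))) \<partial>lborel)"
      by (rule nn_integral_cmult[symmetric]) measurable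
    also have "\<dots> = (\<integral>\<^sup>+y. ennreal (norm (u x) * norm (u y) * \<gamma> (y - x)) \<partial>lborel)"
      by (simp add: norm_mult \<gamma>0 mult.assoc flip: ennreal_mult)
    finally show "ennreal (norm (u x * (LINT y|lborel. cnj (u y) * of_real (\<gamma> (y - x))))) \<le>
        (\<integral>\<^sup>+y. ennreal (norm (u x) * norm (u y) * \<gamma> (y - x)) \<partial>lborel)"
      by (simp add: norm_mult ennreal_mult)
  qed
  also note bound
  finally show ?thesis .
qed

text \<open>Fatou's lemma removes the Gaussian damping of \<open>fourier_gauss_bound\<close> as s
  tends to 0.\<close>

lemma fourier_L2:
  fixes u :: "real ^ 'd::finite \<Rightarrow> complex"
  assumes u1: "integrable lborel u" and u2: "u \<in> L2"
  shows "fourier u \<in> L2"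
proof (rule L2I[where b = "(L2_norm u)\<^sup>2"])
  note [measurable] = fourier_borel[OF u1]
  show "fourier u \<in> borel_measurable borel" by measurable
  have lim: "(\<lambda>n. (norm (fourier u w))\<^sup>2 * gauss (1 / real (Suc n)) w) \<longlonglongrightarrow> (norm (fourier u w))\<^sup>2" for w
  proof -
    have "(\<lambda>n. gauss (1 / real (Suc n)) w) \<longlonglongrightarrow> exp (- (pi * 0\<^sup>2 * (w \<bullet> w)))"
      unfolding gauss_def using LIMSEQ_inverse_real_of_nat by (intro tendsto_intros) (simp add: inverse_eq_divide)
    from tendsto_mult[OF tendsto_const this, of "(norm (fourier u w))\<^sup>2"] show ?thesis by simp
  qed
  have "(\<integral>\<^sup>+w. ennreal ((norm (fourier u w))\<^sup>2) \<partial>lborel) =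
      (\<integral>\<^sup>+w. liminf (\<lambda>n. ennreal ((norm (fourier u w))\<^sup>2 * gauss (1 / real (Suc n)) w)) \<partial>lborel)"
    by (intro nn_integral_cong lim_imp_Liminf[symmetric] tendsto_ennrealI lim) simp
  also have "\<dots> \<le> liminf (\<lambda>n. \<integral>\<^sup>+w. ennreal ((norm (fourier u w))\<^sup>2 * gauss (1 / real (Suc n)) w) \<partial>lborel)"
    by (rule nn_integral_liminf) measurable
  also have "\<dots> \<le> liminf (\<lambda>n::nat. ennreal ((L2_norm u)\<^sup>2))"
    by (intro Liminf_mono always_eventually allI fourier_gauss_bound u1 u2) simp
  also have "\<dots> = ennreal ((L2_norm u)\<^sup>2)" by (simp add: Liminf_const)
  finally show "(\<integral>\<^sup>+w. ennreal ((norm (fourier u w))\<^sup>2) \<partial>lborel) \<le> ennreal ((L2_norm u)\<^sup>2)" .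
qed

text \<open>Parseval's relation against a test function. For the integrable approximants it is
  \<open>Fubini_kernel\<close>; both sides are continuous along the L2 limits, and
  \<open>fourier_L2\<close> places the approximating transforms in \<open>L2\<close>.\<close>

lemma is_L2_fourier_inner:
  fixes f g h :: "real ^ 'd::finite \<Rightarrow> complex"
  assumes fg: "is_L2_fourier f g" and h: "h \<in> L2" "integrable lborel h" and H: "inv_fourier h \<in> L2"
  shows "(LINT x|lborel. f x * cnj (inv_fourier h x)) = (LINT w|lborel. g w * cnj (h w))"
proof -
  obtain u where f: "f \<in> L2" and g: "g \<in> L2" and u: "\<And>n. u n \<in> L2" "\<And>n. integrable lborel (u n)"
    and uf: "L2_limit u f" and ug: "L2_limit (\<lambda>n. fourier (u n)) g"
    using fg unfolding is_L2_fourier_def by blast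
  have hc: "integrable lborel (\<lambda>w. cnj (h w))" using h by simp
  have eq: "(LINT x|lborel. u n x * cnj (inv_fourier h x)) = (LINT w|lborel. fourier (u n) w * cnj (h w))" for n
  proof -
    have "cnj (inv_fourier h x) = (LINT w|lborel. cnj (h w) * chr (- w) x)" for x
      unfolding inv_fourier_def Bochner_Integration.integral_cnj[symmetric] by simp
    then have "(LINT x|lborel. u n x * cnj (inv_fourier h x)) =
        (LINT x|lborel. u n x * (LINT w|lborel. cnj (h w) * chr (- w) x))" by simp
    also have "\<dots> = (LINT w|lborel. cnj (h w) * (LINT x|lborel. u n x * chr (- w) x))"
      by (rule Fubini_kernel[OF u(2) hc, symmetric]) auto
    finally show ?thesis by (simp add: fourier_eq mult.commute)
  qed
  have "(\<lambda>n. LINT x|lborel. u n x * cnj (inv_fourier h x)) \<longlonglongrightarrow> (LINT x|lborel. f x * cnj (inv_fourier h x))"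
    by (rule tendsto_L2_inner[OF u(1) f H uf])
  moreover have "(\<lambda>n. LINT w|lborel. fourier (u n) w * cnj (h w)) \<longlonglongrightarrow> (LINT w|lborel. g w * cnj (h w))"
    by (rule tendsto_L2_inner[OF fourier_L2[OF u(2,1)] g h(1) ug])
  ultimately show ?thesis unfolding eq by (rule LIMSEQ_unique)
qed

section \<open>Uniqueness and inversion of the Fourier transform\<close>

lemma nn_integral_scale:
  fixes f :: "real ^ 'd::finite \<Rightarrow> ennreal"
  assumes "f \<in> borel_measurable borel" "0 < c"
  shows "(\<integral>\<^sup>+x. f x \<partial>lborel) = ennreal (c ^ CARD('d)) * (\<integral>\<^sup>+x. f (c *\<^sub>R x) \<partial>lborel)"
proof -
  note [measurable] = assms(1)
  have "(\<integral>\<^sup>+x. f x \<partial>lborel) = (\<integral>\<^sup>+x. f x \<partial>density (distr lborel borel (\<lambda>x. 0 + c *\<^sub>R x)) (\<lambda>_. ennreal (\<bar>c\<bar> ^ DIM(real ^ 'd))))"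
    using lborel_affine[of c "0 :: real ^ 'd"] assms(2) by simp
  also have "\<dots> = ennreal (c ^ CARD('d)) * (\<integral>\<^sup>+x. f (c *\<^sub>R x) \<partial>lborel)"
    using assms(2) by (simp add: nn_integral_density nn_integral_distr nn_integral_cmult)
  finally show ?thesis .
qed

lemma integral_scale:
  fixes f :: "real ^ 'd::finite \<Rightarrow> complex"
  assumes f: "integrable lborel f" and c: "0 < c"
  shows "integrable lborel (\<lambda>x. f (c *\<^sub>R x))"
    and "(LINT x|lborel. f x) = c ^ CARD('d) *\<^sub>R (LINT x|lborel. f (c *\<^sub>R x))"
proof -
  have [measurable]: "f \<in> borel_measurable borel" using f by (auto dest: borel_measurable_integrable)
  have "(\<integral>\<^sup>+x. ennreal (norm (f (c *\<^sub>R x))) \<partial>lborel) \<noteq> \<infinity>"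
  proof
    assume "(\<integral>\<^sup>+x. ennreal (norm (f (c *\<^sub>R x))) \<partial>lborel) = \<infinity>"
    then have "(\<integral>\<^sup>+x. ennreal (norm (f x)) \<partial>lborel) = \<infinity>"
      using nn_integral_scale[of "\<lambda>x. ennreal (norm (f x))" c] c by (simp add: ennreal_mult_eq_top_iff)
    then show False using f by (simp add: integrable_iff_bounded)
  qed
  then show "integrable lborel (\<lambda>x. f (c *\<^sub>R x))"
    by (intro integrableI_bounded) (auto simp: less_top)
  have "(LINT x|lborel. f x) = (LINT x|density (distr lborel borel (\<lambda>x. 0 + c *\<^sub>R x)) (\<lambda>_. ennreal (\<bar>c\<bar> ^ DIM(real ^ 'd))). f x)"
    using lborel_affine[of c "0 :: real ^ 'd"] c by simp
  also have "\<dots> = c ^ CARD('d) *\<^sub>R (LINT x|lborel. f (c *\<^sub>R x))"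
    using c by (subst integral_density) (simp_all add: integral_distr)
  finally show "(LINT x|lborel. f x) = c ^ CARD('d) *\<^sub>R (LINT x|lborel. f (c *\<^sub>R x))" .
qed

lemma ex_lat_0: "\<exists>n0. lat n0 = (0 :: real ^ 'd::finite)"
  using lat_surj[OF int_lattice_0] by metis

text \<open>If all integrals of \<open>E\<close> against characters vanish, so do the Fourier coefficients of the
  periodization of \<open>E\<close>. Hence the mass of \<open>E\<close> on the cube is at most the mass off the cube, and
  this remains true after rescaling \<open>E\<close>.\<close>

lemma cube_mass_le:
  fixes E :: "real ^ 'd::finite \<Rightarrow> complex"
  assumes E: "integrable lborel E"
    and z: "\<And>a. (LINT x|lborel. E x * chr a x) = 0"
  shows "(\<integral>\<^sup>+x. ennreal (norm (E x)) \<partial>lborel) \<le> 2 * (\<integral>\<^sup>+x. ennreal (norm (E x)) * indicator (- unit_cube) x \<partial>lborel)"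
proof -
  have [measurable]: "E \<in> borel_measurable borel" using E by (auto dest: borel_measurable_integrable)
  define P where "P x = (\<Sum>n. E (x + lat n))" for x
  have "AE x in cube_measure. P x = 0"
  proof (rule cube_L1_unique)
    show "integrable cube_measure P" unfolding P_def by (rule integral_periodize(2)[OF E])
    fix l :: "real ^ 'd" assume l: "l \<in> int_lattice"
    have El: "integrable lborel (\<lambda>x. E x * chr l x)" by (rule integrable_chr_mult(2)[OF E])
    \<comment> \<open>The character of l is constant on cosets of the lattice, so it can be moved
      inside the periodization.\<close>
    have "(LINT x|cube_measure. P x * chr l x) = (LINT x|cube_measure. (\<Sum>n. E (x + lat n) * chr l (x + lat n)))"
    proof (rule integral_cong_AE)
      show "AE x in cube_measure. P x * chr l x = (\<Sum>n. E (x + lat n) * chr l (x + lat n))"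
        using integral_periodize(1)[OF E]
      proof eventually_elim
        case (elim x)
        then have "summable (\<lambda>n. E (x + lat n))" by (rule summable_norm_cancel)
        then have "P x * chr l x = (\<Sum>n. E (x + lat n) * chr l x)" unfolding P_def by (rule suminf_mult2)
        then show ?case using l by (simp add: chr_add_right)
      qed
      show "(\<lambda>x. P x * chr l x) \<in> borel_measurable cube_measure"
        using borel_measurable_integrable[OF integral_periodize(2)[OF E]] unfolding P_def by measurable
      show "(\<lambda>x. \<Sum>n. E (x + lat n) * chr l (x + lat n)) \<in> borel_measurable cube_measure"
        by (rule borel_measurable_integrable[OF integral_periodize(2)[OF El]])
    qed
    then show "(LINT x|cube_measure. P x * chr l x) = 0" using integral_periodize(3)[OF El] z by simp
  qed
  obtain n0 where n0: "lat n0 = (0 :: real ^ 'd)" using ex_lat_0 by blast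
  let ?e = "\<lambda>n x. ennreal (norm (E (x + lat n)))"
  have split: "(\<Sum>n. ?e n x) = ?e n0 x + (\<Sum>n. if n = n0 then 0 else ?e n x)" for x
  proof -
    have "(\<Sum>n. ?e n x) = (\<Sum>n. (if n = n0 then ?e n0 x else 0) + (if n = n0 then 0 else ?e n x))"
      by (intro arg_cong[where f = suminf] ext) auto
    also have "\<dots> = (\<Sum>n. if n = n0 then ?e n0 x else 0) + (\<Sum>n. if n = n0 then 0 else ?e n x)"
      by (intro suminf_add[symmetric]) auto
    also have "(\<Sum>n. if n = n0 then ?e n0 x else 0) = ?e n0 x"
      using sums_single[of n0 "\<lambda>_. ?e n0 x"] by (simp add: sums_iff)
    finally show ?thesis .
  qed
  \<comment> \<open>Since the periodization vanishes, the value at x is minus the sum of the values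
    at the other translates of x.\<close>
  have le: "AE x in cube_measure. ?e n0 x \<le> (\<Sum>n. if n = n0 then 0 else ?e n x)"
    using \<open>AE x in cube_measure. P x = 0\<close> integral_periodize(1)[OF E]
  proof eventually_elim
    case (elim x)
    have s: "summable (\<lambda>n. E (x + lat n))" using elim(2) by (rule summable_norm_cancel)
    let ?r = "\<lambda>n. if n = n0 then 0 else E (x + lat n)"
    have nr: "summable (\<lambda>n. norm (?r n))"
      by (rule summable_comparison_test'[OF elim(2)]) auto
    have "(\<lambda>n. (if n = n0 then E (x + lat n0) else 0) + ?r n) sums (E (x + lat n0) + (\<Sum>n. ?r n))"
      by (intro sums_add sums_single summable_sums summable_norm_cancel[OF nr])
    moreover have "(\<lambda>n. (if n = n0 then E (x + lat n0) else 0) + ?r n) = (\<lambda>n. E (x + lat n))" by auto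
    ultimately have "E (x + lat n0) = - (\<Sum>n. ?r n)"
      using elim(1) by (simp add: P_def sums_iff eq_neg_iff_add_eq_0)
    then have "norm (E (x + lat n0)) \<le> (\<Sum>n. norm (?r n))"
      using summable_norm[OF nr] by simp
    then have "?e n0 x \<le> ennreal (\<Sum>n. norm (?r n))" by (rule ennreal_leI)
    also have "\<dots> = (\<Sum>n. ennreal (norm (?r n)))" by (intro suminf_ennreal2[symmetric] nr) simp
    also have "\<dots> = (\<Sum>n. if n = n0 then 0 else ?e n x)" by (intro arg_cong[where f = suminf] ext) simp
    finally show ?case .
  qed
  have off: "(\<integral>\<^sup>+x. (\<Sum>n. if n = n0 then 0 else ?e n x) \<partial>cube_measure) =
      (\<integral>\<^sup>+x. ennreal (norm (E x)) * indicator (- unit_cube) x \<partial>lborel)"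
  proof -
    have "AE x in (lborel :: (real^'d) measure). \<forall>j. \<bar>x $ j\<bar> \<noteq> 1 / 2" by (rule AE_boundary_unit_cube)
    then have "AE x in (cube_measure :: (real^'d) measure). \<forall>n. (x + lat n \<in> unit_cube \<longleftrightarrow> n = n0)"
      unfolding AE_cube_measure
    proof eventually_elim
      case (elim x)
      show ?case
      proof (intro impI allI)
        fix n assume x: "x \<in> unit_cube"
        show "x + lat n \<in> unit_cube \<longleftrightarrow> n = n0"
        proof
          assume "n = n0" then show "x + lat n \<in> unit_cube" using x n0 by simp
        next
          assume c: "x + lat n \<in> unit_cube"
          have "lat n $ j = 0" for j :: 'd
          proof -
            have "lat n $ j \<in> \<int>" using lat_in[of n] unfolding int_lattice_def by blast
            then obtain z :: int where z: "lat n $ j = of_int z" by (auto elim: Ints_cases)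
            have "- 1 / 2 \<le> (x + lat n) $ j \<and> (x + lat n) $ j \<le> 1 / 2" using c unfolding mem_unit_cube by blast
            moreover have "- 1 / 2 \<le> x $ j \<and> x $ j \<le> 1 / 2" using x unfolding mem_unit_cube by blast
            moreover have "\<bar>x $ j\<bar> \<noteq> 1 / 2" using elim by blast
            ultimately have "\<bar>of_int z :: real\<bar> < 1" using z unfolding vector_add_component by linarith
            then have "z = 0" by linarith
            then show ?thesis using z by simp
          qed
          then have "lat n = (lat n0 :: real ^ 'd)" unfolding n0 vec_eq_iff by simp
          then show "n = n0" by simp
        qed
      qed
    qed
    then have "AE x in cube_measure. (\<Sum>n. if n = n0 then 0 else ?e n x) = (\<Sum>n. ?e n x * indicator (- unit_cube) (x + lat n))"
    proof eventually_elim
      case (elim x)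
      then have "(if n = n0 then 0 else ?e n x) = ?e n x * indicator (- unit_cube) (x + lat n)" for n by simp
      then show ?case by simp
    qed
    then have "(\<integral>\<^sup>+x. (\<Sum>n. if n = n0 then 0 else ?e n x) \<partial>cube_measure) =
        (\<integral>\<^sup>+x. (\<Sum>n. ?e n x * indicator (- unit_cube) (x + lat n)) \<partial>cube_measure)"
      by (rule nn_integral_cong_AE)
    also have "\<dots> = (\<integral>\<^sup>+x. ennreal (norm (E x)) * indicator (- unit_cube) x \<partial>lborel)"
      by (rule nn_integral_periodize[symmetric]) measurable
    finally show ?thesis .
  qed
  have "(\<integral>\<^sup>+x. ennreal (norm (E x)) \<partial>lborel) = (\<integral>\<^sup>+x. (\<Sum>n. ?e n x) \<partial>cube_measure)"
    by (rule nn_integral_periodize) measurable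
  also have "\<dots> \<le> (\<integral>\<^sup>+x. 2 * (\<Sum>n. if n = n0 then 0 else ?e n x) \<partial>cube_measure)"
    using le by (intro nn_integral_mono_AE) (auto simp: split mult_2 elim!: eventually_mono intro: add_right_mono)
  also have "\<dots> = 2 * (\<integral>\<^sup>+x. (\<Sum>n. if n = n0 then 0 else ?e n x) \<partial>cube_measure)"
    by (rule nn_integral_cmult) measurable
  finally show ?thesis unfolding off .
qed

text \<open>Applied to E(c x) with c = n + 1, \<open>cube_mass_le\<close> bounds the total mass by
  twice the mass outside a cube of side n + 1, which tends to 0. The dilates qualify because the
  hypothesis covers all real frequencies.\<close>

lemma fourier_L1_unique:
  fixes E :: "real ^ 'd::finite \<Rightarrow> complex"
  assumes E: "integrable lborel E"
    and z: "\<And>a. (LINT x|lborel. E x * chr a x) = 0"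
  shows "AE x in lborel. E x = 0"
proof -
  have [measurable]: "E \<in> borel_measurable borel" using E by (auto dest: borel_measurable_integrable)
  define I where "I = (\<integral>\<^sup>+x. ennreal (norm (E x)) \<partial>lborel)"
  define J where "J n = (LINT x|lborel. norm (E x) * indicator (- unit_cube) ((1 / real (Suc n)) *\<^sub>R x))" for n
  have ij: "integrable lborel (\<lambda>x. norm (E x) * indicator (- unit_cube) ((1 / real (Suc n)) *\<^sub>R x))" for n
    by (rule Bochner_Integration.integrable_bound[OF E]) (auto simp: indicator_def)
  have le: "I \<le> ennreal (2 * J n)" for n
  proof -
    let ?c = "real (Suc n)"
    have c: "0 < ?c" by simp
    have "(LINT x|lborel. E (?c *\<^sub>R x) * chr a x) = 0" for a
    proof -
      have "integrable lborel (\<lambda>x. E x * chr (inverse ?c *\<^sub>R a) x)" by (rule integrable_chr_mult(2)[OF E])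
      from integral_scale(2)[OF this c] have "(LINT x|lborel. E (?c *\<^sub>R x) * chr (inverse ?c *\<^sub>R a) (?c *\<^sub>R x)) = 0"
        using z by (simp del: of_nat_Suc)
      moreover have "chr (inverse ?c *\<^sub>R a) (?c *\<^sub>R x) = chr a x" for x
      proof -
        have "?c * (inverse ?c * (a \<bullet> x)) = a \<bullet> x" unfolding mult.assoc[symmetric] by simp
        then show ?thesis by (simp only: chr_def inner_scaleR_left inner_scaleR_right)
      qed
      ultimately show ?thesis by simp
    qed
    from cube_mass_le[OF integral_scale(1)[OF E c] this]
    have "(\<integral>\<^sup>+x. ennreal (norm (E (?c *\<^sub>R x))) \<partial>lborel) \<le>
        2 * (\<integral>\<^sup>+x. ennreal (norm (E (?c *\<^sub>R x))) * indicator (- unit_cube) x \<partial>lborel)" .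
    then have "ennreal (?c ^ CARD('d)) * (\<integral>\<^sup>+x. ennreal (norm (E (?c *\<^sub>R x))) \<partial>lborel) \<le>
        2 * (ennreal (?c ^ CARD('d)) * (\<integral>\<^sup>+x. ennreal (norm (E (?c *\<^sub>R x))) * indicator (- unit_cube) x \<partial>lborel))"
      by (subst mult.left_commute) (rule mult_left_mono, simp_all)
    also have "ennreal (?c ^ CARD('d)) * (\<integral>\<^sup>+x. ennreal (norm (E (?c *\<^sub>R x))) * indicator (- unit_cube) x \<partial>lborel) =
        (\<integral>\<^sup>+x. ennreal (norm (E x)) * indicator (- unit_cube) ((1 / ?c) *\<^sub>R x) \<partial>lborel)"
      using nn_integral_scale[of "\<lambda>x. ennreal (norm (E x)) * indicator (- unit_cube) ((1 / ?c) *\<^sub>R x)" ?c] c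
      by (simp del: of_nat_Suc)
    also have "\<dots> = (\<integral>\<^sup>+x. ennreal (norm (E x) * indicator (- unit_cube) ((1 / ?c) *\<^sub>R x)) \<partial>lborel)"
      by (intro nn_integral_cong) (simp add: indicator_def del: of_nat_Suc)
    also have "\<dots> = ennreal (J n)"
      unfolding J_def by (intro nn_integral_eq_integral ij) simp
    also have "ennreal (?c ^ CARD('d)) * (\<integral>\<^sup>+x. ennreal (norm (E (?c *\<^sub>R x))) \<partial>lborel) = I"
      unfolding I_def using c by (intro nn_integral_scale[symmetric]) measurable
    finally show ?thesis by (simp add: ennreal_mult' J_def)
  qed
  have "J \<longlonglongrightarrow> (LINT x|(lborel :: (real^'d) measure). 0)"
    unfolding J_def
  proof (rule integral_dominated_convergence[where w = "\<lambda>x. norm (E x)"])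
    show "AE x in lborel. (\<lambda>n. norm (E x) * indicator (- unit_cube) ((1 / real (Suc n)) *\<^sub>R x)) \<longlonglongrightarrow> 0"
    proof (rule AE_I2)
      fix x :: "real ^ 'd"
      have "(1 / real (Suc n)) *\<^sub>R x \<in> unit_cube" if n: "2 * norm x \<le> real n" for n
        unfolding mem_unit_cube
      proof
        fix j
        have "\<bar>x $ j\<bar> \<le> norm x" by (rule component_le_norm_cart)
        then have "2 * \<bar>x $ j\<bar> \<le> real (Suc n)" using n by simp
        then have "\<bar>x $ j / real (Suc n)\<bar> \<le> 1 / 2" by (simp add: abs_div_pos[symmetric] pos_divide_le_eq del: of_nat_Suc)
        then show "- 1 / 2 \<le> ((1 / real (Suc n)) *\<^sub>R x) $ j \<and> ((1 / real (Suc n)) *\<^sub>R x) $ j \<le> 1 / 2"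
        proof -
          have "((1 / real (Suc n)) *\<^sub>R x) $ j = x $ j / real (Suc n)" by simp
          then show ?thesis using \<open>\<bar>x $ j / real (Suc n)\<bar> \<le> 1 / 2\<close> by linarith
        qed
      qed
      then have "\<forall>\<^sub>F n in sequentially. norm (E x) * indicator (- unit_cube) ((1 / real (Suc n)) *\<^sub>R x) = 0"
        using eventually_ge_at_top[of "nat \<lceil>2 * norm x\<rceil>"]
        by (elim eventually_mono) (auto simp: nat_le_iff ceiling_le_iff indicator_def)
      then show "(\<lambda>n. norm (E x) * indicator (- unit_cube) ((1 / real (Suc n)) *\<^sub>R x)) \<longlonglongrightarrow> 0"
        by (rule tendsto_eventually)
    qed
    show "AE x in lborel. norm (norm (E x) * indicator (- unit_cube) ((1 / real (Suc n)) *\<^sub>R x)) \<le> norm (E x)" for n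
      by (intro AE_I2) (simp add: indicator_def)
  qed (use E in auto)
  then have "(\<lambda>n. ennreal (2 * J n)) \<longlonglongrightarrow> ennreal (2 * 0)" by (intro tendsto_intros tendsto_ennrealI) simp
  then have "I \<le> ennreal (2 * 0)" using le by (intro LIMSEQ_le_const) auto
  then have "I = 0" by simp
  then show ?thesis unfolding I_def by (subst (asm) nn_integral_0_iff_AE) auto
qed

text \<open>Both sides have the same integrals against a Gaussian times any character: the inverse
  transform of a translated Gaussian is a modulated Gaussian, so \<open>is_L2_fourier_inner\<close>
  computes the integral of f. The Gaussian makes the difference integrable, and
  \<open>fourier_L1_unique\<close> applies.\<close>

lemma fourier_inversion:
  fixes f g :: "real ^ 'd::finite \<Rightarrow> complex"
  assumes fg: "is_L2_fourier f g" and g: "integrable lborel g"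
  shows "AE x in lborel. f x = inv_fourier g x"
proof -
  have f2: "f \<in> L2" and g2: "g \<in> L2" using fg by (auto simp: is_L2_fourier_def)
  note [measurable] = L2_borel[OF f2] L2_borel[OF g2] inv_fourier_borel[OF g]
  have g1: "integrable lborel (\<lambda>x. complex_of_real (gauss 1 (x :: real^'d)))"
    using gauss_integrable[of 1] by (intro integrable_of_real) simp
  have gL2: "(\<lambda>x. complex_of_real (gauss 1 (x :: real^'d)) * chr a x) \<in> L2" for a by (rule gauss_L2) simp
  have i1: "integrable lborel (\<lambda>x. f x * cnj (of_real (gauss 1 x) * chr a x))" for a
    by (rule L2_mult_integrable(1)[OF f2 L2_cnj[OF gL2]])
  have i2: "integrable lborel (\<lambda>x. inv_fourier g x * cnj (of_real (gauss 1 x) * chr a x))" for a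
  proof (rule Bochner_Integration.integrable_bound)
    show "integrable lborel (\<lambda>x. (LINT w|lborel. norm (g w)) * gauss 1 (x :: real^'d))"
      using gauss_integrable[of 1] by (intro integrable_mult_right) simp
    show "AE x in lborel. norm (inv_fourier g x * cnj (of_real (gauss 1 x) * chr a x)) \<le>
        norm ((LINT w|lborel. norm (g w)) * gauss 1 x)"
      using norm_inv_fourier_le[OF g] by (intro AE_I2) (simp add: norm_mult abs_mult mult_right_mono)
  qed measurable
  have eq: "(LINT x|lborel. f x * cnj (of_real (gauss 1 x) * chr a x)) =
      (LINT x|lborel. inv_fourier g x * cnj (of_real (gauss 1 x) * chr a x))" for a
  proof -
    define h where "h w = complex_of_real (gauss 1 (w - a))" for w
    have h1: "integrable lborel h"
      using g1 lborel_integrable_translate[of "\<lambda>x. complex_of_real (gauss 1 x)" "- a"] by (simp add: h_def[abs_def])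
    have h2: "h \<in> L2"
      using L2_translate(1)[OF gL2[of 0], of "- a"] by (simp add: h_def[abs_def])
    have H: "inv_fourier h x = of_real (gauss 1 x) * chr a x" for x
    proof -
      have "inv_fourier h x = (LINT w|lborel. of_real (gauss 1 w) * chr (w + a) x)"
        using lborel_integral_translate[of "\<lambda>w. h w * chr w x" a] by (simp add: inv_fourier_def h_def)
      also have "\<dots> = (LINT w|lborel. of_real (gauss 1 w) * chr x w * chr a x)"
        by (simp add: chr_add_left mult.assoc chr_commute[of x])
      also have "\<dots> = of_real (gauss 1 x) * chr a x"
        using integral_gaussian(2)[of 1 x] by simp
      finally show ?thesis .
    qed
    have "(LINT x|lborel. f x * cnj (inv_fourier h x)) = (LINT w|lborel. g w * cnj (h w))"
      using gL2[of a] by (intro is_L2_fourier_inner[OF fg h2 h1]) (simp add: H[abs_def])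
    also have "\<dots> = (LINT w|lborel. g w * (LINT x|lborel. cnj (of_real (gauss 1 x) * chr a x) * chr w x))"
    proof (intro Bochner_Integration.integral_cong refl arg_cong2[of _ _ _ _ "(*)"])
      fix w
      have "(LINT x|lborel. cnj (of_real (gauss 1 x) * chr a x) * chr w x) =
          (LINT x|lborel. of_real (gauss 1 x) * chr (w - a) x)"
        by (simp add: chr_add_left[of w "- a", simplified] mult_ac)
      also have "\<dots> = cnj (h w)" using integral_gaussian(2)[of 1 "w - a"] by (simp add: h_def)
      finally show "cnj (h w) = (LINT x|lborel. cnj (of_real (gauss 1 x) * chr a x) * chr w x)" ..
    qed
    also have "\<dots> = (LINT x|lborel. cnj (of_real (gauss 1 x) * chr a x) * (LINT w|lborel. g w * chr w x))"
    proof (rule Fubini_kernel[OF _ g])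
      show "integrable lborel (\<lambda>x. cnj (complex_of_real (gauss 1 x) * chr a x))"
        using integrable_chr_mult(2)[OF g1, of a] by (simp only: integrable_cnj)
    qed auto
    also have "\<dots> = (LINT x|lborel. inv_fourier g x * cnj (of_real (gauss 1 x) * chr a x))"
      by (simp only: inv_fourier_def mult.commute)
    finally show ?thesis by (simp add: H)
  qed
  have "AE x in lborel. (f x - inv_fourier g x) * of_real (gauss 1 x) = 0"
  proof (rule fourier_L1_unique)
    show "integrable lborel (\<lambda>x. (f x - inv_fourier g x) * of_real (gauss 1 x))"
      using Bochner_Integration.integrable_diff[OF i1[of 0] i2[of 0]] by (simp add: left_diff_distrib)
    fix a :: "real ^ 'd"
    have "(LINT x|lborel. (f x - inv_fourier g x) * of_real (gauss 1 x) * chr a x) =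
        (LINT x|lborel. f x * cnj (of_real (gauss 1 x) * chr (- a) x) - inv_fourier g x * cnj (of_real (gauss 1 x) * chr (- a) x))"
      by (intro Bochner_Integration.integral_cong refl) (simp add: algebra_simps)
    also have "\<dots> = 0"
      using i1[of "- a"] i2[of "- a"] eq[of "- a"] by (subst Bochner_Integration.integral_diff) auto
    finally show "(LINT x|lborel. (f x - inv_fourier g x) * of_real (gauss 1 x) * chr a x) = 0" .
  qed
  then show ?thesis
  proof eventually_elim
    case (elim x)
    then show ?case using gauss_pos[of 1 x] by simp
  qed
qed


text \<open>Modulating the approximants translates their transforms by a; both operations preserve
  L2 distances.\<close>

lemma is_L2_fourier_modulate:
  fixes f g h :: "real ^ 'd::finite \<Rightarrow> complex"
  assumes fg: "is_L2_fourier f g" and h: "h \<in> L2" and hf: "AE x in lborel. h x = chr a x * f x"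
  shows "is_L2_fourier h (\<lambda>w. g (w - a))"
proof -
  obtain u where f: "f \<in> L2" and g: "g \<in> L2" and u: "\<And>n. u n \<in> L2" "\<And>n. integrable lborel (u n)"
    and uf: "L2_limit u f" and ug: "L2_limit (\<lambda>n. fourier (u n)) g"
    using fg unfolding is_L2_fourier_def by blast
  note [measurable] = L2_borel[OF f] L2_borel[OF h] L2_borel[OF u(1)]
  define v where "v n x = chr a x * u n x" for n x
  have [measurable]: "v n \<in> borel_measurable borel" for n unfolding v_def by measurable
  have v1: "integrable lborel (v n)" for n
    unfolding v_def using integrable_chr_mult(2)[OF u(2)[of n], of a] by (simp add: mult.commute)
  have v2: "v n \<in> L2" for n
    using L2_integrable[OF u(1)[of n]] by (simp add: L2_iff v_def norm_mult)
  have "L2_norm (\<lambda>x. v n x - h x) = L2_norm (\<lambda>x. u n x - f x)" for n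
    unfolding L2_norm_def
  proof (intro arg_cong[where f = sqrt] integral_cong_AE)
    show "AE x in lborel. (norm (v n x - h x))\<^sup>2 = (norm (u n x - f x))\<^sup>2"
      using hf
    proof eventually_elim
      case (elim x)
      then have "v n x - h x = chr a x * (u n x - f x)" by (simp add: v_def algebra_simps)
      then show ?case by (simp add: norm_mult)
    qed
  qed measurable
  then have vh: "L2_limit v h" using uf by (simp add: L2_limit_def)
  have F: "fourier (v n) w = fourier (u n) (w - a)" for n w
    unfolding fourier_eq v_def using chr_add_left[of a "- w"] by (simp add: mult.assoc mult.left_commute)
  have "L2_norm (\<lambda>w. fourier (u n) (w + - a) - g (w + - a)) = L2_norm (\<lambda>w. fourier (u n) w - g w)" for n
    by (rule L2_translate(2)[OF L2_diff[OF fourier_L2[OF u(2,1)] g]])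
  then have "L2_limit (\<lambda>n. fourier (v n)) (\<lambda>w. g (w - a))"
    using ug by (simp add: L2_limit_def F)
  moreover have "(\<lambda>w. g (w - a)) \<in> L2" using L2_translate(1)[OF g, of "- a"] by simp
  ultimately show ?thesis unfolding is_L2_fourier_def using h v1 v2 vh by blast
qed

text \<open>The mass of g is the integral of its periodized modulus over a cube of measure
  1.\<close>

lemma integrable_if_periodization_bounded:
  fixes g :: "real ^ 'd::finite \<Rightarrow> complex"
  assumes [measurable]: "g \<in> borel_measurable borel"
    and C: "AE w in cube_measure. (\<Sum>n. ennreal (norm (g (w + lat n)))) \<le> ennreal C"
  shows "integrable lborel g"
proof (rule integrableI_bounded)
  have "(\<integral>\<^sup>+w. ennreal (norm (g w)) \<partial>lborel) = (\<integral>\<^sup>+w. (\<Sum>n. ennreal (norm (g (w + lat n)))) \<partial>cube_measure)"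
    by (rule nn_integral_periodize) measurable
  also have "\<dots> \<le> (\<integral>\<^sup>+w. ennreal C \<partial>(cube_measure :: (real^'d) measure))"
    using C by (rule nn_integral_mono_AE)
  also have "\<dots> = ennreal C * emeasure (cube_measure :: (real^'d) measure) (space cube_measure)"
    by (rule nn_integral_const)
  also have "\<dots> < \<infinity>" unfolding cube.emeasure_space_1 by simp
  finally show "(\<integral>\<^sup>+w. ennreal (norm (g w)) \<partial>lborel) < \<infinity>" .
qed measurable

text \<open>Orthonormality of the translates says that the periodization of \<open>g i * cnj (g j)\<close> has the
  Fourier coefficients of a constant.\<close>

lemma periodized_product_eq:
  fixes f1 f2 g1 g2 :: "real ^ 'd::finite \<Rightarrow> complex"
  assumes fg1: "is_L2_fourier f1 g1" and fg2: "is_L2_fourier f2 g2" and g2: "integrable lborel g2"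
    and orth: "\<And>l. l \<in> int_lattice \<Longrightarrow> (LINT x|lborel. f1 x * cnj (f2 (x - l))) = (if l = 0 then c else 0)"
  shows "AE w in cube_measure. (\<Sum>n. g1 (w + lat n) * cnj (g2 (w + lat n))) = c"
proof -
  have L: "f1 \<in> L2" "g1 \<in> L2" "f2 \<in> L2" "g2 \<in> L2"
    using fg1 fg2 by (auto simp: is_L2_fourier_def)
  note [measurable] = L2_borel[OF L(1)] L2_borel[OF L(2)] L2_borel[OF L(3)] L2_borel[OF L(4)]
  have inv: "AE x in lborel. f2 x = inv_fourier g2 x" by (rule fourier_inversion[OF fg2 g2])
  define q where "q w = g1 w * cnj (g2 w)" for w
  have qi: "integrable lborel q" unfolding q_def by (intro L2_mult_integrable(1) L2_cnj L)
  have qc: "(LINT w|lborel. q w * chr l w) = (if l = 0 then c else 0)" if l: "l \<in> int_lattice" for l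
  proof -
    \<comment> \<open>\<open>h\<close> is the transform of the translate of f2 by l, so the
      hypothesis \<open>orth\<close> gives the integral of \<open>q\<close> against the character of
      l.\<close>
    define h where "h w = g2 w * chr (- l) w" for w
    have h1: "integrable lborel h" unfolding h_def by (rule integrable_chr_mult(4)[OF g2])
    have [measurable]: "h \<in> borel_measurable borel" unfolding h_def[abs_def] by measurable
    have h2: "h \<in> L2" using L2_integrable[OF L(4)] by (simp add: L2_iff h_def norm_mult)
    have H: "inv_fourier h x = inv_fourier g2 (x - l)" for x
    proof -
      have "h w * chr w x = g2 w * chr w (x - l)" for w
        using chr_add_right[of w x "- l"] by (simp add: h_def chr_commute[of "- l"] mult_ac)
      then show ?thesis by (simp add: inv_fourier_def)
    qed
    have "AE x in distr lborel borel ((+) (- l)). f2 x = inv_fourier g2 x"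
      unfolding lborel_distr_plus by (rule inv)
    then have ae: "AE x in lborel. f2 (x - l) = inv_fourier h x"
      unfolding H using inv_fourier_borel[OF g2]
      by (subst (asm) AE_distr_iff) (auto simp: algebra_simps)
    have "(\<lambda>x. f2 (x - l)) \<in> L2" using L2_translate(1)[OF L(3), of "- l"] by simp
    then have HL: "inv_fourier h \<in> L2"
      by (rule L2_cong_AE(1)[OF _ ae inv_fourier_borel[OF h1]])
    have "(LINT w|lborel. q w * chr l w) = (LINT w|lborel. g1 w * cnj (h w))"
      by (simp add: q_def h_def mult.assoc)
    also have "\<dots> = (LINT x|lborel. f1 x * cnj (inv_fourier h x))"
      by (rule is_L2_fourier_inner[OF fg1 h2 h1 HL, symmetric])
    also have "\<dots> = (LINT x|lborel. f1 x * cnj (f2 (x - l)))"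
      using ae L2_borel[OF HL] by (intro integral_cong_AE) auto
    finally show ?thesis using orth[OF l] by simp
  qed
  define D where "D w = (\<Sum>n. q (w + lat n)) - c" for w
  have "AE w in cube_measure. D w = 0"
  proof (rule cube_L1_unique)
    show "integrable cube_measure D"
      unfolding D_def by (intro Bochner_Integration.integrable_diff integral_periodize(2) qi) simp
    fix l :: "real ^ 'd" assume l: "l \<in> int_lattice"
    have ql: "integrable lborel (\<lambda>w. q w * chr l w)" by (rule integrable_chr_mult(2)[OF qi])
    have "(LINT w|cube_measure. D w * chr l w) =
        (LINT w|cube_measure. (\<Sum>n. q (w + lat n) * chr l (w + lat n)) - c * chr l w)"
    proof (rule integral_cong_AE)
      show "AE w in cube_measure. D w * chr l w = (\<Sum>n. q (w + lat n) * chr l (w + lat n)) - c * chr l w"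
        using integral_periodize(1)[OF qi]
      proof eventually_elim
        case (elim w)
        then have "summable (\<lambda>n. q (w + lat n))" by (rule summable_norm_cancel)
        then have "(\<Sum>n. q (w + lat n)) * chr l w = (\<Sum>n. q (w + lat n) * chr l w)" by (rule suminf_mult2)
        then show ?case using l by (simp add: chr_add_right D_def left_diff_distrib)
      qed
      show "(\<lambda>w. D w * chr l w) \<in> borel_measurable cube_measure"
        using borel_measurable_integrable[OF integral_periodize(2)[OF qi]] unfolding D_def by measurable
      show "(\<lambda>w. (\<Sum>n. q (w + lat n) * chr l (w + lat n)) - c * chr l w) \<in> borel_measurable cube_measure"
        using borel_measurable_integrable[OF integral_periodize(2)[OF ql]] by measurable
    qed
    also have "\<dots> = (LINT w|lborel. q w * chr l w) - c * (LINT w|cube_measure. chr l w)"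
      using integral_periodize(2,3)[OF ql]
      by (subst Bochner_Integration.integral_diff)
        (auto intro!: integrable_mult_right cube_integrable_bounded[of _ 1])
    also have "\<dots> = 0" using l by (simp add: qc integral_chr)
    finally show "(LINT w|cube_measure. D w * chr l w) = 0" .
  qed
  then show ?thesis by eventually_elim (simp add: D_def q_def)
qed

section \<open>The shift-invariant space and its fibers\<close>

lemma borel_measurable_suminf_metric:
  fixes f :: "nat \<Rightarrow> 'a \<Rightarrow> 'b::{banach, second_countable_topology}"
  assumes [measurable]: "\<And>n. f n \<in> borel_measurable M"
  shows "(\<lambda>x. \<Sum>n. f n x) \<in> borel_measurable M"
  unfolding suminf_eq_lim by (rule borel_measurable_lim_metric) measurable

lemma borel_measurable_cube_measure: "f \<in> borel_measurable borel \<Longrightarrow> f \<in> borel_measurable cube_measure"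
  by (simp cong: measurable_cong_sets)

lemma chr_borel: "chr a \<in> borel_measurable borel"
  by (intro borel_measurable_continuous_onI continuous_intros)

text \<open>The Zak transform with the sign of the character reversed, as an ordinary series;
  \<open>zak_chr_shift\<close> relates it to \<open>zak\<close>.\<close>

definition zak_chr :: "(real ^ 'd::finite \<Rightarrow> complex) \<Rightarrow> real ^ 'd \<Rightarrow> real ^ 'd \<Rightarrow> complex" where
  "zak_chr g w x = (\<Sum>n. g (w + lat n) * chr (lat n) x)"

lemma summable_periodization:
  assumes "(\<Sum>n. ennreal (norm (g (w + lat n)))) \<le> ennreal C" and "0 \<le> C"
  shows "summable (\<lambda>n. norm (g (w + lat n)))" "(\<Sum>n. norm (g (w + lat n))) \<le> C"
proof -
  show s: "summable (\<lambda>n. norm (g (w + lat n)))"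
    using assms by (intro summable_suminf_not_top) (auto simp: top_unique)
  have "ennreal (\<Sum>n. norm (g (w + lat n))) = (\<Sum>n. ennreal (norm (g (w + lat n))))"
    by (intro suminf_ennreal2[symmetric] s) simp
  then have "ennreal (\<Sum>n. norm (g (w + lat n))) \<le> ennreal C" using assms(1) by simp
  then show "(\<Sum>n. norm (g (w + lat n))) \<le> C" using assms(2) by (subst (asm) ennreal_le_iff) auto
qed

lemma norm_zak_chr_le:
  assumes "(\<Sum>n. ennreal (norm (g (w + lat n)))) \<le> ennreal C" and "0 \<le> C"
  shows "norm (zak_chr g w x) \<le> C"
proof -
  note s = summable_periodization[OF assms]
  have "norm (zak_chr g w x) \<le> (\<Sum>n. norm (g (w + lat n) * chr (lat n) x))"
    unfolding zak_chr_def using s(1) by (intro summable_norm) (simp add: norm_mult)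
  then show ?thesis using s(2) by (simp add: norm_mult)
qed

lemma zak_chr_borel:
  assumes [measurable]: "g \<in> borel_measurable borel"
  shows "(\<lambda>w. zak_chr g w x) \<in> borel_measurable borel"
  unfolding zak_chr_def by (rule borel_measurable_suminf_metric) measurable

lemma zak_chr_borel_right: "(\<lambda>x. zak_chr g w x) \<in> borel_measurable borel"
  unfolding zak_chr_def by (rule borel_measurable_suminf_metric) measurable

text \<open>Poisson summation: the frequency integral is folded onto the cube, and the characters of
  lattice frequencies do not see the lattice shift of x. The samples on the coset of x are therefore
  Fourier coefficients in w.\<close>

lemma inv_fourier_lattice:
  fixes g :: "real ^ 'd::finite \<Rightarrow> complex"
  assumes g: "integrable lborel g" and l: "l \<in> int_lattice"
  shows "inv_fourier g (x + l) = (LINT w|cube_measure. zak_chr g w x * chr (x + l) w)"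
proof -
  have gc: "integrable lborel (\<lambda>w. g w * chr w (x + l))" by (rule integrable_chr_mult(1)[OF g])
  have "inv_fourier g (x + l) = (LINT w|cube_measure. (\<Sum>n. g (w + lat n) * chr (w + lat n) (x + l)))"
    unfolding inv_fourier_def by (rule integral_periodize(3)[OF gc, symmetric])
  also have "\<dots> = (LINT w|cube_measure. zak_chr g w x * chr (x + l) w)"
  proof (rule integral_cong_AE)
    show "(\<lambda>w. \<Sum>n. g (w + lat n) * chr (w + lat n) (x + l)) \<in> borel_measurable cube_measure"
      by (rule borel_measurable_integrable[OF integral_periodize(2)[OF gc]])
    show "(\<lambda>w. zak_chr g w x * chr (x + l) w) \<in> borel_measurable cube_measure"
      using borel_measurable_integrable[OF g]
      by (intro borel_measurable_cube_measure borel_measurable_times zak_chr_borel chr_borel) simp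
    show "AE w in cube_measure. (\<Sum>n. g (w + lat n) * chr (w + lat n) (x + l)) = zak_chr g w x * chr (x + l) w"
      using integral_periodize(1)[OF g]
    proof eventually_elim
      case (elim w)
      have "summable (\<lambda>n. g (w + lat n) * chr (lat n) x)"
        by (rule summable_norm_cancel) (simp add: norm_mult elim)
      then have "zak_chr g w x * chr (x + l) w = (\<Sum>n. (g (w + lat n) * chr (lat n) x) * chr (x + l) w)"
        unfolding zak_chr_def by (rule suminf_mult2)
      also have "\<dots> = (\<Sum>n. g (w + lat n) * chr (w + lat n) (x + l))"
      proof (intro arg_cong[where f = suminf] ext)
        fix n
        have "chr (w + lat n) (x + l) = chr w (x + l) * chr (lat n) (x + l)" by (rule chr_add_left)
        moreover have "chr (lat n) (x + l) = chr (lat n) x" using l by (simp add: chr_add_right)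
        ultimately show "(g (w + lat n) * chr (lat n) x) * chr (x + l) w = g (w + lat n) * chr (w + lat n) (x + l)"
          unfolding chr_commute[of "x + l" w] by simp
      qed
      finally show ?case ..
    qed
  qed
  finally show ?thesis .
qed

text \<open>Minkowski's inequality on finite sections shows that the square-summable norms of
  \<open>a\<close> and \<open>b n\<close> differ by at most \<open>e n\<close>.\<close>

lemma sums_square_limit:
  fixes a :: "nat \<Rightarrow> complex" and b :: "nat \<Rightarrow> nat \<Rightarrow> complex"
  assumes b: "\<And>n. summable (\<lambda>i. (norm (b n i))\<^sup>2)"
    and d: "\<And>n N. (\<Sum>i<N. (norm (a i - b n i))\<^sup>2) \<le> (e n)\<^sup>2" and e: "e \<longlonglongrightarrow> 0" "\<And>n. 0 \<le> e n"
  shows "summable (\<lambda>i. (norm (a i))\<^sup>2)"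
    and "(\<lambda>n. \<Sum>i. (norm (b n i))\<^sup>2) \<longlonglongrightarrow> (\<Sum>i. (norm (a i))\<^sup>2)"
proof -
  have tri: "L2_set (\<lambda>i. norm (p i)) {..<N} \<le> L2_set (\<lambda>i. norm (q i)) {..<N} + L2_set (\<lambda>i. norm (p i - q i)) {..<N}"
    for p q :: "nat \<Rightarrow> complex" and N
  proof -
    have "L2_set (\<lambda>i. norm (p i)) {..<N} \<le> L2_set (\<lambda>i. norm (q i) + norm (p i - q i)) {..<N}"
    proof (rule L2_set_mono)
      fix i show "norm (p i) \<le> norm (q i) + norm (p i - q i)"
        using norm_triangle_ineq[of "q i" "p i - q i"] by simp
    qed simp
    also have "\<dots> \<le> L2_set (\<lambda>i. norm (q i)) {..<N} + L2_set (\<lambda>i. norm (p i - q i)) {..<N}"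
      by (rule L2_set_triangle_ineq)
    finally show ?thesis .
  qed
  have dL: "L2_set (\<lambda>i. norm (a i - b n i)) {..<N} \<le> e n" for n N
    unfolding L2_set_def using real_sqrt_le_mono[OF d[where n = n and N = N]] e(2)[of n] by simp
  have dL': "L2_set (\<lambda>i. norm (b n i - a i)) {..<N} \<le> e n" for n N
    using dL[of n N] by (simp add: norm_minus_commute)
  define B where "B n = (\<Sum>i. (norm (b n i))\<^sup>2)" for n
  have B0: "0 \<le> B n" for n unfolding B_def by (intro suminf_nonneg b) simp
  have bL: "L2_set (\<lambda>i. norm (b n i)) {..<N} \<le> sqrt (B n)" for n N
    unfolding L2_set_def B_def by (intro real_sqrt_le_mono sum_le_suminf b) auto
  have aL: "(\<Sum>i<N. (norm (a i))\<^sup>2) \<le> (sqrt (B n) + e n)\<^sup>2" for n N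
  proof -
    have "L2_set (\<lambda>i. norm (a i)) {..<N} \<le> sqrt (B n) + e n"
      using tri[of a N "b n"] bL[of n N] dL[of n N] by linarith
    then have "(L2_set (\<lambda>i. norm (a i)) {..<N})\<^sup>2 \<le> (sqrt (B n) + e n)\<^sup>2"
      by (intro power_mono) (auto simp: L2_set_nonneg)
    then show ?thesis by (simp add: L2_set_def sum_nonneg)
  qed
  show s: "summable (\<lambda>i. (norm (a i))\<^sup>2)"
    by (rule bounded_imp_summable[where B = "(sqrt (B 0) + e 0)\<^sup>2"])
      (simp_all only: lessThan_Suc_atMost[symmetric] aL norm_ge_zero zero_le_power2)
  define A where "A = (\<Sum>i. (norm (a i))\<^sup>2)"
  have A0: "0 \<le> A" unfolding A_def by (intro suminf_nonneg s) simp
  have up: "sqrt A \<le> sqrt (B n) + e n" for n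
  proof -
    have "A \<le> (sqrt (B n) + e n)\<^sup>2" unfolding A_def by (intro suminf_le_const s aL)
    then show ?thesis using B0[of n] e(2)[of n] by (intro real_le_lsqrt) auto
  qed
  have low: "sqrt (B n) \<le> sqrt A + e n" for n
  proof -
    have "(\<Sum>i<N. (norm (b n i))\<^sup>2) \<le> (sqrt A + e n)\<^sup>2" for N
    proof -
      have "L2_set (\<lambda>i. norm (a i)) {..<N} \<le> sqrt A"
        unfolding L2_set_def A_def by (intro real_sqrt_le_mono sum_le_suminf s) auto
      then have "L2_set (\<lambda>i. norm (b n i)) {..<N} \<le> sqrt A + e n"
        using tri[of "b n" N a] dL'[of n N] by linarith
      then have "(L2_set (\<lambda>i. norm (b n i)) {..<N})\<^sup>2 \<le> (sqrt A + e n)\<^sup>2"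
        by (intro power_mono) (auto simp: L2_set_nonneg)
      then show ?thesis by (simp add: L2_set_def sum_nonneg)
    qed
    then have "B n \<le> (sqrt A + e n)\<^sup>2" unfolding B_def by (intro suminf_le_const b)
    then show ?thesis using A0 e(2)[of n] by (intro real_le_lsqrt) auto
  qed
  have "(\<lambda>n. sqrt (B n) - sqrt A) \<longlonglongrightarrow> 0"
  proof (rule Lim_null_comparison[OF _ e(1)])
    show "\<forall>\<^sub>F n in sequentially. norm (sqrt (B n) - sqrt A) \<le> e n"
      using up low by (intro always_eventually allI) (simp add: abs_le_iff algebra_simps)
  qed
  then have "(\<lambda>n. sqrt (B n)) \<longlonglongrightarrow> sqrt A" by (rule LIM_zero_cancel)
  then have "(\<lambda>n. (sqrt (B n))\<^sup>2) \<longlonglongrightarrow> (sqrt A)\<^sup>2" by (rule tendsto_power)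
  then show "(\<lambda>n. \<Sum>i. (norm (b n i))\<^sup>2) \<longlonglongrightarrow> (\<Sum>i. (norm (a i))\<^sup>2)"
    using A0 B0 by (simp add: B_def[symmetric] A_def[symmetric])
qed

section \<open>Finite combinations of translates\<close>

type_synonym 'd coeff = "nat \<times> (real ^ 'd) \<Rightarrow> complex"

text \<open>The hypotheses speak of the transforms \<open>g\<close> of the \<phi> i. They differ
  from those of the \<psi> i by a lattice shift of the frequency, under which the periodization is
  invariant.\<close>

locale orthonormal_shifts =
  fixes k :: nat and \<phi> g :: "nat \<Rightarrow> real ^ 'd::finite \<Rightarrow> complex" and C :: real
  assumes ft: "i \<in> {1..k} \<Longrightarrow> is_L2_fourier (\<phi> i) (g i)"
    and orthonormal: "orthonormal_translates k \<phi>"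
    and C_nonneg: "0 \<le> C"
    and periodization_le: "i \<in> {1..k} \<Longrightarrow> AE w in cube_measure. (\<Sum>n. ennreal (norm (g i (w + lat n)))) \<le> ennreal C"
begin

definition idx :: "(nat \<times> (real ^ 'd)) set" where "idx = {1..k} \<times> int_lattice"

definition coeffs :: "'d coeff set" where
  "coeffs = {c. finite {p. c p \<noteq> 0} \<and> {p. c p \<noteq> 0} \<subseteq> idx}"

definition synth :: "'d coeff \<Rightarrow> real ^ 'd \<Rightarrow> complex" where
  "synth c x = (\<Sum>p | c p \<noteq> 0. c p * \<phi> (fst p) (x - snd p))"

text \<open>The combination of \<open>synth\<close> with each \<phi> i replaced by the continuous
  representative that \<open>fourier_inversion\<close> provides.\<close>

definition rep :: "'d coeff \<Rightarrow> real ^ 'd \<Rightarrow> complex" where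
  "rep c x = (\<Sum>p | c p \<noteq> 0. c p * inv_fourier (g (fst p)) (x - snd p))"

definition good :: "(real ^ 'd) set" where
  "good = {w. \<forall>i\<in>{1..k}. (\<Sum>n. ennreal (norm (g i (w + lat n)))) \<le> ennreal C}"

text \<open>Set to 0 outside \<open>good\<close>, a set of full measure in the cube, so that the
  bound by C holds at every w.\<close>

definition fiber :: "real ^ 'd \<Rightarrow> real ^ 'd \<Rightarrow> nat \<Rightarrow> complex" where
  "fiber w x i = (if w \<in> good then zak_chr (g i) w x else 0)"

text \<open>The conjugates of the Fourier series of the coefficients, so that \<open>ip\<close> applies.\<close>

definition symbol :: "'d coeff \<Rightarrow> real ^ 'd \<Rightarrow> nat \<Rightarrow> complex" where
  "symbol c w i = cnj (\<Sum>p | c p \<noteq> 0 \<and> fst p = i. c p * chr (- snd p) w)"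

lemma g_borel: "i \<in> {1..k} \<Longrightarrow> g i \<in> borel_measurable borel"
  and phi_L2: "i \<in> {1..k} \<Longrightarrow> \<phi> i \<in> L2" and g_L2: "i \<in> {1..k} \<Longrightarrow> g i \<in> L2"
  using ft by (auto simp: is_L2_fourier_def intro: L2_borel)

lemma g_integrable: "i \<in> {1..k} \<Longrightarrow> integrable lborel (g i)"
  by (rule integrable_if_periodization_bounded[OF g_borel periodization_le])

lemma good_borel [measurable]: "good \<in> sets borel"
proof -
  have "Measurable.pred borel (\<lambda>w. \<forall>i\<in>{1..k}. (\<Sum>n. ennreal (norm (g i (w + lat n)))) \<le> ennreal C)"
  proof (intro pred_intros_finite)
    fix i assume "i \<in> {1..k}"
    then have [measurable]: "g i \<in> borel_measurable borel" by (rule g_borel)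
    show "Measurable.pred borel (\<lambda>w. (\<Sum>n. ennreal (norm (g i (w + lat n)))) \<le> ennreal C)" by measurable
  qed simp
  then show ?thesis by (simp add: good_def pred_def)
qed

lemma AE_good: "AE w in cube_measure. w \<in> good"
  unfolding good_def mem_Collect_eq by (intro AE_finite_allI periodization_le) auto

lemma norm_fiber_le: "i \<in> {1..k} \<Longrightarrow> norm (fiber w x i) \<le> C"
  using norm_zak_chr_le[OF _ C_nonneg, of "g i" w x] C_nonneg by (auto simp: fiber_def good_def)

lemma nsq_fiber_le: "nsq {1..k} (fiber w x) \<le> real k * C\<^sup>2"
proof -
  have "nsq {1..k} (fiber w x) \<le> (\<Sum>i\<in>{1..k}. C\<^sup>2)"
    unfolding nsq_def by (intro sum_mono power_mono norm_fiber_le) auto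
  then show ?thesis by simp
qed

lemma fiber_borel: "i \<in> {1..k} \<Longrightarrow> (\<lambda>w. fiber w x i) \<in> borel_measurable borel"
  unfolding fiber_def by (intro measurable_If_set zak_chr_borel g_borel) simp_all

lemma fiber_borel_right: "(\<lambda>x. fiber w x i) \<in> borel_measurable borel"
  unfolding fiber_def by (cases "w \<in> good") (simp_all add: zak_chr_borel_right)

lemma symbol_borel: "(\<lambda>w. symbol c w i) \<in> borel_measurable borel"
  unfolding symbol_def by measurable

lemma coeffs_finite: "c \<in> coeffs \<Longrightarrow> finite {p. c p \<noteq> 0}"
  and coeffs_idx: "c \<in> coeffs \<Longrightarrow> c p \<noteq> 0 \<Longrightarrow> fst p \<in> {1..k} \<and> snd p \<in> int_lattice"
  by (auto simp: coeffs_def idx_def)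

lemma synth_superset: "finite T \<Longrightarrow> {p. c p \<noteq> 0} \<subseteq> T \<Longrightarrow> synth c x = (\<Sum>p\<in>T. c p * \<phi> (fst p) (x - snd p))"
  unfolding synth_def by (intro sum.mono_neutral_left) auto

lemma rep_superset: "finite T \<Longrightarrow> {p. c p \<noteq> 0} \<subseteq> T \<Longrightarrow> rep c x = (\<Sum>p\<in>T. c p * inv_fourier (g (fst p)) (x - snd p))"
  unfolding rep_def by (intro sum.mono_neutral_left) auto

lemma coeffs_add_scale:
  assumes "c \<in> coeffs" "d \<in> coeffs"
  shows "(\<lambda>p. c p + a * d p) \<in> coeffs"
    and "synth (\<lambda>p. c p + a * d p) x = synth c x + a * synth d x"
    and "rep (\<lambda>p. c p + a * d p) x = rep c x + a * rep d x"
proof -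
  let ?T = "{p. c p \<noteq> 0} \<union> {p. d p \<noteq> 0}"
  have T: "finite ?T" using assms by (simp add: coeffs_finite)
  have sub: "{p. c p + a * d p \<noteq> 0} \<subseteq> ?T" by auto
  show "(\<lambda>p. c p + a * d p) \<in> coeffs"
    unfolding coeffs_def using finite_subset[OF sub T] sub assms by (auto simp: coeffs_def)
  show "synth (\<lambda>p. c p + a * d p) x = synth c x + a * synth d x"
    using synth_superset[OF T sub] synth_superset[OF T, of c] synth_superset[OF T, of d]
    by (simp add: sum.distrib sum_distrib_left algebra_simps)
  show "rep (\<lambda>p. c p + a * d p) x = rep c x + a * rep d x"
    using rep_superset[OF T sub] rep_superset[OF T, of c] rep_superset[OF T, of d]
    by (simp add: sum.distrib sum_distrib_left algebra_simps)
qed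

lemma coeffs_diff:
  assumes "c \<in> coeffs" "d \<in> coeffs"
  shows "(\<lambda>p. c p - d p) \<in> coeffs" "synth (\<lambda>p. c p - d p) x = synth c x - synth d x"
    "rep (\<lambda>p. c p - d p) x = rep c x - rep d x"
  using coeffs_add_scale[OF assms, of "-1"] by simp_all

lemma zero_coeffs: "(\<lambda>p. 0) \<in> coeffs" "synth (\<lambda>p. 0) = (\<lambda>x. 0)"
  by (auto simp: coeffs_def synth_def)

lemma phi_translate_L2: "i \<in> {1..k} \<Longrightarrow> (\<lambda>x. \<phi> i (x - l)) \<in> L2"
  using L2_translate(1)[OF phi_L2, of i "- l"] by simp

lemma synth_L2: "c \<in> coeffs \<Longrightarrow> synth c \<in> L2"
  unfolding synth_def[abs_def] by (intro L2_sum L2_scale phi_translate_L2) (auto dest: coeffs_idx)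

lemma continuous_rep: "c \<in> coeffs \<Longrightarrow> continuous_on UNIV (rep c)"
  unfolding rep_def[abs_def]
  by (intro continuous_intros continuous_on_compose2[OF continuous_inv_fourier[OF g_integrable]])
    (auto dest: coeffs_idx)

lemma is_cont_rep_synth:
  assumes c: "c \<in> coeffs" shows "is_cont_rep (synth c) (rep c)"
  unfolding is_cont_rep_def
proof
  show "continuous_on UNIV (rep c)" by (rule continuous_rep[OF c])
  have "AE x in lborel. \<phi> (fst p) (x - snd p) = inv_fourier (g (fst p)) (x - snd p)" if p: "p \<in> {p. c p \<noteq> 0}" for p
  proof -
    have i: "fst p \<in> {1..k}" using coeffs_idx[OF c] p by auto
    note [measurable] = L2_borel[OF phi_L2[OF i]] inv_fourier_borel[OF g_integrable[OF i]]
    have "AE x in distr lborel borel ((+) (- snd p)). \<phi> (fst p) x = inv_fourier (g (fst p)) x"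
      unfolding lborel_distr_plus by (rule fourier_inversion[OF ft[OF i] g_integrable[OF i]])
    then show ?thesis by (subst (asm) AE_distr_iff) (auto simp: algebra_simps)
  qed
  then have "AE x in lborel. \<forall>p\<in>{p. c p \<noteq> 0}. \<phi> (fst p) (x - snd p) = inv_fourier (g (fst p)) (x - snd p)"
    by (intro AE_finite_allI coeffs_finite[OF c])
  then show "AE x in lborel. synth c x = rep c x"
    by eventually_elim (auto simp: synth_def rep_def intro!: sum.cong)
qed

lemma L2_norm_synth:
  assumes c: "c \<in> coeffs" shows "(L2_norm (synth c))\<^sup>2 = (\<Sum>p | c p \<noteq> 0. (norm (c p))\<^sup>2)"
proof -
  let ?T = "{p. c p \<noteq> 0}" and ?f = "\<lambda>p x. \<phi> (fst p) (x - snd p)"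
  note idx = coeffs_idx[OF c]
  have T: "finite ?T" by (rule coeffs_finite[OF c])
  have L: "?f p \<in> L2" if "p \<in> ?T" for p using idx that by (intro phi_translate_L2) auto
  have i: "integrable lborel (\<lambda>x. (c p * cnj (c q)) * (?f p x * cnj (?f q x)))" if "p \<in> ?T" "q \<in> ?T" for p q
    using that by (intro integrable_mult_right L2_mult_integrable(1) L2_cnj L)
  have on: "(LINT x|lborel. ?f p x * cnj (?f q x)) = (if p = q then 1 else 0)" if "p \<in> ?T" "q \<in> ?T" for p q
    using orthonormal idx that unfolding orthonormal_translates_def L2_inner_def by (auto simp: prod_eq_iff)
  have "complex_of_real ((L2_norm (synth c))\<^sup>2) = (LINT x|lborel. (\<Sum>p\<in>?T. \<Sum>q\<in>?T. (c p * cnj (c q)) * (?f p x * cnj (?f q x))))"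
    unfolding L2_norm_square integral_complex_of_real[symmetric] complex_norm_square synth_def
    by (intro Bochner_Integration.integral_cong refl) (simp add: sum_product mult_ac)
  also have "\<dots> = (\<Sum>p\<in>?T. LINT x|lborel. (\<Sum>q\<in>?T. (c p * cnj (c q)) * (?f p x * cnj (?f q x))))"
    by (intro Bochner_Integration.integral_sum Bochner_Integration.integrable_sum i)
  also have "\<dots> = (\<Sum>p\<in>?T. \<Sum>q\<in>?T. (c p * cnj (c q)) * (LINT x|lborel. ?f p x * cnj (?f q x)))"
  proof (intro sum.cong refl)
    fix p assume p: "p \<in> ?T"
    have "(LINT x|lborel. (\<Sum>q\<in>?T. (c p * cnj (c q)) * (?f p x * cnj (?f q x)))) =
        (\<Sum>q\<in>?T. LINT x|lborel. (c p * cnj (c q)) * (?f p x * cnj (?f q x)))"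
      by (intro Bochner_Integration.integral_sum i p)
    then show "(LINT x|lborel. (\<Sum>q\<in>?T. (c p * cnj (c q)) * (?f p x * cnj (?f q x)))) =
        (\<Sum>q\<in>?T. (c p * cnj (c q)) * (LINT x|lborel. ?f p x * cnj (?f q x)))" by simp
  qed
  also have "\<dots> = (\<Sum>p\<in>?T. \<Sum>q\<in>?T. if p = q then c p * cnj (c q) else 0)"
    by (intro sum.cong refl) (simp add: on)
  also have "\<dots> = (\<Sum>p\<in>?T. c p * cnj (c p))" using T by simp
  also have "\<dots> = complex_of_real (\<Sum>p\<in>?T. (norm (c p))\<^sup>2)"
    unfolding of_real_sum complex_norm_square ..
  finally show ?thesis unfolding of_real_eq_iff .
qed

lemma integral_nsq_symbol:
  assumes c: "c \<in> coeffs"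
  shows "integrable cube_measure (\<lambda>w. nsq {1..k} (symbol c w))"
    and "(LINT w|cube_measure. nsq {1..k} (symbol c w)) = (L2_norm (synth c))\<^sup>2"
proof -
  let ?T = "\<lambda>i. {l. c (i, l) \<noteq> 0}"
  have T: "finite (?T i)" "?T i \<subseteq> int_lattice" for i
  proof -
    have "?T i \<subseteq> snd ` {p. c p \<noteq> 0}" by force
    then show "finite (?T i)" using coeffs_finite[OF c] by (blast intro: finite_subset)
    show "?T i \<subseteq> int_lattice" using coeffs_idx[OF c, of "(i, _)"] by auto
  qed
  have sym: "symbol c w i = cnj (\<Sum>l\<in>?T i. c (i, l) * chr (- l) w)" for w i
    unfolding symbol_def
    by (intro arg_cong[where f = cnj] sum.reindex_bij_witness[of _ "\<lambda>l. (i, l)" snd]) auto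
  have bd: "norm (symbol c w i) \<le> (\<Sum>l\<in>?T i. norm (c (i, l)))" for w i
    unfolding sym complex_mod_cnj by (intro sum_norm_le) (simp add: norm_mult)
  have ii: "integrable cube_measure (\<lambda>w. (norm (symbol c w i))\<^sup>2)" for i
  proof (rule cube_integrable_bounded[where B = "(\<Sum>l\<in>?T i. norm (c (i, l)))\<^sup>2"])
    show "(\<lambda>w. (norm (symbol c w i))\<^sup>2) \<in> borel_measurable borel" using symbol_borel[of c i] by measurable
    show "norm ((norm (symbol c w i))\<^sup>2) \<le> (\<Sum>l\<in>?T i. norm (c (i, l)))\<^sup>2" for w
      using power_mono[OF bd[of w i]] by simp
  qed
  show "integrable cube_measure (\<lambda>w. nsq {1..k} (symbol c w))"
    unfolding nsq_def by (intro Bochner_Integration.integrable_sum ii)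
  have "(LINT w|cube_measure. nsq {1..k} (symbol c w)) = (\<Sum>i\<in>{1..k}. LINT w|cube_measure. (norm (symbol c w i))\<^sup>2)"
    unfolding nsq_def by (intro Bochner_Integration.integral_sum ii)
  also have "\<dots> = (\<Sum>i\<in>{1..k}. \<Sum>l\<in>?T i. (norm (c (i, l)))\<^sup>2)"
  proof (intro sum.cong refl)
    fix i
    \<comment> \<open>For W = 0 the Pythagorean identity gives the norm of a trigonometric
      polynomial.\<close>
    show "(LINT w|cube_measure. (norm (symbol c w i))\<^sup>2) = (\<Sum>l\<in>?T i. (norm (c (i, l)))\<^sup>2)"
      using integral_norm_diff_trig_poly[of "\<lambda>_. 0" 0 "?T i" "\<lambda>l. c (i, l)"] T[of i] unfolding sym complex_mod_cnj by simp
  qed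
  also have "\<dots> = (\<Sum>p\<in>Sigma {1..k} ?T. (norm (c p))\<^sup>2)"
    using T(1) by (subst sum.Sigma) auto
  also have "Sigma {1..k} ?T = {p. c p \<noteq> 0}" using coeffs_idx[OF c] by force
  finally show "(LINT w|cube_measure. nsq {1..k} (symbol c w)) = (L2_norm (synth c))\<^sup>2"
    using L2_norm_synth[OF c] by simp
qed

text \<open>By \<open>inv_fourier_lattice\<close> the samples of \<open>rep c\<close> on the coset
  of x are the Fourier coefficients of \<open>W\<close>, which is the conjugated inner product of
  fiber and symbol times a factor of modulus 1. Parseval's identity then gives the sum.\<close>

lemma rep_sums:
  assumes c: "c \<in> coeffs"
  shows "(\<lambda>n. (norm (rep c (x + lat n)))\<^sup>2) sums
    (LINT w|cube_measure. (norm (ip {1..k} (fiber w x) (symbol c w)))\<^sup>2)"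
proof -
  let ?T = "{p. c p \<noteq> 0}"
  have T: "finite ?T" by (rule coeffs_finite[OF c])
  define W where "W w = chr x w * cnj (ip {1..k} (fiber w x) (symbol c w))" for w
  have W: "W w = (\<Sum>p\<in>?T. c p * (fiber w x (fst p) * chr (x - snd p) w))" for w
  proof -
    have "cnj (ip {1..k} (fiber w x) (symbol c w)) =
        (\<Sum>i\<in>{1..k}. \<Sum>p | c p \<noteq> 0 \<and> fst p = i. fiber w x (fst p) * (c p * chr (- snd p) w))"
      by (simp add: ip_def symbol_def sum_distrib_left)
    also have "\<dots> = (\<Sum>i\<in>{1..k}. \<Sum>p\<in>{p\<in>?T. fst p = i}. fiber w x (fst p) * (c p * chr (- snd p) w))"
      by (simp add: Collect_conj_eq)
    also have "\<dots> = (\<Sum>p\<in>?T. fiber w x (fst p) * (c p * chr (- snd p) w))"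
      using coeffs_idx[OF c] by (intro sum.group T) auto
    moreover have "chr (x - l) w = chr x w * chr (- l) w" for l
      using chr_add_left[of x "- l" w] by simp
    ultimately show ?thesis
      by (simp add: W_def sum_distrib_left mult_ac)
  qed
  have fm: "(\<lambda>w. fiber w x (fst p)) \<in> borel_measurable borel" if "p \<in> ?T" for p
    using coeffs_idx[OF c] that by (intro fiber_borel) auto
  have Wm: "W \<in> borel_measurable borel"
    unfolding W[abs_def]
    by (intro borel_measurable_sum borel_measurable_times borel_measurable_const fm chr_borel)
  have Wb: "norm (W w) \<le> (\<Sum>p\<in>?T. norm (c p) * C)" for w
    unfolding W using coeffs_idx[OF c]
    by (intro sum_norm_le) (auto simp: norm_mult intro!: mult_left_mono norm_fiber_le)
  have coef: "(LINT w|cube_measure. W w * chr (lat n) w) = rep c (x + lat n)" for n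
  proof -
    have i: "integrable cube_measure (\<lambda>w. c p * (fiber w x (fst p) * chr (x + (lat n - snd p)) w))" if p: "p \<in> ?T" for p
    proof (intro integrable_mult_right cube_integrable_bounded[where B = C])
      show "(\<lambda>w. fiber w x (fst p) * chr (x + (lat n - snd p)) w) \<in> borel_measurable borel"
        by (intro borel_measurable_times fm chr_borel p)
      show "norm (fiber w x (fst p) * chr (x + (lat n - snd p)) w) \<le> C" for w
        using norm_fiber_le coeffs_idx[OF c] p by (auto simp: norm_mult)
    qed
    have "(LINT w|cube_measure. W w * chr (lat n) w) =
        (LINT w|cube_measure. (\<Sum>p\<in>?T. c p * (fiber w x (fst p) * chr (x + (lat n - snd p)) w)))"
    proof (intro Bochner_Integration.integral_cong refl)
      fix w
      have "chr (x + (lat n - l)) w = chr (x - l) w * chr (lat n) w" for l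
        using chr_add_left[of "x - l" "lat n" w] by (simp add: algebra_simps)
      then show "W w * chr (lat n) w = (\<Sum>p\<in>?T. c p * (fiber w x (fst p) * chr (x + (lat n - snd p)) w))"
        unfolding W by (simp add: sum_distrib_left mult_ac)
    qed
    also have "\<dots> = (\<Sum>p\<in>?T. LINT w|cube_measure. c p * (fiber w x (fst p) * chr (x + (lat n - snd p)) w))"
      by (intro Bochner_Integration.integral_sum i)
    also have "\<dots> = (\<Sum>p\<in>?T. c p * inv_fourier (g (fst p)) (x + lat n - snd p))"
    proof (intro sum.cong refl)
      fix p assume p: "p \<in> ?T"
      then have pi: "fst p \<in> {1..k}" "snd p \<in> int_lattice" using coeffs_idx[OF c] by auto
      have "(LINT w|cube_measure. fiber w x (fst p) * chr (x + (lat n - snd p)) w) =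
          (LINT w|cube_measure. zak_chr (g (fst p)) w x * chr (x + (lat n - snd p)) w)"
      proof (rule integral_cong_AE)
        show "AE w in cube_measure. fiber w x (fst p) * chr (x + (lat n - snd p)) w =
            zak_chr (g (fst p)) w x * chr (x + (lat n - snd p)) w"
          using AE_good by eventually_elim (simp add: fiber_def)
      qed (intro borel_measurable_cube_measure borel_measurable_times fm chr_borel zak_chr_borel g_borel p pi)+
      also have "\<dots> = inv_fourier (g (fst p)) (x + (lat n - snd p))"
        using pi by (intro inv_fourier_lattice[symmetric] g_integrable int_lattice_diff) auto
      finally show "(LINT w|cube_measure. c p * (fiber w x (fst p) * chr (x + (lat n - snd p)) w)) =
          c p * inv_fourier (g (fst p)) (x + lat n - snd p)" by (simp add: add_diff_eq)
    qed
    finally show ?thesis by (simp add: rep_def)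
  qed
  have "norm (W w) = norm (ip {1..k} (fiber w x) (symbol c w))" for w by (simp add: W_def norm_mult)
  then show ?thesis using cube_parseval[OF Wm Wb] by (simp add: coef)
qed

definition energy :: "(real ^ 'd \<Rightarrow> complex) \<Rightarrow> real ^ 'd \<Rightarrow> real" where
  "energy F x = (\<Sum>n. (norm (F (x + lat n)))\<^sup>2)"

lemma integrable_ip_fiber_symbol:
  assumes c: "c \<in> coeffs"
  shows "integrable cube_measure (\<lambda>w. (norm (ip {1..k} (fiber w x) (symbol c w)))\<^sup>2)"
proof (rule Bochner_Integration.integrable_bound)
  show "integrable cube_measure (\<lambda>w. real k * C\<^sup>2 * nsq {1..k} (symbol c w))"
    by (intro integrable_mult_right integral_nsq_symbol(1) c)
  show "(\<lambda>w. (norm (ip {1..k} (fiber w x) (symbol c w)))\<^sup>2) \<in> borel_measurable cube_measure"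
    unfolding ip_def
    by (intro borel_measurable_power borel_measurable_norm borel_measurable_sum borel_measurable_times borel_measurable_cnj)
      (use fiber_borel symbol_borel in simp_all)
  show "AE w in cube_measure. norm ((norm (ip {1..k} (fiber w x) (symbol c w)))\<^sup>2) \<le> norm (real k * C\<^sup>2 * nsq {1..k} (symbol c w))"
  proof (rule AE_I2)
    fix w
    have "(norm (ip {1..k} (fiber w x) (symbol c w)))\<^sup>2 \<le> real k * C\<^sup>2 * nsq {1..k} (symbol c w)"
      by (rule order_trans[OF ip_Cauchy_Schwarz mult_right_mono[OF nsq_fiber_le nsq_nonneg]])
    then show "norm ((norm (ip {1..k} (fiber w x) (symbol c w)))\<^sup>2) \<le> norm (real k * C\<^sup>2 * nsq {1..k} (symbol c w))"
      by simp
  qed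
qed

lemma energy_rep_eq:
  assumes "c \<in> coeffs"
  shows "energy (rep c) x = (LINT w|cube_measure. (norm (ip {1..k} (fiber w x) (symbol c w)))\<^sup>2)"
    and "summable (\<lambda>n. (norm (rep c (x + lat n)))\<^sup>2)"
  using rep_sums[OF assms, of x] by (auto simp: energy_def sums_iff)

lemma energy_rep_le:
  assumes c: "c \<in> coeffs"
  shows "energy (rep c) x \<le> real k * C\<^sup>2 * (L2_norm (synth c))\<^sup>2"
proof -
  have "energy (rep c) x \<le> (LINT w|cube_measure. real k * C\<^sup>2 * nsq {1..k} (symbol c w))"
    unfolding energy_rep_eq(1)[OF c]
  proof (rule integral_mono)
    show "(norm (ip {1..k} (fiber w x) (symbol c w)))\<^sup>2 \<le> real k * C\<^sup>2 * nsq {1..k} (symbol c w)" for w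
      by (rule order_trans[OF ip_Cauchy_Schwarz mult_right_mono[OF nsq_fiber_le nsq_nonneg]])
  qed (intro integrable_ip_fiber_symbol integrable_mult_right integral_nsq_symbol(1) c)+
  then show ?thesis
    unfolding integral_nsq_symbol(2)[OF c, symmetric] by simp
qed

end

section \<open>The closed span as a reproducing kernel space\<close>

context orthonormal_shifts
begin

abbreviation "V \<equiv> shift_invariant_space k \<phi>"

text \<open>\<open>complex_span\<close> attaches coefficients to functions, whereas
  \<open>coeffs\<close> attaches them to indices. The two descriptions agree because orthonormality
  forbids that two indices give the same function.\<close>

lemma phi_translate_inj:
  assumes p: "p \<in> idx" and q: "q \<in> idx"
    and eq: "(\<lambda>x. \<phi> (fst p) (x - snd p)) = (\<lambda>x. \<phi> (fst q) (x - snd q))"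
  shows "p = q"
proof (rule ccontr)
  assume "p \<noteq> q"
  have "L2_inner (\<lambda>x. \<phi> (fst p) (x - snd p)) (\<lambda>x. \<phi> (fst p) (x - snd p)) = 1"
    using orthonormal p unfolding orthonormal_translates_def idx_def by auto
  moreover have "L2_inner (\<lambda>x. \<phi> (fst p) (x - snd p)) (\<lambda>x. \<phi> (fst q) (x - snd q)) = 0"
    using orthonormal p q \<open>p \<noteq> q\<close> unfolding orthonormal_translates_def idx_def by (auto simp: prod_eq_iff)
  ultimately show False unfolding eq by simp
qed

lemma complex_span_translates: "complex_span (translates k \<phi>) = synth ` coeffs"
proof (intro equalityI subsetI)
  define \<Psi> where "\<Psi> p = (\<lambda>x. \<phi> (fst p) (x - snd p))" for p :: "nat \<times> (real ^ 'd)"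
  have tr: "translates k \<phi> = \<Psi> ` idx"
  proof (intro equalityI subsetI)
    fix u assume "u \<in> translates k \<phi>"
    then obtain i l where "u = \<Psi> (i, l)" "(i, l) \<in> idx"
      by (auto simp: translates_def idx_def \<Psi>_def)
    then show "u \<in> \<Psi> ` idx" by (rule image_eqI)
  next
    fix u assume "u \<in> \<Psi> ` idx"
    then obtain p where p: "p \<in> idx" "u = (\<lambda>x. \<phi> (fst p) (x - snd p))" by (auto simp: \<Psi>_def)
    then show "u \<in> translates k \<phi>"
      unfolding translates_def by (intro CollectI exI[of _ "fst p"] exI[of _ "snd p"]) (auto simp: idx_def)
  qed
  have inj: "inj_on \<Psi> idx" unfolding inj_on_def \<Psi>_def using phi_translate_inj by blast
  fix u
  {
    assume "u \<in> complex_span (translates k \<phi>)"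
    then obtain T c where T: "finite T" "T \<subseteq> \<Psi> ` idx" and u: "u = (\<lambda>x. \<Sum>f\<in>T. c f * f x)"
      unfolding complex_span_def tr by blast
    obtain S where S: "S \<subseteq> idx" "finite S" "T = \<Psi> ` S"
      using finite_subset_image[OF T] by blast
    define e where "e p = (if p \<in> S then c (\<Psi> p) else 0)" for p
    have sub: "{p. e p \<noteq> 0} \<subseteq> S" by (auto simp: e_def)
    have e: "e \<in> coeffs" unfolding coeffs_def using finite_subset[OF sub S(2)] sub S(1) by auto
    have "synth e x = u x" for x
    proof -
      have "synth e x = (\<Sum>p\<in>S. c (\<Psi> p) * \<Psi> p x)"
        unfolding synth_superset[OF S(2) sub] by (intro sum.cong) (auto simp: e_def \<Psi>_def)
      also have "\<dots> = u x"
        unfolding u S(3) by (subst sum.reindex[OF inj_on_subset[OF inj S(1)]]) simp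
      finally show ?thesis .
    qed
    then have "u = synth e" by auto
    then show "u \<in> synth ` coeffs" using e by blast
  next
    assume "u \<in> synth ` coeffs"
    then obtain c where c: "c \<in> coeffs" and u: "u = synth c" by blast
    let ?S = "{p. c p \<noteq> 0}"
    have S: "finite ?S" "?S \<subseteq> idx" using c by (auto simp: coeffs_def)
    have "u = (\<lambda>x. \<Sum>f\<in>\<Psi> ` ?S. c (inv_into idx \<Psi> f) * f x)"
    proof
      fix x
      have "(\<Sum>f\<in>\<Psi> ` ?S. c (inv_into idx \<Psi> f) * f x) = (\<Sum>p\<in>?S. c (inv_into idx \<Psi> (\<Psi> p)) * \<Psi> p x)"
        by (subst sum.reindex[OF inj_on_subset[OF inj S(2)]]) simp
      also have "\<dots> = (\<Sum>p\<in>?S. c p * \<Psi> p x)"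
        using S(2) inv_into_f_f[OF inj] by (intro sum.cong refl) auto
      finally show "u x = (\<Sum>f\<in>\<Psi> ` ?S. c (inv_into idx \<Psi> f) * f x)"
        by (simp add: u synth_def \<Psi>_def)
    qed
    moreover have "finite (\<Psi> ` ?S)" "\<Psi> ` ?S \<subseteq> \<Psi> ` idx" using S by auto
    ultimately show "u \<in> complex_span (translates k \<phi>)"
      unfolding complex_span_def tr
      by (intro CollectI exI[of _ "\<Psi> ` ?S"] exI[of _ "\<lambda>f. c (inv_into idx \<Psi> f)"] conjI)
  }
qed

lemma V_iff: "f \<in> V \<longleftrightarrow> f \<in> L2 \<and> (\<exists>c. (\<forall>n. c n \<in> coeffs) \<and> L2_limit (\<lambda>n. synth (c n)) f)"
proof
  assume "f \<in> V"
  then obtain u where f: "f \<in> L2" and u: "\<forall>n. u n \<in> synth ` coeffs" "L2_limit u f"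
    unfolding shift_invariant_space_def L2_closure_def complex_span_translates by blast
  then have "\<forall>n. \<exists>c. c \<in> coeffs \<and> u n = synth c" by blast
  then obtain c where c: "\<forall>n. c n \<in> coeffs \<and> u n = synth (c n)" by metis
  then have e: "u = (\<lambda>n. synth (c n))" by auto
  show "f \<in> L2 \<and> (\<exists>c. (\<forall>n. c n \<in> coeffs) \<and> L2_limit (\<lambda>n. synth (c n)) f)"
    using c f u(2) unfolding e by (intro conjI exI[of _ c]) auto
next
  assume "f \<in> L2 \<and> (\<exists>c. (\<forall>n. c n \<in> coeffs) \<and> L2_limit (\<lambda>n. synth (c n)) f)"
  then obtain c where "f \<in> L2" "\<forall>n. c n \<in> coeffs" "L2_limit (\<lambda>n. synth (c n)) f" by blast
  then show "f \<in> V"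
    unfolding shift_invariant_space_def L2_closure_def complex_span_translates
    by (auto intro!: exI[of _ "\<lambda>n. synth (c n)"])
qed

lemma synth_in_V: "c \<in> coeffs \<Longrightarrow> synth c \<in> V"
  unfolding V_iff by (intro conjI synth_L2 exI[of _ "\<lambda>_. c"]) (auto simp: L2_limit_def L2_norm_def)

text \<open>The square root of the bound k C^2 on the fibers. It bounds the square-summable norm of
  the samples on every coset by the L2 norm.\<close>

definition frame_const :: real where "frame_const = sqrt (real k) * C"

lemma frame_const: "0 \<le> frame_const" "frame_const\<^sup>2 = real k * C\<^sup>2"
  by (simp_all add: frame_const_def C_nonneg power_mult_distrib)

lemma norm_rep_diff_le:
  assumes c: "c \<in> coeffs" and d: "d \<in> coeffs"
  shows "(\<Sum>i<N. (norm (rep c (x + lat i) - rep d (x + lat i)))\<^sup>2) \<le>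
      (frame_const * L2_norm (\<lambda>x. synth c x - synth d x))\<^sup>2"
    and "norm (rep c x - rep d x) \<le> frame_const * L2_norm (\<lambda>x. synth c x - synth d x)"
proof -
  let ?e = "\<lambda>p. c p - d p"
  note e = coeffs_diff[OF c d]
  have "(\<Sum>i<N. (norm (rep c (y + lat i) - rep d (y + lat i)))\<^sup>2) \<le>
      (frame_const * L2_norm (\<lambda>x. synth c x - synth d x))\<^sup>2" for N y
  proof -
    have "(\<Sum>i<N. (norm (rep ?e (y + lat i)))\<^sup>2) \<le> energy (rep ?e) y"
      unfolding energy_def by (intro sum_le_suminf energy_rep_eq(2) e) auto
    also have "\<dots> \<le> real k * C\<^sup>2 * (L2_norm (synth ?e))\<^sup>2" by (rule energy_rep_le[OF e(1)])
    also have "synth ?e = (\<lambda>x. synth c x - synth d x)" using e(2) by auto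
    finally show ?thesis by (simp add: e(3) power_mult_distrib frame_const)
  qed
  note le = this
  show "(\<Sum>i<N. (norm (rep c (x + lat i) - rep d (x + lat i)))\<^sup>2) \<le>
      (frame_const * L2_norm (\<lambda>x. synth c x - synth d x))\<^sup>2" by (rule le)
  \<comment> \<open>A single value is one term of the sample sum, the one at lattice point
    0.\<close>
  obtain n0 where n0: "lat n0 = (0 :: real ^ 'd)" using ex_lat_0 by blast
  have "(norm (rep c x - rep d x))\<^sup>2 \<le> (\<Sum>i<Suc n0. (norm (rep c (x + lat i) - rep d (x + lat i)))\<^sup>2)"
    using sum_nonneg[of "{..<n0}" "\<lambda>i. (norm (rep c (x + lat i) - rep d (x + lat i)))\<^sup>2"] by (simp add: n0)
  also have "\<dots> \<le> (frame_const * L2_norm (\<lambda>x. synth c x - synth d x))\<^sup>2" by (rule le)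
  finally show "norm (rep c x - rep d x) \<le> frame_const * L2_norm (\<lambda>x. synth c x - synth d x)"
    by (rule power2_le_imp_le) (simp add: frame_const)
qed

text \<open>The sampling bound turns \<open>L\<^sup>2\<close> limits into uniform limits.\<close>

lemma limit_rep:
  assumes f: "f \<in> L2" and c: "\<And>n. c n \<in> coeffs" and lim: "L2_limit (\<lambda>n. synth (c n)) f"
  obtains F where "is_cont_rep f F"
    and "\<And>x. (\<lambda>n. rep (c n) x) \<longlonglongrightarrow> F x"
    and "\<And>n N x. (\<Sum>i<N. (norm (F (x + lat i) - rep (c n) (x + lat i)))\<^sup>2) \<le>
      (frame_const * L2_norm (\<lambda>x. synth (c n) x - f x))\<^sup>2"
proof -
  define \<delta> where "\<delta> n = L2_norm (\<lambda>x. synth (c n) x - f x)" for n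
  have \<delta>: "\<delta> \<longlonglongrightarrow> 0" using lim by (simp add: L2_limit_def \<delta>_def[abs_def])
  have \<delta>0: "0 \<le> \<delta> n" for n by (simp add: \<delta>_def)
  have dd: "L2_norm (\<lambda>x. synth (c n) x - synth (c m) x) \<le> \<delta> n + \<delta> m" for n m
    using L2_norm_triangle_diff[OF synth_L2[OF c] f synth_L2[OF c], of n m]
      L2_norm_minus_commute[of f "synth (c m)"] by (simp add: \<delta>_def)
  have ptw: "norm (rep (c n) x - rep (c m) x) \<le> frame_const * (\<delta> n + \<delta> m)" for n m x
    using norm_rep_diff_le(2)[OF c c] mult_left_mono[OF dd frame_const(1)] by (rule order_trans)
  have fd: "(\<lambda>n. frame_const * \<delta> n) \<longlonglongrightarrow> 0" using tendsto_mult[OF tendsto_const \<delta>, of frame_const] by simp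
  have "\<exists>l. (\<lambda>n. rep (c n) x) \<longlonglongrightarrow> l" for x
  proof -
    have "Cauchy (\<lambda>n. rep (c n) x)"
    proof (rule metric_CauchyI)
      fix e :: real assume "0 < e"
      then have "\<forall>\<^sub>F n in sequentially. frame_const * \<delta> n < e / 2" by (intro order_tendstoD(2)[OF fd]) simp
      then obtain M where M: "\<And>n. M \<le> n \<Longrightarrow> frame_const * \<delta> n < e / 2" by (auto simp: eventually_sequentially)
      show "\<exists>M. \<forall>m\<ge>M. \<forall>n\<ge>M. dist (rep (c m) x) (rep (c n) x) < e"
      proof (intro exI allI impI)
        fix m n assume "M \<le> m" "M \<le> n"
        then show "dist (rep (c m) x) (rep (c n) x) < e"
          using ptw[of m x n] M[of m] M[of n] by (simp add: dist_norm distrib_left)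
      qed
    qed
    then show ?thesis by (simp add: Cauchy_convergent_iff convergent_def)
  qed
  then obtain F where F: "\<And>x. (\<lambda>n. rep (c n) x) \<longlonglongrightarrow> F x" by metis
  have Fn: "norm (F x - rep (c n) x) \<le> frame_const * \<delta> n" for n x
  proof (rule LIMSEQ_le)
    show "(\<lambda>m. norm (rep (c m) x - rep (c n) x)) \<longlonglongrightarrow> norm (F x - rep (c n) x)" by (intro tendsto_intros F)
    show "(\<lambda>m. frame_const * (\<delta> m + \<delta> n)) \<longlonglongrightarrow> frame_const * \<delta> n"
      using tendsto_mult[OF tendsto_const tendsto_add[OF \<delta> tendsto_const], of frame_const "\<delta> n"] by simp
    show "\<exists>N. \<forall>m\<ge>N. norm (rep (c m) x - rep (c n) x) \<le> frame_const * (\<delta> m + \<delta> n)" using ptw by blast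
  qed
  have unif: "uniform_limit UNIV (\<lambda>n. rep (c n)) F sequentially"
  proof (rule uniform_limitI)
    fix e :: real assume "0 < e"
    from order_tendstoD(2)[OF fd this] show "\<forall>\<^sub>F n in sequentially. \<forall>x\<in>UNIV. dist (rep (c n) x) (F x) < e"
    proof eventually_elim
      case (elim n)
      show ?case
      proof
        fix x
        show "dist (rep (c n) x) (F x) < e" using Fn[of x n] elim by (simp add: dist_norm norm_minus_commute)
      qed
    qed
  qed
  have contF: "continuous_on UNIV F"
    by (rule uniform_limit_theorem[OF _ unif]) (auto intro!: always_eventually continuous_rep c)
  note [measurable] = L2_borel[OF f] L2_borel[OF synth_L2[OF c]] borel_measurable_continuous_onI[OF contF]
  \<comment> \<open>By Fatou's lemma the L2 distance from f to the pointwise limit is at most the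
    limit of its distances to \<open>synth (c n)\<close>, which is 0.\<close>
  have "AE x in lborel. f x = F x"
  proof -
    have ae: "AE x in lborel. \<forall>n. synth (c n) x = rep (c n) x"
      using is_cont_rep_synth[OF c] unfolding AE_all_countable is_cont_rep_def by blast
    have "(\<integral>\<^sup>+x. ennreal ((norm (f x - F x))\<^sup>2) \<partial>lborel) =
        (\<integral>\<^sup>+x. liminf (\<lambda>n. ennreal ((norm (synth (c n) x - f x))\<^sup>2)) \<partial>lborel)"
    proof (rule nn_integral_cong_AE)
      show "AE x in lborel. ennreal ((norm (f x - F x))\<^sup>2) = liminf (\<lambda>n. ennreal ((norm (synth (c n) x - f x))\<^sup>2))"
        using ae
      proof eventually_elim
        case (elim x)
        have "(\<lambda>n. synth (c n) x) \<longlonglongrightarrow> F x" using F[of x] elim by simp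
        then have "(\<lambda>n. ennreal ((norm (synth (c n) x - f x))\<^sup>2)) \<longlonglongrightarrow> ennreal ((norm (F x - f x))\<^sup>2)"
          by (intro tendsto_ennrealI tendsto_intros)
        from lim_imp_Liminf[OF _ this] show ?case
          unfolding norm_minus_commute[of "f x" "F x"] by simp
      qed
    qed
    also have "\<dots> \<le> liminf (\<lambda>n. \<integral>\<^sup>+x. ennreal ((norm (synth (c n) x - f x))\<^sup>2) \<partial>lborel)"
      by (rule nn_integral_liminf) measurable
    also have "\<dots> = liminf (\<lambda>n. ennreal ((\<delta> n)\<^sup>2))"
      unfolding \<delta>_def by (intro arg_cong[where f = liminf] ext nn_integral_L2 L2_diff synth_L2 c f)
    also have "\<dots> = 0"
    proof -
      have "(\<lambda>n. ennreal ((\<delta> n)\<^sup>2)) \<longlonglongrightarrow> ennreal (0\<^sup>2)" by (intro tendsto_ennrealI tendsto_intros \<delta>)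
      then show ?thesis by (simp add: lim_imp_Liminf)
    qed
    finally have "(\<integral>\<^sup>+x. ennreal ((norm (f x - F x))\<^sup>2) \<partial>lborel) = 0" by simp
    then show ?thesis by (subst (asm) nn_integral_0_iff_AE) auto
  qed
  then have crF: "is_cont_rep f F" unfolding is_cont_rep_def using contF by simp
  have "(\<Sum>i<N. (norm (F (x + lat i) - rep (c n) (x + lat i)))\<^sup>2) \<le> (frame_const * \<delta> n)\<^sup>2" for n N x
  proof (rule LIMSEQ_le)
    show "(\<lambda>m. \<Sum>i<N. (norm (rep (c m) (x + lat i) - rep (c n) (x + lat i)))\<^sup>2) \<longlonglongrightarrow>
        (\<Sum>i<N. (norm (F (x + lat i) - rep (c n) (x + lat i)))\<^sup>2)"
      by (intro tendsto_intros F)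
    show "(\<lambda>m. (frame_const * (\<delta> m + \<delta> n))\<^sup>2) \<longlonglongrightarrow> (frame_const * \<delta> n)\<^sup>2"
      using tendsto_power[OF tendsto_mult[OF tendsto_const tendsto_add[OF \<delta> tendsto_const], of frame_const "\<delta> n"], of 2]
      by simp
    show "\<exists>M. \<forall>m\<ge>M. (\<Sum>i<N. (norm (rep (c m) (x + lat i) - rep (c n) (x + lat i)))\<^sup>2) \<le> (frame_const * (\<delta> m + \<delta> n))\<^sup>2"
    proof (intro exI[of _ 0] allI impI)
      fix m
      have "frame_const * L2_norm (\<lambda>x. synth (c m) x - synth (c n) x) \<le> frame_const * (\<delta> m + \<delta> n)"
        by (rule mult_left_mono[OF dd frame_const(1)])
      then have "(frame_const * L2_norm (\<lambda>x. synth (c m) x - synth (c n) x))\<^sup>2 \<le> (frame_const * (\<delta> m + \<delta> n))\<^sup>2"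
        by (intro power_mono) (auto simp: frame_const(1))
      with norm_rep_diff_le(1)[OF c c] show "(\<Sum>i<N. (norm (rep (c m) (x + lat i) - rep (c n) (x + lat i)))\<^sup>2) \<le> (frame_const * (\<delta> m + \<delta> n))\<^sup>2"
        by (rule order_trans)
    qed
  qed
  note le = this
  show ?thesis by (rule that[OF crF F le[unfolded \<delta>_def]])
qed

lemma L2_norm_limit:
  assumes "f \<in> L2" "\<And>n. u n \<in> L2" "L2_limit u f"
  shows "(\<lambda>n. L2_norm (u n)) \<longlonglongrightarrow> L2_norm f"
proof -
  have "(\<lambda>n. L2_norm (u n) - L2_norm f) \<longlonglongrightarrow> 0"
    using assms(3) unfolding L2_limit_def
    by (rule Lim_null_comparison[OF always_eventually, rotated])
      (simp add: L2_norm_diff_ge[OF assms(2,1)])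
  then show ?thesis by (rule LIM_zero_cancel)
qed

text \<open>The difference bound of \<open>limit_rep\<close> is what
  \<open>sums_square_limit\<close> asks of the sample sequences.\<close>

lemma energy_limit:
  assumes f: "f \<in> L2" and c: "\<And>n. c n \<in> coeffs" and lim: "L2_limit (\<lambda>n. synth (c n)) f"
  shows "is_cont_rep f (cont_rep f)"
    and "summable (\<lambda>n. (norm (cont_rep f (x + lat n)))\<^sup>2)"
    and "(\<lambda>n. energy (rep (c n)) x) \<longlonglongrightarrow> energy (cont_rep f) x"
    and "energy (cont_rep f) x \<le> (frame_const * L2_norm f)\<^sup>2"
proof -
  obtain F where F: "is_cont_rep f F" and "\<And>x. (\<lambda>n. rep (c n) x) \<longlonglongrightarrow> F x"
    and le: "\<And>n N x. (\<Sum>i<N. (norm (F (x + lat i) - rep (c n) (x + lat i)))\<^sup>2) \<le>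
      (frame_const * L2_norm (\<lambda>x. synth (c n) x - f x))\<^sup>2"
    by (rule limit_rep[OF f c lim]) (rule that)
  have e: "cont_rep f = F" by (rule cont_rep_eq[OF F])
  show "is_cont_rep f (cont_rep f)" unfolding e by (rule F)
  have d: "(\<lambda>n. frame_const * L2_norm (\<lambda>x. synth (c n) x - f x)) \<longlonglongrightarrow> 0"
    using tendsto_mult[OF tendsto_const lim[unfolded L2_limit_def], of frame_const] by simp
  note sq = sums_square_limit[OF energy_rep_eq(2)[OF c] le d]
  show "summable (\<lambda>n. (norm (cont_rep f (x + lat n)))\<^sup>2)" unfolding e by (rule sq(1)) (simp add: frame_const)
  show lim_e: "(\<lambda>n. energy (rep (c n)) x) \<longlonglongrightarrow> energy (cont_rep f) x"
    unfolding e energy_def by (rule sq(2)) (simp add: frame_const)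
  show "energy (cont_rep f) x \<le> (frame_const * L2_norm f)\<^sup>2"
  proof (rule LIMSEQ_le[OF lim_e])
    show "(\<lambda>n. (frame_const * L2_norm (synth (c n)))\<^sup>2) \<longlonglongrightarrow> (frame_const * L2_norm f)\<^sup>2"
      by (intro tendsto_intros L2_norm_limit f synth_L2 c lim)
    show "\<exists>N. \<forall>n\<ge>N. energy (rep (c n)) x \<le> (frame_const * L2_norm (synth (c n)))\<^sup>2"
      using energy_rep_le[OF c] by (simp add: power_mult_distrib frame_const)
  qed
qed

lemma V_cont_rep:
  assumes "f \<in> V"
  shows "f \<in> L2" "is_cont_rep f (cont_rep f)" "summable (\<lambda>n. (norm (cont_rep f (x + lat n)))\<^sup>2)"
    and "energy (cont_rep f) x \<le> (frame_const * L2_norm f)\<^sup>2"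
proof -
  obtain c where f: "f \<in> L2" and c: "\<And>n. c n \<in> coeffs" and lim: "L2_limit (\<lambda>n. synth (c n)) f"
    using assms unfolding V_iff by blast
  show "f \<in> L2" "is_cont_rep f (cont_rep f)" "summable (\<lambda>n. (norm (cont_rep f (x + lat n)))\<^sup>2)"
    and "energy (cont_rep f) x \<le> (frame_const * L2_norm f)\<^sup>2"
    by (rule f energy_limit[OF f c lim])+
qed

lemma norm_cont_rep_le:
  assumes f: "f \<in> V" shows "norm (cont_rep f x) \<le> frame_const * L2_norm f"
proof -
  obtain n0 where n0: "lat n0 = (0 :: real ^ 'd)" using ex_lat_0 by blast
  have "(norm (cont_rep f x))\<^sup>2 = (\<Sum>i\<in>{n0}. (norm (cont_rep f (x + lat i)))\<^sup>2)" by (simp add: n0)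
  also have "\<dots> \<le> energy (cont_rep f) x"
    unfolding energy_def by (intro sum_le_suminf V_cont_rep(3) f) auto
  also have "\<dots> \<le> (frame_const * L2_norm f)\<^sup>2" by (rule V_cont_rep(4)[OF f])
  finally show ?thesis by (rule power2_le_imp_le) (simp add: frame_const)
qed

lemma V_add_scale:
  assumes f: "f \<in> V" and h: "h \<in> V" shows "(\<lambda>x. f x + a * h x) \<in> V"
proof -
  obtain c where c: "f \<in> L2" "\<And>n. c n \<in> coeffs" "L2_limit (\<lambda>n. synth (c n)) f" using f unfolding V_iff by blast
  obtain d where d: "h \<in> L2" "\<And>n. d n \<in> coeffs" "L2_limit (\<lambda>n. synth (d n)) h" using h unfolding V_iff by blast
  have "L2_limit (\<lambda>n. synth (\<lambda>p. c n p + a * d n p)) (\<lambda>x. f x + a * h x)"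
    unfolding L2_limit_def
  proof (rule Lim_null_comparison[OF always_eventually])
    show "\<forall>n. norm (L2_norm (\<lambda>x. synth (\<lambda>p. c n p + a * d n p) x - (f x + a * h x))) \<le>
        L2_norm (\<lambda>x. synth (c n) x - f x) + norm a * L2_norm (\<lambda>x. synth (d n) x - h x)"
    proof
      fix n
      have "L2_norm (\<lambda>x. (synth (c n) x - f x) + a * (synth (d n) x - h x)) \<le>
          L2_norm (\<lambda>x. synth (c n) x - f x) + L2_norm (\<lambda>x. a * (synth (d n) x - h x))"
        by (intro L2_norm_triangle L2_scale L2_diff synth_L2 c d)
      moreover have "(synth (c n) x - f x) + a * (synth (d n) x - h x) = synth (\<lambda>p. c n p + a * d n p) x - (f x + a * h x)" for x
        by (simp add: coeffs_add_scale(2)[OF c(2) d(2)] algebra_simps)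
      ultimately show "norm (L2_norm (\<lambda>x. synth (\<lambda>p. c n p + a * d n p) x - (f x + a * h x))) \<le>
        L2_norm (\<lambda>x. synth (c n) x - f x) + norm a * L2_norm (\<lambda>x. synth (d n) x - h x)"
        by (simp add: L2_norm_scale)
    qed
    show "(\<lambda>n. L2_norm (\<lambda>x. synth (c n) x - f x) + norm a * L2_norm (\<lambda>x. synth (d n) x - h x)) \<longlonglongrightarrow> 0"
      using tendsto_add[OF c(3)[unfolded L2_limit_def] tendsto_mult[OF tendsto_const d(3)[unfolded L2_limit_def]], of "norm a"]
      by simp
  qed
  then show ?thesis
    unfolding V_iff using c d coeffs_add_scale(1)[OF c(2) d(2), of _ a]
    by (intro conjI L2_add L2_scale exI[of _ "\<lambda>n p. c n p + a * d n p"]) auto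
qed

lemma zero_in_V: "(\<lambda>x. 0) \<in> V"
  using synth_in_V[OF zero_coeffs(1)] unfolding zero_coeffs(2) .

lemma V_diff: "f \<in> V \<Longrightarrow> h \<in> V \<Longrightarrow> (\<lambda>x. f x - h x) \<in> V"
  using V_add_scale[of f h "-1"] by simp

lemma cont_rep_diff:
  assumes "f \<in> V" "h \<in> V" shows "cont_rep (\<lambda>x. f x - h x) = (\<lambda>x. cont_rep f x - cont_rep h x)"
proof (rule cont_rep_eq)
  have "AE x in lborel. f x = cont_rep f x" "AE x in lborel. h x = cont_rep h x"
    using V_cont_rep(2) assms by (auto simp: is_cont_rep_def)
  then have "AE x in lborel. f x - h x = cont_rep f x - cont_rep h x" by eventually_elim simp
  then show "is_cont_rep (\<lambda>x. f x - h x) (\<lambda>x. cont_rep f x - cont_rep h x)"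
    using V_cont_rep(2)[OF assms(1)] V_cont_rep(2)[OF assms(2)]
    unfolding is_cont_rep_def by (auto intro!: continuous_intros)
qed

lemma V_closed:
  assumes f: "f \<in> L2" and u: "\<And>n. u n \<in> V" and lim: "L2_limit u f"
  shows "f \<in> V"
proof -
  have "\<exists>c. c \<in> coeffs \<and> L2_norm (\<lambda>x. synth c x - u n x) < inverse (real (Suc n))" for n
  proof -
    obtain c where c: "\<And>m. c m \<in> coeffs" "(\<lambda>m. L2_norm (\<lambda>x. synth (c m) x - u n x)) \<longlonglongrightarrow> 0"
      using u[of n] unfolding V_iff L2_limit_def by blast
    have "\<forall>\<^sub>F m in sequentially. L2_norm (\<lambda>x. synth (c m) x - u n x) < inverse (real (Suc n))"
      by (rule order_tendstoD(2)[OF c(2)]) simp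
    then show ?thesis using c(1) by (auto simp: eventually_sequentially)
  qed
  then obtain c where c: "\<And>n. c n \<in> coeffs"
    and cu: "\<And>n. L2_norm (\<lambda>x. synth (c n) x - u n x) < inverse (real (Suc n))" by metis
  have "L2_limit (\<lambda>n. synth (c n)) f"
    unfolding L2_limit_def
  proof (rule Lim_null_comparison[OF always_eventually])
    show "\<forall>n. norm (L2_norm (\<lambda>x. synth (c n) x - f x)) \<le> inverse (real (Suc n)) + L2_norm (\<lambda>x. u n x - f x)"
    proof
      fix n
      have "L2_norm (\<lambda>x. synth (c n) x - f x) \<le> L2_norm (\<lambda>x. synth (c n) x - u n x) + L2_norm (\<lambda>x. u n x - f x)"
        by (intro L2_norm_triangle_diff synth_L2 c V_cont_rep(1) u f)
      then show "norm (L2_norm (\<lambda>x. synth (c n) x - f x)) \<le> inverse (real (Suc n)) + L2_norm (\<lambda>x. u n x - f x)"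
        using cu[of n] by simp
    qed
    show "(\<lambda>n. inverse (real (Suc n)) + L2_norm (\<lambda>x. u n x - f x)) \<longlonglongrightarrow> 0"
      using tendsto_add[OF LIMSEQ_inverse_real_of_nat lim[unfolded L2_limit_def]] by simp
  qed
  then show ?thesis unfolding V_iff using f c by blast
qed

text \<open>The evaluation bound makes the continuous representatives converge at every point, which
  gives the limit function explicitly. Fatou's lemma shows that it is the L2 limit, and
  \<open>V_closed\<close> puts it into \<open>V\<close>.\<close>

lemma V_complete:
  assumes u: "\<And>n. u n \<in> V"
    and cauchy: "\<And>e. e > 0 \<Longrightarrow> \<exists>N. \<forall>p\<ge>N. \<forall>q\<ge>N. L2_norm (\<lambda>x. u p x - u q x) < e"
  shows "\<exists>f\<in>V. L2_limit u f"
proof -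
  have ptw: "norm (cont_rep (u p) x - cont_rep (u q) x) \<le> frame_const * L2_norm (\<lambda>x. u p x - u q x)" for p q x
    using norm_cont_rep_le[OF V_diff[OF u u], of p q x] by (simp add: cont_rep_diff u)
  have "\<exists>l. (\<lambda>n. cont_rep (u n) x) \<longlonglongrightarrow> l" for x
  proof -
    have "Cauchy (\<lambda>n. cont_rep (u n) x)"
    proof (rule metric_CauchyI)
      fix e :: real assume e: "0 < e"
      have "0 < e / (frame_const + 1)" using e frame_const(1) by simp
      then obtain M where M: "\<forall>p\<ge>M. \<forall>q\<ge>M. L2_norm (\<lambda>x. u p x - u q x) < e / (frame_const + 1)" using cauchy by blast
      show "\<exists>M. \<forall>m\<ge>M. \<forall>n\<ge>M. dist (cont_rep (u m) x) (cont_rep (u n) x) < e"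
      proof (intro exI allI impI)
        fix m n assume mn: "M \<le> m" "M \<le> n"
        have "dist (cont_rep (u m) x) (cont_rep (u n) x) \<le> frame_const * L2_norm (\<lambda>x. u m x - u n x)"
          using ptw by (simp add: dist_norm)
        also have "\<dots> \<le> frame_const * (e / (frame_const + 1))"
          using M mn frame_const(1) by (intro mult_left_mono) (auto intro: less_imp_le)
        also have "\<dots> < (frame_const + 1) * (e / (frame_const + 1))"
          using e frame_const(1) by (intro mult_strict_right_mono) auto
        also have "\<dots> = e" using frame_const(1) by simp
        finally show "dist (cont_rep (u m) x) (cont_rep (u n) x) < e" .
      qed
    qed
    then show ?thesis by (simp add: Cauchy_convergent_iff convergent_def)
  qed
  then obtain F where F: "\<And>x. (\<lambda>n. cont_rep (u n) x) \<longlonglongrightarrow> F x" by metis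
  have cr: "cont_rep (u n) \<in> borel_measurable borel" for n
    using V_cont_rep(2)[OF u] by (auto simp: is_cont_rep_def intro: borel_measurable_continuous_onI)
  have Fm: "F \<in> borel_measurable borel" by (rule borel_measurable_LIMSEQ_metric[OF cr F])
  note [measurable] = cr Fm L2_borel[OF V_cont_rep(1)[OF u]]
  have ae: "AE x in lborel. \<forall>n. u n x = cont_rep (u n) x"
    using V_cont_rep(2)[OF u] unfolding AE_all_countable is_cont_rep_def by blast
  have bound: "(\<integral>\<^sup>+x. ennreal ((norm (u n x - F x))\<^sup>2) \<partial>lborel) \<le> ennreal (e\<^sup>2)"
    if N: "\<forall>p\<ge>N. \<forall>q\<ge>N. L2_norm (\<lambda>x. u p x - u q x) < e" and n: "N \<le> n" for N n e
  proof -
    have e0: "0 < e" using N n L2_norm_nonneg[of "\<lambda>x. u n x - u n x"] by (meson le_less_trans)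
    have "(\<integral>\<^sup>+x. ennreal ((norm (u n x - F x))\<^sup>2) \<partial>lborel) =
        (\<integral>\<^sup>+x. liminf (\<lambda>m. ennreal ((norm (u n x - u m x))\<^sup>2)) \<partial>lborel)"
    proof (rule nn_integral_cong_AE)
      show "AE x in lborel. ennreal ((norm (u n x - F x))\<^sup>2) = liminf (\<lambda>m. ennreal ((norm (u n x - u m x))\<^sup>2))"
        using ae
      proof eventually_elim
        case (elim x)
        have "(\<lambda>m. u m x) \<longlonglongrightarrow> F x" using F[of x] elim by simp
        then have "(\<lambda>m. ennreal ((norm (u n x - u m x))\<^sup>2)) \<longlonglongrightarrow> ennreal ((norm (u n x - F x))\<^sup>2)"
          by (intro tendsto_ennrealI tendsto_intros)
        from lim_imp_Liminf[OF _ this] show ?case by simp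
      qed
    qed
    also have "\<dots> \<le> liminf (\<lambda>m. \<integral>\<^sup>+x. ennreal ((norm (u n x - u m x))\<^sup>2) \<partial>lborel)"
      by (rule nn_integral_liminf) measurable
    also have "\<dots> \<le> liminf (\<lambda>m::nat. ennreal (e\<^sup>2))"
    proof (rule Liminf_mono)
      show "\<forall>\<^sub>F m in sequentially. (\<integral>\<^sup>+x. ennreal ((norm (u n x - u m x))\<^sup>2) \<partial>lborel) \<le> ennreal (e\<^sup>2)"
        using eventually_ge_at_top[of N]
      proof eventually_elim
        case (elim m)
        have "(\<integral>\<^sup>+x. ennreal ((norm (u n x - u m x))\<^sup>2) \<partial>lborel) = ennreal ((L2_norm (\<lambda>x. u n x - u m x))\<^sup>2)"
          by (intro nn_integral_L2 L2_diff V_cont_rep(1) u)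
        also have "\<dots> \<le> ennreal (e\<^sup>2)"
          using N n elim by (intro ennreal_leI power_mono) (auto intro: less_imp_le)
        finally show ?case .
      qed
    qed
    also have "\<dots> = ennreal (e\<^sup>2)" by (simp add: Liminf_const)
    finally show ?thesis .
  qed
  have "\<exists>N. \<forall>p\<ge>N. \<forall>q\<ge>N. L2_norm (\<lambda>x. u p x - u q x) < 1" by (rule cauchy) simp
  then obtain N where N: "\<forall>p\<ge>N. \<forall>q\<ge>N. L2_norm (\<lambda>x. u p x - u q x) < 1" by blast
  have "(\<lambda>x. u N x - F x) \<in> L2" by (rule L2I[OF _ bound[OF N order_refl]]) measurable
  then have FL: "F \<in> L2" using L2_diff[OF V_cont_rep(1)[OF u[of N]]] by fastforce
  have lim: "L2_limit u F"
    unfolding L2_limit_def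
  proof (rule LIMSEQ_I)
    fix r :: real assume r: "0 < r"
    then obtain M where M: "\<forall>p\<ge>M. \<forall>q\<ge>M. L2_norm (\<lambda>x. u p x - u q x) < r / 2" using cauchy[of "r / 2"] by auto
    show "\<exists>no. \<forall>n\<ge>no. norm (L2_norm (\<lambda>x. u n x - F x) - 0) < r"
    proof (intro exI allI impI)
      fix n assume n: "M \<le> n"
      have "ennreal ((L2_norm (\<lambda>x. u n x - F x))\<^sup>2) \<le> ennreal ((r / 2)\<^sup>2)"
        using bound[OF M n] nn_integral_L2[OF L2_diff[OF V_cont_rep(1)[OF u] FL], of n] by simp
      then have "(L2_norm (\<lambda>x. u n x - F x))\<^sup>2 \<le> (r / 2)\<^sup>2" by (subst (asm) ennreal_le_iff) auto
      then have "L2_norm (\<lambda>x. u n x - F x) \<le> r / 2" by (rule power2_le_imp_le) (use r in simp)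
      then show "norm (L2_norm (\<lambda>x. u n x - F x) - 0) < r" using r by simp
    qed
  qed
  then show ?thesis using V_closed[OF FL u lim] by blast
qed

lemma RKHS: "L2_RKHS V"
  unfolding L2_RKHS_def
proof (intro conjI)
  show "V \<subseteq> L2" using V_cont_rep(1) by blast
  show "(\<lambda>x. 0) \<in> V" by (rule zero_in_V)
  show "\<forall>f\<in>V. \<forall>g\<in>V. (\<lambda>x. f x + g x) \<in> V" using V_add_scale[of _ _ 1] by simp
  show "\<forall>c. \<forall>f\<in>V. (\<lambda>x. c * f x) \<in> V" using V_add_scale[OF zero_in_V] by simp
  show "\<forall>f\<in>V. \<exists>g. is_cont_rep f g" using V_cont_rep(2) by blast
  show "\<forall>x. \<exists>B. \<forall>f\<in>V. norm (cont_rep f x) \<le> B * L2_norm f" using norm_cont_rep_le by blast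
qed (use V_complete in blast)

end

section \<open>Isotropy of the fibers and countable dense coefficients\<close>

definition rat_complex :: "complex set" where
  "rat_complex = {z. Re z \<in> \<rat> \<and> Im z \<in> \<rat>}"

lemma countable_rat_complex: "countable rat_complex"
proof -
  have "rat_complex \<subseteq> (\<lambda>(a, b). Complex a b) ` (\<rat> \<times> \<rat>)"
  proof
    fix z assume "z \<in> rat_complex"
    then show "z \<in> (\<lambda>(a, b). Complex a b) ` (\<rat> \<times> \<rat>)"
      by (intro image_eqI[of _ _ "(Re z, Im z)"]) (auto simp: rat_complex_def)
  qed
  then show ?thesis by (rule countable_subset) (intro countable_image countable_SIGMA countable_rat)
qed

lemma rat_complex_approx:
  assumes "0 < e" shows "\<exists>q\<in>rat_complex. norm (z - q) < e"
proof -
  obtain a where a: "a \<in> \<rat>" "Re z - e / 2 < a" "a < Re z" using Rats_dense_in_real[of "Re z - e / 2" "Re z"] assms by auto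
  obtain b where b: "b \<in> \<rat>" "Im z - e / 2 < b" "b < Im z" using Rats_dense_in_real[of "Im z - e / 2" "Im z"] assms by auto
  have "norm (z - Complex a b) \<le> \<bar>Re (z - Complex a b)\<bar> + \<bar>Im (z - Complex a b)\<bar>" by (rule cmod_le)
  also have "\<dots> < e" using a b by simp
  finally show ?thesis using a b by (intro bexI[of _ "Complex a b"]) (auto simp: rat_complex_def)
qed

lemma integral_chr_series:
  fixes b :: "nat \<Rightarrow> complex"
  assumes b: "summable (\<lambda>n. norm (b n))" and h: "h \<in> borel_measurable borel" "\<And>x. norm (h x) \<le> B"
  shows "(LINT x|cube_measure. (\<Sum>n. b n * chr (lat n) (x :: real^'d::finite)) * h x) =
      (\<Sum>n. b n * (LINT x|cube_measure. chr (lat n) x * h x))"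
proof -
  have B0: "0 \<le> B" using norm_ge_zero[of "h 0"] h(2)[of 0] by linarith
  have i: "integrable cube_measure (\<lambda>x. b n * (chr (lat n) (x :: real^'d) * h x))" for n
    using h by (intro integrable_mult_right cube_integrable_bounded[where B = B] borel_measurable_times chr_borel)
      (auto simp: norm_mult)
  have nb: "norm (b n * (chr (lat n) x * h x)) \<le> norm (b n) * B" for n and x :: "real ^ 'd"
    using h(2) by (simp add: norm_mult mult_left_mono)
  have s: "AE x in cube_measure. summable (\<lambda>n. norm (b n * (chr (lat n) (x :: real^'d) * h x)))"
  proof (rule AE_I2)
    fix x :: "real ^ 'd"
    show "summable (\<lambda>n. norm (b n * (chr (lat n) x * h x)))"
      by (rule summable_comparison_test'[OF summable_mult2[OF b, of B]]) (use nb[of _ x] in simp)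
  qed
  have sm: "summable (\<lambda>n. LINT x|cube_measure. norm (b n * (chr (lat n) (x :: real^'d) * h x)))"
  proof (rule summable_comparison_test'[OF summable_mult2[OF b, of B]])
    fix n :: nat
    have "(LINT x|cube_measure. norm (b n * (chr (lat n) (x :: real^'d) * h x))) \<le> (LINT x|(cube_measure :: (real^'d) measure). norm (b n) * B)"
      by (intro integral_mono integrable_norm i nb) simp
    also have "\<dots> = norm (b n) * B" by (simp add: cube.prob_space[simplified])
    finally show "norm (LINT x|cube_measure. norm (b n * (chr (lat n) (x :: real^'d) * h x))) \<le> norm (b n) * B"
      by simp
  qed
  have "(LINT x|cube_measure. (\<Sum>n. b n * chr (lat n) (x :: real^'d)) * h x) =
      (LINT x|cube_measure. (\<Sum>n. b n * (chr (lat n) x * h x)))"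
  proof (intro Bochner_Integration.integral_cong refl)
    fix x :: "real ^ 'd"
    have "summable (\<lambda>n. b n * chr (lat n) x)" by (rule summable_norm_cancel) (simp add: norm_mult b)
    then show "(\<Sum>n. b n * chr (lat n) x) * h x = (\<Sum>n. b n * (chr (lat n) x * h x))"
      by (subst suminf_mult2) (simp_all add: mult.assoc)
  qed
  also have "\<dots> = (\<Sum>n. LINT x|cube_measure. b n * (chr (lat n) (x :: real^'d) * h x))"
    by (rule integral_suminf[OF i s sm])
  finally show ?thesis by simp
qed

text \<open>Parseval's identity in x for two absolutely convergent series, whose Fourier
  coefficients are the values of the functions on the coset of w.\<close>

lemma integral_zak_chr_product:
  fixes g1 g2 :: "real ^ 'd::finite \<Rightarrow> complex"
  assumes g1: "summable (\<lambda>n. norm (g1 (w + lat n)))" and g2: "summable (\<lambda>n. norm (g2 (w + lat n)))"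
  shows "(LINT x|cube_measure. zak_chr g1 w x * cnj (zak_chr g2 w x)) = (\<Sum>n. g1 (w + lat n) * cnj (g2 (w + lat n)))"
proof -
  have bd: "norm (zak_chr g2 w x) \<le> (\<Sum>n. norm (g2 (w + lat n)))" for x
  proof -
    have "norm (zak_chr g2 w x) \<le> (\<Sum>n. norm (g2 (w + lat n) * chr (lat n) x))"
      unfolding zak_chr_def by (rule summable_norm) (simp add: norm_mult g2)
    then show ?thesis by (simp add: norm_mult)
  qed
  have coef: "(LINT x|cube_measure. chr (lat n) x * cnj (zak_chr g2 w x)) = cnj (g2 (w + lat n))" for n
  proof -
    have "(LINT x|cube_measure. chr (lat n) x * cnj (zak_chr g2 w x)) =
        cnj (LINT x|cube_measure. zak_chr g2 w x * chr (- lat n) x)"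
      unfolding Bochner_Integration.integral_cnj[symmetric] by (simp add: mult.commute)
    also have "(LINT x|cube_measure. zak_chr g2 w x * chr (- lat n) x) =
        (\<Sum>m. g2 (w + lat m) * (LINT x|cube_measure. chr (lat m) x * chr (- lat n) (x :: real^'d)))"
      unfolding zak_chr_def
      by (rule integral_chr_series[where B = 1 and h = "chr (- lat n)"]) (simp_all add: g2 chr_borel)
    also have "\<dots> = (\<Sum>m. if m = n then g2 (w + lat m) else 0)"
    proof (intro arg_cong[where f = suminf] ext)
      fix m
      have "(LINT x|cube_measure. chr (lat m) x * chr (- lat n) (x :: real^'d)) = (LINT x|cube_measure. chr (lat m - lat n) (x :: real^'d))"
        using chr_add_left[of "lat m :: real^'d" "- lat n"] by simp
      also have "\<dots> = (if lat m - lat n = (0 :: real^'d) then 1 else 0)"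
        by (intro integral_chr int_lattice_diff) auto
      finally show "g2 (w + lat m) * (LINT x|cube_measure. chr (lat m) x * chr (- lat n) (x :: real^'d)) = (if m = n then g2 (w + lat m) else 0)"
        by simp
    qed
    also have "\<dots> = g2 (w + lat n)" using sums_single[of n "\<lambda>m. g2 (w + lat m)"] by (simp add: sums_iff)
    finally show ?thesis .
  qed
  have "(LINT x|cube_measure. zak_chr g1 w x * cnj (zak_chr g2 w x)) =
      (\<Sum>n. g1 (w + lat n) * (LINT x|cube_measure. chr (lat n) x * cnj (zak_chr g2 w x)))"
    unfolding zak_chr_def[of g1]
    by (rule integral_chr_series[OF g1 borel_measurable_cnj[OF zak_chr_borel_right],
          where B = "\<Sum>n. norm (g2 (w + lat n))"]) (simp only: complex_mod_cnj bd)
  then show ?thesis by (simp add: coef)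
qed

context orthonormal_shifts
begin

definition isotropic_at :: "real ^ 'd \<Rightarrow> bool" where
  "isotropic_at w \<longleftrightarrow> (\<forall>i\<in>{1..k}. \<forall>j\<in>{1..k}.
     (LINT x|cube_measure. cnj (fiber w x i) * fiber w x j) = (if i = j then 1 else 0))"

text \<open>By \<open>integral_zak_chr_product\<close> the integral over x is the periodization of
  \<open>g j\<close> times the conjugate of \<open>g i\<close>, which
  \<open>periodized_product_eq\<close> computes from orthonormality.\<close>

lemma AE_isotropic: "AE w in cube_measure. isotropic_at w"
proof -
  have "AE w in cube_measure. (LINT x|cube_measure. cnj (fiber w x i) * fiber w x j) = (if i = j then 1 else 0)"
    if i: "i \<in> {1..k}" and j: "j \<in> {1..k}" for i j
  proof -
    have "AE w in cube_measure. (\<Sum>n. g j (w + lat n) * cnj (g i (w + lat n))) = (if i = j then 1 else 0)"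
    proof (rule periodized_product_eq[OF ft[OF j] ft[OF i] g_integrable[OF i]])
      fix l :: "real ^ 'd" assume l: "l \<in> int_lattice"
      have "L2_inner (\<lambda>x. \<phi> j (x - 0)) (\<lambda>x. \<phi> i (x - l)) = (if j = i \<and> 0 = l then 1 else 0)"
        using orthonormal i j l int_lattice_0 unfolding orthonormal_translates_def by blast
      then show "(LINT x|lborel. \<phi> j x * cnj (\<phi> i (x - l))) = (if l = 0 then if i = j then 1 else 0 else 0)"
        by (auto simp: L2_inner_def)
    qed
    then show ?thesis using AE_good
    proof eventually_elim
      case (elim w)
      have s: "summable (\<lambda>n. norm (g i (w + lat n)))" "summable (\<lambda>n. norm (g j (w + lat n)))"
        using elim(2) i j unfolding good_def by (auto intro!: summable_periodization(1)[OF _ C_nonneg])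
      have "(LINT x|cube_measure. cnj (fiber w x i) * fiber w x j) = (LINT x|cube_measure. zak_chr (g j) w x * cnj (zak_chr (g i) w x))"
        using elim(2) by (simp add: fiber_def mult.commute)
      then show ?case using integral_zak_chr_product[OF s(2,1)] elim(1) by simp
    qed
  qed
  then show ?thesis unfolding isotropic_at_def by (intro AE_finite_allI) auto
qed

lemma sample_locale:
  assumes w: "isotropic_at w" and R: "0 < real k * C\<^sup>2"
  shows "isotropic_sample cube_measure {1..k} (\<lambda>x. fiber w x) (real k * C\<^sup>2)"
proof (intro isotropic_sample.intro isotropic_sample_axioms.intro)
  show "prob_space (cube_measure :: (real ^ 'd) measure)" by (rule prob_space_cube_measure)
  show "(LINT x|cube_measure. cnj (fiber w x i) * fiber w x j) = (if i = j then 1 else 0)"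
    if "i \<in> {1..k}" "j \<in> {1..k}" for i j using w that unfolding isotropic_at_def by blast
  show "(\<lambda>x. fiber w x i) \<in> borel_measurable cube_measure" for i
    by (rule borel_measurable_cube_measure[OF fiber_borel_right])
qed (use nsq_fiber_le R in auto)

text \<open>A nonempty open set has positive measure. This supplies points with properties known
  only almost everywhere.\<close>

lemma cube_ex_point:
  assumes Q: "AE w in cube_measure. Q w" and U: "open U" "U \<noteq> {}" "U \<subseteq> unit_cube"
  obtains w :: "real ^ 'd" where "w \<in> U" "Q w"
proof -
  have "\<exists>w\<in>U. Q w"
  proof (rule ccontr)
    assume c: "\<not> (\<exists>w\<in>U. Q w)"
    have "AE w in lborel. w \<notin> U"
      using Q unfolding AE_cube_measure by eventually_elim (use c U(3) in blast)
    then have "U \<in> null_sets lborel" using U(1) by (subst (asm) AE_iff_null_sets[symmetric]) auto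
    then have "negligible U" by (simp add: negligible_iff_null_sets null_sets_completionI)
    then show False using open_not_negligible U by blast
  qed
  then show ?thesis using that by blast
qed

text \<open>For C = 0 all fibers vanish, which contradicts isotropy. Positivity makes k C^2
  admissible as the bound R of \<open>isotropic_sample\<close>.\<close>

lemma C_pos:
  assumes k: "1 \<le> k" shows "0 < C"
proof (rule ccontr)
  assume "\<not> 0 < C"
  then have C0: "C = 0" using C_nonneg by simp
  have "interior (unit_cube :: (real ^ 'd) set) \<noteq> {}"
  proof -
    have "0 \<in> box (\<chi> j. - 1 / 2) (\<chi> j. 1 / 2 :: real ^ 'd)" by (simp add: mem_box_cart)
    then show ?thesis unfolding unit_cube_def interior_cbox by blast
  qed
  then obtain w where w: "isotropic_at w"
    using cube_ex_point[OF AE_isotropic open_interior _ interior_subset] by blast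
  have "fiber w x 1 = 0" for x using norm_fiber_le[of 1 w x] k C0 by simp
  moreover have "(LINT x|cube_measure. cnj (fiber w x 1) * fiber w x 1) = 1"
    using w k unfolding isotropic_at_def by simp
  ultimately show False by simp
qed

text \<open>A countable set whose combinations are dense in \<open>V\<close>; it makes the
  quantifier over \<open>V\<close> in the sampling event countable.\<close>

definition rat_coeffs :: "'d coeff set" where
  "rat_coeffs = {c \<in> coeffs. \<forall>p. c p \<in> rat_complex}"

lemma countable_rat_coeffs: "countable rat_coeffs"
proof -
  let ?F = "\<lambda>xs p. case map_of xs p of Some z \<Rightarrow> z | None \<Rightarrow> (0 :: complex)"
  have "rat_coeffs \<subseteq> ?F ` lists (idx \<times> rat_complex)"
  proof
    fix c assume c: "c \<in> rat_coeffs"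
    then have fin: "finite {p. c p \<noteq> 0}" and sub: "{p. c p \<noteq> 0} \<subseteq> idx" by (auto simp: rat_coeffs_def coeffs_def)
    obtain ps where ps: "set ps = {p. c p \<noteq> 0}" using finite_list[OF fin] by blast
    have "c = ?F (map (\<lambda>p. (p, c p)) ps)"
      using ps by (auto simp: fun_eq_iff map_of_map_restrict restrict_map_def)
    moreover have "map (\<lambda>p. (p, c p)) ps \<in> lists (idx \<times> rat_complex)"
      using ps sub c by (auto simp: rat_coeffs_def)
    ultimately show "c \<in> ?F ` lists (idx \<times> rat_complex)" by (rule image_eqI)
  qed
  moreover have "countable (?F ` lists (idx \<times> rat_complex))"
    unfolding idx_def
    by (intro countable_image countable_lists countable_SIGMA countable_int_lattice countable_rat_complex) simp
  ultimately show ?thesis by (rule countable_subset)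
qed

lemma rat_coeffs_dense:
  assumes c: "c \<in> coeffs" and e: "0 < e"
  shows "\<exists>d\<in>rat_coeffs. L2_norm (\<lambda>x. synth d x - synth c x) < e"
proof -
  let ?S = "{p. c p \<noteq> 0}"
  \<comment> \<open>With n coefficients the squared error is at most n \<delta>^2, and n < (n + 1)^2
    makes it less than e^2.\<close>
  define \<delta> where "\<delta> = e / (real (card ?S) + 1)"
  have \<delta>: "0 < \<delta>" using e by (simp add: \<delta>_def)
  have "\<exists>q\<in>rat_complex. norm (z - q) < \<delta>" for z by (rule rat_complex_approx[OF \<delta>])
  then obtain q where q: "\<And>z. q z \<in> rat_complex" "\<And>z. norm (z - q z) < \<delta>" by metis
  \<comment> \<open>Zero coefficients stay zero, so the support stays finite and inside
    \<open>idx\<close>.\<close>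
  define d where "d p = (if c p = 0 then 0 else q (c p))" for p
  have S: "finite ?S" "?S \<subseteq> idx" using c by (auto simp: coeffs_def)
  have sub: "{p. d p \<noteq> 0} \<subseteq> ?S" by (auto simp: d_def)
  have d: "d \<in> coeffs" unfolding coeffs_def using finite_subset[OF sub S(1)] sub S(2) by auto
  have dr: "d \<in> rat_coeffs" using d q(1) by (auto simp: rat_coeffs_def d_def rat_complex_def)
  note dc = coeffs_diff[OF d c]
  have "(L2_norm (\<lambda>x. synth d x - synth c x))\<^sup>2 = (\<Sum>p | d p - c p \<noteq> 0. (norm (d p - c p))\<^sup>2)"
    using L2_norm_synth[OF dc(1)] unfolding dc(2) .
  also have "\<dots> \<le> (\<Sum>p\<in>?S. (norm (d p - c p))\<^sup>2)" using S(1) by (intro sum_mono2) (auto simp: d_def)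
  also have "\<dots> \<le> (\<Sum>p\<in>?S. \<delta>\<^sup>2)"
  proof (intro sum_mono power_mono)
    fix p assume "p \<in> ?S"
    then show "norm (d p - c p) \<le> \<delta>" using q(2)[of "c p"] by (simp add: d_def norm_minus_commute less_imp_le)
  qed simp
  also have "\<dots> = real (card ?S) * \<delta>\<^sup>2" by simp
  also have "\<dots> < (real (card ?S) + 1)\<^sup>2 * \<delta>\<^sup>2"
  proof (intro mult_strict_right_mono)
    have "t < (t + 1)\<^sup>2" if "0 \<le> t" for t :: real
    proof -
      have "(t + 1)\<^sup>2 = t\<^sup>2 + 2 * t + 1" by (simp add: power2_sum)
      then show ?thesis using that zero_le_power2[of t] by linarith
    qed
    then show "real (card ?S) < (real (card ?S) + 1)\<^sup>2" by simp
  qed (use \<delta> in simp)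
  also have "\<dots> = e\<^sup>2" by (simp add: \<delta>_def power_divide)
  finally have "L2_norm (\<lambda>x. synth d x - synth c x) < e" by (rule power2_less_imp_less) (use e in simp)
  then show ?thesis using dr by blast
qed

lemma V_rat_limit:
  assumes f: "f \<in> V"
  obtains d where "\<And>n. d n \<in> rat_coeffs" "L2_limit (\<lambda>n. synth (d n)) f"
proof -
  obtain c where fL: "f \<in> L2" and c: "\<And>n. c n \<in> coeffs" and lim: "L2_limit (\<lambda>n. synth (c n)) f"
    using f unfolding V_iff by blast
  have "\<exists>d\<in>rat_coeffs. L2_norm (\<lambda>x. synth d x - synth (c n) x) < inverse (real (Suc n))" for n
    by (rule rat_coeffs_dense[OF c]) simp
  then obtain d where d: "\<And>n. d n \<in> rat_coeffs"
    and dc: "\<And>n. L2_norm (\<lambda>x. synth (d n) x - synth (c n) x) < inverse (real (Suc n))" by metis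
  have dco: "d n \<in> coeffs" for n using d by (simp add: rat_coeffs_def)
  have "L2_limit (\<lambda>n. synth (d n)) f"
    unfolding L2_limit_def
  proof (rule Lim_null_comparison[OF always_eventually])
    show "\<forall>n. norm (L2_norm (\<lambda>x. synth (d n) x - f x)) \<le> inverse (real (Suc n)) + L2_norm (\<lambda>x. synth (c n) x - f x)"
    proof
      fix n
      have "L2_norm (\<lambda>x. synth (d n) x - f x) \<le> L2_norm (\<lambda>x. synth (d n) x - synth (c n) x) + L2_norm (\<lambda>x. synth (c n) x - f x)"
        by (intro L2_norm_triangle_diff synth_L2 c dco fL)
      then show "norm (L2_norm (\<lambda>x. synth (d n) x - f x)) \<le> inverse (real (Suc n)) + L2_norm (\<lambda>x. synth (c n) x - f x)"
        using dc[of n] by simp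
    qed
    show "(\<lambda>n. inverse (real (Suc n)) + L2_norm (\<lambda>x. synth (c n) x - f x)) \<longlonglongrightarrow> 0"
      using tendsto_add[OF LIMSEQ_inverse_real_of_nat lim[unfolded L2_limit_def]] by simp
  qed
  then show ?thesis using d by (rule that[rotated])
qed

text \<open>The real-valued form of the sampling inequalities; \<open>sampled_iff_ennreal\<close>
  matches it with the extended sums.\<close>

definition sampled :: "nat \<Rightarrow> real \<Rightarrow> real \<Rightarrow> (nat \<Rightarrow> real ^ 'd) \<Rightarrow> (real ^ 'd \<Rightarrow> complex) \<Rightarrow> bool" where
  "sampled m a b x f \<longleftrightarrow> a * (L2_norm f)\<^sup>2 \<le> (\<Sum>r=1..m. energy (cont_rep f) (x r)) \<and>
     (\<Sum>r=1..m. energy (cont_rep f) (x r)) \<le> b * (L2_norm f)\<^sup>2"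

lemma cont_rep_synth: "c \<in> coeffs \<Longrightarrow> cont_rep (synth c) = rep c"
  by (rule cont_rep_eq[OF is_cont_rep_synth])

text \<open>Norms and sample sums are continuous along the L2 limits of \<open>V_rat_limit\<close>,
  and weak inequalities survive limits.\<close>

lemma sampled_iff_rat: "(\<forall>f\<in>V. sampled m a b x f) \<longleftrightarrow> (\<forall>c\<in>rat_coeffs. sampled m a b x (synth c))"
proof
  assume "\<forall>f\<in>V. sampled m a b x f"
  then show "\<forall>c\<in>rat_coeffs. sampled m a b x (synth c)" using synth_in_V by (simp add: rat_coeffs_def)
next
  assume s: "\<forall>c\<in>rat_coeffs. sampled m a b x (synth c)"
  show "\<forall>f\<in>V. sampled m a b x f"
  proof
    fix f assume f: "f \<in> V"
    obtain d where d: "\<And>n. d n \<in> rat_coeffs" and lim: "L2_limit (\<lambda>n. synth (d n)) f"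
      by (rule V_rat_limit[OF f]) (rule that)
    have dc: "d n \<in> coeffs" for n using d by (simp add: rat_coeffs_def)
    note fL = V_cont_rep(1)[OF f]
    have n: "(\<lambda>n. L2_norm (synth (d n))) \<longlonglongrightarrow> L2_norm f" by (rule L2_norm_limit[OF fL synth_L2[OF dc] lim])
    have e: "(\<lambda>n. \<Sum>r=1..m. energy (rep (d n)) (x r)) \<longlonglongrightarrow> (\<Sum>r=1..m. energy (cont_rep f) (x r))"
      by (intro tendsto_sum energy_limit(3)[OF fL dc lim])
    have sd: "a * (L2_norm (synth (d n)))\<^sup>2 \<le> (\<Sum>r=1..m. energy (rep (d n)) (x r)) \<and>
        (\<Sum>r=1..m. energy (rep (d n)) (x r)) \<le> b * (L2_norm (synth (d n)))\<^sup>2" for n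
      using bspec[OF s d[of n]] unfolding sampled_def cont_rep_synth[OF dc] .
    have "a * (L2_norm f)\<^sup>2 \<le> (\<Sum>r=1..m. energy (cont_rep f) (x r))"
    proof (rule LIMSEQ_le[OF _ e])
      show "(\<lambda>n. a * (L2_norm (synth (d n)))\<^sup>2) \<longlonglongrightarrow> a * (L2_norm f)\<^sup>2" by (intro tendsto_intros n)
    qed (use sd in blast)
    moreover have "(\<Sum>r=1..m. energy (cont_rep f) (x r)) \<le> b * (L2_norm f)\<^sup>2"
    proof (rule LIMSEQ_le[OF e])
      show "(\<lambda>n. b * (L2_norm (synth (d n)))\<^sup>2) \<longlonglongrightarrow> b * (L2_norm f)\<^sup>2" by (intro tendsto_intros n)
    qed (use sd in blast)
    ultimately show "sampled m a b x f" by (simp add: sampled_def)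
  qed
qed

lemma energy_rep_borel: "c \<in> coeffs \<Longrightarrow> energy (rep c) \<in> borel_measurable borel"
proof -
  assume "c \<in> coeffs"
  then have [measurable]: "rep c \<in> borel_measurable borel" by (intro borel_measurable_continuous_onI continuous_rep)
  show ?thesis unfolding energy_def[abs_def] by measurable
qed

text \<open>Since \<open>measure\<close> is 0 on sets that are not measurable, a lower bound on the
  probability depends on this.\<close>

lemma sampled_event_measurable:
  assumes X: "\<And>r. r \<in> {1..m} \<Longrightarrow> X r \<in> borel_measurable M"
  shows "{w \<in> space M. \<forall>f\<in>V. sampled m a b (\<lambda>r. X r w) f} \<in> sets M"
proof -
  have "(\<lambda>p. 0) \<in> rat_coeffs" by (simp add: rat_coeffs_def zero_coeffs rat_complex_def)
  then have ne: "rat_coeffs \<noteq> {}" by blast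
  have all: "(\<forall>c\<in>rat_coeffs. Q c) \<longleftrightarrow> (\<forall>n. Q (from_nat_into rat_coeffs n))" for Q
    by (subst range_from_nat_into[OF ne countable_rat_coeffs, symmetric]) simp
  have "Measurable.pred M (\<lambda>w. \<forall>n. sampled m a b (\<lambda>r. X r w) (synth (from_nat_into rat_coeffs n)))"
  proof (rule pred_intros_countable)
    fix n
    let ?c = "from_nat_into rat_coeffs n"
    have c: "?c \<in> coeffs" using from_nat_into[OF ne, of n] by (simp add: rat_coeffs_def)
    have [measurable]: "(\<lambda>w. \<Sum>r=1..m. energy (rep ?c) (X r w)) \<in> borel_measurable M"
      by (intro borel_measurable_sum measurable_compose[OF X energy_rep_borel[OF c]])
    show "Measurable.pred M (\<lambda>w. sampled m a b (\<lambda>r. X r w) (synth ?c))"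
      unfolding sampled_def cont_rep_synth[OF c] by measurable
  qed
  then show ?thesis
    unfolding sampled_iff_rat all by (simp add: pred_def)
qed

lemma infsum_cont_rep:
  assumes f: "f \<in> V"
  shows "(\<Sum>\<^sub>\<infinity>l\<in>int_lattice. ennreal ((norm (cont_rep f (x + l)))\<^sup>2)) = ennreal (energy (cont_rep f) x)"
  unfolding infsum_lattice_ennreal energy_def by (intro suminf_ennreal2 V_cont_rep(3) f) simp

lemma energy_nonneg: "f \<in> V \<Longrightarrow> 0 \<le> energy (cont_rep f) x"
  unfolding energy_def by (intro suminf_nonneg V_cont_rep(3)) auto

lemma sampled_iff_ennreal:
  assumes f: "f \<in> V" and b: "0 \<le> b"
  shows "sampled m a b x f \<longleftrightarrow>
    ennreal (a * (L2_norm f)\<^sup>2) \<le> (\<Sum>r=1..m. \<Sum>\<^sub>\<infinity>l\<in>int_lattice. ennreal ((norm (cont_rep f (x r + l)))\<^sup>2)) \<and>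
    (\<Sum>r=1..m. \<Sum>\<^sub>\<infinity>l\<in>int_lattice. ennreal ((norm (cont_rep f (x r + l)))\<^sup>2)) \<le> ennreal (b * (L2_norm f)\<^sup>2)"
proof -
  have "(\<Sum>r=1..m. \<Sum>\<^sub>\<infinity>l\<in>int_lattice. ennreal ((norm (cont_rep f (x r + l)))\<^sup>2)) = ennreal (\<Sum>r=1..m. energy (cont_rep f) (x r))"
    unfolding infsum_cont_rep[OF f] by (intro sum_ennreal energy_nonneg f)
  moreover have "0 \<le> (\<Sum>r=1..m. energy (cont_rep f) (x r))" by (intro sum_nonneg energy_nonneg f)
  ultimately show ?thesis using b by (simp add: sampled_def ennreal_le_iff)
qed

end

section \<open>The net\<close>

lemma infnorm_le_iff: "infnorm (x :: real ^ 'd::finite) \<le> e \<longleftrightarrow> (\<forall>j. \<bar>x $ j\<bar> \<le> e)"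
proof -
  have "infnorm x \<le> e \<longleftrightarrow> (\<forall>b\<in>Basis. \<bar>x \<bullet> b\<bar> \<le> e)"
    unfolding infnorm_Max by (subst Max_le_iff) auto
  then show ?thesis by (auto simp: Basis_vec_def inner_axis)
qed

definition grid_center :: "nat \<Rightarrow> ('d::finite \<Rightarrow> nat) \<Rightarrow> real ^ 'd" where
  "grid_center N z = (\<chi> j. - 1 / 2 + (real (z j) + 1 / 2) / real N)"

definition grid :: "nat \<Rightarrow> ('d::finite \<Rightarrow> nat) set" where
  "grid N = PiE UNIV (\<lambda>_. {..<N})"

lemma finite_grid: "finite (grid N)" and card_grid: "card (grid N :: ('d::finite \<Rightarrow> nat) set) = N ^ CARD('d)"
  by (simp_all add: grid_def finite_PiE card_PiE)

lemma unit_cube_grid: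
  fixes w :: "real ^ 'd::finite"
  assumes w: "w \<in> unit_cube" and N: "0 < N"
  shows "\<exists>z\<in>grid N. infnorm (w - grid_center N z) \<le> 1 / (2 * real N)"
proof -
  have "\<exists>n<N. \<bar>t - (- 1 / 2 + (real n + 1 / 2) / real N)\<bar> \<le> 1 / (2 * real N)"
    if t: "- 1 / 2 \<le> t" "t \<le> 1 / 2" for t :: real
  proof -
    define s where "s = (t + 1 / 2) * real N"
    have s: "0 \<le> s" "s \<le> real N" using t N by (auto simp: s_def mult_left_le_one_le)
    \<comment> \<open>The minimum puts the right end t = 1/2, where the floor is N, into the last
      subinterval.\<close>
    define n where "n = min (N - 1) (nat \<lfloor>s\<rfloor>)"
    have n: "n < N" using N by (simp add: n_def)
    have "real n \<le> s \<and> s \<le> real n + 1"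
    proof (cases "nat \<lfloor>s\<rfloor> \<le> N - 1")
      case True
      then have "real n = of_int \<lfloor>s\<rfloor>" using s by (simp add: n_def)
      then show ?thesis by linarith
    next
      case False
      then have "real n = real N - 1" using N by (simp add: n_def of_nat_diff)
      moreover have "real N \<le> of_int \<lfloor>s\<rfloor>" using False by linarith
      ultimately show ?thesis using s by linarith
    qed
    then have "\<bar>s - (real n + 1 / 2)\<bar> \<le> 1 / 2" by linarith
    then have "\<bar>s - (real n + 1 / 2)\<bar> / real N \<le> 1 / 2 / real N" by (rule divide_right_mono) simp
    moreover have "t - (- 1 / 2 + (real n + 1 / 2) / real N) = (s - (real n + 1 / 2)) / real N"
      using N by (simp add: s_def field_simps)
    ultimately show ?thesis using n by (intro exI[of _ n]) simp
  qed
  then have "\<forall>j. \<exists>n<N. \<bar>w $ j - (- 1 / 2 + (real n + 1 / 2) / real N)\<bar> \<le> 1 / (2 * real N)"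
    using w unfolding mem_unit_cube by blast
  then obtain z where z: "\<And>j. z j < N" "\<And>j. \<bar>w $ j - (- 1 / 2 + (real (z j) + 1 / 2) / real N)\<bar> \<le> 1 / (2 * real N)"
    by metis
  have "z \<in> grid N" using z(1) by (auto simp: grid_def PiE_iff)
  moreover have "infnorm (w - grid_center N z) \<le> 1 / (2 * real N)"
    unfolding infnorm_le_iff using z(2) by (simp add: grid_center_def)
  ultimately show ?thesis by blast
qed

context orthonormal_shifts
begin

text \<open>The center itself may be exceptional for \<open>Q\<close>. The open box around it whose
  half-width is at most \<eta> and at most half the mesh lies in the cube, and therefore contains a
  point with \<open>Q\<close>.\<close>

lemma grid_point:
  assumes Q: "AE w in cube_measure. Q w" and N: "0 < N" and \<eta>: "0 < \<eta>" and z: "z \<in> grid N"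
  obtains w :: "real ^ 'd" where "Q w" "w \<in> unit_cube" "infnorm (w - grid_center N z) \<le> \<eta>"
proof -
  define e where "e = min \<eta> (1 / (2 * real N))"
  have e: "0 < e" using N \<eta> by (simp add: e_def)
  define U where "U = box (grid_center N z - (\<chi> j. e)) (grid_center N z + (\<chi> j. e))"
  have mem: "w \<in> U \<longleftrightarrow> (\<forall>j. \<bar>w $ j - grid_center N z $ j\<bar> < e)" for w
    unfolding U_def mem_box_cart by (auto simp: abs_less_iff algebra_simps)
  have "grid_center N z \<in> U" using e by (simp add: mem)
  then have ne: "U \<noteq> {}" by blast
  have sub: "U \<subseteq> unit_cube"
  proof
    fix w assume w: "w \<in> U"
    show "w \<in> unit_cube"
      unfolding mem_unit_cube
    proof
      fix j
      have "z j < N" using z by (auto simp: grid_def PiE_iff)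
      then have zj: "real (z j) + 1 \<le> real N" by linarith
      have d: "\<bar>w $ j - grid_center N z $ j\<bar> < 1 / (2 * real N)" using w unfolding mem by (simp add: e_def)
      have c: "grid_center N z $ j = - 1 / 2 + (real (z j) + 1 / 2) / real N" by (simp add: grid_center_def)
      have "1 / (2 * real N) \<le> (real (z j) + 1 / 2) / real N" using N by (simp add: field_simps)
      moreover have "(real (z j) + 1 / 2) / real N + 1 / (2 * real N) \<le> 1" using N zj by (simp add: field_simps)
      ultimately show "- 1 / 2 \<le> w $ j \<and> w $ j \<le> 1 / 2" using d c by linarith
    qed
  qed
  obtain w where w: "w \<in> U" "Q w" by (rule cube_ex_point[OF Q _ ne sub]) (auto simp: U_def intro: that)
  have "infnorm (w - grid_center N z) \<le> \<eta>"
    unfolding infnorm_le_iff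
  proof
    fix j
    have "\<bar>w $ j - grid_center N z $ j\<bar> < e" using w(1) unfolding mem by blast
    then show "\<bar>(w - grid_center N z) $ j\<bar> \<le> \<eta>" by (simp add: e_def)
  qed
  then show ?thesis using w sub by (intro that[of w]) auto
qed

text \<open>The difference of the squares of p and q is |p - q| (p + q), where |p - q| is at most
  sqrt(k) t |y| and both p and q are at most sqrt(k) C |y|.\<close>

lemma fiber_form_diff:
  assumes lip: "\<And>i. i \<in> {1..k} \<Longrightarrow> norm (fiber w x i - fiber w' x i) \<le> t" and t: "0 \<le> t"
  shows "\<bar>(norm (ip {1..k} (fiber w x) y))\<^sup>2 - (norm (ip {1..k} (fiber w' x) y))\<^sup>2\<bar> \<le> 2 * real k * C * t * nsq {1..k} y"
proof -
  let ?I = "{1..k}"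
  have sq: "norm (ip ?I u y) \<le> sqrt (nsq ?I u) * sqrt (nsq ?I y)" for u :: "nat \<Rightarrow> complex"
    using real_sqrt_le_mono[OF ip_Cauchy_Schwarz[of ?I u y]] by (simp add: real_sqrt_mult)
  have b: "norm (ip ?I (fiber w x) y) \<le> sqrt (real k) * C * sqrt (nsq ?I y)" for w
  proof -
    have "sqrt (nsq ?I (fiber w x)) \<le> sqrt (real k) * C"
      using real_sqrt_le_mono[OF nsq_fiber_le[of w x]] C_nonneg by (simp add: real_sqrt_mult)
    then show ?thesis using sq[of "fiber w x"] mult_right_mono[of _ _ "sqrt (nsq ?I y)"]
      by (meson order_trans real_sqrt_ge_zero nsq_nonneg)
  qed
  have "nsq ?I (\<lambda>i. fiber w x i - fiber w' x i) \<le> (\<Sum>i\<in>?I. t\<^sup>2)"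
    unfolding nsq_def using lip by (intro sum_mono power_mono) auto
  then have "sqrt (nsq ?I (\<lambda>i. fiber w x i - fiber w' x i)) \<le> sqrt (real k) * t"
    using t real_sqrt_le_mono[of _ "real k * t\<^sup>2"] by (simp add: real_sqrt_mult)
  then have d: "norm (ip ?I (\<lambda>i. fiber w x i - fiber w' x i) y) \<le> sqrt (real k) * t * sqrt (nsq ?I y)"
    using sq[of "\<lambda>i. fiber w x i - fiber w' x i"] mult_right_mono[of _ _ "sqrt (nsq ?I y)"]
    by (meson order_trans real_sqrt_ge_zero nsq_nonneg)
  define p where "p = norm (ip ?I (fiber w x) y)"
  define q where "q = norm (ip ?I (fiber w' x) y)"
  have "ip ?I (\<lambda>i. fiber w x i - fiber w' x i) y = ip ?I (fiber w x) y - ip ?I (fiber w' x) y"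
    by (simp add: ip_def algebra_simps sum_subtractf)
  then have pq: "\<bar>p - q\<bar> \<le> sqrt (real k) * t * sqrt (nsq ?I y)"
    using d norm_triangle_ineq3[of "ip ?I (fiber w x) y" "ip ?I (fiber w' x) y"] by (simp add: p_def q_def)
  have "\<bar>p\<^sup>2 - q\<^sup>2\<bar> = \<bar>p - q\<bar> * (p + q)"
    unfolding power2_eq_square square_diff_square_factored abs_mult by (simp add: p_def q_def)
  also have "\<dots> \<le> (sqrt (real k) * t * sqrt (nsq ?I y)) * (2 * (sqrt (real k) * C * sqrt (nsq ?I y)))"
    using pq b[of w] b[of w'] t by (intro mult_mono) (auto simp: p_def q_def)
  also have "\<dots> = 2 * (sqrt (real k) * sqrt (real k)) * C * t * (sqrt (nsq ?I y) * sqrt (nsq ?I y))"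
    by (simp only: mult_ac)
  finally show ?thesis by (simp add: p_def q_def)
qed

text \<open>Integration over w turns the inner products of fiber and symbol into sample sums, and
  the squared length of the symbol into the squared norm. The fiberwise deviation bound thus
  integrates to the sampling inequalities.\<close>

lemma sampled_synth:
  assumes c: "c \<in> coeffs"
    and dev: "AE w in cube_measure. \<bar>(\<Sum>r=1..m. (norm (ip {1..k} (fiber w (x r)) (symbol c w)))\<^sup>2) - real m * nsq {1..k} (symbol c w)\<bar>
      \<le> real m * \<alpha> * nsq {1..k} (symbol c w)"
  shows "sampled m (real m * (1 - \<alpha>)) (real m * (1 + \<alpha>)) x (synth c)"
proof -
  let ?n = "\<lambda>w. nsq {1..k} (symbol c w)"
  let ?s = "\<lambda>w. \<Sum>r=1..m. (norm (ip {1..k} (fiber w (x r)) (symbol c w)))\<^sup>2"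
  have i: "integrable cube_measure ?s" by (intro Bochner_Integration.integrable_sum integrable_ip_fiber_symbol c)
  have n: "integrable cube_measure (\<lambda>w. a * ?n w)" for a by (intro integrable_mult_right integral_nsq_symbol(1) c)
  have e: "(\<Sum>r=1..m. energy (rep c) (x r)) = (LINT w|cube_measure. ?s w)"
    unfolding energy_rep_eq(1)[OF c]
    by (rule Bochner_Integration.integral_sum[symmetric]) (rule integrable_ip_fiber_symbol[OF c])
  have nn: "(LINT w|cube_measure. a * ?n w) = a * (L2_norm (synth c))\<^sup>2" for a
    using integral_nsq_symbol(2)[OF c] by simp
  have "(LINT w|cube_measure. real m * (1 - \<alpha>) * ?n w) \<le> (LINT w|cube_measure. ?s w)"
  proof (rule integral_mono_AE[OF n i])
    show "AE w in cube_measure. real m * (1 - \<alpha>) * ?n w \<le> ?s w"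
      using dev by eventually_elim (simp add: abs_le_iff algebra_simps)
  qed
  moreover have "(LINT w|cube_measure. ?s w) \<le> (LINT w|cube_measure. real m * (1 + \<alpha>) * ?n w)"
  proof (rule integral_mono_AE[OF i n])
    show "AE w in cube_measure. ?s w \<le> real m * (1 + \<alpha>) * ?n w"
      using dev by eventually_elim (simp add: abs_le_iff algebra_simps)
  qed
  ultimately show ?thesis unfolding sampled_def cont_rep_synth[OF c] e nn by simp
qed

text \<open>A point w of the cube is within 1/(2 N) of some center, hence within 1/(2 N) + \<eta> of
  a net point. The Lipschitz estimate moves the deviation bound from there to almost every w, for
  all vectors y at once; the cost is the second term in the assumption on \<alpha>.\<close>

lemma sampled_from_grid:
  fixes x :: "nat \<Rightarrow> real ^ 'd" and \<omega> :: "('d \<Rightarrow> nat) \<Rightarrow> real ^ 'd"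
  assumes N: "0 < N" and K: "0 \<le> K" and \<eta>: "0 \<le> \<eta>"
    and near: "\<And>z. z \<in> grid N \<Longrightarrow> infnorm (\<omega> z - grid_center N z) \<le> \<eta>"
    and lip: "\<And>z. z \<in> grid N \<Longrightarrow> AE w in cube_measure. \<forall>i\<in>{1..k}. \<forall>x\<in>unit_cube.
      norm (fiber (\<omega> z) x i - fiber w x i) \<le> K * infnorm (\<omega> z - w)"
    and x: "\<And>r. r \<in> {1..m} \<Longrightarrow> x r \<in> unit_cube"
    and dev: "\<And>z y. z \<in> grid N \<Longrightarrow> \<bar>(\<Sum>r=1..m. (norm (ip {1..k} (fiber (\<omega> z) (x r)) y))\<^sup>2) - real m * nsq {1..k} y\<bar>
      \<le> real m * \<delta> * nsq {1..k} y"
    and \<alpha>: "\<delta> + 2 * real k * C * (K * (1 / (2 * real N) + \<eta>)) \<le> \<alpha>"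
    and f: "f \<in> V"
  shows "sampled m (real m * (1 - \<alpha>)) (real m * (1 + \<alpha>)) x f"
proof -
  let ?t = "K * (1 / (2 * real N) + \<eta>)"
  have t: "0 \<le> ?t" using K \<eta> by simp
  have "AE w in cube_measure. \<forall>z\<in>grid N. \<forall>i\<in>{1..k}. \<forall>x\<in>unit_cube. norm (fiber (\<omega> z) x i - fiber w x i) \<le> K * infnorm (\<omega> z - w)"
    by (intro AE_finite_allI finite_grid lip)
  then have ae: "AE w in cube_measure. \<forall>y. \<bar>(\<Sum>r=1..m. (norm (ip {1..k} (fiber w (x r)) y))\<^sup>2) - real m * nsq {1..k} y\<bar>
      \<le> real m * \<alpha> * nsq {1..k} y"
    using AE_cube_measure_mem
  proof eventually_elim
    case (elim w)
    obtain z where z: "z \<in> grid N" "infnorm (w - grid_center N z) \<le> 1 / (2 * real N)"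
      using unit_cube_grid[OF elim(2) N] by blast
    have "infnorm (\<omega> z - w) \<le> infnorm (\<omega> z - grid_center N z) + infnorm (grid_center N z - w)"
      using infnorm_triangle[of "\<omega> z - grid_center N z" "grid_center N z - w"] by simp
    also have "\<dots> \<le> \<eta> + 1 / (2 * real N)"
      using near[OF z(1)] z(2) infnorm_sub[of w "grid_center N z"] by simp
    finally have d: "infnorm (\<omega> z - w) \<le> 1 / (2 * real N) + \<eta>" by simp
    show ?case
    proof
      fix y
      have "\<bar>(norm (ip {1..k} (fiber (\<omega> z) (x r)) y))\<^sup>2 - (norm (ip {1..k} (fiber w (x r)) y))\<^sup>2\<bar> \<le>
          2 * real k * C * ?t * nsq {1..k} y" if r: "r \<in> {1..m}" for r
      proof (rule fiber_form_diff[OF _ t])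
        fix i assume "i \<in> {1..k}"
        then have "norm (fiber (\<omega> z) (x r) i - fiber w (x r) i) \<le> K * infnorm (\<omega> z - w)"
          using elim(1) z(1) x[OF r] by blast
        also have "\<dots> \<le> ?t" by (rule mult_left_mono[OF d K])
        finally show "norm (fiber (\<omega> z) (x r) i - fiber w (x r) i) \<le> ?t" .
      qed
      then have "(\<Sum>r=1..m. \<bar>(norm (ip {1..k} (fiber (\<omega> z) (x r)) y))\<^sup>2 - (norm (ip {1..k} (fiber w (x r)) y))\<^sup>2\<bar>) \<le>
          (\<Sum>r=1..m. 2 * real k * C * ?t * nsq {1..k} y)"
        by (rule sum_mono)
      then have "\<bar>(\<Sum>r=1..m. (norm (ip {1..k} (fiber (\<omega> z) (x r)) y))\<^sup>2) - (\<Sum>r=1..m. (norm (ip {1..k} (fiber w (x r)) y))\<^sup>2)\<bar> \<le>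
          real m * (2 * real k * C * ?t * nsq {1..k} y)"
        unfolding sum_subtractf[symmetric] by (intro order_trans[OF sum_abs]) simp
      then have "\<bar>(\<Sum>r=1..m. (norm (ip {1..k} (fiber w (x r)) y))\<^sup>2) - real m * nsq {1..k} y\<bar> \<le>
          real m * \<delta> * nsq {1..k} y + real m * (2 * real k * C * ?t * nsq {1..k} y)"
        using dev[OF z(1), of y] by linarith
      also have "\<dots> = real m * nsq {1..k} y * (\<delta> + 2 * real k * C * ?t)" by (simp add: algebra_simps)
      also have "\<dots> \<le> real m * nsq {1..k} y * \<alpha>" by (intro mult_left_mono \<alpha>) simp
      finally show "\<bar>(\<Sum>r=1..m. (norm (ip {1..k} (fiber w (x r)) y))\<^sup>2) - real m * nsq {1..k} y\<bar> \<le> real m * \<alpha> * nsq {1..k} y"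
        by (simp add: mult_ac)
    qed
  qed
  have all: "\<forall>f\<in>V. sampled m (real m * (1 - \<alpha>)) (real m * (1 + \<alpha>)) x f"
    unfolding sampled_iff_rat
  proof
    fix c assume "c \<in> rat_coeffs"
    then have c: "c \<in> coeffs" by (simp add: rat_coeffs_def)
    show "sampled m (real m * (1 - \<alpha>)) (real m * (1 + \<alpha>)) x (synth c)"
    proof (rule sampled_synth[OF c])
      show "AE w in cube_measure. \<bar>(\<Sum>r=1..m. (norm (ip {1..k} (fiber w (x r)) (symbol c w)))\<^sup>2) - real m * nsq {1..k} (symbol c w)\<bar>
        \<le> real m * \<alpha> * nsq {1..k} (symbol c w)"
        using ae by (rule eventually_mono) blast
    qed
  qed
  then show ?thesis using f by blast
qed

end

section \<open>Sample size and the union bound over the net\<close>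

lemma (in isotropic_sample) two_sided_deviation:
  assumes \<delta>: "0 < \<delta>" "\<delta> \<le> 1 / 2"
  shows "\<exists>A. A \<in> sets (PiM {1..m} (\<lambda>_. \<mu>)) \<and>
    emeasure (PiM {1..m} (\<lambda>_. \<mu>)) A \<le> ennreal (2 * real (card I) * exp (- (41 / 100 * real m * \<delta>\<^sup>2 / R))) \<and>
    (\<forall>x\<in>space (PiM {1..m} (\<lambda>_. \<mu>)). x \<notin> A \<longrightarrow>
      (\<forall>y. \<bar>(\<Sum>j=1..m. (cmod (ip I (v (x j)) y))\<^sup>2) - real m * nsq I y\<bar> \<le> real m * \<delta> * nsq I y))"
proof -
  let ?b = "real (card I) * exp (- (41 / 100 * real m * \<delta>\<^sup>2 / R))"
  obtain A where A: "A \<in> sets (PiM {1..m} (\<lambda>_. \<mu>))" "emeasure (PiM {1..m} (\<lambda>_. \<mu>)) A \<le> ennreal ?b"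
    "\<And>x y. x \<in> space (PiM {1..m} (\<lambda>_. \<mu>)) \<Longrightarrow> x \<notin> A \<Longrightarrow>
      (\<Sum>j=1..m. (cmod (ip I (v (x j)) y))\<^sup>2) \<le> real m * (1 + \<delta>) * nsq I y"
    by (rule upper_deviation[OF \<delta>, of m]) (rule that)
  obtain B where B: "B \<in> sets (PiM {1..m} (\<lambda>_. \<mu>))" "emeasure (PiM {1..m} (\<lambda>_. \<mu>)) B \<le> ennreal ?b"
    "\<And>x y. x \<in> space (PiM {1..m} (\<lambda>_. \<mu>)) \<Longrightarrow> x \<notin> B \<Longrightarrow>
      real m * (1 - \<delta>) * nsq I y \<le> (\<Sum>j=1..m. (cmod (ip I (v (x j)) y))\<^sup>2)"
    by (rule lower_deviation[OF \<delta>, of m]) (rule that)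
  have "emeasure (PiM {1..m} (\<lambda>_. \<mu>)) (A \<union> B) \<le> ennreal ?b + ennreal ?b"
    using A B by (intro order_trans[OF emeasure_subadditive] add_mono)
  also have "\<dots> = ennreal (2 * real (card I) * exp (- (41 / 100 * real m * \<delta>\<^sup>2 / R)))"
    by (subst ennreal_plus[symmetric]) simp_all
  finally have "emeasure (PiM {1..m} (\<lambda>_. \<mu>)) (A \<union> B) \<le> \<dots>" .
  moreover have "\<bar>(\<Sum>j=1..m. (cmod (ip I (v (x j)) y))\<^sup>2) - real m * nsq I y\<bar> \<le> real m * \<delta> * nsq I y"
    if "x \<in> space (PiM {1..m} (\<lambda>_. \<mu>))" "x \<notin> A \<union> B" for x y
    using A(3)[of x y] B(3)[of x y] that unfolding abs_le_iff by (simp add: algebra_simps)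
  ultimately show ?thesis using A(1) B(1) by (intro exI[of _ "A \<union> B"] conjI ballI impI allI) auto
qed

text \<open>The union bound over the net points, with the two tails and the dimension k, gives a
  prefactor that the logarithm is made to cancel. The constant 10 suffices because 0.41 * 0.495^2,
  about 0.10046, exceeds 1/10.\<close>

lemma sample_size_bound:
  fixes \<alpha> \<epsilon> C K q :: real
  assumes k: "1 \<le> k" and C: "0 < C" and \<alpha>: "0 < \<alpha>" and \<epsilon>: "0 < \<epsilon>" and q: "0 \<le> q" and n: "real N \<le> q + 1"
    and m: "10 * (C\<^sup>2 / \<alpha>\<^sup>2) * real k * ln (2 * real k / \<epsilon> * (q + 1) ^ d) \<le> real m"
  shows "real (N ^ d) * (2 * real k * exp (- (41 / 100 * real m * (495 / 1000 * \<alpha>)\<^sup>2 / (real k * C\<^sup>2)))) \<le> \<epsilon>"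
proof -
  define L where "L = ln (2 * real k / \<epsilon> * (q + 1) ^ d)"
  define t where "t = real m * \<alpha>\<^sup>2 / (real k * C\<^sup>2)"
  have R: "0 < real k * C\<^sup>2" using k C by simp
  have pos: "0 < 2 * real k / \<epsilon> * (q + 1) ^ d" using k \<epsilon> q by simp
  have t0: "0 \<le> t" using R by (simp add: t_def)
  have "10 * L \<le> t"
  proof -
    have "10 * (C\<^sup>2 / \<alpha>\<^sup>2) * real k * L * (\<alpha>\<^sup>2 / (real k * C\<^sup>2)) \<le> real m * (\<alpha>\<^sup>2 / (real k * C\<^sup>2))"
      using m R by (intro mult_right_mono) (auto simp: L_def)
    moreover have "10 * (C\<^sup>2 / \<alpha>\<^sup>2) * real k * L * (\<alpha>\<^sup>2 / (real k * C\<^sup>2)) = 10 * L"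
      using k C \<alpha> by (simp add: field_simps)
    ultimately show ?thesis by (simp add: t_def)
  qed
  moreover have "41 / 100 * real m * (495 / 1000 * \<alpha>)\<^sup>2 / (real k * C\<^sup>2) = 41 / 100 * (495 / 1000)\<^sup>2 * t"
    unfolding t_def power_mult_distrib by simp
  moreover have "1 / 10 * t \<le> 41 / 100 * (495 / 1000)\<^sup>2 * t"
    using t0 by (intro mult_right_mono) (simp_all add: power2_eq_square)
  ultimately have E: "L \<le> 41 / 100 * real m * (495 / 1000 * \<alpha>)\<^sup>2 / (real k * C\<^sup>2)" by linarith
  have "exp (- (41 / 100 * real m * (495 / 1000 * \<alpha>)\<^sup>2 / (real k * C\<^sup>2))) \<le> exp (- L)" using E by simp
  also have "\<dots> = inverse (2 * real k / \<epsilon> * (q + 1) ^ d)" using pos by (simp add: L_def exp_minus)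
  finally have e: "exp (- (41 / 100 * real m * (495 / 1000 * \<alpha>)\<^sup>2 / (real k * C\<^sup>2))) \<le> inverse (2 * real k / \<epsilon> * (q + 1) ^ d)" .
  have "real (N ^ d) \<le> (q + 1) ^ d" using n by (simp add: power_mono)
  then have "real (N ^ d) * (2 * real k * exp (- (41 / 100 * real m * (495 / 1000 * \<alpha>)\<^sup>2 / (real k * C\<^sup>2)))) \<le>
      (q + 1) ^ d * (2 * real k * inverse (2 * real k / \<epsilon> * (q + 1) ^ d))"
    using e q by (intro mult_mono) auto
  also have "\<dots> = \<epsilon>" using k \<epsilon> q by (simp add: field_simps)
  finally show ?thesis .
qed

context orthonormal_shifts
begin

lemma sampling_probability:
  fixes X :: "nat \<Rightarrow> 'w \<Rightarrow> real ^ 'd"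
  assumes k: "1 \<le> k" and K: "0 \<le> K"
    and lip: "AE w in cube_measure. AE w' in cube_measure. \<forall>i\<in>{1..k}. \<forall>x\<in>unit_cube.
      norm (fiber w x i - fiber w' x i) \<le> K * infnorm (w - w')"
    and M: "prob_space M" and indep: "prob_space.indep_vars M (\<lambda>_. borel) X {1..m}"
    and unif: "\<And>r. r \<in> {1..m} \<Longrightarrow> distr M borel (X r) = uniform_measure lborel unit_cube"
    and \<epsilon>: "0 < \<epsilon>" and \<alpha>: "0 < \<alpha>" "\<alpha> < 1"
    and m: "10 * (C\<^sup>2 / \<alpha>\<^sup>2) * real k * ln (2 * real k / \<epsilon> * (2 * real k * C * K / \<alpha> + 1) ^ CARD('d)) \<le> real m"
  shows "1 - \<epsilon> \<le> measure M {w \<in> space M. \<forall>f\<in>V. sampled m (real m * (1 - \<alpha>)) (real m * (1 + \<alpha>)) (\<lambda>r. X r w) f}"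
proof (cases "1 \<le> \<epsilon>")
  case True
  then have "1 - \<epsilon> \<le> 0" by simp
  then show ?thesis using measure_nonneg order_trans by blast
next
  case False
  interpret M: prob_space M by (rule M)
  have C: "0 < C" by (rule C_pos[OF k])
  define q where "q = 2 * real k * C * K / \<alpha>"
  have q: "0 \<le> q" using C K \<alpha> by (simp add: q_def)
  have "0 < ln (2 * real k / \<epsilon> * (q + 1) ^ CARD('d))"
  proof (rule ln_gt_zero)
    have "1 < 2 * real k / \<epsilon>" using k \<epsilon> False by (simp add: field_simps)
    then show "1 < 2 * real k / \<epsilon> * (q + 1) ^ CARD('d)"
      using q by (intro less_1_mult' one_le_power) auto
  qed
  then have "0 < 10 * (C\<^sup>2 / \<alpha>\<^sup>2) * real k * ln (2 * real k / \<epsilon> * (q + 1) ^ CARD('d))"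
    using C \<alpha> k by simp
  \<comment> \<open>The description of independence by a product law asks for a nonempty index set.
    Here \<epsilon> < 1 makes the lower bound for m positive.\<close>
  then have m0: "0 < m" using m[folded q_def] by simp
  \<comment> \<open>N lies between q and q + 1. The lower bound makes the mesh term at most
    \<alpha>/2; the upper bound keeps the size of the net within the power under the
    logarithm.\<close>
  define N where "N = Suc (nat \<lfloor>q\<rfloor>)"
  have N: "0 < N" "real N \<le> q + 1" "q \<le> real N" unfolding N_def using q by linarith+
  define \<delta> where "\<delta> = 495 / 1000 * \<alpha>"
  have \<delta>: "0 < \<delta>" "\<delta> \<le> 1 / 2" using \<alpha> by (auto simp: \<delta>_def)
  \<comment> \<open>The added 1 keeps the denominator positive when K = 0.\<close>
  define \<eta> where "\<eta> = 5 / 1000 * \<alpha> / (2 * real k * C * K + 1)"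
  have kCK: "0 \<le> 2 * real k * C * K" using C K by simp
  have kCK1: "0 < 2 * real k * C * K + 1" using kCK by linarith
  have \<eta>: "0 < \<eta>" unfolding \<eta>_def using \<alpha> kCK1 by (intro divide_pos_pos) auto
  have \<alpha>bound: "\<delta> + 2 * real k * C * (K * (1 / (2 * real N) + \<eta>)) \<le> \<alpha>"
  proof -
    have "2 * real k * C * K \<le> \<alpha> * real N" using N(3) \<alpha> by (simp add: q_def field_simps)
    then have "2 * real k * C * K * (1 / (2 * real N)) \<le> \<alpha> / 2" using N(1) by (simp add: field_simps)
    moreover have "2 * real k * C * K * \<eta> \<le> 5 / 1000 * \<alpha>"
    proof -
      have "2 * real k * C * K * \<eta> \<le> (2 * real k * C * K + 1) * \<eta>" using \<eta> by (intro mult_right_mono) auto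
      also have "\<dots> = 5 / 1000 * \<alpha>"
      proof -
        have "a * (b / a) = b" if "a \<noteq> 0" for a b :: real using that by simp
        from this[of "2 * real k * C * K + 1"] show ?thesis unfolding \<eta>_def using kCK1 by (metis less_irrefl)
      qed
      finally show ?thesis .
    qed
    moreover have "2 * real k * C * (K * (1 / (2 * real N) + \<eta>)) = 2 * real k * C * K * (1 / (2 * real N)) + 2 * real k * C * K * \<eta>"
      by (simp only: distrib_left mult.assoc)
    ultimately show ?thesis unfolding \<delta>_def by linarith
  qed
  \<comment> \<open>The Lipschitz estimate is asked for a fixed w against almost every w'. In this
    form a bound that holds for almost every pair can be used at chosen points.\<close>
  define Q where "Q w \<longleftrightarrow> isotropic_at w \<and> (AE w' in cube_measure. \<forall>i\<in>{1..k}. \<forall>x\<in>unit_cube.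
      norm (fiber w x i - fiber w' x i) \<le> K * infnorm (w - w'))" for w
  have Q: "AE w in cube_measure. Q w" unfolding Q_def using AE_isotropic lip by (rule AE_conjI)
  have "\<forall>z\<in>grid N. \<exists>w. Q w \<and> infnorm (w - grid_center N z) \<le> \<eta>"
  proof
    fix z :: "'d \<Rightarrow> nat" assume z: "z \<in> grid N"
    obtain w where "Q w" "w \<in> unit_cube" "infnorm (w - grid_center N z) \<le> \<eta>"
      by (rule grid_point[OF Q N(1) \<eta> z]) (rule that)
    then show "\<exists>w. Q w \<and> infnorm (w - grid_center N z) \<le> \<eta>" by blast
  qed
  then obtain \<omega> where \<omega>: "\<forall>z\<in>grid N. Q (\<omega> z) \<and> infnorm (\<omega> z - grid_center N z) \<le> \<eta>"
    by (rule bchoice[THEN exE])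
  define P where "P = PiM {1..m} (\<lambda>_. cube_measure :: (real ^ 'd) measure)"
  define b where "b = 2 * real k * exp (- (41 / 100 * real m * \<delta>\<^sup>2 / (real k * C\<^sup>2)))"
  define dev where "dev z x \<longleftrightarrow> (\<forall>y. \<bar>(\<Sum>r=1..m. (cmod (ip {1..k} (fiber (\<omega> z) (x r)) y))\<^sup>2) - real m * nsq {1..k} y\<bar>
      \<le> real m * \<delta> * nsq {1..k} y)" for z and x :: "nat \<Rightarrow> real ^ 'd"
  have "\<forall>z\<in>grid N. \<exists>A. A \<in> sets P \<and> emeasure P A \<le> ennreal b \<and> (\<forall>x\<in>space P. x \<notin> A \<longrightarrow> dev z x)"
  proof
    fix z :: "'d \<Rightarrow> nat" assume z: "z \<in> grid N"
    interpret S: isotropic_sample cube_measure "{1..k}" "\<lambda>x. fiber (\<omega> z) x" "real k * C\<^sup>2"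
      using \<omega> z C k by (intro sample_locale) (auto simp: Q_def)
    show "\<exists>A. A \<in> sets P \<and> emeasure P A \<le> ennreal b \<and> (\<forall>x\<in>space P. x \<notin> A \<longrightarrow> dev z x)"
      using S.two_sided_deviation[OF \<delta>, of m] unfolding P_def b_def dev_def by simp
  qed
  then obtain A where A: "\<forall>z\<in>grid N. A z \<in> sets P \<and> emeasure P (A z) \<le> ennreal b \<and> (\<forall>x\<in>space P. x \<notin> A z \<longrightarrow> dev z x)"
    by (rule bchoice[THEN exE])
  define Bad where "Bad = (\<Union>z\<in>grid N. A z)"
  have Bad: "Bad \<in> sets P" unfolding Bad_def using A by (intro sets.finite_UN finite_grid) auto
  have "emeasure P Bad \<le> (\<Sum>z\<in>grid N. emeasure P (A z))"
    unfolding Bad_def using A by (intro emeasure_subadditive_finite finite_grid) auto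
  also have "\<dots> \<le> (\<Sum>z\<in>(grid N :: ('d \<Rightarrow> nat) set). ennreal b)" using A by (intro sum_mono) auto
  also have "\<dots> = ennreal (real (N ^ CARD('d)) * b)"
    by (simp add: card_grid b_def ennreal_mult ennreal_of_nat_eq_real_of_nat[symmetric] del: of_nat_power)
  also have "\<dots> \<le> ennreal \<epsilon>"
    unfolding b_def \<delta>_def
    using sample_size_bound[OF k C \<alpha>(1) \<epsilon> q N(2) m[folded q_def]] by (rule ennreal_leI)
  finally have Bad_le: "emeasure P Bad \<le> ennreal \<epsilon>" .
  have X: "X r \<in> borel_measurable M" if "r \<in> {1..m}" for r
    using indep that unfolding M.indep_vars_def2 by blast
  define Y where "Y w = (\<lambda>r\<in>{1..m}. X r w)" for w
  have Y: "Y \<in> M \<rightarrow>\<^sub>M PiM {1..m} (\<lambda>_. borel)"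
    unfolding Y_def by (rule measurable_restrict) (rule X)
  have distr: "distr M (PiM {1..m} (\<lambda>_. borel)) Y = P"
  proof -
    have "distr M (PiM {1..m} (\<lambda>_. borel)) Y = PiM {1..m} (\<lambda>r. distr M borel (X r))"
      unfolding Y_def using indep m0 X by (subst M.indep_vars_iff_distr_eq_PiM'[symmetric]) auto
    also have "\<dots> = P" unfolding P_def by (intro PiM_cong refl) (simp add: unif cube_measure_eq_uniform)
    finally show ?thesis .
  qed
  have sP: "sets P = sets (PiM {1..m} (\<lambda>_. borel))" unfolding distr[symmetric] by simp
  let ?E = "{w \<in> space M. \<forall>f\<in>V. sampled m (real m * (1 - \<alpha>)) (real m * (1 + \<alpha>)) (\<lambda>r. X r w) f}"
  have E: "?E \<in> sets M" by (rule sampled_event_measurable) (rule X)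
  have YB: "Y -` Bad \<inter> space M \<in> sets M" using Bad by (intro measurable_sets[OF Y]) (simp add: sP)
  have "emeasure M (Y -` Bad \<inter> space M) = emeasure P Bad"
    unfolding distr[symmetric] using Bad by (subst emeasure_distr[OF Y]) (simp_all add: sP)
  then have prob: "measure M (Y -` Bad \<inter> space M) \<le> \<epsilon>"
    using Bad_le \<epsilon> by (metis M.emeasure_eq_measure ennreal_le_iff less_imp_le)
  \<comment> \<open>The samples lie in the cube only almost surely, and the Lipschitz estimate is
    available only for x in the cube.\<close>
  have AEX: "AE w in M. \<forall>r\<in>{1..m}. X r w \<in> unit_cube"
  proof (intro AE_finite_allI)
    fix r assume r: "r \<in> {1..m}"
    have "AE x in distr M borel (X r). x \<in> unit_cube"
      unfolding unif[OF r] cube_measure_eq_uniform[symmetric] by (rule AE_cube_measure_mem)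
    then show "AE w in M. X r w \<in> unit_cube" by (subst (asm) AE_distr_iff) (auto intro: X r)
  qed simp
  have "1 - \<epsilon> \<le> measure M (space M - (Y -` Bad \<inter> space M))"
    using prob M.prob_compl[OF YB] by simp
  also have "\<dots> \<le> measure M ?E"
  proof (rule M.finite_measure_mono_AE[OF _ E])
    show "AE w in M. w \<in> space M - (Y -` Bad \<inter> space M) \<longrightarrow> w \<in> ?E"
      using AEX
    proof eventually_elim
      case (elim w)
      show ?case
      proof
        assume "w \<in> space M - (Y -` Bad \<inter> space M)"
        then have w: "w \<in> space M" "Y w \<notin> Bad" by auto
        have YP: "Y w \<in> space P"
          unfolding P_def by (simp add: space_PiM Y_def PiE_iff)
        have "sampled m (real m * (1 - \<alpha>)) (real m * (1 + \<alpha>)) (\<lambda>r. X r w) f" if f: "f \<in> V" for f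
        proof (rule sampled_from_grid[where N = N and \<omega> = \<omega> and K = K and \<eta> = \<eta> and \<delta> = \<delta>])
          show "AE w in cube_measure. \<forall>i\<in>{1..k}. \<forall>x\<in>unit_cube. norm (fiber (\<omega> z) x i - fiber w x i) \<le> K * infnorm (\<omega> z - w)"
            if "z \<in> grid N" for z using \<omega> that unfolding Q_def by blast
          show "\<bar>(\<Sum>r=1..m. (norm (ip {1..k} (fiber (\<omega> z) (X r w)) y))\<^sup>2) - real m * nsq {1..k} y\<bar> \<le> real m * \<delta> * nsq {1..k} y"
            if z: "z \<in> grid N" for z y
          proof -
            have "Y w \<notin> A z" using w(2) z by (auto simp: Bad_def)
            then have "dev z (Y w)" using A z YP by blast
            moreover have "(\<Sum>r=1..m. (cmod (ip {1..k} (fiber (\<omega> z) (Y w r)) y))\<^sup>2) = (\<Sum>r=1..m. (cmod (ip {1..k} (fiber (\<omega> z) (X r w)) y))\<^sup>2)"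
              by (intro sum.cong refl) (simp add: Y_def)
            ultimately show ?thesis unfolding dev_def by metis
          qed
        qed (use N(1) K \<eta> \<omega> elim \<alpha>bound f in auto)
        then show "w \<in> ?E" using w(1) by blast
      qed
    qed
  qed
  finally show ?thesis .
qed

end

section \<open>Transfer of the assumptions from the \<psi> i to the fibers\<close>

lemma infsum_lattice_shift:
  assumes "a \<in> int_lattice"
  shows "(\<Sum>\<^sub>\<infinity>l\<in>int_lattice. f (l - a)) = (\<Sum>\<^sub>\<infinity>l\<in>int_lattice. f (l :: real ^ 'd::finite))"
proof (rule infsum_reindex_bij_betw)
  show "bij_betw (\<lambda>l. l - a) int_lattice int_lattice"
    using assms by (intro bij_betw_byWitness[where f' = "\<lambda>l. l + a"]) (auto intro: int_lattice_add int_lattice_diff)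
qed

text \<open>A lattice shift permutes the terms of the periodization.\<close>

lemma AE_periodization_le:
  assumes "fourier_bound k \<psi>h = ennreal C" and i: "i \<in> {1..k}" and a: "a \<in> int_lattice"
  shows "AE w in cube_measure. (\<Sum>n. ennreal (norm (\<psi>h i (w + lat n - a)))) \<le> ennreal C"
proof -
  let ?f = "\<lambda>w. \<Sum>\<^sub>\<infinity>l\<in>int_lattice. ennreal (norm (\<psi>h i (w + l)))"
  have "esssup (restrict_space lborel unit_cube) ?f \<le> ennreal C"
    unfolding assms(1)[symmetric] fourier_bound_def using i by (rule SUP_upper)
  then have "AE w in restrict_space lborel unit_cube. ?f w \<le> ennreal C"
    by (intro eventually_mono[OF esssup_AE]) (rule order_trans)
  then have "AE w in lborel. w \<in> unit_cube \<longrightarrow> ?f w \<le> ennreal C"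
    by (rule AE_restrict_space_iff[THEN iffD1, rotated]) simp
  then have "AE w in cube_measure. ?f w \<le> ennreal C" by (simp add: AE_cube_measure)
  then show ?thesis
  proof eventually_elim
    case (elim w)
    have "?f w = (\<Sum>\<^sub>\<infinity>l\<in>int_lattice. ennreal (norm (\<psi>h i (w + (l - a)))))"
      by (rule infsum_lattice_shift[OF a, symmetric])
    also have "\<dots> = (\<Sum>n. ennreal (norm (\<psi>h i (w + (lat n - a)))))"
      by (rule infsum_lattice_ennreal)
    finally have "?f w = (\<Sum>n. ennreal (norm (\<psi>h i (w + (lat n - a)))))" .
    then show ?case using elim by (simp add: add_diff_eq)
  qed
qed

text \<open>Fubini's theorem splits a property of almost every pair into almost every w and, given
  w, almost every w'. On the diagonal, which the essential supremum leaves out, the bound is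
  trivial.\<close>

lemma AE_zak_lipschitz:
  fixes \<psi>h :: "nat \<Rightarrow> real ^ 'd::finite \<Rightarrow> complex"
  assumes K: "zak_lipschitz k \<psi>h = ennreal K" "0 \<le> K"
  shows "AE w in cube_measure. AE w' in cube_measure. \<forall>i\<in>{1..k}. \<forall>x\<in>unit_cube.
    norm (zak (\<psi>h i) w x - zak (\<psi>h i) w' x) \<le> K * infnorm (w - w')"
proof -
  let ?S = "{(w, w'). w \<in> unit_cube \<and> w' \<in> unit_cube \<and> w \<noteq> w'} :: ((real ^ 'd) \<times> (real ^ 'd)) set"
  let ?f = "\<lambda>(w, w'). SUP x\<in>unit_cube. SUP i\<in>{1..k}. ennreal (norm (zak (\<psi>h i) w x - zak (\<psi>h i) w' x) / infnorm (w - w'))"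
  have S: "?S \<in> sets lborel"
  proof -
    have "?S = (unit_cube \<times> unit_cube) \<inter> {p. fst p \<noteq> snd p}" by auto
    moreover have "closed (unit_cube \<times> unit_cube :: ((real ^ 'd) \<times> (real ^ 'd)) set)"
      unfolding unit_cube_def by (intro closed_Times closed_cbox)
    moreover have "open {p :: (real ^ 'd) \<times> (real ^ 'd). fst p \<noteq> snd p}"
      by (intro open_Collect_neq continuous_intros)
    ultimately show ?thesis by (simp add: borel_closed borel_open sets.Int)
  qed
  have "AE p in restrict_space lborel ?S. ?f p \<le> ennreal K"
    using esssup_AE[of ?f "restrict_space lborel ?S"] K(1) unfolding zak_lipschitz_def by simp
  then have "AE p in lborel. p \<in> ?S \<longrightarrow> ?f p \<le> ennreal K"
    using S by (intro AE_restrict_space_iff[THEN iffD1]) simp_all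
  then have "AE p in lborel \<Otimes>\<^sub>M lborel. p \<in> ?S \<longrightarrow> ?f p \<le> ennreal K" by (simp only: lborel_prod)
  then have "AE w in lborel. AE w' in lborel. (w, w') \<in> ?S \<longrightarrow> ?f (w, w') \<le> ennreal K"
    by (rule lborel_pair.AE_pair)
  then show ?thesis
    unfolding AE_cube_measure
  proof eventually_elim
    case (elim w)
    show ?case
    proof
      assume w: "w \<in> unit_cube"
      show "AE w' in lborel. w' \<in> unit_cube \<longrightarrow> (\<forall>i\<in>{1..k}. \<forall>x\<in>unit_cube.
          norm (zak (\<psi>h i) w x - zak (\<psi>h i) w' x) \<le> K * infnorm (w - w'))"
        using elim
      proof eventually_elim
        case (elim w')
        show ?case
        proof (intro impI ballI)
          fix i and x :: "real ^ 'd" assume w': "w' \<in> unit_cube" and i: "i \<in> {1..k}" and x: "x \<in> unit_cube"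
          show "norm (zak (\<psi>h i) w x - zak (\<psi>h i) w' x) \<le> K * infnorm (w - w')"
          proof (cases "w = w'")
            case True then show ?thesis using K(2) by (simp add: infnorm_0)
          next
            case False
            then have n: "0 < infnorm (w - w')" by (simp add: infnorm_pos_lt)
            have "ennreal (norm (zak (\<psi>h i) w x - zak (\<psi>h i) w' x) / infnorm (w - w')) \<le>
                (SUP i\<in>{1..k}. ennreal (norm (zak (\<psi>h i) w x - zak (\<psi>h i) w' x) / infnorm (w - w')))"
              using i by (rule SUP_upper)
            also have "\<dots> \<le> (SUP x\<in>unit_cube. SUP i\<in>{1..k}. ennreal (norm (zak (\<psi>h i) w x - zak (\<psi>h i) w' x) / infnorm (w - w')))"
              using x by (rule SUP_upper)
            also have "\<dots> \<le> ennreal K" using elim w w' False by simp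
            finally have "norm (zak (\<psi>h i) w x - zak (\<psi>h i) w' x) / infnorm (w - w') \<le> K"
              using K(2) by (subst (asm) ennreal_le_iff) auto
            then show ?thesis using n by (simp add: pos_divide_le_eq)
          qed
        qed
      qed
    qed
  qed
qed

text \<open>The lattice shift contributes only the factor \<open>chr a x\<close>, which has modulus
  1 and does not depend on w. Differences in w keep their size, and the reflection of x preserves
  the cube, so the Lipschitz constant carries over.\<close>

lemma zak_chr_shift:
  fixes g :: "real ^ 'd::finite \<Rightarrow> complex"
  assumes s: "summable (\<lambda>n. norm (g (w + lat n - a)))" and a: "a \<in> int_lattice"
  shows "zak_chr (\<lambda>w. g (w - a)) w x = chr a x * zak g w (- x)"
proof -
  have "zak_chr (\<lambda>w. g (w - a)) w x = (\<Sum>\<^sub>\<infinity>l\<in>int_lattice. g (w + l - a) * chr l x)"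
    unfolding zak_chr_def using s by (intro infsum_lattice[symmetric]) (simp add: norm_mult)
  also have "\<dots> = (\<Sum>\<^sub>\<infinity>l\<in>int_lattice. chr a x * (g (w + (l - a)) * chr (l - a) x))"
  proof (intro infsum_cong)
    fix l :: "real ^ 'd"
    have "chr l x = chr a x * chr (l - a) x" using chr_add_left[of a "l - a" x] by simp
    then show "g (w + l - a) * chr l x = chr a x * (g (w + (l - a)) * chr (l - a) x)"
      by (simp add: add_diff_eq mult.left_commute)
  qed
  also have "\<dots> = (\<Sum>\<^sub>\<infinity>l\<in>int_lattice. chr a x * (g (w + l) * chr l x))"
    by (rule infsum_lattice_shift[OF a])
  also have "\<dots> = chr a x * (\<Sum>\<^sub>\<infinity>l\<in>int_lattice. g (w + l) * chr l x)"
    by (rule infsum_cmult_right')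
  also have "(\<Sum>\<^sub>\<infinity>l\<in>int_lattice. g (w + l) * chr l x) = zak g w (- x)"
    unfolding zak_def exp_eq_chr by (simp add: chr_commute[of x])
  finally show ?thesis .
qed

theorem mainTheorem1:
  fixes \<phi> \<psi> \<psi>h :: "nat \<Rightarrow> real ^ 'd::finite \<Rightarrow> complex"
    and \<nu> :: "nat \<Rightarrow> real ^ 'd"
    and k m :: nat
    and C K \<epsilon> \<alpha> :: real
    and M :: "'w measure"
    and X :: "nat \<Rightarrow> 'w \<Rightarrow> real ^ 'd"
  assumes "1 \<le> k"
    and "\<forall>i\<in>{1..k}. \<phi> i \<in> L2"
    and "orthonormal_translates k \<phi>"
    and "\<forall>i\<in>{1..k}. \<psi> i \<in> L2"
    and "\<forall>i\<in>{1..k}. \<nu> i \<in> int_lattice"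
    and "\<forall>i\<in>{1..k}. AE x in lborel. \<phi> i x = exp (2 * pi * \<i> * of_real (\<nu> i \<bullet> x)) * \<psi> i x"
    and "sample_bound k \<psi> < \<infinity>"
    and "\<forall>i\<in>{1..k}. is_L2_fourier (\<psi> i) (\<psi>h i)"
    and "fourier_bound k \<psi>h = ennreal C" and "0 \<le> C"
    and "zak_lipschitz k \<psi>h = ennreal K" and "0 \<le> K"
  shows "L2_RKHS (shift_invariant_space k \<phi>) \<and>
    (prob_space M \<and>
     prob_space.indep_vars M (\<lambda>_. borel) X {1..m} \<and>
     (\<forall>r\<in>{1..m}. distr M borel (X r) = uniform_measure lborel unit_cube) \<and>
     0 < \<epsilon> \<and> 0 < \<alpha> \<and> \<alpha> < 1 \<and>
     real m \<ge> 10 * (C\<^sup>2 / \<alpha>\<^sup>2) * real k *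
       ln (2 * real k / \<epsilon> * (2 * real k * C * K / \<alpha> + 1) ^ CARD('d))
     \<longrightarrow>
     measure M {w \<in> space M. \<forall>f\<in>shift_invariant_space k \<phi>.
         ennreal (real m * (1 - \<alpha>) * (L2_norm f)\<^sup>2)
           \<le> (\<Sum>r=1..m. \<Sum>\<^sub>\<infinity>l\<in>int_lattice. ennreal ((norm (cont_rep f (X r w + l)))\<^sup>2)) \<and>
         (\<Sum>r=1..m. \<Sum>\<^sub>\<infinity>l\<in>int_lattice. ennreal ((norm (cont_rep f (X r w + l)))\<^sup>2))
           \<le> ennreal (real m * (1 + \<alpha>) * (L2_norm f)\<^sup>2)}
       \<ge> 1 - \<epsilon>)"
proof -
  define g where "g i w = \<psi>h i (w - \<nu> i)" for i w
  interpret orthonormal_shifts k \<phi> g C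
  proof
    fix i assume i: "i \<in> {1..k}"
    have "AE x in lborel. \<phi> i x = chr (\<nu> i) x * \<psi> i x"
      using assms(6) i unfolding exp_eq_chr by (simp add: chr_commute[of "\<nu> i"])
    then show "is_L2_fourier (\<phi> i) (g i)"
      unfolding g_def[abs_def] using assms(2,8) i by (intro is_L2_fourier_modulate) auto
    show "AE w in cube_measure. (\<Sum>n. ennreal (norm (g i (w + lat n)))) \<le> ennreal C"
      unfolding g_def using assms(5) i by (intro AE_periodization_le[OF assms(9)]) auto
  qed (use assms(3,10) in auto)
  have shift: "fiber w x i = chr (\<nu> i) x * zak (\<psi>h i) w (- x)" if i: "i \<in> {1..k}" and w: "w \<in> good" for w x i
  proof -
    have "summable (\<lambda>n. norm (g i (w + lat n)))"
      using w i unfolding good_def by (intro summable_periodization(1)[OF _ C_nonneg]) auto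
    then have "zak_chr (\<lambda>w. \<psi>h i (w - \<nu> i)) w x = chr (\<nu> i) x * zak (\<psi>h i) w (- x)"
      unfolding g_def using assms(5) i by (intro zak_chr_shift) auto
    moreover have "g i = (\<lambda>w. \<psi>h i (w - \<nu> i))" by (simp add: g_def fun_eq_iff)
    moreover have "fiber w x i = zak_chr (g i) w x" using w by (simp add: fiber_def)
    ultimately show ?thesis by simp
  qed
  have lip: "AE w in cube_measure. AE w' in cube_measure. \<forall>i\<in>{1..k}. \<forall>x\<in>unit_cube.
      norm (fiber w x i - fiber w' x i) \<le> K * infnorm (w - w')"
    using AE_zak_lipschitz[OF assms(11,12)] AE_good
  proof eventually_elim
    case (elim w)
    note w = elim(2)
    show ?case using elim(1) AE_good
    proof eventually_elim
      case (elim w')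
      show ?case
      proof (intro ballI)
        fix i and x :: "real ^ 'd" assume i: "i \<in> {1..k}" and x: "x \<in> unit_cube"
        have "fiber w x i - fiber w' x i = chr (\<nu> i) x * (zak (\<psi>h i) w (- x) - zak (\<psi>h i) w' (- x))"
          using shift[OF i w] shift[OF i elim(2)] by (simp add: right_diff_distrib)
        then have "norm (fiber w x i - fiber w' x i) = norm (zak (\<psi>h i) w (- x) - zak (\<psi>h i) w' (- x))"
          by (simp add: norm_mult)
        also have "\<dots> \<le> K * infnorm (w - w')" using elim(1) i unit_cube_uminus[OF x] by blast
        finally show "norm (fiber w x i - fiber w' x i) \<le> K * infnorm (w - w')" .
      qed
    qed
  qed
  show ?thesis
  proof (intro conjI impI RKHS)
    assume prems: "prob_space M \<and> prob_space.indep_vars M (\<lambda>_. borel) X {1..m} \<and>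
       (\<forall>r\<in>{1..m}. distr M borel (X r) = uniform_measure lborel unit_cube) \<and>
       0 < \<epsilon> \<and> 0 < \<alpha> \<and> \<alpha> < 1 \<and>
       real m \<ge> 10 * (C\<^sup>2 / \<alpha>\<^sup>2) * real k * ln (2 * real k / \<epsilon> * (2 * real k * C * K / \<alpha> + 1) ^ CARD('d))"
    have "1 - \<epsilon> \<le> measure M {w \<in> space M. \<forall>f\<in>V. sampled m (real m * (1 - \<alpha>)) (real m * (1 + \<alpha>)) (\<lambda>r. X r w) f}"
      using prems by (intro sampling_probability[OF assms(1,12) lip]) auto
    also have "{w \<in> space M. \<forall>f\<in>V. sampled m (real m * (1 - \<alpha>)) (real m * (1 + \<alpha>)) (\<lambda>r. X r w) f} =
      {w \<in> space M. \<forall>f\<in>V.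
         ennreal (real m * (1 - \<alpha>) * (L2_norm f)\<^sup>2)
           \<le> (\<Sum>r=1..m. \<Sum>\<^sub>\<infinity>l\<in>int_lattice. ennreal ((norm (cont_rep f (X r w + l)))\<^sup>2)) \<and>
         (\<Sum>r=1..m. \<Sum>\<^sub>\<infinity>l\<in>int_lattice. ennreal ((norm (cont_rep f (X r w + l)))\<^sup>2))
           \<le> ennreal (real m * (1 + \<alpha>) * (L2_norm f)\<^sup>2)}"
    proof -
      have b: "0 \<le> real m * (1 + \<alpha>)" using prems by simp
      show ?thesis
        by (intro Collect_cong conj_cong refl ball_cong) (rule sampled_iff_ennreal[OF _ b])
    qed
    finally show "measure M {w \<in> space M. \<forall>f\<in>V.
         ennreal (real m * (1 - \<alpha>) * (L2_norm f)\<^sup>2)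
           \<le> (\<Sum>r=1..m. \<Sum>\<^sub>\<infinity>l\<in>int_lattice. ennreal ((norm (cont_rep f (X r w + l)))\<^sup>2)) \<and>
         (\<Sum>r=1..m. \<Sum>\<^sub>\<infinity>l\<in>int_lattice. ennreal ((norm (cont_rep f (X r w + l)))\<^sup>2))
           \<le> ennreal (real m * (1 + \<alpha>) * (L2_norm f)\<^sup>2)} \<ge> 1 - \<epsilon>" .
  qed
qed

end
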